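(* Assume that $F$ is aperiodic, $P(X_1\ge0)=1$, $S\in D(\alpha,1)$ with $\alpha\in(0,1)$, and $\beta>-2$, where $b$ is a non-negative function which is regularly varying at $\infty$ of index $\beta$. Put $B(\cdot)=b(A(\cdot))$. Then, when $\alpha(2+\beta)>1$, $$\lim_{x\to\infty}\frac{x\overline F(x)g_b(x)}{B(x)}=g(\alpha,\beta):=\alpha E\bigl(Y^{-\alpha(\beta+1)}\bigr),\qquad(\ast)$$ where $Y$ denotes a random variable having the limiting stable law. When $\alpha(2+\beta)\le1$, $(\ast)$ holds if and only if both $$\lim_{x\to\infty}\frac{x\overline F(x)p(x)}{B(x)}=0$$ and $$\lim_{\delta\to0}\limsup_{x\to\infty}\frac{x\overline F(x)}{B(x)}\sum_{1\le w\le\delta x}\frac{p(x-w)B(w)}{w\overline F(w)^2}=0 .$$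
   Context: $X_1,X_2,\dots$ are i.i.d. integer-valued random variables with mass function $p(z)=P(X_1=z)$ and distribution function $F$; $S_0=0$, $S_n=\sum_{r=1}^nX_r$, $\overline F(x)=P(X_1>x)$. The limits $x\to\infty$ and the sum over $w$ run over integers. "Aperiodic" means that the smallest additive subgroup of $\mathbb Z$ containing $\{z:p(z)>0\}$ is $\mathbb Z$. $S\in D(\alpha,1)$ means that $S$ is in the domain of attraction, without centering, of a stable law of index $\alpha$ with positivity parameter $1$: there are norming constants $a_n>0$ such that $S_n/a_n$ converges in distribution to a random variable $Y$ with a stable law of index $\alpha$ and $P(Y>0)=1$. The function $A$ has the form $A(x)=x^{\alpha}L_0(x)$ with $L_0$ a normalised slowly varying function, and satisfies $A(x)\sim1/\overline F(x)$ as $x\to\infty$; thus $A$ is differentiable with $xA'(x)/A(x)\to\alpha$. The norming sequence (which fixes the scale of $Y$) is chosen so that $A(a_n)=n$, so $n\overline F(a_n)\to1$. With $b_n=b(n)$, the generalized renewal (Green's) function is $g_b(x)=\sum_{n=0}^{\infty}b_nP(S_n=x)$. *)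

theory Defs
  imports
    "HOL-Probability.Probability"
    "HOL-Library.Landau_Symbols"
    "HOL-Computational_Algebra.Group_Closure"
begin

text \<open>The steps are \<open>X 1, X 2, \<dots>\<close>; the value \<open>X 0\<close> plays no role.\<close>

definition iid_steps :: "'a measure \<Rightarrow> (nat \<Rightarrow> 'a \<Rightarrow> int) \<Rightarrow> bool" where
  "iid_steps M X \<longleftrightarrow>
     prob_space M \<and>
     prob_space.indep_vars M (\<lambda>_. count_space UNIV) X {1..} \<and>
     (\<forall>r\<ge>1. distr M (count_space UNIV) (X r) = distr M (count_space UNIV) (X 1))"

definition walk :: "(nat \<Rightarrow> 'a \<Rightarrow> int) \<Rightarrow> nat \<Rightarrow> 'a \<Rightarrow> int" where
  "walk X n \<omega> = (\<Sum>r=1..n. X r \<omega>)"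

definition step_mass :: "'a measure \<Rightarrow> (nat \<Rightarrow> 'a \<Rightarrow> int) \<Rightarrow> int \<Rightarrow> real" where
  "step_mass M X z = measure M {\<omega> \<in> space M. X 1 \<omega> = z}"

definition step_tail :: "'a measure \<Rightarrow> (nat \<Rightarrow> 'a \<Rightarrow> int) \<Rightarrow> real \<Rightarrow> real" where
  "step_tail M X x = measure M {\<omega> \<in> space M. real_of_int (X 1 \<omega>) > x}"

definition aperiodic_step :: "'a measure \<Rightarrow> (nat \<Rightarrow> 'a \<Rightarrow> int) \<Rightarrow> bool" where
  "aperiodic_step M X \<longleftrightarrow> group_closure {z. step_mass M X z > 0} = UNIV"

text \<open>
  A non-degenerate law \<open>\<mu>\<close> on the line is stable of index \<open>\<alpha>\<close> if, for every \<open>n \<ge> 1\<close>, the sum of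
  \<open>n\<close> independent copies of \<open>Y\<close> has the law of \<open>n\<^sup>1\<^sup>/\<^sup>\<alpha> Y + c\<^sub>n\<close>. The shift is allowed for here; a
  law attracting a random walk without centering satisfies this with \<open>c\<^sub>n = 0\<close> if \<open>\<alpha> < 1\<close>.
\<close>

definition stable_law :: "real \<Rightarrow> real measure \<Rightarrow> bool" where
  "stable_law \<alpha> \<mu> \<longleftrightarrow>
     real_distribution \<mu> \<and>
     (\<forall>c. \<mu> \<noteq> return borel c) \<and>
     (\<forall>n\<ge>1. \<exists>c. distr (\<Pi>\<^sub>M i\<in>{..<n}. \<mu>) borel (\<lambda>y. \<Sum>i<n. y i)
                  = distr \<mu> borel (\<lambda>y. real n powr (1 / \<alpha>) * y + c))"

text \<open>
  \<open>S \<in> D(\<alpha>,\<rho>)\<close>, with the norming constants \<open>a\<close> and the limit law \<open>\<mu>\<close> made explicit: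
  \<open>S \<in> D(\<alpha>,\<rho>)\<close> means that there are \<open>a\<close> and \<open>\<mu>\<close> as below.
\<close>

definition domain_of_attraction ::
    "'a measure \<Rightarrow> (nat \<Rightarrow> 'a \<Rightarrow> int) \<Rightarrow> real \<Rightarrow> real \<Rightarrow> (nat \<Rightarrow> real) \<Rightarrow> real measure \<Rightarrow> bool" where
  "domain_of_attraction M X \<alpha> \<rho> a \<mu> \<longleftrightarrow>
     (\<forall>n\<ge>1. a n > 0) \<and>
     stable_law \<alpha> \<mu> \<and>
     measure \<mu> {0<..} = \<rho> \<and>
     weak_conv_m (\<lambda>n. distr M borel (\<lambda>\<omega>. real_of_int (walk X n \<omega>) / a n)) \<mu>"

definition regularly_varying :: "real \<Rightarrow> (real \<Rightarrow> real) \<Rightarrow> bool" where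
  "regularly_varying \<beta> f \<longleftrightarrow>
     (\<exists>x0. f \<in> borel_measurable (lebesgue_on {x0..}) \<and> (\<forall>x\<ge>x0. f x > 0)) \<and>
     (\<forall>c>0. ((\<lambda>x. f (c * x) / f x) \<longlongrightarrow> c powr \<beta>) at_top)"

text \<open>
  A slowly varying function is normalised if the multiplier in its Karamata representation can be
  taken constant. Where such an \<open>L\<close> is differentiable, \<open>x L'(x) / L(x) \<rightarrow> 0\<close>; this holds for
  all large \<open>x\<close> if, as one may assume, \<open>\<epsilon>\<close> is continuous.
\<close>

definition normalised_slowly_varying :: "(real \<Rightarrow> real) \<Rightarrow> bool" where
  "normalised_slowly_varying L \<longleftrightarrow>
     (\<forall>x>0. L x > 0) \<and>
     (\<exists>c>0. \<exists>x0>0. \<exists>\<epsilon>::real \<Rightarrow> real. (\<epsilon> \<longlongrightarrow> 0) at_top \<and>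
        (\<forall>x\<ge>x0. (\<lambda>t. \<epsilon> t / t) integrable_on {x0..x} \<and>
                 L x = c * exp (integral {x0..x} (\<lambda>t. \<epsilon> t / t))))"

text \<open>
  If \<open>b\<close> is regularly varying and the steps are non-negative and not identically zero, then
  \<open>P(S\<^sub>n = x)\<close> decays exponentially in \<open>n\<close> for fixed \<open>x\<close>, so the series converges.
\<close>

definition green :: "'a measure \<Rightarrow> (nat \<Rightarrow> 'a \<Rightarrow> int) \<Rightarrow> (real \<Rightarrow> real) \<Rightarrow> int \<Rightarrow> real" where
  "green M X b x = (\<Sum>n. b (real n) * measure M {\<omega> \<in> space M. walk X n \<omega> = x})"

end

theory Submission
  imports Defs
begin

text \<open>
  Split the Green sum at the times \<open>\<epsilon> A(x)\<close> and \<open>A(x) / \<epsilon>\<close>. A local bound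
  \<open>P(S\<^sub>n = x) \<le> C a\<^sub>n\<^sup>-\<^sup>1 exp(- c n / A(x))\<close> makes the late times negligible. Over a block of
  middle times \<open>s A(x) < n \<le> s' A(x)\<close> the sum \<open>\<Sum>P(S\<^sub>n = y)\<close> varies slowly with \<open>y\<close>, so it may be
  averaged over \<open>y \<in> (x, (1 + \<eta>) x]\<close>, where the weak limit theorem applies; a fine partition of the
  middle times gives \<open>\<alpha> E(Y\<^sup>-\<^sup>\<alpha>\<^sup>(\<^sup>\<beta>\<^sup>+\<^sup>1\<^sup>); \<epsilon> \<le> Y\<^sup>-\<^sup>\<alpha> \<le> 1 / \<epsilon>)\<close>. Everything therefore depends on
  whether the early times are negligible.

  At early times \<open>S\<^sub>n = x\<close> essentially requires one large jump, from some \<open>w\<close> to \<open>x\<close>. Summing over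
  the time and position of that jump turns a Green sum with weights \<open>n\<^sup>k b\<^sub>n\<close> at \<open>x\<close> into one with
  weights \<open>n\<^sup>k\<^sup>+\<^sup>1 b\<^sub>n\<close> at \<open>w\<close>. For large \<open>k\<close> the crude local bound already settles the matter, and for
  \<open>k = 0\<close> it does so if \<open>\<alpha>(2 + \<beta>) > 1\<close>; the two conditions are what allows one to descend from
  \<open>k + 1\<close> to \<open>k\<close>. Conversely, restricting the same decomposition to jumps from \<open>w \<le> \<delta>x\<close> bounds the
  early part from below by the sum in the second condition.
\<close>

section \<open>Convolution powers\<close>

text \<open>Aperiodicity only says that the support generates the group of integers. If all steps
  are odd, S_n has the parity of n and |\<phi>| = 1 at the angle \<pi>, so P(S_n = y) for a single n
  is not smooth in y. Probabilities are therefore compared after summation over a block of times: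
  the geometric sum of the powers of \<phi> is divided by 1 - \<phi>, which vanishes on
  [-\<pi>, \<pi>] only at 0, and the number of terms drops out. A bound for a single P(S_n = x) is
  obtained from \<phi> near 0 alone, by means of a kernel with non-negative transform.

  The limit law enters through its distribution function only. Its density is replaced by a
  difference quotient in \<eta> of integrals of the decreasing function t -> P(Y^(-\<alpha>) >= t).

  A fixed time j contributes a multiple of P(S_j = x), which need not be small compared with A(x)
  B(x) / x. This is the origin of the first condition. It is also why b may be changed at finitely
  many integers only once the fixed times are known to be negligible.\<close>

definition conv_pow :: "(nat \<Rightarrow> real) \<Rightarrow> nat \<Rightarrow> nat \<Rightarrow> real" where
  "conv_pow p n k = fps_nth (Abs_fps p ^ n) k"

text \<open>Convolution powers are coefficients of powers of a generating series. Splitting a law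
  into small and large jumps thus becomes algebra in a commutative ring, with this order in place of
  inequalities between laws.\<close>

definition fps_dominated :: "real fps \<Rightarrow> real fps \<Rightarrow> bool" where
  "fps_dominated f g \<longleftrightarrow> (\<forall>k. fps_nth f k \<le> fps_nth g k)"

lemma fps_dominated_refl [simp]: "fps_dominated f f"
  by (simp add: fps_dominated_def)

lemma fps_dominated_trans [trans]:
  "fps_dominated f g \<Longrightarrow> fps_dominated g h \<Longrightarrow> fps_dominated f h"
  unfolding fps_dominated_def by (meson order_trans)

lemma fps_dominated_add:
  "fps_dominated f g \<Longrightarrow> fps_dominated f' g' \<Longrightarrow> fps_dominated (f + f') (g + g')"
  by (simp add: fps_dominated_def add_mono)

lemma fps_dominated_mult:
  assumes "fps_dominated f g" "fps_dominated f' g'" "fps_dominated 0 f'" "fps_dominated 0 g"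
  shows "fps_dominated (f * f') (g * g')"
  using assms unfolding fps_dominated_def fps_mult_nth
  by (auto intro!: sum_mono mult_mono)

lemma fps_dominated_0_mult:
  "fps_dominated 0 f \<Longrightarrow> fps_dominated 0 g \<Longrightarrow> fps_dominated 0 (f * g)"
  unfolding fps_dominated_def fps_mult_nth by (auto intro!: sum_nonneg)

lemma fps_dominated_0_power: "fps_dominated 0 f \<Longrightarrow> fps_dominated 0 (f ^ n)"
proof (induction n)
  case (Suc n)
  then show ?case by (simp add: fps_dominated_0_mult)
qed (simp add: fps_dominated_def)

lemma fps_dominated_power:
  assumes "fps_dominated 0 f" "fps_dominated f g"
  shows "fps_dominated (f ^ n) (g ^ n)"
proof (induction n)
  case (Suc n)
  then show ?case
    using assms fps_dominated_trans[OF assms]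
    by (auto intro!: fps_dominated_mult fps_dominated_0_power)
qed simp

text \<open>A union bound: either every factor is \<open>f\<close>, or one of the \<open>n\<close>
  factors is \<open>g\<close> and the others are arbitrary.\<close>

lemma fps_power_split_upper:
  assumes f: "fps_dominated 0 f" and g: "fps_dominated 0 g"
  shows "fps_dominated ((f + g) ^ n) (f ^ n + of_nat n * (g * (f + g) ^ (n - 1)))"
proof (induction n)
  case (Suc n)
  have fg: "fps_dominated 0 (f + g)"
    using fps_dominated_add[OF f g] by simp
  have le: "fps_dominated f (f + g)"
    using fps_dominated_add[OF fps_dominated_refl g] by simp
  have nn: "fps_dominated 0 (of_nat n * (g * (f + g) ^ (n - 1)))"
    by (intro fps_dominated_0_mult fps_dominated_0_power fg g)
       (simp add: fps_dominated_def)
  have "fps_dominated (f * (f + g) ^ n) (f * (f ^ n + of_nat n * (g * (f + g) ^ (n - 1))))"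
    by (intro fps_dominated_mult Suc fps_dominated_0_power fg f fps_dominated_refl)
  also have "f * (f ^ n + of_nat n * (g * (f + g) ^ (n - 1)))
      = f ^ Suc n + of_nat n * ((f * g) * (f + g) ^ (n - 1))"
    by (simp add: algebra_simps)
  also have "fps_dominated \<dots> (f ^ Suc n + of_nat n * (g * (f + g) ^ n))"
  proof (cases n)
    case (Suc m)
    have "fps_dominated (of_nat n * ((f * g) * (f + g) ^ m)) (of_nat n * ((f + g) * g * (f + g) ^ m))"
      by (intro fps_dominated_mult fps_dominated_refl le fps_dominated_0_mult fps_dominated_0_power fg f g)
         (auto simp: fps_dominated_def)
    then show ?thesis
      using Suc by (intro fps_dominated_add) (auto simp: algebra_simps)
  qed simp
  finally have "fps_dominated (f * (f + g) ^ n + g * (f + g) ^ n)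
      ((f ^ Suc n + of_nat n * (g * (f + g) ^ n)) + g * (f + g) ^ n)"
    by (intro fps_dominated_add) auto
  then show ?case
    by (simp add: algebra_simps)
qed simp

text \<open>The terms with exactly one factor \<open>g\<close> are part of the binomial
  expansion.\<close>

lemma fps_power_split_lower:
  assumes f: "fps_dominated 0 f" and g: "fps_dominated 0 g"
  shows "fps_dominated (of_nat n * (g * f ^ (n - 1))) ((f + g) ^ n)"
proof (induction n)
  case 0
  then show ?case by (simp add: fps_dominated_def)
next
  case (Suc n)
  have fg: "fps_dominated 0 (f + g)"
    using fps_dominated_add[OF f g] by simp
  have le: "fps_dominated f (f + g)"
    using fps_dominated_add[OF fps_dominated_refl g] by simp
  have "fps_dominated (f * (of_nat n * (g * f ^ (n - 1)))) (f * (f + g) ^ n)"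
    by (intro fps_dominated_mult Suc fps_dominated_0_mult fps_dominated_0_power fg f g fps_dominated_refl)
       (simp add: fps_dominated_def)
  moreover have "fps_dominated (g * f ^ n) (g * (f + g) ^ n)"
    by (intro fps_dominated_mult fps_dominated_power f g le fps_dominated_refl fps_dominated_0_power)
  ultimately have "fps_dominated (f * (of_nat n * (g * f ^ (n - 1))) + g * f ^ n)
      (f * (f + g) ^ n + g * (f + g) ^ n)"
    by (rule fps_dominated_add)
  moreover have "f * (of_nat n * (g * f ^ (n - 1))) = of_nat n * (g * f ^ n)"
    by (cases n) (auto simp: algebra_simps)
  ultimately have "fps_dominated (of_nat n * (g * f ^ n) + g * f ^ n) (f * (f + g) ^ n + g * (f + g) ^ n)"
    by (simp only:)
  then show ?case
    by (simp add: algebra_simps)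
qed

lemma conv_pow_0: "conv_pow p 0 k = (if k = 0 then 1 else 0)"
  by (simp add: conv_pow_def fps_one_nth)

lemma conv_pow_1 [simp]: "conv_pow p (Suc 0) k = p k"
  by (simp add: conv_pow_def)

lemma conv_pow_add: "conv_pow p (m + n) k = (\<Sum>i\<le>k. conv_pow p m i * conv_pow p n (k - i))"
  by (simp add: conv_pow_def power_add fps_mult_nth atLeast0AtMost)

lemma conv_pow_Suc: "conv_pow p (Suc n) k = (\<Sum>i\<le>k. p i * conv_pow p n (k - i))"
  using conv_pow_add[of p 1 n k] by simp

lemma conv_pow_nonneg:
  assumes "\<And>k. p k \<ge> 0"
  shows "conv_pow p n k \<ge> 0"
  using fps_dominated_0_power[of "Abs_fps p" n] assms
  by (auto simp: fps_dominated_def conv_pow_def)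

lemma conv_pow_mono:
  assumes "\<And>k. 0 \<le> p k" "\<And>k. p k \<le> q k"
  shows "conv_pow p n k \<le> conv_pow q n k"
  using fps_dominated_power[of "Abs_fps p" "Abs_fps q" n] assms
  by (auto simp: fps_dominated_def conv_pow_def)

definition truncate_at :: "nat \<Rightarrow> (nat \<Rightarrow> real) \<Rightarrow> nat \<Rightarrow> real" where
  "truncate_at Y p k = (if k \<le> Y then p k else 0)"

lemma conv_pow_cong:
  assumes "\<And>j. j \<le> k \<Longrightarrow> p j = q j"
  shows "conv_pow p n k = conv_pow q n k"
  using assms
proof (induction n arbitrary: k)
  case (Suc n)
  then show ?case by (auto simp: conv_pow_Suc intro!: sum.cong)
qed (simp add: conv_pow_0)

lemma conv_pow_truncate_eq: "k \<le> Y \<Longrightarrow> conv_pow (truncate_at Y p) n k = conv_pow p n k"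
  by (rule conv_pow_cong) (simp add: truncate_at_def)

lemma sum_tail_reindex:
  fixes p h :: "nat \<Rightarrow> real"
  assumes "Y \<le> x"
  shows "(\<Sum>i\<in>{..x}. (if i \<le> Y then 0 else p i) * h (x - i)) = (\<Sum>w<x - Y. p (x - w) * h w)"
proof -
  have "(\<Sum>i\<in>{..x}. (if i \<le> Y then 0 else p i) * h (x - i)) = (\<Sum>i\<in>{Y<..x}. p i * h (x - i))"
    by (rule sum.mono_neutral_cong_right) auto
  also have "\<dots> = (\<Sum>w<x - Y. p (x - w) * h w)"
    using assms by (intro sum.reindex_bij_witness[of _ "\<lambda>w. x - w" "\<lambda>i. x - i"]) auto
  finally show ?thesis .
qed

lemma truncate_split:
  "Abs_fps p = Abs_fps (truncate_at Y p) + Abs_fps (\<lambda>i. if i \<le> Y then 0 else p i)"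
  by (rule fps_ext) (simp add: truncate_at_def)

text \<open>Here \<open>w\<close> is the sum of all steps except one that exceeds \<open>Y\<close>;
  by exchangeability the choice of that step costs the factor \<open>n\<close>. The other steps are
  unrestricted, so paths with several large steps are counted more than once.\<close>

lemma conv_pow_big_jump_upper:
  assumes p: "\<And>k. 0 \<le> p k" and "Y \<le> x"
  shows "conv_pow p n x \<le> conv_pow (truncate_at Y p) n x
           + real n * (\<Sum>w<x - Y. p (x - w) * conv_pow p (n - 1) w)"
proof -
  define f where "f = Abs_fps (truncate_at Y p)"
  define g where "g = Abs_fps (\<lambda>i. if i \<le> Y then 0 else p i)"
  have s: "Abs_fps p = f + g"
    unfolding f_def g_def by (rule truncate_split)
  have "fps_dominated ((f + g) ^ n) (f ^ n + of_nat n * (g * (f + g) ^ (n - 1)))"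
    by (rule fps_power_split_upper) (auto simp: fps_dominated_def f_def g_def truncate_at_def p)
  then have "fps_nth ((f + g) ^ n) x \<le> fps_nth (f ^ n) x + real n * fps_nth (g * (f + g) ^ (n - 1)) x"
    by (auto simp: fps_dominated_def fps_mult_of_nat_nth)
  also have "fps_nth (g * (f + g) ^ (n - 1)) x = (\<Sum>w<x - Y. p (x - w) * conv_pow p (n - 1) w)"
    using sum_tail_reindex[OF assms(2), of p "conv_pow p (n - 1)"]
    unfolding s [symmetric] by (simp add: fps_mult_nth atLeast0AtMost g_def conv_pow_def)
  finally show ?thesis
    by (simp add: conv_pow_def s f_def)
qed

text \<open>Counts the paths with exactly one step above \<open>Y\<close>. Truncating the other
  steps keeps the \<open>n\<close> choices of the large step disjoint.\<close>

lemma conv_pow_big_jump_lower: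
  assumes p: "\<And>k. 0 \<le> p k" and "Y \<le> x"
  shows "real n * (\<Sum>w<x - Y. p (x - w) * conv_pow (truncate_at Y p) (n - 1) w) \<le> conv_pow p n x"
proof -
  define f where "f = Abs_fps (truncate_at Y p)"
  define g where "g = Abs_fps (\<lambda>i. if i \<le> Y then 0 else p i)"
  have s: "Abs_fps p = f + g"
    unfolding f_def g_def by (rule truncate_split)
  have "fps_dominated (of_nat n * (g * f ^ (n - 1))) ((f + g) ^ n)"
    by (rule fps_power_split_lower) (auto simp: fps_dominated_def f_def g_def truncate_at_def p)
  then have "real n * fps_nth (g * f ^ (n - 1)) x \<le> fps_nth ((f + g) ^ n) x"
    by (auto simp: fps_dominated_def fps_mult_of_nat_nth)
  moreover have "fps_nth (g * f ^ (n - 1)) x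
      = (\<Sum>w<x - Y. p (x - w) * conv_pow (truncate_at Y p) (n - 1) w)"
    using sum_tail_reindex[OF assms(2), of p "conv_pow (truncate_at Y p) (n - 1)"]
    by (simp add: fps_mult_nth atLeast0AtMost g_def conv_pow_def f_def)
  ultimately show ?thesis
    by (simp add: conv_pow_def s)
qed

text \<open>A finite form of E z^S_n = (E z^X)^n: the triangle i + j <= N is contained in the
  square. The value z = 1 bounds P(S_n <= N), and z > 1 gives exponential moments of truncated
  walks.\<close>

lemma sum_conv_pow_le_power:
  fixes z :: real
  assumes p: "\<And>k. 0 \<le> p k" and z: "0 \<le> z"
  shows "(\<Sum>k\<le>N. conv_pow p n k * z ^ k) \<le> (\<Sum>k\<le>N. p k * z ^ k) ^ n"
proof (induction n)
  case 0
  have "(\<Sum>k\<le>N. conv_pow p 0 k * z ^ k) = (\<Sum>k\<le>N. if k = 0 then 1 else 0)"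
    by (rule sum.cong) (auto simp: conv_pow_0)
  then show ?case by simp
next
  case (Suc n)
  have "(\<Sum>k\<le>N. conv_pow p (Suc n) k * z ^ k)
      = (\<Sum>k\<le>N. \<Sum>i\<le>k. (p i * z ^ i) * (conv_pow p n (k - i) * z ^ (k - i)))"
    by (auto simp: conv_pow_Suc sum_distrib_right power_add [symmetric] intro!: sum.cong)
  also have "\<dots> = (\<Sum>(i, j)\<in>{(i, j). i + j \<le> N}. (p i * z ^ i) * (conv_pow p n j * z ^ j))"
    by (rule sum.triangle_reindex_eq [symmetric])
  also have "\<dots> \<le> (\<Sum>(i, j)\<in>{..N} \<times> {..N}. (p i * z ^ i) * (conv_pow p n j * z ^ j))"
    by (rule sum_mono2) (auto intro!: mult_nonneg_nonneg conv_pow_nonneg p z zero_le_power)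
  also have "\<dots> = (\<Sum>i\<le>N. p i * z ^ i) * (\<Sum>j\<le>N. conv_pow p n j * z ^ j)"
    by (simp add: sum_product sum.cartesian_product)
  also have "\<dots> \<le> (\<Sum>i\<le>N. p i * z ^ i) * (\<Sum>k\<le>N. p k * z ^ k) ^ n"
    by (intro mult_left_mono Suc sum_nonneg mult_nonneg_nonneg p zero_le_power z)
  finally show ?case by simp
qed

lemma sum_conv_pow_le:
  assumes "\<And>k. 0 \<le> p k"
  shows "(\<Sum>k\<le>N. conv_pow p n k) \<le> (\<Sum>k\<le>N. p k) ^ n"
  using sum_conv_pow_le_power[of p 1 n N] assms by simp

text \<open>No step can exceed a sum of non-negative steps.\<close>

lemma conv_pow_le_sum:
  assumes "\<And>k. 0 \<le> p k"
  shows "conv_pow p n k \<le> (\<Sum>j\<le>k. p j) ^ n"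
proof -
  have "conv_pow p n k \<le> (\<Sum>j\<le>k. conv_pow p n j)"
    by (rule member_le_sum) (auto intro: conv_pow_nonneg assms)
  also have "\<dots> \<le> (\<Sum>j\<le>k. p j) ^ n"
    by (rule sum_conv_pow_le[OF assms])
  finally show ?thesis .
qed

text \<open>The Cauchy product needs absolute convergence, so summability of all convolution powers
  is established first, from a bound on their partial sums.\<close>

lemma conv_pow_sums:
  fixes p :: "nat \<Rightarrow> real"
  assumes p: "\<And>k. 0 \<le> p k" and "p sums 1" and x: "norm x \<le> 1"
  shows "(\<lambda>k. of_real (conv_pow p n k) * x ^ k) sums ((\<Sum>k. of_real (p k) * x ^ k) ^ n :: complex)"
    and "summable (conv_pow p n)"
proof -
  have 1: "summable (\<lambda>k. norm (of_real (q k) * x ^ k :: complex))"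
    if "summable q" "\<And>k. 0 \<le> q k" for q :: "nat \<Rightarrow> real"
  proof (rule summable_comparison_test'[OF that(1)])
    show "norm (norm (of_real (q k) * x ^ k :: complex)) \<le> q k" for k
      using that(2)[of k] x by (auto simp: norm_mult norm_power intro!: mult_left_le power_le_one)
  qed
  show sm: "summable (conv_pow p n)" for n
  proof (rule summableI_nonneg_bounded)
    show "0 \<le> conv_pow p n k" for k by (rule conv_pow_nonneg[OF p])
    show "(\<Sum>i<N. conv_pow p n i) \<le> 1" for N
    proof -
      have "(\<Sum>i<N. conv_pow p n i) \<le> (\<Sum>i\<le>N. conv_pow p n i)"
        by (rule sum_mono2) (auto intro: conv_pow_nonneg p)
      also have "\<dots> \<le> (\<Sum>i\<le>N. p i) ^ n"
        by (rule sum_conv_pow_le[OF p])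
      also have "\<dots> \<le> 1"
        using sum_le_suminf[of p "{..N}"] assms by (intro power_le_one sum_nonneg) (auto simp: sums_iff)
      finally show ?thesis .
    qed
  qed
  show "(\<lambda>k. of_real (conv_pow p n k) * x ^ k) sums ((\<Sum>k. of_real (p k) * x ^ k) ^ n :: complex)"
  proof (induction n)
    case 0
    have "(\<lambda>k. of_real (conv_pow p 0 k) * x ^ k) = (\<lambda>k. if k = 0 then 1 else 0)"
      by (auto simp: conv_pow_0)
    then show ?case
      using sums_single[of 0 "\<lambda>_. 1::complex"] by simp
  next
    case (Suc n)
    have "(\<lambda>k. \<Sum>i\<le>k. (of_real (p i) * x ^ i) * (of_real (conv_pow p n (k - i)) * x ^ (k - i)))
       sums ((\<Sum>k. of_real (p k) * x ^ k) * (\<Sum>k. of_real (conv_pow p n k) * x ^ k))"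
      using assms by (intro Cauchy_product_sums 1 sm conv_pow_nonneg) (auto simp: sums_iff)
    also have "(\<lambda>k. \<Sum>i\<le>k. (of_real (p i) * x ^ i) * (of_real (conv_pow p n (k - i)) * x ^ (k - i)))
       = (\<lambda>k. of_real (conv_pow p (Suc n) k) * x ^ k)"
      by (auto simp: conv_pow_Suc sum_distrib_right power_add [symmetric] fun_eq_iff intro!: sum.cong)
    finally show ?case
      using Suc by (simp add: sums_iff)
  qed
qed

lemma conv_pow_sums_1:
  fixes p :: "nat \<Rightarrow> real"
  assumes p: "\<And>k. 0 \<le> p k" and "p sums 1"
  shows "conv_pow p n sums 1"
proof -
  have "(\<Sum>k. complex_of_real (p k)) = 1"
    using sums_of_real[OF assms(2), where ?'a = complex] by (simp add: sums_iff)
  then have "(\<lambda>k. complex_of_real (conv_pow p n k)) sums of_real 1"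
    using conv_pow_sums(1)[OF assms, of 1 n] by simp
  then show ?thesis by (simp only: sums_of_real_iff)
qed

section \<open>Regular variation\<close>

text \<open>Potter's inequalities, taken as the working form of regular variation of index \<rho>:
  growth at most like the power \<rho> + \<tau> and at least like \<rho> - \<tau>. The norming
  function reaches this form through its normalised representation, the weight function through
  measurability.\<close>

definition potter_bounds :: "real \<Rightarrow> (real \<Rightarrow> real) \<Rightarrow> bool" where
  "potter_bounds \<rho> f \<longleftrightarrow> (\<forall>\<tau>>0. \<exists>x0\<ge>1. \<forall>x\<ge>x0. f x > 0 \<and> (\<forall>y\<ge>x.
     f y \<le> (1 + \<tau>) * (y / x) powr (\<rho> + \<tau>) * f x \<and>
     f x \<le> (1 + \<tau>) * (y / x) powr (\<tau> - \<rho>) * f y))"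

definition locally_bounded_pos :: "(real \<Rightarrow> real) \<Rightarrow> bool" where
  "locally_bounded_pos f \<longleftrightarrow> (\<forall>R. \<exists>l>0. \<exists>u. \<forall>x\<in>{0..R}. l \<le> f x \<and> f x \<le> u)"

lemma locally_bounded_posD:
  assumes "locally_bounded_pos f"
  obtains l u where "l > 0" "\<And>x. x \<in> {0..R} \<Longrightarrow> l \<le> f x \<and> f x \<le> u"
  using assms unfolding locally_bounded_pos_def by meson

lemma locally_bounded_pos_pos:
  assumes "locally_bounded_pos f" "x \<ge> 0"
  shows "f x > 0"
proof -
  obtain l u where "l > 0" "\<And>y. y \<in> {0..x} \<Longrightarrow> l \<le> f y \<and> f y \<le> u"
    using locally_bounded_posD[OF assms(1), where R = x] by metis
  then show ?thesis using assms(2) by force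
qed

text \<open>One-sided, so that it applies to f as well as to 1 / f. Arguments on different sides of
  \<open>x0\<close> are compared through f(x0).\<close>

lemma potter_global_one_sided:
  fixes f :: "real \<Rightarrow> real"
  assumes pos: "\<And>x. x \<ge> 0 \<Longrightarrow> f x > 0"
    and lu: "l > 0" "\<And>x. x \<in> {0..x0} \<Longrightarrow> l \<le> f x \<and> f x \<le> u"
    and x0: "x0 \<ge> 1" and c: "c \<ge> 1"
    and P: "\<And>x y. x \<ge> x0 \<Longrightarrow> y \<ge> x \<Longrightarrow> f y \<le> c * (y / x) powr e * f x"
  shows "\<exists>C\<ge>1. \<forall>x\<ge>1. \<forall>y\<ge>x. f y \<le> C * (y / x) powr e * f x"
proof -
  \<comment> \<open>\<open>K\<close> bounds the oscillation of f on [0, x0]; \<open>D\<close>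
    compensates a power t^e of a ratio t <= x0, which is small when e is negative.\<close>
  define K where "K = u / l"
  define D where "D = x0 powr \<bar>e\<bar>"
  have "l \<le> u" using lu(2)[of 0] x0 by auto
  then have K: "K \<ge> 1" using lu(1) by (simp add: K_def field_simps)
  have D: "D \<ge> 1" using x0 by (simp add: D_def ge_one_powr_ge_zero)
  have cKD: "K * D \<ge> 1" "c * K * D \<ge> 1" "c * K * D \<ge> K * D" "c * K * D \<ge> c"
  proof -
    show 1: "K * D \<ge> 1" using mult_mono[of 1 K 1 D] K D by simp
    show "c * K * D \<ge> K * D" using mult_mono[of 1 c "K * D" "K * D"] c 1 by (simp add: mult_ac)
    then show "c * K * D \<ge> 1" using 1 by linarith
    show "c * K * D \<ge> c" using mult_mono[of c c 1 "K * D"] c 1 by (simp add: mult_ac)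
  qed
  have Dt: "1 \<le> D * t powr e" if "1 \<le> t" "t \<le> x0" for t
  proof -
    have "t powr (-e) \<le> t powr \<bar>e\<bar>" using that by (intro powr_mono) auto
    also have "\<dots> \<le> D" unfolding D_def using that by (intro powr_mono2) auto
    finally have "t powr (-e) * t powr e \<le> D * t powr e"
      by (intro mult_right_mono) auto
    then show ?thesis using that by (simp flip: powr_add)
  qed
  have Kf: "f y \<le> K * f x" if "x \<in> {0..x0}" "y \<in> {0..x0}" for x y
  proof -
    have "f y \<le> u" using lu(2) that by auto
    also have "\<dots> = K * l" using lu(1) by (simp add: K_def)
    also have "\<dots> \<le> K * f x" using lu(2) that K by (intro mult_left_mono) auto
    finally show ?thesis .
  qed
  have "f y \<le> (c * K * D) * (y / x) powr e * f x" if xy: "x \<ge> 1" "y \<ge> x" for x y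
  proof -
  have fx: "f x > 0" using pos xy by auto
  consider "y \<le> x0" | "x \<le> x0" "x0 \<le> y" | "x0 \<le> x" by linarith
  then show ?thesis
  proof cases
    case 1
    have "f y \<le> K * f x" using Kf 1 xy by auto
    also have "\<dots> \<le> K * f x * (D * (y / x) powr e)"
    proof -
      have "y / x \<le> y / 1" using xy by (intro divide_left_mono) auto
      then have "1 \<le> D * (y / x) powr e" using 1 xy by (intro Dt) auto
      then show ?thesis using mult_left_mono[of 1 "D * (y / x) powr e" "K * f x"] K fx by auto
    qed
    also have "\<dots> = (K * D) * ((y / x) powr e * f x)" by simp
    also have "\<dots> \<le> (c * K * D) * ((y / x) powr e * f x)"
      using fx by (intro mult_right_mono[OF cKD(3)]) auto
    finally show ?thesis by (simp only: mult_ac)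
  next
    case 2
    have "f y \<le> c * (y / x0) powr e * f x0" using P 2 by auto
    also have "\<dots> \<le> c * (y / x0) powr e * (K * f x)"
      using Kf[of x x0] 2 xy x0 c by (intro mult_left_mono) auto
    also have "\<dots> = (c * K * f x) * (y / x0) powr e" by (simp only: mult_ac)
    also have "\<dots> \<le> (c * K * f x) * (D * (y / x) powr e)"
    proof (rule mult_left_mono)
      have "x0 / x \<le> x0 / 1" using xy x0 by (intro divide_left_mono) auto
      then have "1 \<le> D * (x0 / x) powr e" using 2 xy by (intro Dt) auto
      then have "1 * (y / x0) powr e \<le> (D * (x0 / x) powr e) * (y / x0) powr e"
        by (rule mult_right_mono) simp
      also have "\<dots> = D * ((x0 / x) * (y / x0)) powr e"
        using xy x0 by (subst powr_mult) auto
      also have "(x0 / x) * (y / x0) = y / x" using xy x0 by simp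
      finally show "(y / x0) powr e \<le> D * (y / x) powr e" by simp
      show "0 \<le> c * K * f x" using c K fx by simp
    qed
    also have "\<dots> = (c * K * D) * (y / x) powr e * f x" by (simp only: mult_ac)
    finally show ?thesis .
  next
    case 3
    have "f y \<le> c * ((y / x) powr e * f x)" using P 3 xy by (auto simp: mult_ac)
    also have "\<dots> \<le> (c * K * D) * ((y / x) powr e * f x)"
      using fx by (intro mult_right_mono[OF cKD(4)]) auto
    finally show ?thesis by (simp only: mult_ac)
  qed
  qed
  with cKD(2) show ?thesis by blast
qed

lemma potter_global:
  assumes "locally_bounded_pos f" "potter_bounds \<rho> f" "\<tau> > 0"
  obtains C where "C \<ge> 1"
    "\<And>x y. x \<ge> 1 \<Longrightarrow> y \<ge> x \<Longrightarrow> f y \<le> C * (y / x) powr (\<rho> + \<tau>) * f x"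
    "\<And>x y. x \<ge> 1 \<Longrightarrow> y \<ge> x \<Longrightarrow> f x \<le> C * (y / x) powr (\<tau> - \<rho>) * f y"
proof -
  have pos: "f x > 0" if "x \<ge> 0" for x
    using locally_bounded_pos_pos[OF assms(1) that] .
  obtain x0 where x0: "x0 \<ge> 1"
    and P: "\<And>x y. x \<ge> x0 \<Longrightarrow> y \<ge> x \<Longrightarrow> f y \<le> (1 + \<tau>) * (y / x) powr (\<rho> + \<tau>) * f x"
    and Q: "\<And>x y. x \<ge> x0 \<Longrightarrow> y \<ge> x \<Longrightarrow> f x \<le> (1 + \<tau>) * (y / x) powr (\<tau> - \<rho>) * f y"
    using assms(2)[unfolded potter_bounds_def, rule_format, OF assms(3)] by blast
  obtain l u where lu: "l > 0" "\<And>x. x \<in> {0..x0} \<Longrightarrow> l \<le> f x \<and> f x \<le> u"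
    using locally_bounded_posD[OF assms(1), where R = x0] by metis
  have "\<exists>C\<ge>1. \<forall>x\<ge>1. \<forall>y\<ge>x. f y \<le> C * (y / x) powr (\<rho> + \<tau>) * f x"
    by (rule potter_global_one_sided[OF pos lu x0 _ P]) (use assms(3) in auto)
  then obtain C1 where C1: "C1 \<ge> 1"
    "\<And>x y. x \<ge> 1 \<Longrightarrow> y \<ge> x \<Longrightarrow> f y \<le> C1 * (y / x) powr (\<rho> + \<tau>) * f x"
    by blast
  \<comment> \<open>The lower bound for f is the upper bound for 1 / f, with exponent \<tau> -
    \<rho>.\<close>
  have u: "u > 0" using lu(2)[of 0] lu(1) x0 by auto
  have lu': "1 / u \<le> 1 / f x \<and> 1 / f x \<le> 1 / l" if "x \<in> {0..x0}" for x
    using lu(2)[OF that] lu(1) by (auto intro!: divide_left_mono mult_pos_pos u)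
  have inv: "1 / f y \<le> (1 + \<tau>) * (y / x) powr (\<tau> - \<rho>) * (1 / f x)" if "x \<ge> x0" "y \<ge> x" for x y
    using Q[OF that] pos[of x] pos[of y] that x0 by (simp add: field_simps)
  have "\<exists>C\<ge>1. \<forall>x\<ge>1. \<forall>y\<ge>x. 1 / f y \<le> C * (y / x) powr (\<tau> - \<rho>) * (1 / f x)"
    by (rule potter_global_one_sided[OF _ _ lu' x0 _ inv]) (use assms(3) u pos in auto)
  then obtain C2 where C2: "C2 \<ge> 1"
    "\<And>x y. x \<ge> 1 \<Longrightarrow> y \<ge> x \<Longrightarrow> 1 / f y \<le> C2 * (y / x) powr (\<tau> - \<rho>) * (1 / f x)"
    by blast
  show ?thesis
  proof
    show "max C1 C2 \<ge> 1" using C1 by auto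
    fix x y :: real assume xy: "x \<ge> 1" "y \<ge> x"
    have p: "f x > 0" "f y > 0" using pos xy by auto
    have "f y \<le> C1 * ((y / x) powr (\<rho> + \<tau>) * f x)" using C1 xy by (auto simp: mult_ac)
    also have "\<dots> \<le> max C1 C2 * ((y / x) powr (\<rho> + \<tau>) * f x)" using p by (intro mult_right_mono) auto
    finally show "f y \<le> max C1 C2 * (y / x) powr (\<rho> + \<tau>) * f x" by (simp add: mult_ac)
    have "f x \<le> C2 * ((y / x) powr (\<tau> - \<rho>) * f y)"
      using C2(2)[OF xy] p by (simp add: field_simps)
    also have "\<dots> \<le> max C1 C2 * ((y / x) powr (\<tau> - \<rho>) * f y)" using p by (intro mult_right_mono) auto
    finally show "f x \<le> max C1 C2 * (y / x) powr (\<tau> - \<rho>) * f y" by (simp add: mult_ac)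
  qed
qed

text \<open>Potter's inequalities concern large arguments only, so freezing below \<open>t0\<close>
  preserves them. Local bounds follow by comparison with the value at \<open>t0\<close>, using the
  case \<tau> = 1.\<close>

lemma potter_bounds_max:
  assumes "potter_bounds \<rho> f"
  obtains t1 where "t1 \<ge> 1"
    "\<And>t0. t0 \<ge> t1 \<Longrightarrow> potter_bounds \<rho> (\<lambda>x. f (max x t0)) \<and> locally_bounded_pos (\<lambda>x. f (max x t0))"
proof -
  obtain t1 where t1: "t1 \<ge> 1" "\<And>x. x \<ge> t1 \<Longrightarrow> f x > 0"
    and P: "\<And>x y. x \<ge> t1 \<Longrightarrow> y \<ge> x \<Longrightarrow> f y \<le> 2 * (y / x) powr (\<rho> + 1) * f x"
    and Q: "\<And>x y. x \<ge> t1 \<Longrightarrow> y \<ge> x \<Longrightarrow> f x \<le> 2 * (y / x) powr (1 - \<rho>) * f y"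
    using assms[unfolded potter_bounds_def, rule_format, of 1] by auto
  show ?thesis
  proof (rule that[of t1])
    show "t1 \<ge> 1" by fact
    fix t0 assume t0: "t0 \<ge> t1"
    have "potter_bounds \<rho> (\<lambda>x. f (max x t0))"
      unfolding potter_bounds_def
    proof (intro allI impI)
      fix \<tau> :: real assume "\<tau> > 0"
      then obtain x0 where "x0 \<ge> 1" and x0: "\<And>x. x \<ge> x0 \<Longrightarrow> f x > 0 \<and> (\<forall>y\<ge>x.
         f y \<le> (1 + \<tau>) * (y / x) powr (\<rho> + \<tau>) * f x \<and>
         f x \<le> (1 + \<tau>) * (y / x) powr (\<tau> - \<rho>) * f y)"
        using assms unfolding potter_bounds_def by blast
      then show "\<exists>x0\<ge>1. \<forall>x\<ge>x0. f (max x t0) > 0 \<and> (\<forall>y\<ge>x.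
         f (max y t0) \<le> (1 + \<tau>) * (y / x) powr (\<rho> + \<tau>) * f (max x t0) \<and>
         f (max x t0) \<le> (1 + \<tau>) * (y / x) powr (\<tau> - \<rho>) * f (max y t0))"
      proof (intro exI[of _ "max x0 t0"] conjI allI impI)
        fix x y assume "max x0 t0 \<le> x" "x \<le> y"
        then have "max x t0 = x" "max y t0 = y" "x \<ge> x0" by auto
        then show "f (max y t0) \<le> (1 + \<tau>) * (y / x) powr (\<rho> + \<tau>) * f (max x t0)"
          and "f (max x t0) \<le> (1 + \<tau>) * (y / x) powr (\<tau> - \<rho>) * f (max y t0)"
          using x0 \<open>x \<le> y\<close> by simp_all
      next
        fix x assume "max x0 t0 \<le> x"
        then show "f (max x t0) > 0" using x0[of x] by (simp add: max_absorb1)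
      qed (use \<open>x0 \<ge> 1\<close> in auto)
    qed
    moreover have "locally_bounded_pos (\<lambda>x. f (max x t0))"
      unfolding locally_bounded_pos_def
    proof
      fix R :: real
      define S where "S = max R t0 / t0"
      have t0': "t0 \<ge> 1" "f t0 > 0" using t0 t1 by auto
      have S: "S \<ge> 1" using t0' by (simp add: S_def)
      define l where "l = f t0 / (2 * S powr \<bar>1 - \<rho>\<bar>)"
      define u where "u = 2 * S powr \<bar>\<rho> + 1\<bar> * f t0"
      have "l > 0" using t0' S by (simp add: l_def)
      moreover have "l \<le> f (max x t0) \<and> f (max x t0) \<le> u" if x: "x \<in> {0..R}" for x
      proof -
        define z where "z = max x t0"
        have z: "z \<ge> t0" "z / t0 \<le> S" "z / t0 \<ge> 1"
          using x t0' by (auto simp: z_def S_def divide_simps)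
        have pw: "(z / t0) powr e \<le> S powr \<bar>e\<bar>" for e
        proof -
          have "(z / t0) powr e \<le> (z / t0) powr \<bar>e\<bar>" using z by (intro powr_mono) auto
          also have "\<dots> \<le> S powr \<bar>e\<bar>" using z by (intro powr_mono2) auto
          finally show ?thesis .
        qed
        have "f z > 0" using t1 t0 z by auto
        have "f z \<le> 2 * (z / t0) powr (\<rho> + 1) * f t0" using P t0 z by auto
        also have "\<dots> \<le> u" unfolding u_def using t0' pw by (intro mult_right_mono mult_left_mono) auto
        finally have 1: "f z \<le> u" .
        have "f t0 \<le> 2 * (z / t0) powr (1 - \<rho>) * f z" using Q t0 z by auto
        also have "\<dots> \<le> 2 * S powr \<bar>1 - \<rho>\<bar> * f z"
          using \<open>f z > 0\<close> pw by (intro mult_right_mono mult_left_mono) auto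
        finally have "l \<le> f z" using S by (simp add: l_def field_simps)
        with 1 show ?thesis by (simp add: z_def)
      qed
      ultimately show "\<exists>l>0. \<exists>u. \<forall>x\<in>{0..R}. l \<le> f (max x t0) \<and> f (max x t0) \<le> u" by blast
    qed
    ultimately show "potter_bounds \<rho> (\<lambda>x. f (max x t0)) \<and> locally_bounded_pos (\<lambda>x. f (max x t0))" ..
  qed
qed

text \<open>L(y) / L(x) is the exponential of the integral of \<epsilon>(t) / t over [x, y], which
  is at most \<tau> ln(y / x) in absolute value. There is no constant in front of the power; this is
  what a normalised function gives beyond Potter's inequalities.\<close>

lemma normalised_slowly_varying_ratio:
  assumes "normalised_slowly_varying L" "\<tau> > 0"
  obtains x0 where "x0 \<ge> 1"
    "\<And>x y. x \<ge> x0 \<Longrightarrow> y \<ge> x \<Longrightarrow> L y \<le> (y / x) powr \<tau> * L x \<and> L x \<le> (y / x) powr \<tau> * L y"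
proof -
  obtain c x1 \<epsilon> where c: "c > 0" and x1: "x1 > 0" and \<epsilon>: "(\<epsilon> \<longlongrightarrow> 0) at_top"
    and intL: "\<forall>x\<ge>x1. (\<lambda>t. \<epsilon> t / t) integrable_on {x1..x} \<and>
       L x = c * exp (integral {x1..x} (\<lambda>t. \<epsilon> t / t))"
    using assms(1) unfolding normalised_slowly_varying_def by blast
  have int: "\<And>x. x \<ge> x1 \<Longrightarrow> (\<lambda>t. \<epsilon> t / t) integrable_on {x1..x}"
    and L: "\<And>x. x \<ge> x1 \<Longrightarrow> L x = c * exp (integral {x1..x} (\<lambda>t. \<epsilon> t / t))"
    using intL by auto
  have "eventually (\<lambda>t. \<bar>\<epsilon> t\<bar> < \<tau>) at_top"
    using tendstoD[OF \<epsilon> assms(2)] by (simp add: dist_norm)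
  then obtain x2 where x2: "\<And>t. t \<ge> x2 \<Longrightarrow> \<bar>\<epsilon> t\<bar> < \<tau>"
    by (auto simp: eventually_at_top_linorder)
  show ?thesis
  proof
    show "max 1 (max x1 x2) \<ge> 1" by simp
    fix x y :: real assume xy: "x \<ge> max 1 (max x1 x2)" "y \<ge> x"
    define I where "I = integral {x..y} (\<lambda>t. \<epsilon> t / t)"
    have Ly: "L y = L x * exp I"
    proof -
      have "integral {x1..y} (\<lambda>t. \<epsilon> t / t) = integral {x1..x} (\<lambda>t. \<epsilon> t / t) + I"
        unfolding I_def using xy by (intro Henstock_Kurzweil_Integration.integral_combine[symmetric] int) auto
      then show ?thesis using L xy by (simp add: exp_add)
    qed
    have h: "((\<lambda>t. \<tau> / t) has_integral (\<tau> * ln y - \<tau> * ln x)) {x..y}"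
      using xy by (intro fundamental_theorem_of_calculus)
        (auto intro!: derivative_eq_intros simp flip: has_real_derivative_iff_has_vector_derivative)
    have "norm I \<le> integral {x..y} (\<lambda>t. \<tau> / t)"
      unfolding I_def
    proof (rule integral_norm_bound_integral)
      show "(\<lambda>t. \<epsilon> t / t) integrable_on {x..y}"
        by (rule integrable_subinterval_real[OF int[of y]]) (use xy in auto)
      show "(\<lambda>t. \<tau> / t) integrable_on {x..y}" using h by blast
      fix t assume "t \<in> {x..y}"
      then show "norm (\<epsilon> t / t) \<le> \<tau> / t"
        using x2[of t] xy by (auto intro!: divide_right_mono)
    qed
    also have "\<dots> = \<tau> * ln (y / x)"
      using h xy by (simp add: integral_unique ln_div algebra_simps)
    finally have I: "\<bar>I\<bar> \<le> \<tau> * ln (y / x)" by simp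
    then have "exp I \<le> (y / x) powr \<tau>" "exp (-I) \<le> (y / x) powr \<tau>"
      using xy by (auto simp: powr_def)
    moreover have "L x > 0" using L xy c by simp
    ultimately show "L y \<le> (y / x) powr \<tau> * L x \<and> L x \<le> (y / x) powr \<tau> * L y"
      using mult_left_mono[of "exp I" "(y / x) powr \<tau>" "L x"]
        mult_right_mono[of "exp (-I)" "(y / x) powr \<tau>" "exp I * L x"]
      by (auto simp: Ly mult_ac exp_minus_inverse)
  qed
qed

text \<open>For \<tau> < \<alpha> the last inequality makes \<open>A\<close> strictly increasing far
  out, which a factor 1 + \<tau> would spoil.\<close>

lemma normalised_regular_ratio:
  assumes "normalised_slowly_varying L" "\<tau> > 0"
    and A: "\<And>x. x > 0 \<Longrightarrow> A x = x powr \<alpha> * L x"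
  obtains x0 where "x0 \<ge> 1"
    "\<And>x. x \<ge> x0 \<Longrightarrow> A x > 0"
    "\<And>x y. x \<ge> x0 \<Longrightarrow> y \<ge> x \<Longrightarrow> A y \<le> (y / x) powr (\<alpha> + \<tau>) * A x"
    "\<And>x y. x \<ge> x0 \<Longrightarrow> y \<ge> x \<Longrightarrow> A x \<le> (y / x) powr (\<tau> - \<alpha>) * A y"
proof -
  obtain x0 where x0: "x0 \<ge> 1"
    "\<And>x y. x \<ge> x0 \<Longrightarrow> y \<ge> x \<Longrightarrow> L y \<le> (y / x) powr \<tau> * L x \<and> L x \<le> (y / x) powr \<tau> * L y"
    using normalised_slowly_varying_ratio[OF assms(1,2)] by metis
  have L: "L x > 0" if "x > 0" for x using assms(1) that by (auto simp: normalised_slowly_varying_def)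
  show ?thesis
  proof
    show "x0 \<ge> 1" by fact
    show "A x > 0" if "x \<ge> x0" for x using A[of x] L[of x] that x0 by simp
    fix x y assume xy: "x \<ge> x0" "y \<ge> x"
    have "A y = (y / x) powr \<alpha> * x powr \<alpha> * L y"
      using xy x0 by (simp add: A powr_divide)
    also have "\<dots> \<le> (y / x) powr \<alpha> * x powr \<alpha> * ((y / x) powr \<tau> * L x)"
      using x0 xy by (intro mult_left_mono) auto
    also have "\<dots> = (y / x) powr (\<alpha> + \<tau>) * A x"
      using xy x0 by (simp add: A powr_add)
    finally show "A y \<le> (y / x) powr (\<alpha> + \<tau>) * A x" .
    have "A x = (y / x) powr (-\<alpha>) * y powr \<alpha> * L x"
      using xy x0 by (simp add: A powr_divide powr_minus field_simps)
    also have "\<dots> \<le> (y / x) powr (-\<alpha>) * y powr \<alpha> * ((y / x) powr \<tau> * L y)"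
      using x0 xy by (intro mult_left_mono) auto
    also have "\<dots> = (y / x) powr (\<tau> - \<alpha>) * A y"
      using xy x0 by (simp add: A powr_diff powr_minus field_simps)
    finally show "A x \<le> (y / x) powr (\<tau> - \<alpha>) * A y" .
  qed
qed

lemma normalised_potter:
  assumes "normalised_slowly_varying L"
    and A: "\<And>x. x > 0 \<Longrightarrow> A x = x powr \<alpha> * L x"
  shows "potter_bounds \<alpha> A"
  unfolding potter_bounds_def
proof (intro allI impI)
  fix \<tau> :: real assume \<tau>: "\<tau> > 0"
  obtain x0 where x0: "x0 \<ge> 1" "\<And>x. x \<ge> x0 \<Longrightarrow> A x > 0"
    and P: "\<And>x y. x \<ge> x0 \<Longrightarrow> y \<ge> x \<Longrightarrow> A y \<le> (y / x) powr (\<alpha> + \<tau>) * A x"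
    and Q: "\<And>x y. x \<ge> x0 \<Longrightarrow> y \<ge> x \<Longrightarrow> A x \<le> (y / x) powr (\<tau> - \<alpha>) * A y"
    using normalised_regular_ratio[OF assms(1) \<tau> A] by metis
  have le: "t \<le> (1 + \<tau>) * t" if "t \<ge> 0" for t :: real using that \<tau> by (simp add: algebra_simps)
  show "\<exists>x0\<ge>1. \<forall>x\<ge>x0. A x > 0 \<and> (\<forall>y\<ge>x. A y \<le> (1 + \<tau>) * (y / x) powr (\<alpha> + \<tau>) * A x \<and>
          A x \<le> (1 + \<tau>) * (y / x) powr (\<tau> - \<alpha>) * A y)"
  proof (intro exI[of _ x0] conjI allI impI)
    fix x y assume xy: "x \<ge> x0" "y \<ge> x"
    have "A x > 0" "A y > 0" using x0(2)[of x] x0(2)[of y] xy by auto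
    then show "A y \<le> (1 + \<tau>) * (y / x) powr (\<alpha> + \<tau>) * A x"
      and "A x \<le> (1 + \<tau>) * (y / x) powr (\<tau> - \<alpha>) * A y"
      using order_trans[OF P[OF xy] le[of "(y / x) powr (\<alpha> + \<tau>) * A x"]]
        order_trans[OF Q[OF xy] le[of "(y / x) powr (\<tau> - \<alpha>) * A y"]]
      by (simp_all add: mult.assoc)
  qed (use x0 in auto)
qed

text \<open>The sets of bad ratios decrease, lie in [1, 4] and have empty intersection by pointwise
  convergence, so continuity of the measure from above applies. Measurability of h makes these sets
  measurable.\<close>

lemma bad_ratios_measure:
  fixes h :: "real \<Rightarrow> real" and y :: "nat \<Rightarrow> real"
  assumes h: "h \<in> borel_measurable lebesgue"
    and lim: "\<And>s. s > 0 \<Longrightarrow> ((\<lambda>x. h (s * x) - h x) \<longlongrightarrow> 0) at_top"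
    and y: "filterlim y at_top sequentially" and \<kappa>: "\<kappa> > 0"
  defines "S \<equiv> \<lambda>n. {s \<in> {1..4}. \<exists>m\<ge>n. \<bar>h (y m * s) - h (y m)\<bar> > \<kappa>}"
  shows "\<And>n. S n \<in> lmeasurable" "(\<lambda>n. measure lebesgue (S n)) \<longlonglongrightarrow> 0"
proof -
  have S: "S n \<in> sets lebesgue" for n
  proof -
    have m: "(\<lambda>s. h (y m * s)) \<in> borel_measurable lebesgue" for m
      using measurable_compose[OF lebesgue_measurable_scaling[of "y m"] h] by simp
    have "{s \<in> space lebesgue. \<bar>h (y m * s) - h (y m)\<bar> > \<kappa>} \<in> sets lebesgue" for m
      using m[of m] by measurable
    then have "{1..4} \<inter> (\<Union>m\<in>{n..}. {s. \<bar>h (y m * s) - h (y m)\<bar> > \<kappa>}) \<in> sets lebesgue"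
      by (intro sets.Int sets.countable_UN) auto
    also have "{1..4} \<inter> (\<Union>m\<in>{n..}. {s. \<bar>h (y m * s) - h (y m)\<bar> > \<kappa>}) = S n"
      by (auto simp: S_def)
    finally show ?thesis .
  qed
  show L: "S n \<in> lmeasurable" for n
  proof (rule fmeasurableI2)
    show "{1..4::real} \<in> lmeasurable" by (rule lmeasurable_interval)
    show "S n \<subseteq> {1..4}" by (auto simp: S_def)
  qed (rule S)
  have "(\<lambda>n. measure lebesgue (S n)) \<longlonglongrightarrow> measure lebesgue (\<Inter>n. S n)"
  proof (rule Lim_measure_decseq)
    show "range S \<subseteq> sets lebesgue" using S by auto
    show "decseq S" unfolding decseq_def S_def using order_trans by blast
    show "emeasure lebesgue (S n) \<noteq> \<infinity>" for n using L[of n] by (auto simp: fmeasurable_def)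
  qed
  also have "(\<Inter>n. S n) = {}"
  proof (rule ccontr)
    assume "(\<Inter>n. S n) \<noteq> {}"
    then obtain s where s: "\<And>n. s \<in> S n" by blast
    then have s1: "s \<ge> 1" by (auto simp: S_def)
    have "(\<lambda>m. h (s * y m) - h (y m)) \<longlonglongrightarrow> 0"
      by (rule filterlim_compose[OF lim y]) (use s1 in auto)
    from tendstoD[OF this \<kappa>] obtain n where "\<And>m. m \<ge> n \<Longrightarrow> \<bar>h (s * y m) - h (y m)\<bar> < \<kappa>"
      by (auto simp: eventually_sequentially dist_norm)
    with s[of n] show False by (force simp: S_def mult.commute)
  qed
  finally show "(\<lambda>n. measure lebesgue (S n)) \<longlonglongrightarrow> 0" by simp
qed

text \<open>If uniformity failed along scales \<open>y\<^sub>m\<close> with ratios \<open>u\<^sub>m\<close>, the ratios \<open>s \<in> [2, 4]\<close> would be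
  covered by those that are bad for \<open>y\<close> and those for which \<open>s / u\<^sub>m\<close> is bad for \<open>u y\<close>; both sets
  have small measure.\<close>

lemma slowly_varying_uniform:
  fixes h :: "real \<Rightarrow> real"
  assumes h: "h \<in> borel_measurable lebesgue"
    and lim: "\<And>s. s > 0 \<Longrightarrow> ((\<lambda>x. h (s * x) - h x) \<longlongrightarrow> 0) at_top" and \<kappa>: "\<kappa> > 0"
  shows "\<exists>x0. \<forall>x\<ge>x0. \<forall>s\<in>{1..2}. \<bar>h (s * x) - h x\<bar> \<le> \<kappa>"
proof (rule ccontr)
  assume "\<not> ?thesis"
  then have nb: "\<not> (\<forall>x\<ge>real n. \<forall>s\<in>{1..2}. \<bar>h (s * x) - h x\<bar> \<le> \<kappa>)" for n
    by blast
  have "\<forall>n. \<exists>xu. fst xu \<ge> real n \<and> snd xu \<in> {1..2} \<and> \<bar>h (snd xu * fst xu) - h (fst xu)\<bar> > \<kappa>"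
  proof
    fix n
    from nb[of n] obtain x s where "x \<ge> real n" "s \<in> {1..2}" "\<bar>h (s * x) - h x\<bar> > \<kappa>"
      by (meson not_le)
    then show "\<exists>xu. fst xu \<ge> real n \<and> snd xu \<in> {1..2} \<and> \<bar>h (snd xu * fst xu) - h (fst xu)\<bar> > \<kappa>"
      by (intro exI[of _ "(x, s)"]) auto
  qed
  then obtain xu where xu: "\<forall>n. fst (xu n) \<ge> real n \<and> snd (xu n) \<in> {1..2} \<and>
      \<bar>h (snd (xu n) * fst (xu n)) - h (fst (xu n))\<bar> > \<kappa>"
    by (rule choice[THEN exE])
  define y u where "y = fst \<circ> xu" and "u = snd \<circ> xu"
  have yu: "y n \<ge> real n" "u n \<in> {1..2}" "\<bar>h (u n * y n) - h (y n)\<bar> > \<kappa>" for n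
    using xu by (auto simp: y_def u_def)
  have y: "filterlim y at_top sequentially"
    by (rule filterlim_at_top_mono[OF filterlim_real_sequentially]) (use yu in auto)
  have uy: "filterlim (\<lambda>n. u n * y n) at_top sequentially"
  proof (rule filterlim_at_top_mono[OF y], rule always_eventually, rule allI)
    fix n
    have "y n \<ge> 0" using yu(1)[of n] by (meson of_nat_0_le_iff order_trans)
    then show "y n \<le> u n * y n" using yu(2)[of n] by (simp add: mult_le_cancel_right1)
  qed
  define S where "S = (\<lambda>n. {s \<in> {1..4}. \<exists>m\<ge>n. \<bar>h (y m * s) - h (y m)\<bar> > \<kappa> / 2})"
  define T where "T = (\<lambda>n. {s \<in> {1..4}. \<exists>m\<ge>n. \<bar>h (u m * y m * s) - h (u m * y m)\<bar> > \<kappa> / 2})"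
  have k2: "\<kappa> / 2 > 0" using \<kappa> by simp
  have Sm: "\<And>n. S n \<in> lmeasurable" "(\<lambda>n. measure lebesgue (S n)) \<longlonglongrightarrow> 0"
    unfolding S_def by (rule bad_ratios_measure[OF h lim y k2], assumption)+
  have Tm: "\<And>n. T n \<in> lmeasurable" "(\<lambda>n. measure lebesgue (T n)) \<longlonglongrightarrow> 0"
    unfolding T_def by (rule bad_ratios_measure[OF h lim uy k2], assumption)+
  have "eventually (\<lambda>n. measure lebesgue (S n) < 1 / 10 \<and> measure lebesgue (T n) < 1 / 10) sequentially"
    using order_tendstoD(2)[OF Sm(2), of "1 / 10"] order_tendstoD(2)[OF Tm(2), of "1 / 10"]
    by (simp add: eventually_conj)
  then obtain N where N: "measure lebesgue (S N) < 1 / 10" "measure lebesgue (T N) < 1 / 10"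
    unfolding eventually_sequentially by blast
  have uN: "1 \<le> u N" "u N \<le> 2" using yu(2)[of N] by auto
  \<comment> \<open>Multiplication by u_N turns ratios that are bad for the scale u_N y_N into
    ratios relative to y_N.\<close>
  define T' where "T' = (\<lambda>x. u N *\<^sub>R x + 0) ` T N"
  have T'meas: "measure lebesgue T' = u N * measure lebesgue (T N)"
    unfolding T'_def using measure_lebesgue_affine[of "u N" 0 "T N"] uN by simp
  have T'L: "T' \<in> lmeasurable"
  proof (rule fmeasurableI2)
    show "{0..8::real} \<in> lmeasurable" by (rule lmeasurable_interval)
    show "T' \<subseteq> {0..8}"
    proof
      fix x assume "x \<in> T'"
      then obtain t where "x = u N * t" "t \<in> T N" by (auto simp: T'_def)
      then show "x \<in> {0..8}" using uN mult_mono[of "u N" 2 t 4] by (auto simp: T_def)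
    qed
    have "T' = (*\<^sub>R) (1 / u N) -` T N \<inter> space lebesgue"
      using uN by (force simp: T'_def)
    then show "T' \<in> sets lebesgue"
      using measurable_sets[OF lebesgue_measurable_scaling fmeasurableD[OF Tm(1)[of N]]] by metis
  qed
  have "{2..4} \<subseteq> S N \<union> T'"
  proof
    fix s :: real assume s: "s \<in> {2..4}"
    show "s \<in> S N \<union> T'"
    proof (rule ccontr)
      assume n: "s \<notin> S N \<union> T'"
      have 1: "\<bar>h (y N * s) - h (y N)\<bar> \<le> \<kappa> / 2"
        using n s by (force simp: S_def)
      have r: "s / u N \<in> {1..4}"
        using s uN by (auto simp: divide_simps)
      have "s / u N \<notin> T N"
      proof
        assume "s / u N \<in> T N"
        then have "u N *\<^sub>R (s / u N) + 0 \<in> T'" unfolding T'_def by (rule imageI)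
        then show False using n uN by simp
      qed
      then have "\<bar>h (u N * y N * (s / u N)) - h (u N * y N)\<bar> \<le> \<kappa> / 2"
        using r by (force simp: T_def)
      then have "\<bar>h (y N * s) - h (u N * y N)\<bar> \<le> \<kappa> / 2" using uN by (simp add: mult.commute)
      with 1 yu(3)[of N] show False by linarith
    qed
  qed
  \<comment> \<open>The interval has length 2, while the two sets have measure at most 1/10 and
    2/10.\<close>
  then have "measure lebesgue {2..4::real} \<le> measure lebesgue (S N \<union> T')"
    by (intro measure_mono_fmeasurable) (auto intro: Sm(1) T'L fmeasurable.Un)
  also have "\<dots> \<le> measure lebesgue (S N) + measure lebesgue T'"
    by (intro measure_Un_le) (use Sm(1)[of N] T'L in auto)
  also have "\<dots> \<le> 1 / 10 + 2 * (1 / 10)"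
    unfolding T'meas using N uN by (intro add_mono mult_mono) auto
  finally show False by simp
qed

text \<open>In logarithmic form the uniform bound for ratios in [1, 2] is iterated along powers of
  2. About log_2(y / x) iterations are needed, so the errors add up to a small multiple of ln(y /
  x).\<close>

lemma regularly_varying_potter:
  assumes f: "regularly_varying \<beta> f"
  shows "potter_bounds \<beta> f"
proof -
  obtain x0 where meas: "f \<in> borel_measurable (lebesgue_on {x0..})" and pos: "\<And>x. x \<ge> x0 \<Longrightarrow> f x > 0"
    and lim: "\<And>c. c > 0 \<Longrightarrow> ((\<lambda>x. f (c * x) / f x) \<longlongrightarrow> c powr \<beta>) at_top"
    using f unfolding regularly_varying_def by blast
  define h where "h = (\<lambda>x. ln (if x \<in> {x0..} then f x else 0) - \<beta> * ln x)"
  have "(\<lambda>x. if x \<in> {x0..} then f x else 0) \<in> borel_measurable lebesgue"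
    using meas by (subst (asm) measurable_restrict_space_iff[where c = 0]) auto
  then have h: "h \<in> borel_measurable lebesgue"
    unfolding h_def
    by (intro borel_measurable_diff borel_measurable_ln borel_measurable_times borel_measurable_const)
       (auto intro!: measurable_completion)
  have hlim: "((\<lambda>x. h (s * x) - h x) \<longlongrightarrow> 0) at_top" if s: "s > 0" for s
  proof -
    have "((\<lambda>x. ln (f (s * x) / f x) - \<beta> * ln s) \<longlongrightarrow> ln (s powr \<beta>) - \<beta> * ln s) at_top"
      by (intro tendsto_intros lim s) (use s in auto)
    then have "((\<lambda>x. ln (f (s * x) / f x) - \<beta> * ln s) \<longlongrightarrow> 0) at_top"
      using s by (simp add: ln_powr)
    moreover have "eventually (\<lambda>x. ln (f (s * x) / f x) - \<beta> * ln s = h (s * x) - h x) at_top"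
      using eventually_ge_at_top[of "max x0 (x0 / s)"] eventually_gt_at_top[of 0]
    proof eventually_elim
      case (elim x)
      then have "s * x \<ge> x0" "x \<ge> x0" using s by (auto simp: field_simps)
      then show ?case
        using pos[of x] pos[of "s * x"] elim s by (simp add: h_def ln_div ln_mult algebra_simps)
    qed
    ultimately show ?thesis by (rule Lim_transform_eventually)
  qed
  show ?thesis
    unfolding potter_bounds_def
  proof (intro allI impI)
    fix \<tau> :: real assume \<tau>: "\<tau> > 0"
    \<comment> \<open>Each doubling costs at most \<tau> ln 2, which yields the exponent \<tau>; the
      one remaining step costs at most ln(1 + \<tau>), which yields the constant.\<close>
    define \<kappa> where "\<kappa> = min (\<tau> * ln 2) (ln (1 + \<tau>))"
    have \<kappa>: "\<kappa> > 0" "\<kappa> \<le> \<tau> * ln 2" "\<kappa> \<le> ln (1 + \<tau>)" using \<tau> by (auto simp: \<kappa>_def)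
    obtain x1 where x1: "\<And>x s. x \<ge> x1 \<Longrightarrow> s \<in> {1..2} \<Longrightarrow> \<bar>h (s * x) - h x\<bar> \<le> \<kappa>"
      using slowly_varying_uniform[OF h hlim \<kappa>(1)] by blast
    define X where "X = max 1 (max x0 x1)"
    have dyadic: "\<bar>h (s * 2 ^ n * x) - h x\<bar> \<le> real (Suc n) * \<kappa>"
      if "x \<ge> X" "s \<in> {1..2}" for s x n
    proof (induction n)
      case 0
      show ?case using x1[of x s] that by (simp add: X_def)
    next
      case (Suc n)
      have "1 * x \<le> (s * 2 ^ n) * x"
        using that mult_mono[of 1 s 1 "2 ^ n::real"] by (intro mult_right_mono) (auto simp: X_def)
      then have "\<bar>h (2 * (s * 2 ^ n * x)) - h (s * 2 ^ n * x)\<bar> \<le> \<kappa>"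
        using that by (intro x1) (auto simp: X_def intro: order_trans)
      with Suc show ?case by (simp add: algebra_simps)
    qed
    show "\<exists>x0\<ge>1. \<forall>x\<ge>x0. f x > 0 \<and> (\<forall>y\<ge>x. f y \<le> (1 + \<tau>) * (y / x) powr (\<beta> + \<tau>) * f x \<and>
          f x \<le> (1 + \<tau>) * (y / x) powr (\<tau> - \<beta>) * f y)"
    proof (intro exI[of _ X] conjI allI impI)
      show "X \<ge> 1" by (simp add: X_def)
      show "f x > 0" if "x \<ge> X" for x using pos that by (simp add: X_def)
      fix x y assume xy: "x \<ge> X" "y \<ge> x"
      have x0': "x \<ge> 1" "x \<ge> x0" "y \<ge> x0" using xy by (auto simp: X_def)
      have fp: "f x > 0" "f y > 0" using pos x0' by auto
      define n where "n = nat \<lfloor>log 2 (y / x)\<rfloor>"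
      have l0: "log 2 (y / x) \<ge> 0" using xy x0' by simp
      then have n: "real n \<le> log 2 (y / x)" "log 2 (y / x) < real n + 1"
        unfolding n_def by linarith+
      define s where "s = (y / x) / 2 ^ n"
      have yx: "y / x \<ge> 1" using xy x0' by simp
      have "2 ^ n \<le> y / x" "y / x < 2 * 2 ^ n"
        using n yx less_powr_iff[of 2 "y / x" "real n + 1"] powr_le_iff[of 2 "y / x" "real n"]
        by (simp_all add: powr_add powr_realpow mult.commute)
      moreover have "q / 2 ^ n \<in> {1..2}" if "2 ^ n \<le> q" "q < 2 * 2 ^ n" for q :: real
        using that by (simp add: field_simps)
      ultimately have s: "s \<in> {1..2}"
        unfolding s_def by blast
      have "\<bar>h y - h x\<bar> \<le> real (Suc n) * \<kappa>"
        using dyadic[OF xy(1) s, of n] x0' by (simp add: s_def)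
      also have "\<dots> \<le> log 2 (y / x) * (\<tau> * ln 2) + ln (1 + \<tau>)"
        using mult_mono[OF n(1) \<kappa>(2)] \<kappa> l0 by (simp add: algebra_simps)
      also have "\<dots> = \<tau> * ln (y / x) + ln (1 + \<tau>)" by (simp add: log_def)
      finally have H: "\<bar>h y - h x\<bar> \<le> \<tau> * ln (y / x) + ln (1 + \<tau>)" .
      have hh: "h y - h x = ln (f y / f x) - \<beta> * ln (y / x)"
        using x0' fp xy by (simp add: h_def ln_div algebra_simps)
      have "ln (f y / f x) \<le> ln (1 + \<tau>) + (\<beta> + \<tau>) * ln (y / x)"
        using H hh by (simp add: abs_le_iff ring_distribs)
      also have "\<dots> = ln ((1 + \<tau>) * (y / x) powr (\<beta> + \<tau>))"
        using xy x0' \<tau> by (simp add: ln_mult ln_powr)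
      finally have "ln (f y / f x) \<le> ln ((1 + \<tau>) * (y / x) powr (\<beta> + \<tau>))" .
      then have "f y / f x \<le> (1 + \<tau>) * (y / x) powr (\<beta> + \<tau>)"
        using fp yx \<tau> by (subst (asm) ln_le_cancel_iff) (auto intro!: mult_pos_pos)
      then show "f y \<le> (1 + \<tau>) * (y / x) powr (\<beta> + \<tau>) * f x"
        using fp by (simp add: pos_divide_le_eq)
      have "ln (f x / f y) = - ln (f y / f x)" using fp by (simp add: ln_div)
      also have "\<dots> \<le> ln (1 + \<tau>) + (\<tau> - \<beta>) * ln (y / x)"
        using H hh by (simp add: abs_le_iff ring_distribs)
      also have "\<dots> = ln ((1 + \<tau>) * (y / x) powr (\<tau> - \<beta>))"
        using xy x0' \<tau> by (simp add: ln_mult ln_powr)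
      finally have "ln (f x / f y) \<le> ln ((1 + \<tau>) * (y / x) powr (\<tau> - \<beta>))" .
      then have "f x / f y \<le> (1 + \<tau>) * (y / x) powr (\<tau> - \<beta>)"
        using fp yx \<tau> by (subst (asm) ln_le_cancel_iff) (auto intro!: mult_pos_pos)
      then show "f x \<le> (1 + \<tau>) * (y / x) powr (\<tau> - \<beta>) * f y"
        using fp by (simp add: pos_divide_le_eq)
    qed
  qed
qed

section \<open>Exponential decay, power series on the unit circle, explicit integrals\<close>

lemma powr_exp_bounded:
  fixes c m :: real
  assumes "c > 0" "m \<ge> 0"
  obtains C where "C > 0" "\<And>x. x > 0 \<Longrightarrow> x powr m * exp (- c * x) \<le> C"
proof -
  define k where "k = nat \<lceil>m\<rceil>"
  have k: "m \<le> real k" unfolding k_def using assms(2) by linarith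
  have "x powr m * exp (- c * x) \<le> 1 + fact k / c ^ k" if x: "x > 0" for x
  proof -
    have "(\<Sum>n\<in>{k}. (c * x) ^ n /\<^sub>R fact n) \<le> (\<Sum>n. (c * x) ^ n /\<^sub>R fact n)"
      using x assms summable_exp_generic[of "c * x"] by (intro sum_le_suminf) auto
    then have "(c * x) ^ k / fact k \<le> exp (c * x)"
      by (simp add: exp_def divide_inverse mult.commute)
    then have "x ^ k * exp (- c * x) \<le> fact k / c ^ k"
      using assms by (simp add: exp_minus field_simps power_mult_distrib)
    moreover have "x powr m \<le> 1 + x ^ k"
    proof (cases "x \<le> 1")
      case True
      then have "x powr m \<le> 1" using x assms(2) by (simp add: powr_le1)
      then show ?thesis using x by (simp add: add_increasing2)
    next
      case False
      then have "x powr m \<le> x powr real k" using k by (intro powr_mono) auto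
      then show ?thesis using x by (simp add: powr_realpow)
    qed
    then have "x powr m * exp (- c * x) \<le> (1 + x ^ k) * exp (- c * x)"
      by (rule mult_right_mono) simp
    moreover have "exp (- c * x) \<le> 1" using x assms by simp
    ultimately show ?thesis unfolding ring_distribs mult_1_left by linarith
  qed
  moreover have "1 + fact k / c ^ k > 0" using assms by (intro add_pos_nonneg) auto
  ultimately show ?thesis using that by blast
qed

lemma integral_power_series_mult:
  fixes c :: "nat \<Rightarrow> real" and h :: "real \<Rightarrow> complex"
  assumes c: "\<And>k. 0 \<le> c k" "summable c" and h: "continuous_on {u..v} h"
  defines "f \<equiv> \<lambda>\<theta>. (\<Sum>k. of_real (c k) * cis \<theta> ^ k) * h \<theta>"
  shows "f integrable_on {u..v}"
    and "(\<lambda>k. of_real (c k) * integral {u..v} (\<lambda>\<theta>. cis \<theta> ^ k * h \<theta>)) sums integral {u..v} f"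
proof -
  obtain B where B: "\<And>\<theta>. \<theta> \<in> {u..v} \<Longrightarrow> norm (h \<theta>) \<le> B"
    using compact_imp_bounded[OF compact_continuous_image[OF h compact_Icc]]
    unfolding bounded_iff by (metis imageI)
  define g where "g = (\<lambda>k \<theta>. of_real (c k) * cis \<theta> ^ k * h \<theta>)"
  have sm: "summable (\<lambda>k. of_real (c k) * cis \<theta> ^ k)" for \<theta>
    by (rule summable_comparison_test'[OF c(2), of 0]) (use c in \<open>auto simp: norm_mult norm_power\<close>)
  have "uniform_limit {u..v} (\<lambda>n \<theta>. \<Sum>k<n. g k \<theta>) (\<lambda>\<theta>. \<Sum>k. g k \<theta>) sequentially"
  proof (rule Weierstrass_m_test)
    show "norm (g k \<theta>) \<le> c k * B" if "\<theta> \<in> {u..v}" for k \<theta>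
      using B[OF that] c by (auto simp: g_def norm_mult norm_power intro!: mult_left_mono)
    show "summable (\<lambda>k. c k * B)" using c by (intro summable_mult2)
  qed
  also have "(\<lambda>\<theta>. \<Sum>k. g k \<theta>) = f"
    unfolding g_def f_def by (intro ext suminf_mult2[symmetric] sm)
  finally have lim: "uniform_limit {u..v} (\<lambda>n \<theta>. \<Sum>k<n. g k \<theta>) f sequentially" .
  have cont: "continuous_on {u..v} (g k)" for k
    unfolding g_def by (intro continuous_intros h)
  obtain I J where IJ: "\<And>n. ((\<lambda>\<theta>. \<Sum>k<n. g k \<theta>) has_integral I n) {u..v}"
      "(f has_integral J) {u..v}" "I \<longlonglongrightarrow> J"
    by (rule uniform_limit_integral[OF lim]) (auto intro!: continuous_on_sum cont)
  show "f integrable_on {u..v}" using IJ by blast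
  have "I n = (\<Sum>k<n. of_real (c k) * integral {u..v} (\<lambda>\<theta>. cis \<theta> ^ k * h \<theta>))" for n
  proof -
    have "I n = integral {u..v} (\<lambda>\<theta>. \<Sum>k<n. g k \<theta>)"
      using integral_unique[OF IJ(1)[of n]] by simp
    also have "\<dots> = (\<Sum>k<n. integral {u..v} (g k))"
      by (intro integral_sum integrable_continuous_interval cont) auto
    also have "\<dots> = (\<Sum>k<n. of_real (c k) * integral {u..v} (\<lambda>\<theta>. cis \<theta> ^ k * h \<theta>))"
      by (simp add: g_def mult.assoc)
    finally show ?thesis .
  qed
  then have "I = (\<lambda>n. \<Sum>k<n. of_real (c k) * integral {u..v} (\<lambda>\<theta>. cis \<theta> ^ k * h \<theta>))" ..
  then show "(\<lambda>k. of_real (c k) * integral {u..v} (\<lambda>\<theta>. cis \<theta> ^ k * h \<theta>)) sums integral {u..v} f"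
    using IJ(3) unfolding sums_def integral_unique[OF IJ(2)] by simp
qed

lemma continuous_power_series_cis:
  fixes c :: "nat \<Rightarrow> real"
  assumes c: "\<And>k. 0 \<le> c k" "summable c"
  shows "continuous_on S (\<lambda>\<theta>. \<Sum>k. of_real (c k) * cis \<theta> ^ k :: complex)"
proof (rule uniform_limit_theorem)
  show "uniform_limit S (\<lambda>n \<theta>. \<Sum>k<n. of_real (c k) * cis \<theta> ^ k) (\<lambda>\<theta>. \<Sum>k. of_real (c k) * cis \<theta> ^ k) sequentially"
    by (rule Weierstrass_m_test[OF _ c(2)]) (use c in \<open>auto simp: norm_mult norm_power\<close>)
  show "\<forall>\<^sub>F n in sequentially. continuous_on S (\<lambda>\<theta>. \<Sum>k<n. of_real (c k) * cis \<theta> ^ k)"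
    by (intro always_eventually allI continuous_intros)
qed auto

lemma integral_cis_orthogonal:
  "integral {-pi..pi} (\<lambda>\<theta>. cis \<theta> ^ j * cis (- \<theta>) ^ k) = (if j = k then 2 * pi else 0)"
proof -
  have e: "cis \<theta> ^ j * cis (- \<theta>) ^ k = cis ((real j - real k) * \<theta>)" for \<theta>
  proof -
    have "cis \<theta> ^ j * cis (- \<theta>) ^ k = cis (real j * \<theta> + real k * (- \<theta>))"
      by (simp only: Complex.DeMoivre cis_mult)
    also have "real j * \<theta> + real k * (- \<theta>) = (real j - real k) * \<theta>" by (simp add: algebra_simps)
    finally show ?thesis .
  qed
  show ?thesis
  proof (cases "j = k")
    case True
    then show ?thesis unfolding e by (simp add: scaleR_conv_of_real)
  next
    case False
    define r where "r = real j - real k"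
    have r: "r \<noteq> 0" using False by (simp add: r_def)
    have "((\<lambda>\<theta>. cis (r * \<theta>)) has_integral (cis (r * pi) / (\<i> * r) - cis (r * (-pi)) / (\<i> * r))) {-pi..pi}"
    proof (rule fundamental_theorem_of_calculus)
      fix x assume "x \<in> {-pi..pi}"
      have "((\<lambda>\<theta>. exp (\<i> * (r * \<theta>)) / (\<i> * r)) has_vector_derivative exp (\<i> * (r * x))) (at x within {-pi..pi})"
        using r by (auto intro!: derivative_eq_intros has_vector_derivative_real_field simp: mult.commute mult.left_commute)
      then show "((\<lambda>\<theta>. cis (r * \<theta>) / (\<i> * r)) has_vector_derivative cis (r * x)) (at x within {-pi..pi})"
        by (simp add: cis_conv_exp)
    qed simp
    moreover have "cis (r * pi) = cis (r * (-pi))"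
    proof -
      have "cis (r * pi) = cis (r * (-pi)) * cis (2 * pi * r)"
        by (simp add: cis_mult algebra_simps)
      also have "cis (2 * pi * r) = 1" by (rule cis_multiple_2pi) (simp add: r_def)
      finally show ?thesis by simp
    qed
    ultimately have "((\<lambda>\<theta>. cis (r * \<theta>)) has_integral 0) {-pi..pi}" by simp
    then show ?thesis using False by (simp add: e integral_unique flip: r_def)
  qed
qed

text \<open>For r different from 0 the cosine transform of the triangle weight is (1 - cos(r d)) /
  (d r^2), hence non-negative. This positivity lets a single probability be bounded by an integral
  over [0, d] rather than over the whole circle.\<close>

lemma integral_triangle_cos:
  fixes d r :: real
  assumes d: "d > 0"
  shows "integral {0..d} (\<lambda>\<theta>. (1 - \<theta> / d) * cos (r * \<theta>)) \<ge> 0"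
    and "integral {0..d} (\<lambda>\<theta>. (1 - \<theta> / d)) = d / 2"
proof -
  have "((\<lambda>\<theta>. 1 - \<theta> / d) has_integral ((d - d\<^sup>2 / (2 * d)) - (0 - 0\<^sup>2 / (2 * d)))) {0..d}"
    by (rule fundamental_theorem_of_calculus)
       (use d in \<open>auto intro!: derivative_eq_intros simp: field_simps simp flip: has_real_derivative_iff_has_vector_derivative\<close>)
  then show 1: "integral {0..d} (\<lambda>\<theta>. (1 - \<theta> / d)) = d / 2"
    using d by (subst integral_unique) (auto simp: power2_eq_square)
  show "integral {0..d} (\<lambda>\<theta>. (1 - \<theta> / d) * cos (r * \<theta>)) \<ge> 0"
  proof (cases "r = 0")
    case True
    then show ?thesis using 1 d by simp
  next
    case False
    define G where "G = (\<lambda>\<theta>. (1 - \<theta> / d) * sin (r * \<theta>) / r - cos (r * \<theta>) / (d * r\<^sup>2))"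
    have "((\<lambda>\<theta>. (1 - \<theta> / d) * cos (r * \<theta>)) has_integral (G d - G 0)) {0..d}"
    proof (rule fundamental_theorem_of_calculus)
      fix x assume "x \<in> {0..d}"
      have "(G has_real_derivative (1 - x / d) * cos (r * x)) (at x within {0..d})"
        unfolding G_def using d False
        by (auto intro!: derivative_eq_intros simp: field_simps power2_eq_square)
      then show "(G has_vector_derivative (1 - x / d) * cos (r * x)) (at x within {0..d})"
        by (simp add: has_real_derivative_iff_has_vector_derivative)
    qed (use d in simp)
    moreover have "G d - G 0 = (1 - cos (r * d)) / (d * r\<^sup>2)"
      using d False by (simp add: G_def field_simps)
    moreover have "\<dots> \<ge> 0" using d by simp
    ultimately show ?thesis by (simp add: integral_unique)
  qed
qed

lemma integral_inverse_square_le: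
  fixes u s t :: real
  assumes "u > 0" "s \<le> t"
  shows "(\<lambda>\<theta>. 1 / (1 + (u * \<theta>)\<^sup>2)) integrable_on {s..t}"
    and "integral {s..t} (\<lambda>\<theta>. 1 / (1 + (u * \<theta>)\<^sup>2)) \<le> 4 / u"
proof -
  have "((\<lambda>\<theta>. 1 / (1 + (u * \<theta>)\<^sup>2)) has_integral (arctan (u * t) / u - arctan (u * s) / u)) {s..t}"
  proof (rule fundamental_theorem_of_calculus)
    fix x assume "x \<in> {s..t}"
    have "((\<lambda>\<theta>. arctan (u * \<theta>) / u) has_real_derivative (inverse (1 + (u * x)\<^sup>2) * u / u)) (at x within {s..t})"
      by (intro DERIV_cdivide DERIV_chain2[OF DERIV_arctan] DERIV_cmult_Id)
    then show "((\<lambda>\<theta>. arctan (u * \<theta>) / u) has_vector_derivative 1 / (1 + (u * x)\<^sup>2)) (at x within {s..t})"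
      using assms by (simp add: has_real_derivative_iff_has_vector_derivative inverse_eq_divide)
  qed (use assms in simp)
  \<comment> \<open>The range of arctan has length \<pi> < 4.\<close>
  moreover have "arctan (u * t) / u - arctan (u * s) / u \<le> 4 / u"
    using arctan_ubound[of "u * t"] arctan_lbound[of "u * s"] pi_less_4 assms
    by (simp add: divide_right_mono flip: diff_divide_distrib)
  ultimately show "(\<lambda>\<theta>. 1 / (1 + (u * \<theta>)\<^sup>2)) integrable_on {s..t}"
    "integral {s..t} (\<lambda>\<theta>. 1 / (1 + (u * \<theta>)\<^sup>2)) \<le> 4 / u"
    by (auto simp: integral_unique)
qed

section \<open>Characteristic functions and local bounds\<close>

text \<open>\<open>A\<close> and \<open>a\<close> stand for the given functions frozen below a
  threshold, which is why monotonicity and the lower bound 1 hold everywhere. Aperiodicity appears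
  in dual form: an angle that no point of the support can detect is a multiple of 2\<pi>.\<close>

locale renewal_walk =
  fixes p :: "nat \<Rightarrow> real" and A :: "real \<Rightarrow> real" and a :: "nat \<Rightarrow> real" and \<alpha> :: real
  assumes p_nonneg: "\<And>k. 0 \<le> p k" and p_sums: "p sums 1"
    and alpha: "0 < \<alpha>" "\<alpha> < 1"
    and aperiodic: "\<And>\<theta>. (\<And>k. p k > 0 \<Longrightarrow> cos (real k * \<theta>) = 1) \<Longrightarrow> cos \<theta> = 1"
    and A_mono: "\<And>x y. x \<le> y \<Longrightarrow> A x \<le> A y" and A_ge_1: "\<And>x. A x \<ge> 1"
    and A_potter: "potter_bounds \<alpha> A"
    and tail_A: "(\<lambda>k. (1 - (\<Sum>j\<le>k. p j)) * A (real k)) \<longlonglongrightarrow> 1"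
    and a_mono: "\<And>m n. m \<le> n \<Longrightarrow> a m \<le> a n" and a_ge_1: "\<And>n. a n \<ge> 1"
    and a_top: "filterlim a at_top sequentially"
    and A_a: "eventually (\<lambda>n. A (a n) = real n) sequentially"
begin

abbreviation P :: "nat \<Rightarrow> nat \<Rightarrow> real" where "P \<equiv> conv_pow p"

definition tail :: "nat \<Rightarrow> real" where "tail k = 1 - (\<Sum>j\<le>k. p j)"

lemma A_pos [simp]: "A x > 0" "A x \<ge> 0" "A x \<noteq> 0"
  using A_ge_1[of x] by auto

lemma a_pos [simp]: "a n > 0" "a n \<ge> 0" "a n \<noteq> 0"
  using a_ge_1[of n] by auto

lemma A_locally_bounded: "locally_bounded_pos A"
  unfolding locally_bounded_pos_def
  using A_mono A_ge_1 by (intro allI exI[of _ 1] conjI exI ballI) (auto intro: A_mono)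

lemma P_nonneg: "P n k \<ge> 0"
  by (rule conv_pow_nonneg[OF p_nonneg])

lemma p_summable: "summable p"
  using p_sums by (simp add: sums_iff)

lemma P_summable: "summable (P n)" and P_sums: "P n sums 1"
  using conv_pow_sums_1[OF p_nonneg p_sums] by (simp_all add: sums_iff)

lemma sum_p_le_1: "(\<Sum>j\<in>S. p j) \<le> 1" if "finite S"
  using sum_le_suminf[OF p_summable that] p_nonneg p_sums by (simp add: sums_iff)

lemma P_le_1: "P n k \<le> 1"
proof -
  have "P n k \<le> (\<Sum>j\<le>k. p j) ^ n" by (rule conv_pow_le_sum[OF p_nonneg])
  also have "\<dots> \<le> 1" by (intro power_le_one sum_nonneg p_nonneg sum_p_le_1) auto
  finally show ?thesis .
qed

lemma tail_nonneg: "tail k \<ge> 0" and tail_le_1: "tail k \<le> 1"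
  using sum_p_le_1[of "{..k}"] sum_nonneg[of "{..k}" p] p_nonneg by (auto simp: tail_def)

lemma tail_antimono: "j \<le> k \<Longrightarrow> tail k \<le> tail j"
  unfolding tail_def by (intro diff_left_mono sum_mono2) (auto intro: p_nonneg)

lemma tail_diff: "j \<le> k \<Longrightarrow> (\<Sum>i\<in>{j<..k}. p i) = tail j - tail k"
proof -
  assume "j \<le> k"
  then have "{..k} = {..j} \<union> {j<..k}" by auto
  moreover have "(\<Sum>i\<in>{..j} \<union> {j<..k}. p i) = (\<Sum>i\<le>j. p i) + (\<Sum>i\<in>{j<..k}. p i)"
    by (rule sum.union_disjoint) auto
  ultimately have "(\<Sum>i\<le>k. p i) = (\<Sum>i\<le>j. p i) + (\<Sum>i\<in>{j<..k}. p i)"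
    by (simp only:)
  then show ?thesis by (simp add: tail_def)
qed

lemma tail_bounds:
  obtains c C where "c > 0" "\<And>k. c / A (real k) \<le> tail k" "\<And>k. tail k \<le> C / A (real k)"
proof -
  have lim: "(\<lambda>k. tail k * A (real k)) \<longlonglongrightarrow> 1" using tail_A by (simp add: tail_def)
  then obtain C where C: "\<And>k. norm (tail k * A (real k)) \<le> C"
    using convergent_imp_Bseq[THEN BseqE, of "\<lambda>k. tail k * A (real k)"] by (auto simp: convergent_def)
  obtain K where K: "\<And>k. k \<ge> K \<Longrightarrow> tail k * A (real k) > 1 / 2"
    using order_tendstoD(1)[OF lim, of "1/2"] by (auto simp: eventually_sequentially)
  define c where "c = min (1 / 2) (tail K)"
  have "0 < tail K * A (real K)" using K[of K] by linarith
  then have "tail K > 0" by (rule zero_less_mult_pos2) simp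
  then have c: "c > 0" by (simp add: c_def)
  have "c / A (real k) \<le> tail k" for k
  proof (cases "k \<ge> K")
    case True
    then have "c \<le> tail k * A (real k)" using K[of k] by (simp add: c_def)
    then show ?thesis by (simp add: pos_divide_le_eq)
  next
    case False
    have "c / A (real k) \<le> c / 1" using c A_ge_1 by (intro divide_left_mono) auto
    also have "\<dots> \<le> tail K" by (simp add: c_def)
    also have "\<dots> \<le> tail k" using False by (intro tail_antimono) auto
    finally show ?thesis .
  qed
  moreover have "tail k \<le> C / A (real k)" for k
    using C[of k] by (simp add: pos_le_divide_eq)
  ultimately show ?thesis using c that by blast
qed

lemma A_potter_global:
  assumes "\<tau> > 0"
  shows "\<exists>C\<ge>1. \<forall>x\<ge>1. \<forall>y\<ge>x. A y \<le> C * (y / x) powr (\<alpha> + \<tau>) * A x \<and>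
    A x \<le> C * (y / x) powr (\<tau> - \<alpha>) * A y"
proof (rule potter_global[OF A_locally_bounded A_potter assms])
  fix C assume C: "1 \<le> C"
    "\<And>x y. 1 \<le> x \<Longrightarrow> x \<le> y \<Longrightarrow> A y \<le> C * (y / x) powr (\<alpha> + \<tau>) * A x"
    "\<And>x y. 1 \<le> x \<Longrightarrow> x \<le> y \<Longrightarrow> A x \<le> C * (y / x) powr (\<tau> - \<alpha>) * A y"
  show ?thesis by (rule exI[of _ C]) (use C in simp)
qed

lemma A_lower_half:
  obtains C where "C \<ge> 1" "\<And>x y. x \<ge> 1 \<Longrightarrow> y \<ge> x \<Longrightarrow> A x \<le> C * (y / x) powr (- (\<alpha> / 2)) * A y"
proof -
  have "\<alpha> / 2 - \<alpha> = - (\<alpha> / 2)" by simp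
  with A_potter_global[of "\<alpha> / 2"] alpha
  have "\<exists>C\<ge>1. \<forall>x\<ge>1. \<forall>y\<ge>x. A x \<le> C * (y / x) powr (- (\<alpha> / 2)) * A y"
    by auto
  then show ?thesis using that by blast
qed

lemma A_a_bounds:
  obtains c C where "c > 0" "C > 0" "\<And>n. n \<ge> 1 \<Longrightarrow> c * real n \<le> A (a n)" "\<And>n. n \<ge> 1 \<Longrightarrow> A (a n) \<le> C * real n"
proof -
  obtain N where N: "\<And>n. n \<ge> N \<Longrightarrow> A (a n) = real n"
    using A_a by (auto simp: eventually_sequentially)
  define c where "c = 1 / (real N + 1)"
  define C where "C = real N + 1"
  have cC: "c > 0" "c \<le> 1" "C \<ge> 1" by (auto simp: c_def C_def)
  have "c * real n \<le> A (a n)" if "n \<ge> 1" for n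
  proof (cases "n \<ge> N")
    case True
    then show ?thesis using N[of n] cC mult_right_mono[of c 1 "real n"] by simp
  next
    case False
    then have "c * real n \<le> 1" by (simp add: c_def field_simps)
    then show ?thesis using A_ge_1[of "a n"] by linarith
  qed
  moreover have "A (a n) \<le> C * real n" if n: "n \<ge> 1" for n
  proof (cases "n \<ge> N")
    case True
    then show ?thesis using N[of n] cC mult_right_mono[of 1 C "real n"] by simp
  next
    case False
    then have "A (a n) \<le> A (a N)" by (intro A_mono a_mono) auto
    also have "\<dots> \<le> C * 1" using N[of N] by (simp add: C_def)
    also have "\<dots> \<le> C * real n" using n cC by (intro mult_left_mono) auto
    finally show ?thesis .
  qed
  ultimately show ?thesis using that cC by (metis less_le_trans zero_less_one)
qed

text \<open>The factor 3 is there because n <= 3 (n div 2) for n >= 2, so that walks can be cut into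
  two halves. A large quotient a_n / a_m would make A(a_n) / A(a_m) large, whereas the latter is at
  most a constant times n / m.\<close>

lemma a_doubling:
  obtains C where "C > 0" "\<And>m n. m \<ge> 1 \<Longrightarrow> n \<le> 3 * m \<Longrightarrow> a n \<le> C * a m"
proof -
  obtain c C where cC: "c > 0" "C > 0" "\<And>n. n \<ge> 1 \<Longrightarrow> c * real n \<le> A (a n)" "\<And>n. n \<ge> 1 \<Longrightarrow> A (a n) \<le> C * real n"
    using A_a_bounds by blast
  obtain D where D: "D \<ge> 1"
    "\<And>x y. x \<ge> 1 \<Longrightarrow> y \<ge> x \<Longrightarrow> A x \<le> D * (y / x) powr (- (\<alpha> / 2)) * A y"
    using A_lower_half by blast
  define K where "K = (D * C * 3 / c) powr (2 / \<alpha>)"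
  have "a n \<le> max 1 K * a m" if mn: "m \<ge> 1" "n \<le> 3 * m" for m n
  proof (cases "a n \<le> a m")
    case True
    have "1 * a m \<le> max 1 K * a m" by (rule mult_right_mono) auto
    then show ?thesis using True by linarith
  next
    case False
    then have n: "n > m" using a_mono[of n m] by (meson linorder_not_le)
    define q where "q = a n / a m"
    have q: "q > 1" using False by (simp add: q_def)
    have "c * real m \<le> A (a m)" using cC mn by auto
    also have "\<dots> \<le> D * q powr (- (\<alpha> / 2)) * A (a n)"
      unfolding q_def using False a_ge_1 by (intro D(2)) auto
    also have "\<dots> \<le> D * q powr (- (\<alpha> / 2)) * (C * real (3 * m))"
    proof (rule mult_left_mono)
      have "A (a n) \<le> C * real n" using cC n mn by auto
      also have "\<dots> \<le> C * real (3 * m)" using mn cC by (intro mult_left_mono) linarith+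
      finally show "A (a n) \<le> C * real (3 * m)" .
    qed (use D in simp)
    finally have "c * real m \<le> (D * C * 3 * q powr (- (\<alpha> / 2))) * real m"
      by (simp add: algebra_simps)
    then have "c \<le> D * C * 3 * q powr (- (\<alpha> / 2))" using mn by (subst (asm) mult_le_cancel_right) auto
    then have "q powr (\<alpha> / 2) \<le> D * C * 3 / c"
      using q cC by (simp add: powr_minus field_simps)
    then have "(q powr (\<alpha> / 2)) powr (2 / \<alpha>) \<le> K"
      unfolding K_def using alpha by (intro powr_mono2) auto
    then have "q \<le> K" using q alpha by (simp add: powr_powr)
    then have "q \<le> max 1 K" by simp
    then show ?thesis by (simp add: q_def pos_divide_le_eq)
  qed
  then show ?thesis using that[of "max 1 K"] by (simp add: less_max_iff_disj)
qed

definition \<phi> :: "real \<Rightarrow> complex" where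
  "\<phi> \<theta> = (\<Sum>k. of_real (p k) * cis \<theta> ^ k)"

lemma \<phi>_power_sums: "(\<lambda>k. of_real (P n k) * cis \<theta> ^ k) sums (\<phi> \<theta> ^ n)"
  unfolding \<phi>_def by (rule conv_pow_sums(1)[OF p_nonneg p_sums]) simp

lemma \<phi>_power_eq: "\<phi> \<theta> ^ n = (\<Sum>k. of_real (P n k) * cis \<theta> ^ k)"
  using \<phi>_power_sums by (simp add: sums_iff)

lemma continuous_\<phi>: "continuous_on S \<phi>"
  unfolding \<phi>_def[abs_def] by (rule continuous_power_series_cis[OF p_nonneg p_summable])

lemma sums_Re_\<phi>: "(\<lambda>k. p k * cos (real k * \<theta> + \<tau>)) sums Re (cis \<tau> * \<phi> \<theta>)"
proof -
  have "(\<lambda>k. of_real (p k) * cis \<theta> ^ k) sums \<phi> \<theta>" using \<phi>_power_sums[of 1 \<theta>] by simp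
  then have "(\<lambda>k. Re (cis \<tau> * (of_real (p k) * cis \<theta> ^ k))) sums Re (cis \<tau> * \<phi> \<theta>)"
    by (intro sums_Re sums_mult)
  also have "(\<lambda>k. Re (cis \<tau> * (of_real (p k) * cis \<theta> ^ k))) = (\<lambda>k. p k * cos (real k * \<theta> + \<tau>))"
  proof
    fix k
    have "cis \<tau> * cis \<theta> ^ k = cis (real k * \<theta> + \<tau>)"
      by (simp only: Complex.DeMoivre cis_mult add.commute)
    then have "cis \<tau> * (of_real (p k) * cis \<theta> ^ k) = of_real (p k) * cis (real k * \<theta> + \<tau>)"
      by (simp add: mult.left_commute)
    then have "Re (cis \<tau> * (of_real (p k) * cis \<theta> ^ k)) = Re (of_real (p k) * cis (real k * \<theta> + \<tau>))"
      by (simp only:)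
    then show "Re (cis \<tau> * (of_real (p k) * cis \<theta> ^ k)) = p k * cos (real k * \<theta> + \<tau>)"
      by (simp only: Re_complex_of_real cis.simps times_complex.sel Im_complex_of_real mult_zero_left diff_zero)
  qed
  finally show ?thesis .
qed

lemma norm_\<phi>_le_1: "norm (\<phi> \<theta>) \<le> 1"
proof -
  have "norm (\<phi> \<theta>) \<le> (\<Sum>k. norm (of_real (p k) * cis \<theta> ^ k))"
    unfolding \<phi>_def using p_summable p_nonneg by (intro summable_norm) (simp add: norm_mult norm_power)
  also have "\<dots> = 1" using p_sums p_nonneg by (simp add: norm_mult norm_power sums_iff)
  finally show ?thesis .
qed

text \<open>All terms of 1 - Re(e^(i\<tau>) \<phi>), the sum of p(k) (1 - cos(k\<theta> + \<tau>)),
  are non-negative, so any finite set of them gives a lower bound.\<close>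

lemma norm_\<phi>_cos_bound:
  assumes "finite K" "\<And>k. k \<in> K \<Longrightarrow> cos (real k * \<theta> + \<tau>) \<le> 1 - \<delta>"
  shows "Re (cis \<tau> * \<phi> \<theta>) \<le> 1 - \<delta> * (\<Sum>k\<in>K. p k)"
proof -
  have s: "(\<lambda>k. p k - p k * cos (real k * \<theta> + \<tau>)) sums (1 - Re (cis \<tau> * \<phi> \<theta>))"
    by (intro sums_diff p_sums sums_Re_\<phi>)
  have nn: "p k - p k * cos (real k * \<theta> + \<tau>) \<ge> 0" for k
    using mult_left_mono[OF cos_le_one[of "real k * \<theta> + \<tau>"] p_nonneg[of k]] by simp
  have "\<delta> * (\<Sum>k\<in>K. p k) = (\<Sum>k\<in>K. p k - p k * (1 - \<delta>))"
    by (simp add: sum_distrib_left algebra_simps)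
  also have "\<dots> \<le> (\<Sum>k\<in>K. p k - p k * cos (real k * \<theta> + \<tau>))"
    by (intro sum_mono diff_left_mono mult_left_mono assms p_nonneg)
  also have "\<dots> \<le> (\<Sum>k. p k - p k * cos (real k * \<theta> + \<tau>))"
    using s nn assms(1) by (intro sum_le_suminf) (auto simp: sums_iff)
  also have "\<dots> = 1 - Re (cis \<tau> * \<phi> \<theta>)" using s by (simp add: sums_iff)
  finally show ?thesis by simp
qed

text \<open>A(2m) / A(m) tends to 2^\<alpha> > 1, so a fixed proportion of the mass beyond m lies in
  (m, 2m].\<close>

lemma tail_dyadic:
  obtains c where "c > 0" "eventually (\<lambda>m. c / A (real m) \<le> tail m - tail (2 * m)) sequentially"
proof -
  have "((\<lambda>\<tau>. (1 + \<tau>)\<^sup>2 * 2 powr (\<tau> - \<alpha>)) \<longlongrightarrow> (1 + 0)\<^sup>2 * 2 powr (0 - \<alpha>)) (at_right (0::real))"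
    by (intro tendsto_intros) auto
  moreover have "(1 + 0)\<^sup>2 * 2 powr (0 - \<alpha>) < 2 powr (0::real)"
    unfolding one_power2 add_0_right mult_1_left using alpha by (intro powr_less_mono) auto
  ultimately have "eventually (\<lambda>\<tau>. (1 + \<tau>)\<^sup>2 * 2 powr (\<tau> - \<alpha>) < 1) (at_right 0)"
    by (intro order_tendstoD) auto
  moreover have "eventually (\<lambda>\<tau>. \<tau> > (0::real)) (at_right 0)" by (rule eventually_at_right_less)
  ultimately have "eventually (\<lambda>\<tau>. (1 + \<tau>)\<^sup>2 * 2 powr (\<tau> - \<alpha>) < 1 \<and> \<tau> > 0) (at_right 0)"
    by (rule eventually_conj)
  then obtain \<tau> :: real where \<tau>: "\<tau> > 0" "(1 + \<tau>)\<^sup>2 * 2 powr (\<tau> - \<alpha>) < 1"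
    using eventually_happens'[OF trivial_limit_at_right_real] by blast
  \<comment> \<open>\<open>q\<close> < 1 eventually bounds tail(2m) A(m) from above, while tail(m)
    A(m) tends to 1.\<close>
  define q where "q = (1 + \<tau>)\<^sup>2 * 2 powr (\<tau> - \<alpha>)"
  have q: "0 < q" "q < 1" using \<tau> by (auto simp: q_def)
  obtain x0 where x0: "x0 \<ge> 1" "\<And>x y. x \<ge> x0 \<Longrightarrow> y \<ge> x \<Longrightarrow> A x \<le> (1 + \<tau>) * (y / x) powr (\<tau> - \<alpha>) * A y"
    using A_potter \<tau> unfolding potter_bounds_def by blast
  have lim: "(\<lambda>k. tail k * A (real k)) \<longlonglongrightarrow> 1" using tail_A by (simp add: tail_def)
  have lim2: "(\<lambda>k. tail (2 * k) * A (real (2 * k))) \<longlonglongrightarrow> 1"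
    by (rule filterlim_compose[OF lim]) (rule mult_nat_left_at_top, simp)
  have "eventually (\<lambda>m. tail m * A (real m) > (1 + q) / 2) sequentially"
    by (rule order_tendstoD(1)[OF lim]) (use q in simp)
  moreover have "eventually (\<lambda>m. tail (2 * m) * A (real (2 * m)) < 1 + \<tau>) sequentially"
    by (rule order_tendstoD(2)[OF lim2]) (use \<tau> in simp)
  moreover have "eventually (\<lambda>m. m \<ge> nat \<lceil>x0\<rceil>) sequentially"
    by (rule eventually_ge_at_top)
  ultimately have "eventually (\<lambda>m. ((1 - q) / 2) / A (real m) \<le> tail m - tail (2 * m)) sequentially"
  proof (eventually_elim)
    case (elim m)
    have m: "real m \<ge> x0" using elim(3) by linarith
    have "tail (2 * m) * A (real m) \<le> tail (2 * m) * ((1 + \<tau>) * (real (2 * m) / real m) powr (\<tau> - \<alpha>) * A (real (2 * m)))"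
      using m x0 by (intro mult_left_mono tail_nonneg x0) auto
    also have "\<dots> = (1 + \<tau>) * 2 powr (\<tau> - \<alpha>) * (tail (2 * m) * A (real (2 * m)))"
      using m x0(1) by simp
    also have "\<dots> \<le> (1 + \<tau>) * 2 powr (\<tau> - \<alpha>) * (1 + \<tau>)"
      using elim(2) \<tau> by (intro mult_left_mono) auto
    also have "\<dots> = q" by (simp add: q_def power2_eq_square)
    finally have "(1 - q) / 2 \<le> (tail m - tail (2 * m)) * A (real m)"
      using elim(1) q by (simp add: left_diff_distrib field_simps)
    then show ?case by (simp add: pos_divide_le_eq)
  qed
  moreover have "(1 - q) / 2 > 0" using q by simp
  ultimately show ?thesis using that by blast
qed

text \<open>With \<open>\<tau> = - arg \<phi>(\<theta>)\<close> one has \<open>1 - |\<phi>(\<theta>)| = \<Sum> p(k) (1 - cos (k\<theta> + \<tau>))\<close>. If \<open>\<tau>\<close> is near \<open>0\<close>, the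
  jumps of size about \<open>1 / \<theta>\<close> contribute; otherwise the small jumps do.\<close>

lemma norm_\<phi>_near_0:
  obtains c d where "c > 0" "0 < d" "d \<le> 1"
    "\<And>\<theta>. 0 < \<theta> \<Longrightarrow> \<theta> \<le> d \<Longrightarrow> norm (\<phi> \<theta>) \<le> exp (- c / A (1 / \<theta>))"
proof -
  obtain c1 where c1: "c1 > 0" "eventually (\<lambda>m. c1 / A (real m) \<le> tail m - tail (2 * m)) sequentially"
    using tail_dyadic by blast
  then obtain m1 where m1: "\<And>m. m \<ge> m1 \<Longrightarrow> c1 / A (real m) \<le> tail m - tail (2 * m)"
    by (auto simp: eventually_sequentially)
  have "(\<lambda>n. \<Sum>k\<le>n. p k) \<longlonglongrightarrow> 1" using p_sums by (simp add: sums_def_le)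
  then have "eventually (\<lambda>n. (\<Sum>k\<le>n. p k) > 1 / 2) sequentially"
    by (rule order_tendstoD(1)) simp
  then obtain m2 where m2: "\<And>n. n \<ge> m2 \<Longrightarrow> (\<Sum>k\<le>n. p k) > 1 / 2"
    by (auto simp: eventually_sequentially)
  \<comment> \<open>The phases k\<theta> + \<tau> will be kept at distance at least 1/4 from the
    multiples of 2\<pi>.\<close>
  define \<delta> where "\<delta> = 1 - cos (1/4::real)"
  have \<delta>: "\<delta> > 0"
  proof -
    have "cos (1/4::real) < cos 0" by (rule cos_monotone_0_pi) (use pi_gt3 in auto)
    then show ?thesis by (simp add: \<delta>_def)
  qed
  define c where "c = \<delta> * min c1 (1 / 2)"
  \<comment> \<open>Makes 1 / \<theta> so large that the integer parts used below are at least
    \<open>m1\<close> and \<open>m2\<close>.\<close>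
  define d where "d = 1 / (4 * (real m1 + real m2 + 1))"
  have c: "c > 0" using c1 \<delta> by (simp add: c_def)
  have d: "0 < d" "d \<le> 1" by (auto simp: d_def)
  have "norm (\<phi> \<theta>) \<le> exp (- c / A (1 / \<theta>))" if \<theta>: "0 < \<theta>" "\<theta> \<le> d" for \<theta>
  proof -
    define \<tau> where "\<tau> = - Arg (\<phi> \<theta>)"
    have \<tau>: "\<bar>\<tau>\<bar> \<le> pi" using Arg_bounded[of "\<phi> \<theta>"] by (auto simp: \<tau>_def)
    have "cis \<tau> * \<phi> \<theta> = of_real (norm (\<phi> \<theta>))"
    proof (cases "\<phi> \<theta> = 0")
      case False
      have "\<phi> \<theta> = of_real (norm (\<phi> \<theta>)) * cis (- \<tau>)"
        using rcis_cmod_Arg[of "\<phi> \<theta>"] by (simp add: rcis_def \<tau>_def)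
      then have "cis \<tau> * \<phi> \<theta> = of_real (norm (\<phi> \<theta>)) * (cis \<tau> * cis (- \<tau>))"
        by (metis mult.left_commute)
      then show ?thesis by (simp add: cis_mult)
    qed simp
    then have Re: "norm (\<phi> \<theta>) = Re (cis \<tau> * \<phi> \<theta>)" by simp
    have big: "1 / \<theta> \<ge> 4 * (real m1 + real m2 + 1)"
      using \<theta> by (simp add: d_def field_simps)
    have "Re (cis \<tau> * \<phi> \<theta>) \<le> 1 - c / A (1 / \<theta>)"
    \<comment> \<open>For |\<tau>| <= 1/2 the jumps with 1 < k\<theta> <= 2 have phases in
      [1/2, 5/2]; their mass is at least of order 1 / A(1 / \<theta>). For larger |\<tau>| the jumps
      with k\<theta> <= 1/4 do not bring the phase back to 0, and they carry mass at least
      1/2.\<close>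
    proof (cases "\<bar>\<tau>\<bar> \<le> 1 / 2")
      case True
      define m where "m = nat \<lfloor>1 / \<theta>\<rfloor>"
      define n where "n = nat \<lfloor>2 / \<theta>\<rfloor>"
      have m: "real m \<le> 1 / \<theta>" "1 / \<theta> < real m + 1" using \<theta> by (auto simp: m_def)
      have n: "real n \<le> 2 / \<theta>" "2 / \<theta> < real n + 1" using \<theta> by (auto simp: n_def)
      have mn: "2 * m \<le> n"
      proof -
        have "real (2 * m) \<le> 2 / \<theta>" using m by simp
        then have "real (2 * m) < real (n + 1)" using n by simp
        then show ?thesis by linarith
      qed
      have "4 * (real m1 + real m2 + 1) < real m + 1" by (rule le_less_trans[OF big m(2)])
      then have "real (4 * (m1 + m2 + 1)) < real (m + 1)" by simp
      then have "4 * (m1 + m2 + 1) < m + 1" by (simp only: of_nat_less_iff)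
      then have mm1: "m1 \<le> m" by simp
      have "Re (cis \<tau> * \<phi> \<theta>) \<le> 1 - \<delta> * (\<Sum>k\<in>{m<..n}. p k)"
      proof (rule norm_\<phi>_cos_bound)
        fix k assume "k \<in> {m<..n}"
        then have "1 / \<theta> < real k" "real k \<le> 2 / \<theta>" using m n by auto
        then have k: "1 < real k * \<theta>" "real k * \<theta> \<le> 2" using \<theta> by (auto simp: field_simps)
        have "cos (real k * \<theta> + \<tau>) \<le> cos (1/4)"
          by (rule cos_monotone_0_pi_le) (use k True pi_gt3 in \<open>auto simp: abs_le_iff\<close>)
        then show "cos (real k * \<theta> + \<tau>) \<le> 1 - \<delta>" by (simp add: \<delta>_def)
      qed simp
      also have "(\<Sum>k\<in>{m<..n}. p k) = tail m - tail n" using mn by (intro tail_diff) auto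
      also have "1 - \<delta> * (tail m - tail n) \<le> 1 - \<delta> * (c1 / A (1 / \<theta>))"
      proof (intro diff_left_mono mult_left_mono)
        have "c1 / A (1 / \<theta>) \<le> c1 / A (real m)"
          using c1 m by (intro divide_left_mono A_mono mult_pos_pos) auto
        also have "\<dots> \<le> tail m - tail (2 * m)" using mm1 by (rule m1)
        also have "\<dots> \<le> tail m - tail n" using tail_antimono[OF mn] by simp
        finally show "c1 / A (1 / \<theta>) \<le> tail m - tail n" .
      qed (use \<delta> in simp)
      also have "\<dots> \<le> 1 - c / A (1 / \<theta>)"
        using \<delta> c1 by (simp add: c_def divide_right_mono mult_left_mono)
      finally show ?thesis .
    next
      case False
      define m where "m = nat \<lfloor>1 / (4 * \<theta>)\<rfloor>"
      have m: "real m \<le> 1 / (4 * \<theta>)" "1 / (4 * \<theta>) < real m + 1" using \<theta> by (auto simp: m_def)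
      have "Re (cis \<tau> * \<phi> \<theta>) \<le> 1 - \<delta> * (\<Sum>k\<le>m. p k)"
      proof (rule norm_\<phi>_cos_bound)
        fix k assume "k \<in> {..m}"
        then have "real k \<le> 1 / (4 * \<theta>)" using m by auto
        then have k: "0 \<le> real k * \<theta>" "real k * \<theta> \<le> 1 / 4" using \<theta> by (auto simp: field_simps)
        define x where "x = \<bar>real k * \<theta> + \<tau>\<bar>"
        have x: "1 / 4 \<le> x" "x \<le> pi + 1 / 4" using k False \<tau> unfolding x_def by linarith+
        have "cos x \<le> cos (1/4)"
        proof (cases "x \<le> pi")
          case True
          then show ?thesis by (intro cos_monotone_0_pi_le) (use x in auto)
        next
          case False
          have "cos x = - cos (x - pi)" by simp
          moreover have "cos (x - pi) \<ge> 0" using False x pi_gt3 by (intro cos_ge_zero) auto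
          moreover have "cos (1/4::real) \<ge> 0" using pi_gt3 by (intro cos_ge_zero) auto
          ultimately show ?thesis by linarith
        qed
        then show "cos (real k * \<theta> + \<tau>) \<le> 1 - \<delta>" by (simp add: \<delta>_def x_def)
      qed simp
      also have "\<dots> \<le> 1 - \<delta> * (1 / 2)"
      proof (intro diff_left_mono mult_left_mono)
        have "real m1 + real m2 + 1 \<le> 1 / (4 * \<theta>)" using big \<theta> by (simp add: field_simps)
        then have "real m1 + real m2 + 1 < real m + 1" using m(2) by (rule le_less_trans)
        then show "1 / 2 \<le> (\<Sum>k\<le>m. p k)" using m2[of m] by simp
      qed (use \<delta> in simp)
      also have "\<dots> \<le> 1 - c / A (1 / \<theta>)"
      proof -
        have "c / A (1 / \<theta>) \<le> c / 1" using c A_ge_1 by (intro divide_left_mono) auto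
        also have "\<dots> \<le> \<delta> * (1 / 2)" unfolding c_def using \<delta> by (simp add: mult_left_mono)
        finally show ?thesis by simp
      qed
      finally show ?thesis .
    qed
    also have "\<dots> \<le> exp (- c / A (1 / \<theta>))"
      using exp_ge_add_one_self[of "- c / A (1 / \<theta>)"] by simp
    finally show ?thesis using Re by simp
  qed
  then show ?thesis using that c d by blast
qed

text \<open>When a_n \<theta> > 1, the quotient n / A(1 / \<theta>) is at least a constant times
  (a_n \<theta>)^(\<alpha>/2), so the exponential bound beats any power of a_n \<theta>. With the
  cube, the bound is still integrable after multiplication by a_n \<theta>.\<close>

lemma norm_\<phi>_power_decay:
  obtains C d where "C > 0" "0 < d" "d \<le> 1"
    "\<And>n \<theta>. n \<ge> 1 \<Longrightarrow> \<bar>\<theta>\<bar> \<le> d \<Longrightarrow> norm (\<phi> \<theta>) ^ n \<le> C / (1 + (a n * \<bar>\<theta>\<bar>) ^ 3)"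
proof -
  obtain c d where cd: "c > 0" "0 < d" "d \<le> 1"
    "\<And>\<theta>. 0 < \<theta> \<Longrightarrow> \<theta> \<le> d \<Longrightarrow> norm (\<phi> \<theta>) \<le> exp (- c / A (1 / \<theta>))"
    using norm_\<phi>_near_0 by blast
  obtain D where D: "D \<ge> 1"
    "\<And>x y. x \<ge> 1 \<Longrightarrow> y \<ge> x \<Longrightarrow> A x \<le> D * (y / x) powr (- (\<alpha> / 2)) * A y"
    using A_lower_half by blast
  obtain c1 C1 where "c1 > 0" and C1: "C1 > 0" and "\<And>n. n \<ge> 1 \<Longrightarrow> c1 * real n \<le> A (a n)"
    and C1n: "\<And>n. n \<ge> 1 \<Longrightarrow> A (a n) \<le> C1 * real n"
    using A_a_bounds by blast
  define c' where "c' = c / (D * C1)"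
  have c': "c' > 0" using cd D C1 by (simp add: c'_def)
  \<comment> \<open>With v = (a_n \<theta>)^(\<alpha>/2), the power v^(6/\<alpha>) is the cube of
    a_n \<theta>.\<close>
  have "0 \<le> 6 / \<alpha>" using alpha by simp
  then obtain K where K: "K > 0" "\<And>v. v > 0 \<Longrightarrow> v powr (6 / \<alpha>) * exp (- c' * v) \<le> K"
    using powr_exp_bounded[OF c'] by blast
  define C where "C = max 2 (2 * K)"
  have C: "C > 0" "C \<ge> 2" "C \<ge> 2 * K" by (auto simp: C_def)
  have pos: "norm (\<phi> \<theta>) ^ n \<le> C / (1 + (a n * \<theta>) ^ 3)" if n: "n \<ge> 1" and \<theta>: "0 \<le> \<theta>" "\<theta> \<le> d" for n \<theta>
  proof -
    define u where "u = a n * \<theta>"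
    have u0: "u \<ge> 0" using \<theta> by (simp add: u_def)
    show ?thesis
    proof (cases "u \<le> 1")
      case True
      have "norm (\<phi> \<theta>) ^ n \<le> 1" using norm_\<phi>_le_1 by (intro power_le_one) auto
      moreover have "1 + u ^ 3 \<le> C" using True u0 C power_le_one[of u 3] by linarith
      moreover have "1 + u ^ 3 > 0" using u0 by (simp add: add_pos_nonneg)
      ultimately show ?thesis unfolding u_def[symmetric] by (simp add: pos_le_divide_eq mult_le_one order_trans)
    next
      case False
      then have th: "\<theta> > 0" using \<theta> u_def by (cases "\<theta> = 0") auto
      define v where "v = u powr (\<alpha> / 2)"
      have v: "v > 0" using False by (simp add: v_def)
      have "A (1 / \<theta>) \<le> D * (a n / (1 / \<theta>)) powr (- (\<alpha> / 2)) * A (a n)"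
      proof (rule D(2))
        show "1 \<le> 1 / \<theta>" using th \<theta> cd by simp
        show "1 / \<theta> \<le> a n" using False th by (simp add: u_def field_simps)
      qed
      also have "\<dots> \<le> D * (a n / (1 / \<theta>)) powr (- (\<alpha> / 2)) * (C1 * real n)"
        using D C1 C1n[OF n] by (intro mult_left_mono) auto
      also have "\<dots> = D * C1 * real n / v"
        using th by (simp add: v_def u_def powr_minus field_simps)
      finally have "c' * v \<le> c * real n / A (1 / \<theta>)"
        using v D C1 cd n by (simp add: c'_def field_simps)
      moreover have "norm (\<phi> \<theta>) ^ n \<le> exp (- c / A (1 / \<theta>)) ^ n"
        using cd(4) th \<theta> by (intro power_mono) auto
      then have "norm (\<phi> \<theta>) ^ n \<le> exp (- (c * real n / A (1 / \<theta>)))"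
        by (simp flip: exp_of_nat_mult add: mult.commute)
      ultimately have 1: "norm (\<phi> \<theta>) ^ n \<le> exp (- c' * v)" by (smt (verit) exp_le_cancel_iff mult_minus_left)
      have "v powr (6 / \<alpha>) = u powr 3" using alpha by (simp add: v_def powr_powr)
      also have "\<dots> = u ^ 3" using False powr_realpow[of u 3] by simp
      finally have "u ^ 3 * exp (- c' * v) \<le> K" using K(2)[OF v] by simp
      moreover have "(1 + u ^ 3) * exp (- c' * v) \<le> (2 * u ^ 3) * exp (- c' * v)"
        using False one_le_power[of u 3] by (intro mult_right_mono) auto
      ultimately have "(1 + u ^ 3) * exp (- c' * v) \<le> C" using C by linarith
      moreover have "1 + u ^ 3 > 0" using u0 by (simp add: add_pos_nonneg)
      ultimately have "exp (- c' * v) \<le> C / (1 + u ^ 3)" by (simp add: pos_le_divide_eq mult.commute)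
      with 1 show ?thesis unfolding u_def by linarith
    qed
  qed
  have neg: "norm (\<phi> (- \<theta>)) = norm (\<phi> \<theta>)" for \<theta>
  proof -
    have "(\<lambda>k. cnj (of_real (p k) * cis \<theta> ^ k)) sums cnj (\<phi> \<theta>)"
      using \<phi>_power_sums[of 1 \<theta>] by (subst sums_cnj) simp
    then have "\<phi> (- \<theta>) = cnj (\<phi> \<theta>)"
      by (simp add: \<phi>_def cis_cnj sums_iff)
    then show ?thesis by simp
  qed
  have "norm (\<phi> \<theta>) ^ n \<le> C / (1 + (a n * \<bar>\<theta>\<bar>) ^ 3)" if "n \<ge> 1" "\<bar>\<theta>\<bar> \<le> d" for n \<theta>
    using pos[OF that(1), of "\<bar>\<theta>\<bar>"] that(2) neg[of \<theta>] by (cases "\<theta> \<ge> 0") auto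
  then show ?thesis using that C(1) cd(2,3) by blast
qed

text \<open>Integrate \<phi>^n against the triangle kernel centred at z: the term k = z contributes
  P(S_n = z) d / 2, and all other terms are non-negative.\<close>

lemma P_le_integral:
  assumes d: "d > 0"
  shows "P n z \<le> (2 / d) * integral {0..d} (\<lambda>\<theta>. norm (\<phi> \<theta>) ^ n)"
proof -
  define h where "h = (\<lambda>\<theta>. complex_of_real (1 - \<theta> / d) * cis (- \<theta>) ^ z)"
  have hc: "continuous_on {0..d} h" unfolding h_def using d by (intro continuous_intros) auto
  define I where "I = (\<lambda>k. integral {0..d} (\<lambda>\<theta>. cis \<theta> ^ k * h \<theta>))"
  have sums: "(\<lambda>k. of_real (P n k) * I k) sums integral {0..d} (\<lambda>\<theta>. \<phi> \<theta> ^ n * h \<theta>)"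
    and int: "(\<lambda>\<theta>. \<phi> \<theta> ^ n * h \<theta>) integrable_on {0..d}"
    using integral_power_series_mult[OF P_nonneg P_summable hc, of n] by (simp_all add: \<phi>_power_eq I_def)
  have Re_I: "Re (I k) = integral {0..d} (\<lambda>\<theta>. (1 - \<theta> / d) * cos ((real k - real z) * \<theta>))" for k
  proof -
    have "(\<lambda>\<theta>. cis \<theta> ^ k * h \<theta>) integrable_on {0..d}"
      by (intro integrable_continuous_interval continuous_intros hc)
    then have "Re (I k) = integral {0..d} (Re \<circ> (\<lambda>\<theta>. cis \<theta> ^ k * h \<theta>))"
      unfolding I_def by (rule integral_linear[OF _ bounded_linear_Re, symmetric])
    also have "Re \<circ> (\<lambda>\<theta>. cis \<theta> ^ k * h \<theta>) = (\<lambda>\<theta>. (1 - \<theta> / d) * cos ((real k - real z) * \<theta>))"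
    proof
      fix \<theta>
      have "cis \<theta> ^ k * h \<theta> = of_real (1 - \<theta> / d) * (cis \<theta> ^ k * cis (- \<theta>) ^ z)"
        by (simp only: h_def mult.left_commute)
      also have "cis \<theta> ^ k * cis (- \<theta>) ^ z = cis ((real k - real z) * \<theta>)"
        by (simp only: Complex.DeMoivre cis_mult) (simp add: algebra_simps)
      finally have "cis \<theta> ^ k * h \<theta> = of_real (1 - \<theta> / d) * cis ((real k - real z) * \<theta>)" .
      then have "(Re \<circ> (\<lambda>\<theta>. cis \<theta> ^ k * h \<theta>)) \<theta> = Re (of_real (1 - \<theta> / d) * cis ((real k - real z) * \<theta>))"
        by (simp only: o_def)
      then show "(Re \<circ> (\<lambda>\<theta>. cis \<theta> ^ k * h \<theta>)) \<theta> = (1 - \<theta> / d) * cos ((real k - real z) * \<theta>)"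
        by (simp only: Re_complex_of_real cis.simps times_complex.sel Im_complex_of_real mult_zero_left diff_zero)
    qed
    finally show ?thesis .
  qed
  have Re_sums: "(\<lambda>k. P n k * Re (I k)) sums Re (integral {0..d} (\<lambda>\<theta>. \<phi> \<theta> ^ n * h \<theta>))"
    using sums_Re[OF sums] by simp
  have "P n z * (d / 2) = (\<Sum>k\<in>{z}. P n k * Re (I k))"
    using integral_triangle_cos(2)[OF d] by (simp add: Re_I)
  also have "\<dots> \<le> (\<Sum>k. P n k * Re (I k))"
    using Re_sums integral_triangle_cos(1)[OF d]
    by (intro sum_le_suminf) (auto simp: sums_iff Re_I intro!: mult_nonneg_nonneg P_nonneg)
  also have "\<dots> = Re (integral {0..d} (\<lambda>\<theta>. \<phi> \<theta> ^ n * h \<theta>))"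
    using Re_sums by (simp add: sums_iff)
  also have "\<dots> \<le> norm (integral {0..d} (\<lambda>\<theta>. \<phi> \<theta> ^ n * h \<theta>))" by (rule complex_Re_le_cmod)
  also have "\<dots> \<le> integral {0..d} (\<lambda>\<theta>. norm (\<phi> \<theta>) ^ n)"
  proof (rule integral_norm_bound_integral[OF int])
    show "(\<lambda>\<theta>. norm (\<phi> \<theta>) ^ n) integrable_on {0..d}"
      by (intro integrable_continuous_interval continuous_intros continuous_\<phi>)
    show "norm (\<phi> \<theta> ^ n * h \<theta>) \<le> norm (\<phi> \<theta>) ^ n" if "\<theta> \<in> {0..d}" for \<theta>
    proof -
      have "norm (h \<theta>) \<le> 1"
        unfolding h_def norm_mult norm_power norm_cis norm_of_real
        using that d by (simp add: abs_le_iff field_simps)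
      then have "norm (\<phi> \<theta>) ^ n * norm (h \<theta>) \<le> norm (\<phi> \<theta>) ^ n * 1" by (intro mult_left_mono) auto
      then show ?thesis by (simp add: norm_mult norm_power)
    qed
  qed
  finally show ?thesis using d by (simp add: field_simps)
qed

lemma cube_square_bounds:
  fixes u :: real
  assumes "u \<ge> 0"
  shows "1 / (1 + u ^ 3) \<le> 2 / (1 + u\<^sup>2)" "u / (1 + u ^ 3) \<le> 2 / (1 + u\<^sup>2)"
proof -
  have fr: "r / s \<le> v / w" if "r * w \<le> v * s" "s > 0" "w > 0" for r s v w :: real
    using that by (simp add: field_simps)
  have p: "u ^ 3 \<ge> 0" "1 + u ^ 3 > 0" "1 + u\<^sup>2 > 0" using assms by (auto intro: add_pos_nonneg)
  have b: "u\<^sup>2 \<le> 1 + u ^ 3" "u + u * u\<^sup>2 \<le> 2 + 2 * u ^ 3"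
  proof -
    show "u\<^sup>2 \<le> 1 + u ^ 3"
    proof (cases "u \<le> 1")
      case True
      then have "u\<^sup>2 \<le> 1" using assms by (simp add: power_le_one)
      then show ?thesis using assms by (simp add: add_increasing2)
    next
      case False
      then have "u\<^sup>2 \<le> u ^ 3" by (intro power_increasing) auto
      then show ?thesis by simp
    qed
    have "u \<le> 1 + u ^ 3"
    proof (cases "u \<le> 1")
      case False
      then show ?thesis using power_increasing[of 1 3 u] by simp
    qed (use assms in \<open>simp add: add_increasing2\<close>)
    moreover have "u * u\<^sup>2 = u ^ 3" by (simp add: power2_eq_square power3_eq_cube)
    ultimately show "u + u * u\<^sup>2 \<le> 2 + 2 * u ^ 3" using assms by (simp add: add_increasing)
  qed
  have "1 * (1 + u\<^sup>2) \<le> 2 * (1 + u ^ 3)" unfolding mult_1 distrib_left using b(1) p(1) by linarith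
  then show "1 / (1 + u ^ 3) \<le> 2 / (1 + u\<^sup>2)"
    by (rule fr) (use p in auto)
  have "u * (1 + u\<^sup>2) \<le> 2 * (1 + u ^ 3)" using b(2) by (simp add: ring_distribs)
  then show "u / (1 + u ^ 3) \<le> 2 / (1 + u\<^sup>2)"
    by (rule fr) (use p in auto)
qed

text \<open>The triangle kernel confines the integral to angles near 0, so the bound also holds when
  |\<phi>| = 1 at some other angle.\<close>

lemma P_uniform_bound:
  obtains C where "C > 0" "\<And>n z. n \<ge> 1 \<Longrightarrow> P n z \<le> C / a n"
proof -
  obtain C d where Cd: "C > 0" "0 < d" "d \<le> 1"
    "\<And>n \<theta>. n \<ge> 1 \<Longrightarrow> \<bar>\<theta>\<bar> \<le> d \<Longrightarrow> norm (\<phi> \<theta>) ^ n \<le> C / (1 + (a n * \<bar>\<theta>\<bar>) ^ 3)"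
    using norm_\<phi>_power_decay by blast
  have "P n z \<le> (2 / d * (2 * C) * 4) / a n" if n: "n \<ge> 1" for n z
  proof -
    have "P n z \<le> (2 / d) * integral {0..d} (\<lambda>\<theta>. norm (\<phi> \<theta>) ^ n)" by (rule P_le_integral) fact
    also have "\<dots> \<le> (2 / d) * integral {0..d} (\<lambda>\<theta>. (2 * C) * (1 / (1 + (a n * \<theta>)\<^sup>2)))"
    proof (intro mult_left_mono integral_le)
      show "(\<lambda>\<theta>. norm (\<phi> \<theta>) ^ n) integrable_on {0..d}"
        by (intro integrable_continuous_interval continuous_intros continuous_\<phi>)
      show "(\<lambda>\<theta>. (2 * C) * (1 / (1 + (a n * \<theta>)\<^sup>2))) integrable_on {0..d}"
        using integral_inverse_square_le(1)[of "a n" 0 d] Cd by (intro integrable_on_mult_right) auto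
      fix \<theta> assume \<theta>: "\<theta> \<in> {0..d}"
      have "norm (\<phi> \<theta>) ^ n \<le> C * (1 / (1 + (a n * \<theta>) ^ 3))" using Cd(4)[OF n, of \<theta>] \<theta> by simp
      also have "\<dots> \<le> C * (2 / (1 + (a n * \<theta>)\<^sup>2))"
        using \<theta> Cd by (intro mult_left_mono cube_square_bounds) auto
      finally show "norm (\<phi> \<theta>) ^ n \<le> (2 * C) * (1 / (1 + (a n * \<theta>)\<^sup>2))" by (simp add: mult.commute)
    qed (use Cd in simp)
    also have "\<dots> \<le> (2 / d) * ((2 * C) * (4 / a n))"
      unfolding integral_mult_right
      using Cd integral_inverse_square_le(2)[of "a n" 0 d] by (intro mult_left_mono) auto
    finally show ?thesis by simp
  qed
  moreover have "2 / d * (2 * C) * 4 > 0" using Cd by simp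
  ultimately show ?thesis using that by blast
qed

lemma Fourier_inversion:
  "(\<lambda>\<theta>. \<phi> \<theta> ^ n * cis (- \<theta>) ^ x) integrable_on {-pi..pi}"
  "integral {-pi..pi} (\<lambda>\<theta>. \<phi> \<theta> ^ n * cis (- \<theta>) ^ x) = 2 * pi * P n x"
proof -
  have h: "continuous_on {-pi..pi} (\<lambda>\<theta>. cis (- \<theta>) ^ x)" by (intro continuous_intros)
  note s = integral_power_series_mult[OF P_nonneg P_summable h, of n, folded \<phi>_power_eq]
  show "(\<lambda>\<theta>. \<phi> \<theta> ^ n * cis (- \<theta>) ^ x) integrable_on {-pi..pi}" by (rule s(1))
  have "(\<lambda>k. of_real (P n k) * complex_of_real (if k = x then 2 * pi else 0)) sums
      integral {-pi..pi} (\<lambda>\<theta>. \<phi> \<theta> ^ n * cis (- \<theta>) ^ x)"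
    using s(2) unfolding integral_cis_orthogonal .
  moreover have "(\<lambda>k. of_real (P n k) * complex_of_real (if k = x then 2 * pi else 0))
      = (\<lambda>k. if k = x then complex_of_real (2 * pi * P n k) else 0)" by auto
  moreover have "(\<lambda>k. if k = x then complex_of_real (2 * pi * P n k) else 0) sums complex_of_real (2 * pi * P n x)"
    by (rule sums_single)
  ultimately show "integral {-pi..pi} (\<lambda>\<theta>. \<phi> \<theta> ^ n * cis (- \<theta>) ^ x) = 2 * pi * P n x"
    by (simp only: sums_unique2)
qed

text \<open>By Parseval the integral of |\<phi>|^(2m) is 2\<pi> times the sum of P(S_m = k)^2, hence
  at most 2\<pi> times the largest P(S_m = k). Angles other than 0 with |\<phi>| near 1 are covered
  without being located.\<close>

lemma integral_norm_\<phi>_power: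
  obtains C where "C > 0" "\<And>n. n \<ge> 1 \<Longrightarrow> integral {-pi..pi} (\<lambda>\<theta>. norm (\<phi> \<theta>) ^ n) \<le> C / a n"
proof -
  obtain C where C: "C > 0" "\<And>n z. n \<ge> 1 \<Longrightarrow> P n z \<le> C / a n" using P_uniform_bound by blast
  obtain D where D: "D > 0" "\<And>m n. m \<ge> 1 \<Longrightarrow> n \<le> 3 * m \<Longrightarrow> a n \<le> D * a m" using a_doubling by blast
  have int: "(\<lambda>\<theta>. norm (\<phi> \<theta>) ^ n) integrable_on {-pi..pi}" for n
    by (intro integrable_continuous_interval continuous_intros continuous_\<phi>)
  have even: "integral {-pi..pi} (\<lambda>\<theta>. norm (\<phi> \<theta>) ^ (2 * m)) \<le> 2 * pi * C / a m" if m: "m \<ge> 1" for m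
  proof -
    have h: "continuous_on {-pi..pi} (\<lambda>\<theta>. cnj (\<phi> \<theta> ^ m))" by (intro continuous_intros continuous_\<phi>)
    note s = integral_power_series_mult[OF P_nonneg P_summable h, of m, folded \<phi>_power_eq]
    have I: "integral {-pi..pi} (\<lambda>\<theta>. cis \<theta> ^ k * cnj (\<phi> \<theta> ^ m)) = 2 * pi * P m k" for k
    proof -
      have "integral {-pi..pi} (cnj \<circ> (\<lambda>\<theta>. \<phi> \<theta> ^ m * cis (- \<theta>) ^ k)) = cnj (2 * pi * P m k)"
        unfolding Fourier_inversion(2)[symmetric]
        by (rule integral_linear[OF Fourier_inversion(1) bounded_linear_cnj])
      moreover have "cnj \<circ> (\<lambda>\<theta>. \<phi> \<theta> ^ m * cis (- \<theta>) ^ k) = (\<lambda>\<theta>. cis \<theta> ^ k * cnj (\<phi> \<theta> ^ m))"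
        by (auto simp: fun_eq_iff cis_cnj mult.commute)
      ultimately show ?thesis by simp
    qed
    have "(\<lambda>k. complex_of_real (P m k) * (2 * pi * P m k)) sums integral {-pi..pi} (\<lambda>\<theta>. \<phi> \<theta> ^ m * cnj (\<phi> \<theta> ^ m))"
      using s(2) unfolding I .
    then have "(\<lambda>k. Re (complex_of_real (P m k) * (2 * pi * P m k))) sums Re (integral {-pi..pi} (\<lambda>\<theta>. \<phi> \<theta> ^ m * cnj (\<phi> \<theta> ^ m)))"
      by (rule sums_Re)
    also have "Re (integral {-pi..pi} (\<lambda>\<theta>. \<phi> \<theta> ^ m * cnj (\<phi> \<theta> ^ m))) = integral {-pi..pi} (Re \<circ> (\<lambda>\<theta>. \<phi> \<theta> ^ m * cnj (\<phi> \<theta> ^ m)))"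
      by (rule integral_linear[OF s(1) bounded_linear_Re, symmetric])
    also have "Re \<circ> (\<lambda>\<theta>. \<phi> \<theta> ^ m * cnj (\<phi> \<theta> ^ m)) = (\<lambda>\<theta>. norm (\<phi> \<theta>) ^ (2 * m))"
    proof
      fix \<theta>
      have "\<phi> \<theta> ^ m * cnj (\<phi> \<theta> ^ m) = of_real ((norm (\<phi> \<theta> ^ m))\<^sup>2)" by (rule complex_norm_square[symmetric])
      then show "(Re \<circ> (\<lambda>\<theta>. \<phi> \<theta> ^ m * cnj (\<phi> \<theta> ^ m))) \<theta> = norm (\<phi> \<theta>) ^ (2 * m)"
        by (simp only: o_def Re_complex_of_real norm_power power_mult[symmetric] mult.commute)
    qed
    finally have s2: "(\<lambda>k. P m k * (2 * pi * P m k)) sums integral {-pi..pi} (\<lambda>\<theta>. norm (\<phi> \<theta>) ^ (2 * m))" by simp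
    moreover have "(\<lambda>k. 2 * pi * C / a m * P m k) sums (2 * pi * C / a m * 1)"
      by (intro sums_mult P_sums)
    moreover have "P m k * (2 * pi * P m k) \<le> 2 * pi * C / a m * P m k" for k
      using mult_left_mono[OF C(2)[OF m, of k], of "2 * pi * P m k"] P_nonneg[of m k] by (simp add: mult_ac)
    ultimately show ?thesis using sums_le[OF _ s2] by fastforce
  qed
  \<comment> \<open>An exponent n >= 2 is lowered to the even number 2 (n div 2); n = 1 is covered
    by the trivial bound 2\<pi>.\<close>
  define E where "E = max (2 * pi * C * D) (2 * pi * a 1)"
  have "integral {-pi..pi} (\<lambda>\<theta>. norm (\<phi> \<theta>) ^ n) \<le> E / a n" if n: "n \<ge> 1" for n
  proof (cases "n = 1")
    case True
    have "integral {-pi..pi} (\<lambda>\<theta>. norm (\<phi> \<theta>) ^ n) \<le> integral {-pi..pi} (\<lambda>\<theta>. 1)"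
      using norm_\<phi>_le_1 by (intro integral_le int power_le_one) auto
    also have "\<dots> = 2 * pi * a 1 / a n" using True by simp
    also have "\<dots> \<le> E / a n" by (intro divide_right_mono) (auto simp: E_def)
    finally show ?thesis .
  next
    case False
    define m where "m = n div 2"
    have m: "m \<ge> 1" "2 * m \<le> n" "n \<le> 3 * m" using n False by (auto simp: m_def)
    have "integral {-pi..pi} (\<lambda>\<theta>. norm (\<phi> \<theta>) ^ n) \<le> integral {-pi..pi} (\<lambda>\<theta>. norm (\<phi> \<theta>) ^ (2 * m))"
      using norm_\<phi>_le_1 m by (intro integral_le int power_decreasing) auto
    also have "\<dots> \<le> 2 * pi * C / a m" using even m by auto
    also have "\<dots> \<le> 2 * pi * C * D / a n"
      using D(2)[of m n] m C by (simp add: field_simps)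
    also have "\<dots> \<le> E / a n" by (intro divide_right_mono) (auto simp: E_def)
    finally show ?thesis .
  qed
  moreover have "E > 0" unfolding E_def using C D by (simp add: less_max_iff_disj)
  ultimately show ?thesis using that by blast
qed

text \<open>\<phi>(\<theta>) = 1 forces cos(k\<theta>) = 1 on the whole support. Other values of
  modulus 1 are not excluded.\<close>

lemma \<phi>_neq_1:
  assumes "0 < \<bar>\<theta>\<bar>" "\<bar>\<theta>\<bar> \<le> pi"
  shows "\<phi> \<theta> \<noteq> 1"
proof
  assume 1: "\<phi> \<theta> = 1"
  have s: "(\<lambda>k. p k - p k * cos (real k * \<theta> + 0)) sums (1 - Re (cis 0 * \<phi> \<theta>))"
    by (intro sums_diff p_sums sums_Re_\<phi>)
  then have s0: "(\<lambda>k. p k - p k * cos (real k * \<theta>)) sums 0" using 1 by simp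
  have nn: "p k - p k * cos (real k * \<theta>) \<ge> 0" for k
    using mult_left_mono[OF cos_le_one[of "real k * \<theta>"] p_nonneg[of k]] by simp
  have "cos (real k * \<theta>) = 1" if k: "p k > 0" for k
  proof -
    have "(\<Sum>i\<in>{k}. p i - p i * cos (real i * \<theta>)) \<le> (\<Sum>i. p i - p i * cos (real i * \<theta>))"
      using s0 nn by (intro sum_le_suminf) (auto simp: sums_iff)
    also have "\<dots> = 0" using s0 by (simp add: sums_iff)
    finally have "p k * 1 \<le> p k * cos (real k * \<theta>)" by simp
    then have "1 \<le> cos (real k * \<theta>)" using k by (subst (asm) mult_le_cancel_left_pos)
    then show ?thesis by (simp add: order_antisym)
  qed
  then have "cos \<theta> = 1" by (rule aperiodic)
  moreover have "cos \<bar>\<theta>\<bar> < cos 0" by (rule cos_monotone_0_pi) (use assms in auto)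
  ultimately show False by simp
qed

text \<open>Multiplying the geometric sum by 1 - \<phi> leaves two powers, so the bound does not
  depend on the length of the block.\<close>

lemma integral_\<phi>_block_bound:
  fixes g :: "real \<Rightarrow> complex"
  assumes \<kappa>: "\<kappa> > 0" "\<And>\<theta>. \<theta> \<in> {s..t} \<Longrightarrow> \<kappa> \<le> norm (1 - \<phi> \<theta>)"
    and g: "continuous_on {s..t} g" "\<And>\<theta>. \<theta> \<in> {s..t} \<Longrightarrow> norm (g \<theta>) \<le> 2"
    and st: "-pi \<le> s" "t \<le> pi" and N: "N \<le> N'"
  shows "norm (integral {s..t} (\<lambda>\<theta>. (\<Sum>n\<in>{N..<N'}. \<phi> \<theta> ^ n) * g \<theta>))
     \<le> (4 / \<kappa>) * integral {-pi..pi} (\<lambda>\<theta>. norm (\<phi> \<theta>) ^ N)"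
proof -
  have int: "(\<lambda>\<theta>. norm (\<phi> \<theta>) ^ n) integrable_on {s..t}" for n s t
    by (intro integrable_continuous_interval continuous_intros continuous_\<phi>)
  have "norm (integral {s..t} (\<lambda>\<theta>. (\<Sum>n\<in>{N..<N'}. \<phi> \<theta> ^ n) * g \<theta>))
      \<le> integral {s..t} (\<lambda>\<theta>. (4 / \<kappa>) * norm (\<phi> \<theta>) ^ N)"
  proof (rule integral_norm_bound_integral)
    show "(\<lambda>\<theta>. (\<Sum>n\<in>{N..<N'}. \<phi> \<theta> ^ n) * g \<theta>) integrable_on {s..t}"
      by (intro integrable_continuous_interval continuous_intros continuous_\<phi> g)
    show "(\<lambda>\<theta>. (4 / \<kappa>) * norm (\<phi> \<theta>) ^ N) integrable_on {s..t}"
      by (intro integrable_on_mult_right int)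
    fix \<theta> assume \<theta>: "\<theta> \<in> {s..t}"
    have "(\<Sum>n\<in>{N..<N'}. \<phi> \<theta> ^ n) * (1 - \<phi> \<theta>) = \<phi> \<theta> ^ N - \<phi> \<theta> ^ N'"
      using N
    proof (induction N' rule: dec_induct)
      case (step n)
      have "(\<Sum>n\<in>{N..<Suc n}. \<phi> \<theta> ^ n) * (1 - \<phi> \<theta>)
          = (\<Sum>n\<in>{N..<n}. \<phi> \<theta> ^ n) * (1 - \<phi> \<theta>) + \<phi> \<theta> ^ n * (1 - \<phi> \<theta>)"
        using step.hyps by (simp add: distrib_right)
      also have "\<dots> = \<phi> \<theta> ^ N - \<phi> \<theta> ^ Suc n"
        by (simp only: step.IH) (simp add: algebra_simps)
      finally show ?case .
    qed simp
    then have "norm (\<Sum>n\<in>{N..<N'}. \<phi> \<theta> ^ n) * norm (1 - \<phi> \<theta>) = norm (\<phi> \<theta> ^ N - \<phi> \<theta> ^ N')"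
      by (metis norm_mult)
    also have "\<dots> \<le> norm (\<phi> \<theta>) ^ N + norm (\<phi> \<theta>) ^ N'"
      using norm_triangle_ineq4 by (metis norm_power)
    also have "\<dots> \<le> 2 * norm (\<phi> \<theta>) ^ N"
      using power_decreasing[OF N, of "norm (\<phi> \<theta>)"] norm_\<phi>_le_1 by simp
    finally have b: "norm (\<Sum>n\<in>{N..<N'}. \<phi> \<theta> ^ n) * norm (1 - \<phi> \<theta>) \<le> 2 * norm (\<phi> \<theta>) ^ N" .
    have "norm (\<Sum>n\<in>{N..<N'}. \<phi> \<theta> ^ n) * \<kappa> \<le> norm (\<Sum>n\<in>{N..<N'}. \<phi> \<theta> ^ n) * norm (1 - \<phi> \<theta>)"
      by (intro mult_left_mono \<kappa>(2) \<theta>) auto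
    with b have "norm (\<Sum>n\<in>{N..<N'}. \<phi> \<theta> ^ n) \<le> (2 * norm (\<phi> \<theta>) ^ N) / \<kappa>"
      using \<kappa>(1) by (simp add: pos_le_divide_eq)
    then have "norm (\<Sum>n\<in>{N..<N'}. \<phi> \<theta> ^ n) * norm (g \<theta>) \<le> (2 * norm (\<phi> \<theta>) ^ N) / \<kappa> * 2"
      using g(2)[OF \<theta>] \<kappa>(1) by (intro mult_mono) auto
    then show "norm ((\<Sum>n\<in>{N..<N'}. \<phi> \<theta> ^ n) * g \<theta>) \<le> (4 / \<kappa>) * norm (\<phi> \<theta>) ^ N"
      by (simp add: norm_mult)
  qed
  also have "\<dots> = (4 / \<kappa>) * integral {s..t} (\<lambda>\<theta>. norm (\<phi> \<theta>) ^ N)" by simp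
  also have "\<dots> \<le> (4 / \<kappa>) * integral {-pi..pi} (\<lambda>\<theta>. norm (\<phi> \<theta>) ^ N)"
    using \<kappa> st by (intro mult_left_mono integral_subset_le int) auto
  finally show ?thesis .
qed

lemma norm_cis_power_diff_le: "norm (cis (- \<theta>) ^ x - cis (- \<theta>) ^ y) \<le> \<bar>\<theta>\<bar> * \<bar>real x - real y\<bar>"
proof -
  have lip: "norm (cis s - cis t) \<le> \<bar>s - t\<bar>" for s t
  proof -
    have "norm (cis s - cis t) = norm (cis t) * norm (cis (s - t) - 1)"
    proof -
      have "cis s - cis t = cis t * (cis (s - t) - 1)" by (simp add: right_diff_distrib cis_mult)
      then show ?thesis by (simp add: norm_mult)
    qed
    also have "\<dots> = 2 * \<bar>sin ((s - t) / 2)\<bar>"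
      using dist_exp_i_1[of "s - t"] by (simp add: cis_conv_exp)
    also have "\<dots> \<le> \<bar>s - t\<bar>" using abs_sin_x_le_abs_x[of "(s - t) / 2"] by simp
    finally show ?thesis .
  qed
  show ?thesis
    using lip[of "real x * (- \<theta>)" "real y * (- \<theta>)"]
    by (simp only: Complex.DeMoivre) (simp add: abs_mult algebra_simps flip: abs_mult)
qed

text \<open>Near 0 the factor |\<theta>| |x - y| is integrated against |\<phi>|^n, which gives
  (a_N)^(-2) for each of the N' - N times. Away from 0 the geometric sum gives 1 / a_N for the whole
  block. If N and N' - N are of order A(x) and |x - y| <= \<eta>x, the result is \<eta> times the
  order A(x) / x of the block sum, up to a lower-order term.\<close>

lemma block_equicontinuity:
  obtains C where "C > 0"
    "\<And>N N' x y. N \<ge> 1 \<Longrightarrow> N \<le> N' \<Longrightarrow> \<bar>\<Sum>n\<in>{N..<N'}. P n x - P n y\<bar>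
       \<le> C * (\<bar>real x - real y\<bar> * real (N' - N) / (a N)\<^sup>2 + 1 / a N)"
proof -
  obtain C d where Cd: "C > 0" "0 < d" "d \<le> 1"
    "\<And>n \<theta>. n \<ge> 1 \<Longrightarrow> \<bar>\<theta>\<bar> \<le> d \<Longrightarrow> norm (\<phi> \<theta>) ^ n \<le> C / (1 + (a n * \<bar>\<theta>\<bar>) ^ 3)"
    using norm_\<phi>_power_decay by blast
  obtain C1 where C1: "C1 > 0" "\<And>n. n \<ge> 1 \<Longrightarrow> integral {-pi..pi} (\<lambda>\<theta>. norm (\<phi> \<theta>) ^ n) \<le> C1 / a n"
    using integral_norm_\<phi>_power by blast
  have dpi: "d < pi" using Cd pi_gt3 by linarith
  \<comment> \<open>The continuous function |1 - \<phi>| has a positive minimum on the compact set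
    of angles away from 0.\<close>
  obtain \<kappa> where \<kappa>: "\<kappa> > 0" "\<And>\<theta>. \<theta> \<in> {-pi..-d} \<union> {d..pi} \<Longrightarrow> \<kappa> \<le> norm (1 - \<phi> \<theta>)"
  proof -
    have "\<exists>\<theta>0\<in>{-pi..-d} \<union> {d..pi}. \<forall>\<theta>\<in>{-pi..-d} \<union> {d..pi}. norm (1 - \<phi> \<theta>0) \<le> norm (1 - \<phi> \<theta>)"
      using dpi by (intro continuous_attains_inf continuous_intros continuous_\<phi> compact_Un) auto
    then obtain \<theta>0 where t0: "\<theta>0 \<in> {-pi..-d} \<union> {d..pi}"
      "\<forall>\<theta>\<in>{-pi..-d} \<union> {d..pi}. norm (1 - \<phi> \<theta>0) \<le> norm (1 - \<phi> \<theta>)" by blast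
    have "\<phi> \<theta>0 \<noteq> 1" using t0(1) Cd by (intro \<phi>_neq_1) auto
    then have "norm (1 - \<phi> \<theta>0) > 0" by simp
    with t0(2) show ?thesis using that by blast
  qed
  define E where "E = max (8 * C) (8 * C1 / \<kappa>)"
  have E: "E > 0" "E \<ge> 8 * C" "E \<ge> 8 * C1 / \<kappa>" using Cd by (auto simp: E_def less_max_iff_disj)
  have "\<bar>\<Sum>n\<in>{N..<N'}. P n x - P n y\<bar> \<le> E * (\<bar>real x - real y\<bar> * real (N' - N) / (a N)\<^sup>2 + 1 / a N)"
    if N: "N \<ge> 1" "N \<le> N'" for N N' x y
  proof -
    define g where "g = (\<lambda>\<theta>. cis (- \<theta>) ^ x - cis (- \<theta>) ^ y)"
    define f where "f = (\<lambda>\<theta>. (\<Sum>n\<in>{N..<N'}. \<phi> \<theta> ^ n) * g \<theta>)"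
    have gc: "continuous_on S g" for S unfolding g_def by (intro continuous_intros)
    have fint: "f integrable_on {s..t}" for s t
      unfolding f_def by (intro integrable_continuous_interval continuous_intros continuous_\<phi> gc)
    have g2: "norm (g \<theta>) \<le> 2" for \<theta>
      unfolding g_def using norm_triangle_ineq4[of "cis (- \<theta>) ^ x" "cis (- \<theta>) ^ y"] by (simp add: norm_power)
    have inv: "integral {-pi..pi} f = 2 * pi * (\<Sum>n\<in>{N..<N'}. P n x - P n y)"
    proof -
      have "integral {-pi..pi} f = integral {-pi..pi} (\<lambda>\<theta>. \<Sum>n\<in>{N..<N'}. \<phi> \<theta> ^ n * cis (- \<theta>) ^ x - \<phi> \<theta> ^ n * cis (- \<theta>) ^ y)"
        by (simp add: f_def g_def sum_distrib_right right_diff_distrib sum_subtractf)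
      also have "\<dots> = (\<Sum>n\<in>{N..<N'}. 2 * pi * P n x - 2 * pi * P n y)"
        by (simp add: integral_sum integral_diff Fourier_inversion integrable_diff)
      finally show ?thesis by (simp add: sum_distrib_left right_diff_distrib)
    qed
    have split: "integral {-pi..pi} f = integral {-pi..-d} f + integral {-d..d} f + integral {d..pi} f"
    proof -
      have "integral {-pi..pi} f = integral {-pi..-d} f + integral {-d..pi} f"
        using dpi Cd by (intro Henstock_Kurzweil_Integration.integral_combine[symmetric] fint) auto
      also have "integral {-d..pi} f = integral {-d..d} f + integral {d..pi} f"
        using dpi Cd by (intro Henstock_Kurzweil_Integration.integral_combine[symmetric] fint) auto
      finally show ?thesis by (simp add: add.assoc)
    qed
    have far: "norm (integral {s..t} f) \<le> 4 * C1 / \<kappa> * (1 / a N)"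
      if "-pi \<le> s" "t \<le> pi" "{s..t} \<subseteq> {-pi..-d} \<union> {d..pi}" for s t
    proof -
      have "norm (integral {s..t} f) \<le> (4 / \<kappa>) * integral {-pi..pi} (\<lambda>\<theta>. norm (\<phi> \<theta>) ^ N)"
        unfolding f_def using that \<kappa> N by (intro integral_\<phi>_block_bound gc g2) auto
      also have "\<dots> \<le> (4 / \<kappa>) * (C1 / a N)"
        using \<kappa> N by (intro mult_left_mono C1) auto
      finally show ?thesis by simp
    qed
    have near: "norm (integral {-d..d} f) \<le> 8 * C * (\<bar>real x - real y\<bar> * real (N' - N) / (a N)\<^sup>2)"
    proof -
      define L where "L = real (N' - N) * (2 * C / a N) * \<bar>real x - real y\<bar>"
      have L0: "L \<ge> 0" using Cd by (simp add: L_def)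
      have "norm (integral {-d..d} f) \<le> integral {-d..d} (\<lambda>\<theta>. L * (1 / (1 + (a N * \<theta>)\<^sup>2)))"
      proof (rule integral_norm_bound_integral[OF fint])
        show "(\<lambda>\<theta>. L * (1 / (1 + (a N * \<theta>)\<^sup>2))) integrable_on {-d..d}"
          using integral_inverse_square_le(1)[of "a N" "-d" d] Cd by (intro integrable_on_mult_right) auto
        fix \<theta> assume "\<theta> \<in> {-d..d}"
        then have \<theta>: "\<bar>\<theta>\<bar> \<le> d" by auto
        have 1: "norm (\<phi> \<theta>) ^ n * \<bar>\<theta>\<bar> \<le> 2 * C / a N * (1 / (1 + (a N * \<theta>)\<^sup>2))" if "n \<ge> N" for n
        proof -
          have "norm (\<phi> \<theta>) ^ n * \<bar>\<theta>\<bar> \<le> norm (\<phi> \<theta>) ^ N * \<bar>\<theta>\<bar>"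
            using that norm_\<phi>_le_1 by (intro mult_right_mono power_decreasing) auto
          also have "\<dots> \<le> C / (1 + (a N * \<bar>\<theta>\<bar>) ^ 3) * \<bar>\<theta>\<bar>"
            using Cd(4)[OF N(1) \<theta>] by (intro mult_right_mono) auto
          also have "\<dots> = C / a N * ((a N * \<bar>\<theta>\<bar>) / (1 + (a N * \<bar>\<theta>\<bar>) ^ 3))" by simp
          also have "\<dots> \<le> C / a N * (2 / (1 + (a N * \<bar>\<theta>\<bar>)\<^sup>2))"
            using Cd by (intro mult_left_mono cube_square_bounds) auto
          finally show ?thesis by (simp add: power_mult_distrib mult.commute)
        qed
        have "norm (f \<theta>) \<le> (\<Sum>n\<in>{N..<N'}. norm (\<phi> \<theta>) ^ n) * (\<bar>\<theta>\<bar> * \<bar>real x - real y\<bar>)"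
          unfolding f_def norm_mult
        proof (rule mult_mono)
          show "norm (\<Sum>n\<in>{N..<N'}. \<phi> \<theta> ^ n) \<le> (\<Sum>n\<in>{N..<N'}. norm (\<phi> \<theta>) ^ n)"
            using norm_sum[of "\<lambda>n. \<phi> \<theta> ^ n" "{N..<N'}"] by (simp add: norm_power)
          show "norm (g \<theta>) \<le> \<bar>\<theta>\<bar> * \<bar>real x - real y\<bar>" unfolding g_def by (rule norm_cis_power_diff_le)
        qed (auto intro: sum_nonneg)
        also have "\<dots> = (\<Sum>n\<in>{N..<N'}. norm (\<phi> \<theta>) ^ n * \<bar>\<theta>\<bar>) * \<bar>real x - real y\<bar>"
          by (simp add: sum_distrib_right mult.assoc)
        also have "\<dots> \<le> (\<Sum>n\<in>{N..<N'}. 2 * C / a N * (1 / (1 + (a N * \<theta>)\<^sup>2))) * \<bar>real x - real y\<bar>"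
          using 1 by (intro mult_right_mono sum_mono) auto
        also have "\<dots> = L * (1 / (1 + (a N * \<theta>)\<^sup>2))" by (simp add: L_def)
        finally show "norm (f \<theta>) \<le> L * (1 / (1 + (a N * \<theta>)\<^sup>2))" .
      qed
      also have "\<dots> = L * integral {-d..d} (\<lambda>\<theta>. 1 / (1 + (a N * \<theta>)\<^sup>2))" by (rule integral_mult_right)
      also have "\<dots> \<le> L * (4 / a N)"
        using Cd by (intro mult_left_mono integral_inverse_square_le(2) L0) auto
      finally show ?thesis by (simp add: L_def power2_eq_square field_simps)
    qed
    have "2 * pi * \<bar>\<Sum>n\<in>{N..<N'}. P n x - P n y\<bar> = norm (integral {-pi..pi} f)"
      unfolding inv by (simp add: norm_mult flip: of_real_sum of_real_diff)
    also have "\<dots> \<le> norm (integral {-pi..-d} f) + norm (integral {-d..d} f) + norm (integral {d..pi} f)"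
      unfolding split by (meson norm_triangle_ineq norm_triangle_le order_trans add_right_mono)
    also have "\<dots> \<le> 4 * C1 / \<kappa> * (1 / a N) + 8 * C * (\<bar>real x - real y\<bar> * real (N' - N) / (a N)\<^sup>2) + 4 * C1 / \<kappa> * (1 / a N)"
      using dpi Cd by (intro add_mono far near) auto
    also have "\<dots> = 8 * C * (\<bar>real x - real y\<bar> * real (N' - N) / (a N)\<^sup>2) + 8 * C1 / \<kappa> * (1 / a N)" by simp
    also have "\<dots> \<le> E * (\<bar>real x - real y\<bar> * real (N' - N) / (a N)\<^sup>2) + E * (1 / a N)"
      using E by (intro add_mono mult_right_mono) auto
    finally have b: "2 * pi * \<bar>\<Sum>n\<in>{N..<N'}. P n x - P n y\<bar> \<le> E * (\<bar>real x - real y\<bar> * real (N' - N) / (a N)\<^sup>2 + 1 / a N)"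
      by (simp only: distrib_left)
    have "1 * \<bar>\<Sum>n\<in>{N..<N'}. P n x - P n y\<bar> \<le> 2 * pi * \<bar>\<Sum>n\<in>{N..<N'}. P n x - P n y\<bar>"
      using pi_gt3 by (intro mult_right_mono) auto
    with b show ?thesis by linarith
  qed
  then show ?thesis using that E(1) by blast
qed

end

section \<open>Sums of powers, truncated means and large deviations\<close>

lemma powr_le_tangent:
  fixes t s :: real
  assumes "t \<ge> 0" "0 \<le> s" "s \<le> 1"
  shows "t powr s \<le> 1 + s * (t - 1)"
proof (cases "t = 0")
  case False
  have "exp ((1 - s) *\<^sub>R 0 + s *\<^sub>R ln t) \<le> (1 - s) * exp 0 + s * exp (ln t)"
    using exp_convex assms by (intro convex_onD[where A = UNIV]) auto
  then show ?thesis using assms False by (simp add: powr_def algebra_simps)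
qed (use assms in auto)

lemma sum_powr_le:
  fixes e :: real
  assumes e: "e > -1"
  obtains C where "C > 0" "\<And>N. N \<ge> 0 \<Longrightarrow> (\<Sum>n\<in>{1..nat \<lfloor>N\<rfloor>}. real n powr e) \<le> C * N powr (e + 1)"
proof (cases "e \<ge> 0")
  case True
  have "(\<Sum>n\<in>{1..nat \<lfloor>N\<rfloor>}. real n powr e) \<le> 1 * N powr (e + 1)" if N: "N \<ge> 0" for N
  proof -
    have le: "real n \<le> N" if "n \<in> {1..nat \<lfloor>N\<rfloor>}" for n using that N by (auto simp: le_nat_iff le_floor_iff)
    have "(\<Sum>n\<in>{1..nat \<lfloor>N\<rfloor>}. real n powr e) \<le> (\<Sum>n\<in>{1..nat \<lfloor>N\<rfloor>}. N powr e)"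
      using True le by (intro sum_mono powr_mono2) auto
    also have "\<dots> = real (nat \<lfloor>N\<rfloor>) * N powr e" by simp
    also have "\<dots> \<le> N * N powr e" using N by (intro mult_right_mono) auto
    also have "\<dots> = N powr (e + 1)" using N by (simp add: powr_mult_base add.commute)
    finally show ?thesis by simp
  qed
  then show ?thesis using that[of 1] by simp
next
  case False
  define s where "s = e + 1"
  have s: "0 < s" "s \<le> 1" using False e by (auto simp: s_def)
  \<comment> \<open>Telescoping: by concavity, n^s - (n - 1)^s >= s n^(s - 1).\<close>
  have bound: "(\<Sum>n\<in>{1..k}. real n powr e) \<le> real k powr s / s" for k :: nat
  proof (induction k)
    case (Suc k)
    define n where "n = real (Suc k)"
    have n: "n > 0" "real k / n \<ge> 0" "real k = n - 1" by (auto simp: n_def)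
    have "real k powr s = n powr s * (real k / n) powr s"
      using n(1) by (simp flip: powr_mult)
    also have "\<dots> \<le> n powr s * (1 + s * (real k / n - 1))"
      using n s by (intro mult_left_mono powr_le_tangent) auto
    also have "\<dots> = n powr s - s * n powr e"
      using n(1) by (simp add: n(3) s_def powr_add field_simps)
    finally have "n powr e \<le> (n powr s - real k powr s) / s"
      using s by (simp add: field_simps)
    with Suc show ?case using s by (simp add: n_def diff_divide_distrib)
  qed simp
  have "(\<Sum>n\<in>{1..nat \<lfloor>N\<rfloor>}. real n powr e) \<le> (1 / s) * N powr (e + 1)" if N: "N \<ge> 0" for N
  proof -
    have "real (nat \<lfloor>N\<rfloor>) powr s \<le> N powr s" using N s by (intro powr_mono2) auto
    then have "real (nat \<lfloor>N\<rfloor>) powr s / s \<le> N powr s / s" using s by (intro divide_right_mono) auto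
    then show ?thesis using bound[of "nat \<lfloor>N\<rfloor>"] by (simp add: s_def)
  qed
  then show ?thesis using that[of "1 / s"] s by simp
qed

lemma sum_inverse_power_tail:
  fixes M :: real
  assumes M: "M > 0" and R: "R \<ge> 2"
  shows "(\<Sum>n\<in>{n\<in>{1..N}. real n > M}. 1 / real n ^ R) \<le> 2 / M ^ (R - 1)"
proof -
  define n0 where "n0 = nat \<lfloor>M\<rfloor> + 1"
  have n0: "real n0 \<ge> M" "n0 \<ge> 1" "real n0 > 0" unfolding n0_def using M by linarith+
  have S: "{n\<in>{1..N}. real n > M} \<subseteq> {n0..<Suc (max N n0)}"
  proof
    fix n assume "n \<in> {n\<in>{1..N}. real n > M}"
    then have "real n > M" "n \<le> N" by auto
    then show "n \<in> {n0..<Suc (max N n0)}" unfolding n0_def using M by auto linarith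
  qed
  have tele: "(\<Sum>n\<in>{n0..<k}. 1 / (real n)\<^sup>2) \<le> 2 / real n0 - 2 / real k" if "k \<ge> n0" for k
    using that
  proof (induction k rule: dec_induct)
    case (step k)
    then have k: "real k \<ge> 1" using n0 by auto
    have tl: "1 / t\<^sup>2 \<le> 2 / t - 2 / (t + 1)" if "t \<ge> 1" for t :: real
    proof -
      have "2 / t - 2 / (t + 1) - 1 / t\<^sup>2 = (t - 1) / (t\<^sup>2 * (t + 1))"
      proof -
        have "t \<noteq> 0" "t + 1 \<noteq> 0" using that by auto
        then show ?thesis by (simp add: divide_simps power2_eq_square)
      qed
      moreover have "\<dots> \<ge> 0" using that by simp
      ultimately show ?thesis by linarith
    qed
    have "1 / (real k)\<^sup>2 \<le> 2 / real k - 2 / real (Suc k)"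
      using tl[OF k] by (simp add: add.commute)
    with step show ?case by simp
  qed simp
  have "(\<Sum>n\<in>{n\<in>{1..N}. real n > M}. 1 / real n ^ R) \<le> (\<Sum>n\<in>{n\<in>{1..N}. real n > M}. (1 / (real n)\<^sup>2) * (1 / M ^ (R - 2)))"
  proof (rule sum_mono)
    fix n assume "n \<in> {n\<in>{1..N}. real n > M}"
    then have n: "real n > M" by auto
    have "real n ^ R = real n ^ (2 + (R - 2))"
      by (rule arg_cong[where f = "\<lambda>k. real n ^ k"]) (use R in simp)
    also have "\<dots> = (real n)\<^sup>2 * real n ^ (R - 2)" by (rule power_add)
    finally have "real n ^ R = (real n)\<^sup>2 * real n ^ (R - 2)" .
    moreover have "M ^ (R - 2) \<le> real n ^ (R - 2)" using n M by (intro power_mono) auto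
    ultimately show "1 / real n ^ R \<le> (1 / (real n)\<^sup>2) * (1 / M ^ (R - 2))"
      using n M by (simp add: divide_le_cancel frac_le mult_left_mono)
  qed
  also have "\<dots> = (\<Sum>n\<in>{n\<in>{1..N}. real n > M}. 1 / (real n)\<^sup>2) * (1 / M ^ (R - 2))"
    by (simp only: sum_distrib_right)
  also have "\<dots> \<le> (\<Sum>n\<in>{n0..<Suc (max N n0)}. 1 / (real n)\<^sup>2) * (1 / M ^ (R - 2))"
    using S M by (intro mult_right_mono sum_mono2) auto
  also have "\<dots> \<le> (2 / real n0) * (1 / M ^ (R - 2))"
  proof (intro mult_right_mono)
    show "(\<Sum>n\<in>{n0..<Suc (max N n0)}. 1 / (real n)\<^sup>2) \<le> 2 / real n0"
      by (rule order_trans[OF tele]) auto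
  qed (use M in simp)
  also have "\<dots> \<le> (2 / M) * (1 / M ^ (R - 2))"
    using n0 M by (intro mult_right_mono divide_left_mono) auto
  also have "\<dots> = 2 / M ^ Suc (R - 2)" by simp
  also have "Suc (R - 2) = R - 1" using R by simp
  finally show ?thesis .
qed

context renewal_walk
begin

text \<open>Summation by parts.\<close>

lemma sum_mean_tail: "(\<Sum>k\<le>Y. real k * p k) + real Y * tail Y = (\<Sum>j<Y. tail j)"
proof (induction Y)
  case (Suc Y)
  have pS: "p (Suc Y) = tail Y - tail (Suc Y)" by (simp add: tail_def)
  show ?case
    by (simp only: sum.atMost_Suc sum.lessThan_Suc of_nat_Suc Suc.IH[symmetric] pS) (simp add: algebra_simps)
qed simp

text \<open>The tails decay at most like a power with exponent above -1, because \<alpha> < 1; hence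
  their sum up to \<open>Y\<close> is of the order of its last term times \<open>Y\<close>.\<close>

lemma truncated_mean_bound:
  obtains C where "C > 0" "\<And>Y. Y \<ge> 1 \<Longrightarrow> (\<Sum>k\<le>Y. real k * p k) \<le> C * real Y / A (real Y)"
proof -
  obtain c C where cC: "c > 0" "\<And>k. c / A (real k) \<le> tail k" "\<And>k. tail k \<le> C / A (real k)"
    using tail_bounds by blast
  define \<tau> where "\<tau> = (1 - \<alpha>) / 2"
  have \<tau>: "\<tau> > 0" "\<alpha> + \<tau> < 1" using alpha by (auto simp: \<tau>_def field_simps)
  obtain D where D: "D \<ge> 1" "\<forall>x\<ge>1. \<forall>y\<ge>x. A y \<le> D * (y / x) powr (\<alpha> + \<tau>) * A x \<and>
      A x \<le> D * (y / x) powr (\<tau> - \<alpha>) * A y"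
    using A_potter_global[OF \<tau>(1)] by blast
  have "- (\<alpha> + \<tau>) > -1" using \<tau> by simp
  then obtain E where E: "E > 0"
    "\<And>N. N \<ge> 0 \<Longrightarrow> (\<Sum>n\<in>{1..nat \<lfloor>N\<rfloor>}. real n powr - (\<alpha> + \<tau>)) \<le> E * N powr (- (\<alpha> + \<tau>) + 1)"
    using sum_powr_le by blast
  have C: "C > 0"
  proof -
    have "c / A 0 \<le> C / A 0" using cC(2)[of 0] cC(3)[of 0] by simp
    then show ?thesis using cC(1) by (simp add: divide_le_cancel)
  qed
  have "(\<Sum>k\<le>Y. real k * p k) \<le> (D * A 1 + C * D * E) * real Y / A (real Y)" if Y: "Y \<ge> 1" for Y
  proof -
    have "(\<Sum>k\<le>Y. real k * p k) \<le> (\<Sum>j<Y. tail j)"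
      using sum_mean_tail[of Y] tail_nonneg[of Y] by (smt (verit) mult_nonneg_nonneg of_nat_0_le_iff)
    also have "\<dots> \<le> 1 + (\<Sum>j\<in>{1..Y}. tail j)"
    proof -
      have "(\<Sum>j<Y. tail j) \<le> (\<Sum>j\<in>insert 0 {1..Y}. tail j)"
        by (intro sum_mono2) (auto intro: tail_nonneg)
      also have "\<dots> \<le> 1 + (\<Sum>j\<in>{1..Y}. tail j)" using tail_le_1[of 0] by simp
      finally show ?thesis .
    qed
    also have "(\<Sum>j\<in>{1..Y}. tail j) \<le> (\<Sum>j\<in>{1..Y}. C * D * real Y powr (\<alpha> + \<tau>) / A Y * real j powr - (\<alpha> + \<tau>))"
    proof (rule sum_mono)
      fix j assume j: "j \<in> {1..Y}"
      have "A Y \<le> D * (real Y / real j) powr (\<alpha> + \<tau>) * A j" using D(2) j by auto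
      then have "1 / A j \<le> D * (real Y / real j) powr (\<alpha> + \<tau>) / A Y" by (simp add: field_simps)
      then have "C * (1 / A j) \<le> C * (D * (real Y / real j) powr (\<alpha> + \<tau>) / A Y)"
        using C by (intro mult_left_mono) auto
      moreover have "(real Y / real j) powr (\<alpha> + \<tau>) = real Y powr (\<alpha> + \<tau>) * real j powr - (\<alpha> + \<tau>)"
      proof -
        have "(u / v) powr e = u powr e * v powr - e" if "u \<ge> 0" "v \<ge> 0" for u v e :: real
          using that by (simp add: powr_divide powr_minus_divide)
        then show ?thesis by simp
      qed
      ultimately have "C * (1 / A j) \<le> C * D * real Y powr (\<alpha> + \<tau>) / A Y * real j powr - (\<alpha> + \<tau>)"
        by (simp add: mult_ac)
      with cC(3)[of j] show "tail j \<le> C * D * real Y powr (\<alpha> + \<tau>) / A Y * real j powr - (\<alpha> + \<tau>)" by simp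
    qed
    also have "\<dots> = C * D * real Y powr (\<alpha> + \<tau>) / A Y * (\<Sum>j\<in>{1..Y}. real j powr - (\<alpha> + \<tau>))"
      by (simp only: sum_distrib_left)
    also have "\<dots> \<le> C * D * real Y powr (\<alpha> + \<tau>) / A Y * (E * real Y powr (- (\<alpha> + \<tau>) + 1))"
      using E(2)[of "real Y"] C D by (intro mult_left_mono) auto
    also have "\<dots> = C * D * E * (real Y powr (\<alpha> + \<tau>) * real Y powr (- (\<alpha> + \<tau>) + 1)) / A Y" by simp
    also have "real Y powr (\<alpha> + \<tau>) * real Y powr (- (\<alpha> + \<tau>) + 1) = real Y" using Y by (simp flip: powr_add)
    also have "1 \<le> D * A 1 * real Y / A Y"
    proof -
      have "A Y \<le> D * (real Y / 1) powr (\<alpha> + \<tau>) * A 1" using D(2) Y by (metis of_nat_1 of_nat_le_iff order_refl)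
      also have "\<dots> \<le> D * (real Y / 1) powr 1 * A 1"
        using D Y \<tau> by (intro mult_right_mono mult_left_mono powr_mono) auto
      finally show ?thesis using Y by (simp add: field_simps)
    qed
    finally show ?thesis by (simp add: ring_distribs add_divide_distrib)
  qed
  moreover have "D * A 1 + C * D * E > 0" using C D E by (intro add_pos_pos mult_pos_pos) auto
  ultimately show ?thesis using that by blast
qed

text \<open>A Fuk--Nagaev bound: Markov's inequality for \<open>z\<^sup>S\<close> with \<open>z\<^sup>Y = A(Y) / n\<close>.\<close>

lemma truncated_large_deviation:
  obtains C where "C > 0"
    "\<And>Y n h N. Y \<ge> 1 \<Longrightarrow> n \<ge> 1 \<Longrightarrow> real n \<le> A (real Y) \<Longrightarrow>
       (\<Sum>k\<in>{h..N}. conv_pow (truncate_at Y p) n k) \<le> C * (real n / A (real Y)) powr (real h / real Y)"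
proof -
  obtain C where C: "C > 0" "\<And>Y. Y \<ge> 1 \<Longrightarrow> (\<Sum>k\<le>Y. real k * p k) \<le> C * real Y / A (real Y)"
    using truncated_mean_bound by blast
  have "(\<Sum>k\<in>{h..N}. conv_pow (truncate_at Y p) n k) \<le> exp C * (real n / A (real Y)) powr (real h / real Y)"
    if Y: "Y \<ge> 1" and n: "n \<ge> 1" and le: "real n \<le> A (real Y)" for Y n h N
  proof -
    define Q where "Q = A (real Y) / real n"
    define z where "z = Q powr (1 / real Y)"
    have Q: "Q \<ge> 1" using n le by (simp add: Q_def)
    have z: "z \<ge> 1" using Q by (simp add: z_def ge_one_powr_ge_zero)
    have zk: "z ^ k = Q powr (real k / real Y)" for k
      using Q by (simp add: z_def powr_powr flip: powr_realpow)
    have tp: "truncate_at Y p k \<ge> 0" for k using p_nonneg by (simp add: truncate_at_def)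
    have "(\<Sum>k\<le>N. truncate_at Y p k * z ^ k) \<le> (\<Sum>k\<le>Y. p k * z ^ k)"
    proof -
      have "(\<Sum>k\<le>N. truncate_at Y p k * z ^ k) \<le> (\<Sum>k\<le>max N Y. truncate_at Y p k * z ^ k)"
        using z tp by (intro sum_mono2) auto
      also have "\<dots> = (\<Sum>k\<le>Y. p k * z ^ k)"
        by (rule sum.mono_neutral_cong_right) (auto simp: truncate_at_def)
      finally show ?thesis .
    qed
    also have "\<dots> \<le> (\<Sum>k\<le>Y. p k + real k * p k * (Q / real Y))"
    proof (rule sum_mono)
      fix k assume k: "k \<in> {..Y}"
      \<comment> \<open>The tangent of t^(k/Y) at t = 1 lies above the graph for k <= Y; it turns
        the exponential moment into the truncated mean.\<close>
      have "Q powr (real k / real Y) \<le> 1 + real k / real Y * (Q - 1)"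
        using k Y Q by (intro powr_le_tangent) auto
      also have "\<dots> \<le> 1 + real k / real Y * Q" by (intro add_left_mono mult_left_mono) auto
      finally have "p k * z ^ k \<le> p k * (1 + real k / real Y * Q)"
        unfolding zk by (rule mult_left_mono[OF _ p_nonneg])
      then show "p k * z ^ k \<le> p k + real k * p k * (Q / real Y)" by (simp add: algebra_simps)
    qed
    also have "\<dots> = (\<Sum>k\<le>Y. p k) + (\<Sum>k\<le>Y. real k * p k) * (Q / real Y)"
      by (simp only: sum.distrib sum_distrib_right)
    also have "\<dots> \<le> 1 + (C * real Y / A (real Y)) * (Q / real Y)"
      using Q by (intro add_mono mult_right_mono C Y sum_p_le_1) auto
    \<comment> \<open>The choice of \<open>z\<close> makes the excess over 1 of order 1 / n, so its
      n-th power stays bounded.\<close>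
    also have "\<dots> = 1 + C / real n" using Y by (simp add: Q_def)
    also have "\<dots> \<le> exp (C / real n)" by (rule exp_ge_add_one_self)
    finally have gen: "(\<Sum>k\<le>N. truncate_at Y p k * z ^ k) \<le> exp (C / real n)" .
    have "(\<Sum>k\<in>{h..N}. conv_pow (truncate_at Y p) n k) * z ^ h
        = (\<Sum>k\<in>{h..N}. conv_pow (truncate_at Y p) n k * z ^ h)"
      by (rule sum_distrib_right)
    also have "\<dots> \<le> (\<Sum>k\<in>{h..N}. conv_pow (truncate_at Y p) n k * z ^ k)"
      using z by (intro sum_mono mult_left_mono power_increasing conv_pow_nonneg tp) auto
    also have "\<dots> \<le> (\<Sum>k\<le>N. conv_pow (truncate_at Y p) n k * z ^ k)"
      using z tp by (intro sum_mono2) (auto intro!: mult_nonneg_nonneg conv_pow_nonneg)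
    also have "\<dots> \<le> (\<Sum>k\<le>N. truncate_at Y p k * z ^ k) ^ n"
      using z tp by (intro sum_conv_pow_le_power) auto
    also have "\<dots> \<le> exp (C / real n) ^ n"
      using gen z tp by (intro power_mono sum_nonneg) auto
    also have "\<dots> = exp C" using n by (simp flip: exp_of_nat_mult)
    finally have "(\<Sum>k\<in>{h..N}. conv_pow (truncate_at Y p) n k) \<le> exp C / z ^ h"
      using z by (simp add: pos_le_divide_eq)
    also have "\<dots> = exp C * (real n / A (real Y)) powr (real h / real Y)"
      using n by (simp add: zk Q_def powr_divide)
    finally show ?thesis .
  qed
  then show ?thesis using that by (metis exp_gt_zero)
qed

text \<open>Cut the walk into two halves in time. One of them must cover x/2, at least J times the
  truncation level, which has probability of order (n / A(x))^J; the other contributes 1 / a_n by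
  the uniform bound.\<close>

lemma truncated_local_bound:
  assumes J: "J \<ge> 1"
  obtains C c where "C > 0" "c > 0"
    "\<And>x n. x \<ge> 2 * J \<Longrightarrow> n \<ge> 1 \<Longrightarrow> real n \<le> c * A (real x) \<Longrightarrow>
       conv_pow (truncate_at (x div (2 * J)) p) n x \<le> C / a n * (real n / A (real x)) ^ J"
proof -
  obtain C1 where C1: "C1 > 0" "\<And>n z. n \<ge> 1 \<Longrightarrow> P n z \<le> C1 / a n" using P_uniform_bound by blast
  obtain C2 where C2: "C2 > 0" "\<And>m n. m \<ge> 1 \<Longrightarrow> n \<le> 3 * m \<Longrightarrow> a n \<le> C2 * a m" using a_doubling by blast
  obtain C3 where C3: "C3 > 0"
    "\<And>Y n h N. Y \<ge> 1 \<Longrightarrow> n \<ge> 1 \<Longrightarrow> real n \<le> A (real Y) \<Longrightarrow>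
       (\<Sum>k\<in>{h..N}. conv_pow (truncate_at Y p) n k) \<le> C3 * (real n / A (real Y)) powr (real h / real Y)"
    using truncated_large_deviation by blast
  obtain D where D: "D \<ge> 1" "\<forall>x\<ge>1. \<forall>y\<ge>x. A y \<le> D * (y / x) powr (\<alpha> + 1) * A x \<and>
      A x \<le> D * (y / x) powr (1 - \<alpha>) * A y"
    using A_potter_global[of 1] by auto
  \<comment> \<open>Since x <= 4 J Y, A(x) <= K A(Y); the restriction n <= A(x) / K then gives n <=
    A(Y), as the large deviation bound requires.\<close>
  define K where "K = D * (4 * real J) powr (\<alpha> + 1)"
  have K: "K \<ge> 1"
  proof -
    have "1 \<le> (4 * real J) powr (\<alpha> + 1)" using J alpha by (intro ge_one_powr_ge_zero) auto
    then show ?thesis using D mult_mono[of 1 D 1 "(4 * real J) powr (\<alpha> + 1)"] by (simp add: K_def)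
  qed
  have main: "conv_pow (truncate_at (x div (2 * J)) p) n x \<le> (2 * C1 * C2 * C3 * K ^ J) / a n * (real n / A (real x)) ^ J"
    if x: "x \<ge> 2 * J" and n: "n \<ge> 1" "real n \<le> (1 / K) * A (real x)" for x n
  proof -
    define Y where "Y = x div (2 * J)"
    define q where "q = conv_pow (truncate_at Y p)"
    have Y: "Y \<ge> 1" using x J by (simp add: Y_def Suc_le_eq div_greater_zero_iff)
    have "2 * J * Y + x mod (2 * J) = x" unfolding Y_def by (rule mult_div_mod_eq)
    moreover have "x mod (2 * J) < 2 * J" using J by simp
    ultimately have Yx: "2 * (J * Y) \<le> x" "x < 2 * (J * Y) + 2 * J" by (simp_all add: mult.assoc)
    have JY: "J \<le> J * Y" "Y \<le> J * Y" using Y J by simp_all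
    have xY: "x \<le> 4 * (J * Y)" and Yle: "Y < x" using Yx JY Y by linarith+
    have AY: "A x \<le> K * A Y"
    proof -
      have "real Y \<ge> 1" "real x \<ge> real Y" using Y Yle by auto
      then have "A x \<le> D * (real x / real Y) powr (\<alpha> + 1) * A Y" using D(2) by blast
      also have "\<dots> \<le> D * (4 * real J) powr (\<alpha> + 1) * A Y"
      proof (intro mult_right_mono mult_left_mono powr_mono2)
        have "real x \<le> real (4 * (J * Y))" using xY by (simp only: of_nat_le_iff)
        then show "real x / real Y \<le> 4 * real J" using Y by (simp add: divide_le_eq)
      qed (use D alpha in auto)
      finally show ?thesis by (simp add: K_def)
    qed
    have nAY: "real n \<le> A Y"
    proof -
      have "real n \<le> (1 / K) * (K * A Y)"
        by (rule order_trans[OF n(2) mult_left_mono[OF AY]]) (use K in simp)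
      then show ?thesis using K by simp
    qed
    have qnn: "q m k \<ge> 0" for m k unfolding q_def using p_nonneg by (intro conv_pow_nonneg) (simp add: truncate_at_def)
    have qP: "q m k \<le> P m k" for m k unfolding q_def using p_nonneg by (intro conv_pow_mono) (simp_all add: truncate_at_def)
    show ?thesis
    proof (cases "n = 1")
      case True
      have "q n x = 0" using True Yle by (simp add: q_def truncate_at_def)
      then show ?thesis using C1 C2 C3 K by (simp add: q_def Y_def)
    next
      case False
      define m where "m = n div 2"
      define m' where "m' = n - m"
      have m: "m \<ge> 1" "m' \<ge> 1" "n \<le> 3 * m" "n \<le> 3 * m'" "m \<le> n" "m' \<le> n" "n = m + m'"
        using False n(1) by (auto simp: m_def m'_def)
      \<comment> \<open>Half of x, rounded up: if the first half of the walk covers less than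
        \<open>h\<close>, the second covers at least \<open>h\<close>.\<close>
      define h where "h = (x + 1) div 2"
      have sup: "q j k \<le> C1 * C2 / a n" if "j \<ge> 1" "n \<le> 3 * j" for j k
      proof -
        have "q j k \<le> C1 / a j" using qP C1(2)[OF that(1), of k] by (meson order_trans)
        also have "\<dots> \<le> C1 * C2 / a n" using C2(2)[OF that] C1 by (simp add: field_simps)
        finally show ?thesis .
      qed
      have dev: "(\<Sum>k\<in>{h..x}. q j k) \<le> C3 * (real n / A Y) ^ J" if "j \<ge> 1" "j \<le> n" for j
      proof -
        have "(\<Sum>k\<in>{h..x}. q j k) \<le> C3 * (real j / A Y) powr (real h / real Y)"
          unfolding q_def using that nAY by (intro C3 Y) auto
        also have "(real j / A Y) powr (real h / real Y) \<le> (real j / A Y) powr real J"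
        proof (rule powr_mono')
          have "J * Y \<le> h" using Yx(1) by (simp add: h_def)
          then have "real J * real Y \<le> real h" by (simp flip: of_nat_mult)
          then show "real J \<le> real h / real Y" using Y by (simp add: le_divide_eq)
          show "real j / A Y \<le> 1" using that nAY by simp
        qed simp
        also have "\<dots> = (real j / A Y) ^ J" using that by (simp add: powr_realpow)
        also have "\<dots> \<le> (real n / A Y) ^ J" using that by (intro power_mono divide_right_mono) auto
        finally show ?thesis using C3 by simp
      qed
      have "q n x = (\<Sum>i\<le>x. q m i * q m' (x - i))"
        unfolding q_def m(7) by (rule conv_pow_add)
      also have "\<dots> = (\<Sum>i\<in>{..<h}. q m i * q m' (x - i)) + (\<Sum>i\<in>{h..x}. q m i * q m' (x - i))"
      proof -
        have "{..x} = {..<h} \<union> {h..x}" by (auto simp: h_def)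
        moreover have "(\<Sum>i\<in>{..<h} \<union> {h..x}. q m i * q m' (x - i)) = (\<Sum>i\<in>{..<h}. q m i * q m' (x - i)) + (\<Sum>i\<in>{h..x}. q m i * q m' (x - i))"
          by (rule sum.union_disjoint) auto
        ultimately show ?thesis by (simp only:)
      qed
      also have "(\<Sum>i\<in>{h..x}. q m i * q m' (x - i)) \<le> (\<Sum>i\<in>{h..x}. q m i * (C1 * C2 / a n))"
        using sup m qnn by (intro sum_mono mult_left_mono) auto
      also have "\<dots> = (C1 * C2 / a n) * (\<Sum>i\<in>{h..x}. q m i)"
        by (simp only: sum_distrib_right[symmetric] mult.commute)
      also have "\<dots> \<le> (C1 * C2 / a n) * (C3 * (real n / A Y) ^ J)"
        using dev m C1 C2 by (intro mult_left_mono) auto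
      also have "(\<Sum>i\<in>{..<h}. q m i * q m' (x - i)) \<le> (\<Sum>i\<in>{..<h}. (C1 * C2 / a n) * q m' (x - i))"
        using sup m qnn by (intro sum_mono mult_right_mono) auto
      also have "\<dots> = (C1 * C2 / a n) * (\<Sum>i\<in>{..<h}. q m' (x - i))" by (simp add: sum_distrib_left)
      also have "(\<Sum>i\<in>{..<h}. q m' (x - i)) = (\<Sum>j\<in>(\<lambda>i. x - i) ` {..<h}. q m' j)"
        by (subst sum.reindex) (auto simp: inj_on_def h_def)
      also have "\<dots> \<le> (\<Sum>j\<in>{h..x}. q m' j)"
        using qnn by (intro sum_mono2) (auto simp: h_def)
      also have "\<dots> \<le> C3 * (real n / A Y) ^ J" using dev m by auto
      finally have "q n x \<le> 2 * (C1 * C2 / a n) * (C3 * (real n / A Y) ^ J)"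
        using C1 C2 by (simp add: mult_left_mono divide_right_mono mult.assoc)
      also have "\<dots> \<le> 2 * (C1 * C2 / a n) * (C3 * (K * (real n / A x)) ^ J)"
      proof (intro mult_left_mono power_mono)
        have "real n * A x \<le> real n * (K * A Y)" by (intro mult_left_mono AY) simp
        then show "real n / A Y \<le> K * (real n / A x)" by (simp add: field_simps)
      qed (use C1 C2 C3 in auto)
      also have "\<dots> = (2 * C1 * C2 * C3 * K ^ J) / a n * (real n / A (real x)) ^ J"
        by (simp add: power_mult_distrib power_divide)
      finally show ?thesis by (simp add: q_def Y_def)
    qed
  qed
  have "2 * C1 * C2 * C3 * K ^ J > 0" "1 / K > 0" using C1 C2 C3 K by auto
  with main show ?thesis using that by blast
qed

end

section \<open>Late times and comparison of orders of magnitude\<close>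

lemma nat_floor_ge_iff: "n \<in> {1..nat \<lfloor>M\<rfloor>} \<longleftrightarrow> 1 \<le> n \<and> real n \<le> M"
proof (cases "1 \<le> n")
  case True
  then have "n \<le> nat \<lfloor>M\<rfloor> \<longleftrightarrow> int n \<le> \<lfloor>M\<rfloor>" by arith
  then show ?thesis using True by (simp add: le_floor_iff)
qed simp

context renewal_walk
begin

text \<open>One half of the steps gives 1 / a_n. In the other half no step may exceed x, which has
  probability at most (1 - tail(x))^(n/2).\<close>

lemma P_exp_bound:
  obtains C c where "C > 0" "c > 0" "\<And>n x. n \<ge> 1 \<Longrightarrow> P n x \<le> C / a n * exp (- c * (real n / A (real x)))"
proof -
  obtain C1 where C1: "C1 > 0" "\<And>n z. n \<ge> 1 \<Longrightarrow> P n z \<le> C1 / a n" using P_uniform_bound by blast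
  obtain C2 where C2: "C2 > 0" "\<And>m n. m \<ge> 1 \<Longrightarrow> n \<le> 3 * m \<Longrightarrow> a n \<le> C2 * a m" using a_doubling by blast
  obtain c0 C0 where c0: "c0 > 0" "\<And>k. c0 / A (real k) \<le> tail k" "\<And>k. tail k \<le> C0 / A (real k)"
    using tail_bounds by blast
  define c where "c = c0 / 2"
  define C where "C = max (C1 * C2) (a 1 * exp c)"
  have c: "c > 0" using c0 by (simp add: c_def)
  have C: "C > 0" "C \<ge> C1 * C2" "C \<ge> a 1 * exp c" using C1 C2 by (auto simp: C_def less_max_iff_disj)
  have "P n x \<le> C / a n * exp (- c * (real n / A (real x)))" if n: "n \<ge> 1" for n x
  proof (cases "n = 1")
    case True
    have "c * (1 / A (real x)) \<le> c * 1" using c A_ge_1[of x] by (intro mult_left_mono) auto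
    then have "1 \<le> exp c * exp (- c * (1 / A (real x)))" by (simp flip: exp_add)
    also have "\<dots> \<le> C / a 1 * exp (- c * (1 / A (real x)))"
      using C(3) by (intro mult_right_mono) (simp_all add: pos_le_divide_eq mult.commute)
    finally have "1 \<le> C / a n * exp (- c * (real n / A (real x)))" by (simp only: True of_nat_1)
    then show ?thesis using P_le_1[of n x] by linarith
  next
    case False
    define m where "m = n div 2"
    have m: "m \<ge> 1" "n \<le> 3 * m" "n = m + (n - m)" "real n / 2 \<le> real (n - m)" using False n by (auto simp: m_def)
    have "P n x = (\<Sum>i\<le>x. P m i * P (n - m) (x - i))"
      by (subst m(3)) (rule conv_pow_add)
    also have "\<dots> \<le> (\<Sum>i\<le>x. C1 / a m * P (n - m) (x - i))"
      using C1 m by (intro sum_mono mult_right_mono P_nonneg) auto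
    also have "\<dots> = C1 / a m * (\<Sum>i\<le>x. P (n - m) (x - i))" by (rule sum_distrib_left[symmetric])
    also have "(\<Sum>i\<le>x. P (n - m) (x - i)) = (\<Sum>i\<le>x. P (n - m) i)"
      by (rule sum.reindex_bij_witness[of _ "\<lambda>i. x - i" "\<lambda>i. x - i"]) auto
    also have "C1 / a m * \<dots> \<le> C1 / a m * (\<Sum>i\<le>x. p i) ^ (n - m)"
      using C1 by (intro mult_left_mono sum_conv_pow_le p_nonneg) auto
    also have "(\<Sum>i\<le>x. p i) ^ (n - m) \<le> exp (- tail x) ^ (n - m)"
      using exp_ge_add_one_self[of "- tail x"] by (intro power_mono sum_nonneg p_nonneg) (simp add: tail_def)
    also have "\<dots> = exp (- (tail x * real (n - m)))" by (simp flip: exp_of_nat_mult add: mult.commute)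
    also have "\<dots> \<le> exp (- c * (real n / A (real x)))"
    proof -
      have "c0 / A x * (real n / 2) \<le> tail x * real (n - m)"
        using c0 m(4) tail_nonneg by (intro mult_mono) auto
      then show ?thesis by (simp add: c_def)
    qed
    finally have "P n x \<le> C1 / a m * exp (- c * (real n / A (real x)))"
      using C1 by (simp add: mult_left_mono divide_right_mono)
    also have "\<dots> \<le> C / a n * exp (- c * (real n / A (real x)))"
    proof (rule mult_right_mono)
      have "C1 / a m \<le> C1 * C2 / a n" using C2(2)[OF m(1,2)] C1 by (simp add: field_simps)
      also have "\<dots> \<le> C / a n" using C by (intro divide_right_mono) auto
      finally show "C1 / a m \<le> C / a n" .
    qed simp
    finally show ?thesis .
  qed
  then show ?thesis using that C(1) c by blast
qed

lemma A_comparable: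
  assumes \<delta>: "0 < \<delta>" "\<delta> \<le> 1"
  obtains C where "C \<ge> 1" "\<And>x w. w \<ge> 1 \<Longrightarrow> \<delta> * x \<le> w \<Longrightarrow> w \<le> x \<Longrightarrow> A x \<le> C * A w"
proof -
  obtain D where D: "D \<ge> 1" "\<forall>x\<ge>1. \<forall>y\<ge>x. A y \<le> D * (y / x) powr (\<alpha> + 1) * A x \<and>
      A x \<le> D * (y / x) powr (1 - \<alpha>) * A y"
    using A_potter_global[OF zero_less_one] by blast
  define C where "C = D * (1 / \<delta>) powr (\<alpha> + 1)"
  have "1 \<le> (1 / \<delta>) powr (\<alpha> + 1)" using \<delta> alpha by (intro ge_one_powr_ge_zero) auto
  then have "C \<ge> 1" using D mult_mono[of 1 D 1 "(1 / \<delta>) powr (\<alpha> + 1)"] by (simp add: C_def)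
  moreover have "A x \<le> C * A w" if w: "w \<ge> 1" "\<delta> * x \<le> w" "w \<le> x" for x w
  proof -
    have "A x \<le> D * (x / w) powr (\<alpha> + 1) * A w" using D(2) w by auto
    also have "\<dots> \<le> D * (1 / \<delta>) powr (\<alpha> + 1) * A w"
      using w \<delta> D alpha by (intro mult_right_mono mult_left_mono powr_mono2) (auto simp: field_simps)
    finally show ?thesis by (simp add: C_def)
  qed
  ultimately show ?thesis using that by blast
qed

text \<open>Potter's inequality for \<open>A\<close>, inverted through the fact that A(a_n) is of
  order n. The exponent 1 / (\<alpha> - \<tau>) stands for 1 / \<alpha> up to an arbitrarily small
  loss.\<close>

lemma x_over_a_bound:
  assumes \<tau>: "0 < \<tau>" "\<tau> < \<alpha>"
  obtains K where "K \<ge> 1" "\<And>n x. n \<ge> 1 \<Longrightarrow> x \<ge> 1 \<Longrightarrow> real n \<le> A x \<Longrightarrow> x / a n \<le> K * (real n / A x) powr - (1 / (\<alpha> - \<tau>))"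
    "\<And>n x. n \<ge> 1 \<Longrightarrow> x \<ge> 1 \<Longrightarrow> real n \<ge> A x \<Longrightarrow> x / a n \<le> K"
proof -
  obtain D where D: "D \<ge> 1" "\<forall>x\<ge>1. \<forall>y\<ge>x. A y \<le> D * (y / x) powr (\<alpha> + \<tau>) * A x \<and>
      A x \<le> D * (y / x) powr (\<tau> - \<alpha>) * A y"
    using A_potter_global[OF \<tau>(1)] by blast
  obtain c C where cC: "c > 0" "C > 0" "\<And>n. n \<ge> 1 \<Longrightarrow> c * real n \<le> A (a n)" "\<And>n. n \<ge> 1 \<Longrightarrow> A (a n) \<le> C * real n"
    using A_a_bounds by blast
  define s where "s = 1 / (\<alpha> - \<tau>)"
  have s: "s > 0" using \<tau> by (simp add: s_def)
  define K where "K = max 1 ((D / c) powr s)"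
  have K: "K \<ge> 1" "(D / c) powr s \<le> K" by (auto simp: K_def)
  have gen: "x / a n \<le> max 1 ((D / c) powr s * (real n / A x) powr - s)" if n: "n \<ge> 1" "x \<ge> 1" for n x
  proof (cases "x \<le> a n")
    case False
    define q where "q = x / a n"
    have q: "q > 1" using False by (simp add: q_def)
    have "c * real n \<le> A (a n)" using cC n by auto
    also have "\<dots> \<le> D * q powr (\<tau> - \<alpha>) * A x" unfolding q_def using D(2) a_ge_1[of n] False by auto
    finally have "q powr (\<alpha> - \<tau>) \<le> (D / c) * (1 / (real n / A x))"
      using q cC n by (simp add: field_simps powr_diff)
    then have "(q powr (\<alpha> - \<tau>)) powr s \<le> ((D / c) * (1 / (real n / A x))) powr s"
      using s by (intro powr_mono2) auto
    moreover have "(q powr (\<alpha> - \<tau>)) powr s = q" using q \<tau> by (simp add: powr_powr s_def)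
    moreover have "((D / c) * (1 / (real n / A x))) powr s = (D / c) powr s * (real n / A x) powr - s"
    proof -
      have "((D / c) * (1 / (real n / A x))) powr s = (D / c) powr s * (1 / (real n / A x)) powr s"
        by (rule powr_mult)
      also have "(1 / (real n / A x)) powr s = 1 powr s / (real n / A x) powr s"
        by (rule powr_divide)
      finally show ?thesis by (simp add: powr_minus_divide)
    qed
    ultimately show ?thesis by (simp add: q_def)
  qed (simp add: max.coboundedI1)
  show ?thesis
  proof (rule that[OF K(1)])
    fix n :: nat and x :: real assume n: "n \<ge> 1" "x \<ge> 1"
    show "x / a n \<le> K * (real n / A x) powr - (1 / (\<alpha> - \<tau>))" if "real n \<le> A x"
    proof -
      have u: "real n / A x \<le> 1" "real n / A x > 0" using that n by auto
      then have "1 \<le> (real n / A x) powr - s" using s n(1) powr_mono'[of "-s" 0 "real n / A x"] by simp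
      then have "1 \<le> K * (real n / A x) powr - s" using K mult_mono[of 1 K 1 "(real n / A x) powr - s"] by simp
      moreover have "(D / c) powr s * (real n / A x) powr - s \<le> K * (real n / A x) powr - s"
        using K by (intro mult_right_mono) auto
      ultimately show ?thesis using gen[OF n] by (simp add: s_def)
    qed
    show "x / a n \<le> K" if "real n \<ge> A x"
    proof -
      have "real n / A x \<ge> 1" using that by simp
      then have "(real n / A x) powr - s \<le> 1" using s n(1) powr_mono[of "-s" 0 "real n / A x"] by simp
      then have "(D / c) powr s * (real n / A x) powr - s \<le> (D / c) powr s" by (simp add: mult_left_le)
      then show ?thesis using gen[OF n] K by linarith
    qed
  qed
qed

end

section \<open>Early times\<close>

locale weighted_walk = renewal_walk +
  fixes b :: "real \<Rightarrow> real" and \<beta> :: real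
  assumes b_bounded: "locally_bounded_pos b" and b_potter: "potter_bounds \<beta> b"
begin

definition B :: "real \<Rightarrow> real" where "B x = b (A x)"

lemma b_pos: "t \<ge> 0 \<Longrightarrow> b t > 0"
  by (rule locally_bounded_pos_pos[OF b_bounded])

lemma b_of_nat_pos [simp]: "b (real n) > 0" "b (real n) \<ge> 0"
  using b_pos[of "real n"] by auto

lemma B_pos [simp]: "B x > 0" "B x \<ge> 0" "B x \<noteq> 0"
  using b_pos[of "A x"] by (auto simp: B_def)

lemma b_potter_global:
  assumes "\<tau> > 0"
  shows "\<exists>C\<ge>1. \<forall>x\<ge>1. \<forall>y\<ge>x. b y \<le> C * (y / x) powr (\<beta> + \<tau>) * b x \<and>
    b x \<le> C * (y / x) powr (\<tau> - \<beta>) * b y"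
proof (rule potter_global[OF b_bounded b_potter assms])
  fix C assume C: "1 \<le> C"
    "\<And>x y. 1 \<le> x \<Longrightarrow> x \<le> y \<Longrightarrow> b y \<le> C * (y / x) powr (\<beta> + \<tau>) * b x"
    "\<And>x y. 1 \<le> x \<Longrightarrow> x \<le> y \<Longrightarrow> b x \<le> C * (y / x) powr (\<tau> - \<beta>) * b y"
  show ?thesis by (rule exI[of _ C]) (use C in simp)
qed

lemma B_comparable:
  assumes \<delta>: "0 < \<delta>" "\<delta> \<le> 1"
  obtains C where "C \<ge> 1" "\<And>x w. w \<ge> 1 \<Longrightarrow> \<delta> * x \<le> w \<Longrightarrow> w \<le> x \<Longrightarrow>
    B w \<le> C * B x \<and> B x \<le> C * B w \<and> A x \<le> C * A w"
proof -
  obtain D where D: "D \<ge> 1" "\<And>x w. w \<ge> 1 \<Longrightarrow> \<delta> * x \<le> w \<Longrightarrow> w \<le> x \<Longrightarrow> A x \<le> D * A w"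
    using A_comparable[OF \<delta>] by blast
  obtain E where E: "E \<ge> 1" "\<forall>x\<ge>1. \<forall>y\<ge>x. b y \<le> E * (y / x) powr (\<beta> + 1) * b x \<and>
    b x \<le> E * (y / x) powr (1 - \<beta>) * b y"
    using b_potter_global[OF zero_less_one] by blast
  define m where "m = \<bar>\<beta>\<bar> + 1"
  define C where "C = max D (E * D powr m)"
  have "C \<ge> 1" using D by (simp add: C_def)
  moreover have "B w \<le> C * B x \<and> B x \<le> C * B w \<and> A x \<le> C * A w" if w: "w \<ge> 1" "\<delta> * x \<le> w" "w \<le> x" for x w
  proof -
    define q where "q = A x / A w"
    have q: "1 \<le> q" "q \<le> D" using D(2)[OF w] A_mono[OF w(3)] by (auto simp: q_def divide_le_eq)
    have pw: "q powr e \<le> D powr m" if "e \<le> m" for e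
    proof -
      have "q powr e \<le> q powr m" using q that by (intro powr_mono) auto
      also have "\<dots> \<le> D powr m" using q by (intro powr_mono2) (auto simp: m_def)
      finally show ?thesis .
    qed
    have ED: "E * q powr e * B z \<le> C * B z" if "e \<le> m" for e z
    proof (intro mult_right_mono)
      have "E * q powr e \<le> E * D powr m" using pw[OF that] E by (intro mult_left_mono) auto
      then show "E * q powr e \<le> C" by (simp add: C_def)
    qed simp
    have e: "\<beta> + 1 \<le> m" "1 - \<beta> \<le> m" by (auto simp: m_def)
    have h: "B x \<le> E * q powr (\<beta> + 1) * B w" "B w \<le> E * q powr (1 - \<beta>) * B x"
      using E(2) A_ge_1[of w] A_mono[OF w(3)] by (auto simp: B_def q_def)
    have "B x \<le> C * B w" "B w \<le> C * B x"
      by (rule order_trans[OF h(1) ED[OF e(1)]], rule order_trans[OF h(2) ED[OF e(2)]])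
    moreover have "A x \<le> C * A w"
    proof -
      have "D * A w \<le> C * A w" by (intro mult_right_mono) (auto simp: C_def)
      then show ?thesis using D(2)[OF w] by linarith
    qed
    ultimately show ?thesis by blast
  qed
  ultimately show ?thesis using that by blast
qed

text \<open>With u = n / A(x), the quotient b(n) / a_n is of order (B(x) / x) u^(\<beta> -
  1/\<alpha>) up to small powers of u. For u >= 1 any fixed power will do, since the exponential
  bound absorbs it.\<close>

lemma b_over_a_bound:
  assumes r: "r > 1 / \<alpha> - \<beta>"
  obtains C m where "C > 0" "m \<ge> 0"
    "\<And>n x. n \<ge> 1 \<Longrightarrow> x \<ge> 1 \<Longrightarrow> real n \<le> A x \<Longrightarrow> b (real n) / a n \<le> C * (B x / x) * (real n / A x) powr - r"
    "\<And>n x. n \<ge> 1 \<Longrightarrow> x \<ge> 1 \<Longrightarrow> real n \<ge> A x \<Longrightarrow> b (real n) / a n \<le> C * (B x / x) * (real n / A x) powr m"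
proof -
  \<comment> \<open>The strict inequality for \<open>r\<close> leaves room for the losses in both
    Potter bounds.\<close>
  have "((\<lambda>\<tau>. 1 / (\<alpha> - \<tau>) - \<beta> + \<tau>) \<longlongrightarrow> 1 / (\<alpha> - 0) - \<beta> + 0) (at_right (0::real))"
    using alpha by (intro tendsto_intros) auto
  then have "eventually (\<lambda>\<tau>. 1 / (\<alpha> - \<tau>) - \<beta> + \<tau> < r) (at_right 0)"
    using r by (intro order_tendstoD) auto
  moreover have "eventually (\<lambda>\<tau>. \<tau> \<in> {0<..<\<alpha>}) (at_right 0)"
    using alpha by (intro eventually_at_right_real) auto
  ultimately have "eventually (\<lambda>\<tau>. 1 / (\<alpha> - \<tau>) - \<beta> + \<tau> < r \<and> \<tau> \<in> {0<..<\<alpha>}) (at_right 0)"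
    by (rule eventually_conj)
  then obtain \<tau> where "1 / (\<alpha> - \<tau>) - \<beta> + \<tau> < r \<and> \<tau> \<in> {0<..<\<alpha>}"
    using eventually_happens'[OF trivial_limit_at_right_real] by blast
  then have \<tau>: "0 < \<tau>" "\<tau> < \<alpha>" "1 / (\<alpha> - \<tau>) + (\<tau> - \<beta>) \<le> r" by auto
  obtain K where K: "K \<ge> 1" "\<And>n x. n \<ge> 1 \<Longrightarrow> x \<ge> 1 \<Longrightarrow> real n \<le> A x \<Longrightarrow> x / a n \<le> K * (real n / A x) powr - (1 / (\<alpha> - \<tau>))"
    "\<And>n x. n \<ge> 1 \<Longrightarrow> x \<ge> 1 \<Longrightarrow> real n \<ge> A x \<Longrightarrow> x / a n \<le> K"
    using x_over_a_bound[OF \<tau>(1,2)] by blast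
  obtain E where E: "E \<ge> 1" "\<forall>x\<ge>1. \<forall>y\<ge>x. b y \<le> E * (y / x) powr (\<beta> + \<tau>) * b x \<and>
    b x \<le> E * (y / x) powr (\<tau> - \<beta>) * b y"
    using b_potter_global[OF \<tau>(1)] by blast
  define m where "m = max 0 (\<beta> + \<tau>)"
  have EK: "E * K > 0" using E K by simp
  have 1: "b (real n) / a n \<le> (E * K) * (B x / x) * (real n / A x) powr - r"
    if n: "n \<ge> 1" "x \<ge> 1" "real n \<le> A x" for n x
  proof -
    define u where "u = real n / A x"
    have u: "0 < u" "u \<le> 1" using n by (auto simp: u_def)
    have "b (real n) \<le> E * (A x / real n) powr (\<tau> - \<beta>) * b (A x)" using E(2) n by auto
    also have "A x / real n = 1 / u" by (simp add: u_def)
    also have "(1 / u) powr (\<tau> - \<beta>) = u powr - (\<tau> - \<beta>)"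
    proof -
      have "(1 / u) powr e = u powr - e" for e using u by (simp add: powr_divide powr_minus_divide)
      then show ?thesis .
    qed
    finally have "b (real n) * (x / a n) \<le> (E * u powr - (\<tau> - \<beta>) * B x) * (K * u powr - (1 / (\<alpha> - \<tau>)))"
      using K(2)[OF n] E n by (intro mult_mono) (auto simp: u_def B_def less_imp_le[OF b_pos])
    also have "\<dots> = (E * K) * B x * u powr - (1 / (\<alpha> - \<tau>) + (\<tau> - \<beta>))"
      using u by (simp add: powr_add powr_minus powr_diff field_simps)
    also have "\<dots> \<le> (E * K) * B x * u powr - r"
      using \<tau>(3) u EK by (intro mult_left_mono powr_mono') auto
    finally show ?thesis using n by (simp add: u_def field_simps)
  qed
  have 2: "b (real n) / a n \<le> (E * K) * (B x / x) * (real n / A x) powr m"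
    if n: "n \<ge> 1" "x \<ge> 1" "real n \<ge> A x" for n x
  proof -
    define u where "u = real n / A x"
    have u: "u \<ge> 1" using n by (auto simp: u_def)
    have "b (real n) \<le> E * u powr (\<beta> + \<tau>) * B x" using E(2) n A_ge_1[of x] by (auto simp: u_def B_def)
    also have "\<dots> \<le> E * u powr m * B x"
      using E u by (intro mult_right_mono mult_left_mono powr_mono) (auto simp: m_def)
    finally have "b (real n) * (x / a n) \<le> (E * u powr m * B x) * K"
      using K(3)[OF n] E n by (intro mult_mono) auto
    then show ?thesis using n by (simp add: u_def field_simps)
  qed
  show ?thesis by (rule that[OF EK _ 1 2]) (auto simp: m_def)
qed

text \<open>The condition on \<open>m\<close> makes n^(m - r) have an exponent above -1. The
  resulting power of \<epsilon> is then positive, which is what makes early times small.\<close>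

lemma sum_b_over_a:
  assumes r: "r > 1 / \<alpha> - \<beta>" and m: "real m + 1 - r > 0"
  obtains C where "C > 0" "\<And>x \<epsilon>. x \<ge> 1 \<Longrightarrow> 0 < \<epsilon> \<Longrightarrow> \<epsilon> \<le> 1 \<Longrightarrow>
    (\<Sum>n\<in>{1..nat \<lfloor>\<epsilon> * A x\<rfloor>}. real n ^ m * (b (real n) / a n)) \<le> C * \<epsilon> powr (real m + 1 - r) * A x ^ (m + 1) * (B x / x)"
proof -
  obtain C1 m1 where C1: "C1 > 0" "m1 \<ge> 0"
    "\<And>n x. n \<ge> 1 \<Longrightarrow> x \<ge> 1 \<Longrightarrow> real n \<le> A x \<Longrightarrow> b (real n) / a n \<le> C1 * (B x / x) * (real n / A x) powr - r"
    "\<And>n x. n \<ge> 1 \<Longrightarrow> x \<ge> 1 \<Longrightarrow> real n \<ge> A x \<Longrightarrow> b (real n) / a n \<le> C1 * (B x / x) * (real n / A x) powr m1"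
    using b_over_a_bound[OF r] by blast
  have "real m - r > -1" using m by simp
  then obtain C2 where C2: "C2 > 0"
    "\<And>N. N \<ge> 0 \<Longrightarrow> (\<Sum>n\<in>{1..nat \<lfloor>N\<rfloor>}. real n powr (real m - r)) \<le> C2 * N powr (real m - r + 1)"
    using sum_powr_le by blast
  have "(\<Sum>n\<in>{1..nat \<lfloor>\<epsilon> * A x\<rfloor>}. real n ^ m * (b (real n) / a n)) \<le> (C1 * C2) * \<epsilon> powr (real m + 1 - r) * A x ^ (m + 1) * (B x / x)"
    if x: "x \<ge> 1" and \<epsilon>: "0 < \<epsilon>" "\<epsilon> \<le> 1" for x \<epsilon>
  proof -
    have "(\<Sum>n\<in>{1..nat \<lfloor>\<epsilon> * A x\<rfloor>}. real n ^ m * (b (real n) / a n))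
        \<le> (\<Sum>n\<in>{1..nat \<lfloor>\<epsilon> * A x\<rfloor>}. C1 * (B x / x) * A x powr r * real n powr (real m - r))"
    proof (rule sum_mono)
      fix n assume "n \<in> {1..nat \<lfloor>\<epsilon> * A x\<rfloor>}"
      then have n: "n \<ge> 1" "real n \<le> \<epsilon> * A x" by (simp_all only: nat_floor_ge_iff)
      have "\<epsilon> * A x \<le> 1 * A x" by (rule mult_right_mono[OF \<epsilon>(2)]) simp
      then have nA: "real n \<le> A x" using n(2) by linarith
      have "real n ^ m * (b (real n) / a n) \<le> real n ^ m * (C1 * (B x / x) * (real n / A x) powr - r)"
        using C1(3)[OF n(1) x nA] by (intro mult_left_mono) auto
      also have "\<dots> = C1 * (B x / x) * (real n powr real m * (real n / A x) powr - r)"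
        using n(1) by (simp add: powr_realpow)
      also have "real n powr real m * (real n / A x) powr - r = A x powr r * real n powr (real m - r)"
        using n(1) by (simp add: powr_divide powr_minus powr_diff field_simps)
      finally show "real n ^ m * (b (real n) / a n) \<le> C1 * (B x / x) * A x powr r * real n powr (real m - r)"
        by (simp only: mult.assoc)
    qed
    also have "\<dots> = C1 * (B x / x) * A x powr r * (\<Sum>n\<in>{1..nat \<lfloor>\<epsilon> * A x\<rfloor>}. real n powr (real m - r))"
      by (rule sum_distrib_left[symmetric])
    also have "\<dots> \<le> C1 * (B x / x) * A x powr r * (C2 * (\<epsilon> * A x) powr (real m - r + 1))"
      using C1 x \<epsilon> by (intro mult_left_mono C2) auto
    also have "(\<epsilon> * A x) powr (real m - r + 1) = \<epsilon> powr (real m + 1 - r) * A x powr (real m + 1 - r)"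
      using \<epsilon> by (simp add: powr_mult algebra_simps)
    also have "C1 * (B x / x) * A x powr r * (C2 * (\<epsilon> powr (real m + 1 - r) * A x powr (real m + 1 - r)))
      = (C1 * C2) * \<epsilon> powr (real m + 1 - r) * (A x powr r * A x powr (real m + 1 - r)) * (B x / x)"
      by (simp only: mult_ac)
    also have "A x powr r * A x powr (real m + 1 - r) = A x ^ (m + 1)"
      using powr_realpow[of "A x" "m + 1"] by (simp add: add.commute flip: powr_add)
    finally show ?thesis .
  qed
  then show ?thesis using that[of "C1 * C2"] C1 C2 by simp
qed

text \<open>The expected order of magnitude of a Green sum with weights \<open>n\<^sup>k b\<^sub>n\<close> at \<open>x\<close>.\<close>

definition scale :: "nat \<Rightarrow> nat \<Rightarrow> real" where
  "scale k x = A (real x) ^ (k + 1) * (B (real x) / real x)"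

definition partial_green :: "nat \<Rightarrow> nat \<Rightarrow> nat \<Rightarrow> real" where
  "partial_green k N x = (\<Sum>n\<in>{1..N}. real n ^ k * b (real n) * P n x)"

definition small_times_negligible :: "nat \<Rightarrow> bool" where
  "small_times_negligible k \<longleftrightarrow> (\<forall>\<kappa>>0. \<exists>\<epsilon>>0. \<epsilon> \<le> 1 \<and> (\<exists>x0. \<forall>x\<ge>x0.
     partial_green k (nat \<lfloor>\<epsilon> * A (real x)\<rfloor>) x \<le> \<kappa> * scale k x))"

text \<open>The first condition of the theorem: 1 / \<open>scale 0 x\<close> is x / (A(x) B(x)),
  asymptotic to x Fbar(x) / B(x).\<close>

definition mass_condition :: bool where
  "mass_condition \<longleftrightarrow> (\<forall>\<kappa>>0. \<exists>x0. \<forall>x\<ge>x0. p x \<le> \<kappa> * scale 0 x)"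

text \<open>The second condition of the theorem: \<open>scale 1 w\<close> is A(w)^2 B(w) / w,
  asymptotic to B(w) / (w Fbar(w)^2). The sum grows with \<delta>, so one \<delta> for each \<kappa>
  replaces the limit of the upper limits.\<close>

definition sum_condition :: bool where
  "sum_condition \<longleftrightarrow> (\<forall>\<kappa>>0. \<exists>\<delta>>0. \<exists>x0. \<forall>x\<ge>x0.
     (\<Sum>w\<in>{1..nat \<lfloor>\<delta> * real x\<rfloor>}. p (x - w) * scale 1 w) \<le> \<kappa> * scale 0 x)"

lemma scale_nonneg [simp]: "scale k x \<ge> 0"
  by (simp add: scale_def)

lemma scale_pos: "x \<ge> 1 \<Longrightarrow> scale k x > 0"
  by (simp add: scale_def)

lemma scale_0_le: "scale 0 x \<le> scale k x"
  unfolding scale_def by (intro mult_right_mono power_increasing A_ge_1) auto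

lemma scale_Suc: "scale (Suc k) x = A (real x) * scale k x"
  by (simp add: scale_def)

lemma scale_1_eq: "scale (Suc k) x = A (real x) ^ k * scale 1 x"
  by (simp add: scale_def power_add)

lemma weight_nonneg: "real n ^ k * b (real n) * P n x \<ge> 0"
  by (intro mult_nonneg_nonneg P_nonneg) auto

lemma partial_green_mono: "M \<le> N \<Longrightarrow> partial_green k M x \<le> partial_green k N x"
  unfolding partial_green_def by (intro sum_mono2) (auto intro: weight_nonneg)

lemma partial_green_nonneg: "partial_green k N x \<ge> 0"
  unfolding partial_green_def by (intro sum_nonneg weight_nonneg)

text \<open>For n <= A(x) the bound holds because R >= r; for larger n the exponential decay beats
  every power of n / A(x). Thus one power serves all times, and R >= 2 makes it summable.\<close>

lemma weight_tail_bound: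
  obtains C R where "C > 0" "R \<ge> 2"
    "\<And>n x. n \<ge> 1 \<Longrightarrow> x \<ge> 1 \<Longrightarrow> real n ^ k * b (real n) * P n x
       \<le> C * A (real x) ^ k * (B (real x) / real x) * (A (real x) / real n) ^ R"
proof -
  define r where "r = \<bar>1 / \<alpha> - \<beta>\<bar> + 1"
  have r: "r > 1 / \<alpha> - \<beta>" "r > 0" by (auto simp: r_def)
  obtain C1 m where C1: "C1 > 0" "m \<ge> 0"
    "\<And>n x. n \<ge> 1 \<Longrightarrow> x \<ge> 1 \<Longrightarrow> real n \<le> A x \<Longrightarrow> b (real n) / a n \<le> C1 * (B x / x) * (real n / A x) powr - r"
    "\<And>n x. n \<ge> 1 \<Longrightarrow> x \<ge> 1 \<Longrightarrow> real n \<ge> A x \<Longrightarrow> b (real n) / a n \<le> C1 * (B x / x) * (real n / A x) powr m"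
    using b_over_a_bound[OF r(1)] by blast
  obtain C2 c where C2: "C2 > 0" "c > 0" "\<And>n x. n \<ge> 1 \<Longrightarrow> P n x \<le> C2 / a n * exp (- c * (real n / A (real x)))"
    using P_exp_bound by blast
  define R where "R = max 2 (nat \<lceil>r\<rceil>)"
  have R: "R \<ge> 2" "r \<le> real R" unfolding R_def by linarith+
  have "0 \<le> real k + m + real R" using C1 by simp
  then obtain K where K: "K > 0" "\<And>u. u > 0 \<Longrightarrow> u powr (real k + m + real R) * exp (- c * u) \<le> K"
    using powr_exp_bounded[OF C2(2)] by blast
  define C where "C = C1 * C2 * max 1 K"
  have C: "C > 0" using C1 C2 by (simp add: C_def)
  have "real n ^ k * b (real n) * P n x \<le> C * A x ^ k * (B x / x) * (A x / real n) ^ R"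
    if n: "n \<ge> 1" "x \<ge> 1" for n x :: nat
  proof -
    define u where "u = real n / A x"
    have u: "u > 0" using n by (simp add: u_def)
    have x1: "real x \<ge> 1" using n by simp
    obtain f where f: "b (real n) / a n \<le> C1 * (B x / x) * f" "u ^ k * f * exp (- c * u) \<le> max 1 K * (1 / u) ^ R"
    proof (cases "real n \<le> A x")
      case True
      have u1: "u \<le> 1" using True by (simp add: u_def)
      have "u ^ k * u powr - r * exp (- c * u) \<le> 1 * u powr - real R * 1"
        using u u1 C2 R by (intro mult_mono power_le_one powr_mono') auto
      also have "\<dots> = (1 / u) ^ R" using u by (simp add: powr_minus_divide powr_realpow power_one_over)
      also have "\<dots> \<le> max 1 K * (1 / u) ^ R" using u mult_right_mono[of 1 "max 1 K" "(1 / u) ^ R"] by simp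
      finally show ?thesis using that[of "u powr - r"] C1(3)[OF n(1) x1 True] by (simp add: u_def)
    next
      case False
      have "(u ^ k * u powr m * exp (- c * u)) * u ^ R = u powr (real k + m + real R) * exp (- c * u)"
        using u by (simp add: powr_add powr_realpow)
      also have "\<dots> \<le> K" using K u by auto
      finally have "u ^ k * u powr m * exp (- c * u) \<le> K / u ^ R" using u by (simp add: pos_le_divide_eq)
      also have "\<dots> \<le> max 1 K * (1 / u) ^ R"
        using u by (simp add: power_one_over divide_right_mono)
      finally show ?thesis using that[of "u powr m"] C1(4)[OF n(1) x1] False by (simp add: u_def)
    qed
    have "real n ^ k * b (real n) * P n x \<le> real n ^ k * b (real n) * (C2 / a n * exp (- c * u))"
      unfolding u_def using C2(3)[OF n(1)] by (intro mult_left_mono) auto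
    also have "\<dots> = C2 * real n ^ k * exp (- c * u) * (b (real n) / a n)" by simp
    also have "\<dots> \<le> C2 * real n ^ k * exp (- c * u) * (C1 * (B x / x) * f)"
      using f(1) C2 by (intro mult_left_mono) auto
    also have "\<dots> = (C1 * C2) * A x ^ k * (B x / x) * (u ^ k * f * exp (- c * u))"
    proof -
      have "real n ^ k = A x ^ k * u ^ k" by (simp add: u_def power_divide)
      then show ?thesis by (simp only: mult_ac)
    qed
    also have "\<dots> \<le> (C1 * C2) * A x ^ k * (B x / x) * (max 1 K * (1 / u) ^ R)"
      using f(2) C1 C2 by (intro mult_left_mono) auto
    also have "\<dots> = C * A x ^ k * (B x / x) * (A x / real n) ^ R" by (simp add: C_def u_def)
    finally show ?thesis .
  qed
  then show ?thesis using that C R(1) by blast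
qed

text \<open>\<Lambda> may be small: for \<Lambda> = 1 / (2 A(x)) the restriction on n is void, and
  the bound covers the whole sum for a given x.\<close>

lemma partial_green_tail:
  obtains C R where "C > 0" "R \<ge> 2"
    "\<And>x \<Lambda> N. x \<ge> 1 \<Longrightarrow> \<Lambda> > 0 \<Longrightarrow> (\<Sum>n\<in>{n\<in>{1..N}. real n > \<Lambda> * A (real x)}. real n ^ k * b (real n) * P n x)
       \<le> C * scale k x / \<Lambda> ^ (R - 1)"
proof -
  obtain C R where C: "C > 0" and R: "R \<ge> 2"
    and bd: "\<And>n x. n \<ge> 1 \<Longrightarrow> x \<ge> 1 \<Longrightarrow> real n ^ k * b (real n) * P n x
       \<le> C * A (real x) ^ k * (B (real x) / real x) * (A (real x) / real n) ^ R"
    using weight_tail_bound[of k] by blast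
  have "(\<Sum>n\<in>{n\<in>{1..N}. real n > \<Lambda> * A (real x)}. real n ^ k * b (real n) * P n x)
       \<le> (2 * C) * scale k x / \<Lambda> ^ (R - 1)" if x: "x \<ge> 1" and \<Lambda>: "\<Lambda> > 0" for x \<Lambda> N
  proof -
    let ?S = "{n\<in>{1..N}. real n > \<Lambda> * A (real x)}"
    have "(\<Sum>n\<in>?S. real n ^ k * b (real n) * P n x)
        \<le> (\<Sum>n\<in>?S. C * A x ^ k * (B x / x) * A x ^ R * (1 / real n ^ R))"
    proof (rule sum_mono)
      fix n assume "n \<in> ?S"
      then show "real n ^ k * b (real n) * P n x \<le> C * A x ^ k * (B x / x) * A x ^ R * (1 / real n ^ R)"
        using bd[of n x] x by (simp add: power_divide)
    qed
    also have "\<dots> = C * A x ^ k * (B x / x) * A x ^ R * (\<Sum>n\<in>?S. 1 / real n ^ R)"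
      by (rule sum_distrib_left[symmetric])
    also have "\<dots> \<le> C * A x ^ k * (B x / x) * A x ^ R * (2 / (\<Lambda> * A x) ^ (R - 1))"
      using C \<Lambda> by (intro mult_left_mono sum_inverse_power_tail R) auto
    also have "A x ^ R = A x * A x ^ (R - 1)" using R by (cases R) auto
    also have "C * A x ^ k * (B x / x) * (A x * A x ^ (R - 1)) * (2 / (\<Lambda> * A x) ^ (R - 1))
        = (2 * C) * scale k x / \<Lambda> ^ (R - 1)"
      by (simp add: scale_def power_mult_distrib)
    finally show ?thesis .
  qed
  then show ?thesis using that[of "2 * C" R] C R by simp
qed

lemma partial_green_split:
  "partial_green k N x \<le> partial_green k (nat \<lfloor>\<Lambda> * A (real x)\<rfloor>) x
     + (\<Sum>n\<in>{n\<in>{1..N}. real n > \<Lambda> * A (real x)}. real n ^ k * b (real n) * P n x)"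
proof -
  have sub: "{1..N} \<subseteq> {1..nat \<lfloor>\<Lambda> * A (real x)\<rfloor>} \<union> {n\<in>{1..N}. real n > \<Lambda> * A (real x)}"
  proof
    fix n assume "n \<in> {1..N}"
    then show "n \<in> {1..nat \<lfloor>\<Lambda> * A (real x)\<rfloor>} \<union> {n\<in>{1..N}. real n > \<Lambda> * A (real x)}"
      using nat_floor_ge_iff[of n "\<Lambda> * A (real x)"] by (cases "real n > \<Lambda> * A (real x)") auto
  qed
  have "partial_green k N x \<le> (\<Sum>n\<in>{1..nat \<lfloor>\<Lambda> * A (real x)\<rfloor>} \<union> {n\<in>{1..N}. real n > \<Lambda> * A (real x)}. real n ^ k * b (real n) * P n x)"
    unfolding partial_green_def using sub by (intro sum_mono2) (auto intro: weight_nonneg)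
  also have "\<dots> \<le> partial_green k (nat \<lfloor>\<Lambda> * A (real x)\<rfloor>) x
     + (\<Sum>n\<in>{n\<in>{1..N}. real n > \<Lambda> * A (real x)}. real n ^ k * b (real n) * P n x)"
    (is "?U \<le> _")
  proof -
    let ?f = "\<lambda>n. real n ^ k * b (real n) * P n x"
    let ?S = "{1..nat \<lfloor>\<Lambda> * A (real x)\<rfloor>}" and ?T = "{n\<in>{1..N}. real n > \<Lambda> * A (real x)}"
    have "?U + sum ?f (?S \<inter> ?T) = sum ?f ?S + sum ?f ?T" by (rule sum.union_inter) auto
    moreover have "sum ?f (?S \<inter> ?T) \<ge> 0" by (intro sum_nonneg weight_nonneg)
    ultimately show ?thesis unfolding partial_green_def by linarith
  qed
  finally show ?thesis .
qed

lemma small_times_negligible_imp_bounded: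
  assumes "small_times_negligible k"
  obtains C where "C > 0" "\<And>x N. x \<ge> 1 \<Longrightarrow> partial_green k N x \<le> C * scale k x"
proof -
  obtain C R where C: "C > 0" and "R \<ge> 2"
    and tl: "\<And>x \<Lambda> N. x \<ge> 1 \<Longrightarrow> \<Lambda> > 0 \<Longrightarrow> (\<Sum>n\<in>{n\<in>{1..N}. real n > \<Lambda> * A (real x)}. real n ^ k * b (real n) * P n x)
       \<le> C * scale k x / \<Lambda> ^ (R - 1)"
    using partial_green_tail[of k] by blast
  obtain \<epsilon> x0 where \<epsilon>: "\<epsilon> > 0" and small: "\<And>x. x \<ge> x0 \<Longrightarrow> partial_green k (nat \<lfloor>\<epsilon> * A (real x)\<rfloor>) x \<le> 1 * scale k x"
    using assms unfolding small_times_negligible_def by (meson zero_less_one)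
  define D where "D = max (1 + C / \<epsilon> ^ (R - 1)) (C * (2 * A (real x0)) ^ (R - 1))"
  have "D > 0" using C \<epsilon> by (simp add: D_def less_max_iff_disj add_pos_pos)
  moreover have "partial_green k N x \<le> D * scale k x" if x: "x \<ge> 1" for x N
  proof (cases "x \<ge> x0")
    case True
    have "partial_green k N x \<le> 1 * scale k x + C * scale k x / \<epsilon> ^ (R - 1)"
      using partial_green_split[of k N x \<epsilon>] small[OF True] tl[OF x \<epsilon>, of N] by linarith
    also have "\<dots> = (1 + C / \<epsilon> ^ (R - 1)) * scale k x" by (simp add: distrib_right)
    also have "\<dots> \<le> D * scale k x" by (intro mult_right_mono) (auto simp: D_def)
    finally show ?thesis .
  next
    case False
    \<comment> \<open>For the finitely many x below \<open>x0\<close> every time n >= 1 counts as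
      late.\<close>
    define \<Lambda> where "\<Lambda> = 1 / (2 * A (real x))"
    have \<Lambda>: "\<Lambda> > 0" "\<Lambda> * A (real x) = 1 / 2" by (auto simp: \<Lambda>_def)
    have "partial_green k (nat \<lfloor>\<Lambda> * A (real x)\<rfloor>) x = 0" unfolding \<Lambda>(2) by (simp add: partial_green_def)
    then have "partial_green k N x \<le> C * scale k x / \<Lambda> ^ (R - 1)"
      using partial_green_split[of k N x \<Lambda>] tl[OF x \<Lambda>(1), of N] by linarith
    also have "\<dots> = C * (2 * A (real x)) ^ (R - 1) * scale k x" by (simp add: \<Lambda>_def power_one_over)
    also have "\<dots> \<le> C * (2 * A (real x0)) ^ (R - 1) * scale k x"
      using False C by (intro mult_right_mono mult_left_mono power_mono A_mono) auto
    also have "\<dots> \<le> D * scale k x" by (intro mult_right_mono) (auto simp: D_def)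
    finally show ?thesis .
  qed
  ultimately show ?thesis using that by blast
qed

lemma weight_shift:
  obtains C where "C \<ge> 1" "\<And>n. n \<ge> 2 \<Longrightarrow> real n ^ k * b (real n) \<le> C * (real (n - 1) ^ k * b (real (n - 1)))"
proof -
  obtain E where E: "E \<ge> 1" "\<forall>x\<ge>1. \<forall>y\<ge>x. b y \<le> E * (y / x) powr (\<beta> + 1) * b x \<and>
    b x \<le> E * (y / x) powr (1 - \<beta>) * b y"
    using b_potter_global[OF zero_less_one] by blast
  define C where "C = 2 ^ k * (E * 2 powr \<bar>\<beta> + 1\<bar>)"
  have g: "2 powr \<bar>\<beta> + 1\<bar> \<ge> (1::real)" by (intro ge_one_powr_ge_zero) auto
  have "1 \<le> E * 2 powr \<bar>\<beta> + 1\<bar>" using E g mult_mono[of 1 E 1 "2 powr \<bar>\<beta> + 1\<bar>"] by simp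
  then have "C \<ge> 1" using mult_mono[of 1 "2 ^ k" 1 "E * 2 powr \<bar>\<beta> + 1\<bar>"] by (simp add: C_def)
  moreover have "real n ^ k * b (real n) \<le> C * (real (n - 1) ^ k * b (real (n - 1)))" if n: "n \<ge> 2" for n
  proof -
    define t where "t = real (n - 1)"
    have t: "t \<ge> 1" "real n \<ge> t" "real n \<le> 2 * t" using n by (auto simp: t_def)
    have "b (real n) \<le> E * (real n / t) powr (\<beta> + 1) * b t" using E(2) t by blast
    also have "(real n / t) powr (\<beta> + 1) \<le> 2 powr \<bar>\<beta> + 1\<bar>"
    proof -
      have "(real n / t) powr (\<beta> + 1) \<le> (real n / t) powr \<bar>\<beta> + 1\<bar>" using t by (intro powr_mono) auto
      also have "\<dots> \<le> 2 powr \<bar>\<beta> + 1\<bar>" using t by (intro powr_mono2) (auto simp: divide_le_eq)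
      finally show ?thesis .
    qed
    finally have "b (real n) \<le> E * 2 powr \<bar>\<beta> + 1\<bar> * b t"
      using E b_pos[of t] t by (simp add: mult_left_mono mult_right_mono)
    moreover have "real n ^ k \<le> 2 ^ k * t ^ k" using t power_mono[of "real n" "2 * t" k] by (simp add: power_mult_distrib)
    ultimately have "real n ^ k * b (real n) \<le> (2 ^ k * t ^ k) * (E * 2 powr \<bar>\<beta> + 1\<bar> * b t)"
      using t by (intro mult_mono) auto
    then show ?thesis by (simp add: C_def t_def mult_ac)
  qed
  ultimately show ?thesis using that by blast
qed

text \<open>After removal of the large jump n - 1 steps remain, while the weight still refers to n.
  For w >= 1 the time n = 1 contributes nothing.\<close>

lemma shifted_green_le:
  assumes k: "k \<ge> 1"
  obtains C where "C \<ge> 1" "\<And>M w. w \<ge> 1 \<Longrightarrow> (\<Sum>n\<in>{1..M}. real n ^ k * b (real n) * P (n - 1) w) \<le> C * partial_green k M w"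
proof -
  obtain C where C: "C \<ge> 1" "\<And>n. n \<ge> 2 \<Longrightarrow> real n ^ k * b (real n) \<le> C * (real (n - 1) ^ k * b (real (n - 1)))"
    using weight_shift[of k] by blast
  have "(\<Sum>n\<in>{1..M}. real n ^ k * b (real n) * P (n - 1) w) \<le> C * partial_green k M w" if w: "w \<ge> 1" for M w
  proof -
    define f where "f = (\<lambda>n. real n ^ k * b (real n) * P n w)"
    have f: "f n \<ge> 0" for n unfolding f_def by (rule weight_nonneg)
    have "(\<Sum>n\<in>{1..M}. real n ^ k * b (real n) * P (n - 1) w) \<le> (\<Sum>n\<in>{1..M}. C * f (n - 1))"
    proof (rule sum_mono)
      fix n assume n: "n \<in> {1..M}"
      show "real n ^ k * b (real n) * P (n - 1) w \<le> C * f (n - 1)"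
      proof (cases "n = 1")
        case True
        then show ?thesis using w f[of 0] C by (simp add: conv_pow_0)
      next
        case False
        then have "real n ^ k * b (real n) * P (n - 1) w \<le> C * (real (n - 1) ^ k * b (real (n - 1))) * P (n - 1) w"
          using n by (intro mult_right_mono C P_nonneg) auto
        then show ?thesis by (simp add: f_def mult_ac)
      qed
    qed
    also have "\<dots> = C * (\<Sum>n\<in>{1..M}. f (n - 1))" by (rule sum_distrib_left[symmetric])
    also have "(\<Sum>n\<in>{1..M}. f (n - 1)) = (\<Sum>n<M. f n)"
      by (rule sum.reindex_bij_witness[of _ Suc "\<lambda>n. n - 1"]) auto
    also have "\<dots> \<le> (\<Sum>n\<in>insert 0 {1..M}. f n)" using f by (intro sum_mono2) auto
    also have "\<dots> = (\<Sum>n\<in>{1..M}. f n)" using k by (simp add: f_def)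
    finally show ?thesis using C by (simp add: partial_green_def f_def mult_left_mono)
  qed
  then show ?thesis using that C(1) by blast
qed

text \<open>To be at 0 after n - 1 steps, all of them must vanish, and p(0) < 1.\<close>

lemma shifted_green_at_0:
  obtains C where "C > 0" "\<And>M. (\<Sum>n\<in>{1..M}. real n ^ k * b (real n) * P (n - 1) 0) \<le> C"
proof -
  obtain E where E: "E \<ge> 1" "\<forall>x\<ge>1. \<forall>y\<ge>x. b y \<le> E * (y / x) powr (\<beta> + 1) * b x \<and>
    b x \<le> E * (y / x) powr (1 - \<beta>) * b y"
    using b_potter_global[OF zero_less_one] by blast
  define m where "m = real k + \<bar>\<beta> + 1\<bar> + 2"
  define q where "q = p 0"
  have q: "0 \<le> q" "q < 1"
  proof -
    obtain c C where "c > 0" "\<And>k. c / A (real k) \<le> tail k" "\<And>k. tail k \<le> C / A (real k)" using tail_bounds by blast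
    then have "tail 0 > 0" by (metis A_pos(1) divide_pos_pos less_le_trans)
    then show "q < 1" "0 \<le> q" using p_nonneg by (simp_all add: tail_def q_def)
  qed
  define c where "c = 1 - q"
  have c: "c > 0" using q by (simp add: c_def)
  have "0 \<le> m" by (simp add: m_def)
  then obtain K where K: "K > 0" "\<And>u. u > 0 \<Longrightarrow> u powr m * exp (- c * u) \<le> K"
    using powr_exp_bounded[OF c] by blast
  define L where "L = E * b 1 * K * exp c"
  have b1: "b 1 > 0" using b_pos[of 1] by simp
  have L: "L > 0" using E K b1 by (simp add: L_def)
  have term_le: "real n ^ k * b (real n) * P (n - 1) 0 \<le> L * (1 / real n ^ 2)" if n: "n \<ge> 1" for n
  proof -
    have "P (n - 1) 0 \<le> q ^ (n - 1)" using conv_pow_le_sum[where p = p and n = "n - 1" and k = 0, OF p_nonneg] by (simp add: q_def)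
    also have "\<dots> \<le> exp (- c) ^ (n - 1)"
      using exp_ge_add_one_self[of "- c"] q by (intro power_mono) (auto simp: c_def)
    also have "\<dots> = exp c * exp (- c * real n)"
      using n by (simp add: of_nat_diff algebra_simps flip: exp_of_nat_mult exp_add)
    finally have P0: "P (n - 1) 0 \<le> exp c * exp (- c * real n)" .
    have "(1::real) \<le> 1" "1 \<le> real n" using n by auto
    then have "b (real n) \<le> E * (real n / 1) powr (\<beta> + 1) * b 1" using E(2) by blast
    also have "\<dots> \<le> E * real n powr \<bar>\<beta> + 1\<bar> * b 1"
      using E n b1 by (intro mult_right_mono mult_left_mono) (auto intro!: powr_mono)
    finally have "real n ^ k * b (real n) * P (n - 1) 0 \<le> real n ^ k * (E * real n powr \<bar>\<beta> + 1\<bar> * b 1) * (exp c * exp (- c * real n))"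
      using P0 by (intro mult_mono mult_left_mono) (auto intro!: P_nonneg mult_nonneg_nonneg simp: E b1 less_imp_le order_trans[OF zero_le_one E(1)])
    also have "\<dots> = E * b 1 * exp c * (real n powr m * exp (- c * real n)) / real n ^ 2"
      using n by (simp add: m_def powr_add powr_realpow)
    also have "\<dots> \<le> E * b 1 * exp c * K / real n ^ 2"
      using K(2)[of "real n"] n E b1 by (intro divide_right_mono mult_left_mono) auto
    finally show ?thesis by (simp add: L_def mult_ac)
  qed
  have "(\<Sum>n\<in>{1..M}. real n ^ k * b (real n) * P (n - 1) 0) \<le> 4 * L" for M
  proof -
    have "(\<Sum>n\<in>{1..M}. real n ^ k * b (real n) * P (n - 1) 0) \<le> (\<Sum>n\<in>{1..M}. L * (1 / real n ^ 2))"
      using term_le by (intro sum_mono) auto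
    also have "\<dots> = L * (\<Sum>n\<in>{n\<in>{1..M}. real n > 1 / 2}. 1 / real n ^ 2)"
      by (simp add: sum_distrib_left) (rule sum.cong, auto)
    also have "\<dots> \<le> L * (2 / (1 / 2) ^ (2 - 1))"
      using L by (intro mult_left_mono sum_inverse_power_tail) auto
    finally show ?thesis by simp
  qed
  then show ?thesis using that[of "4 * L"] L by simp
qed

text \<open>The sum is at most the probability that one step exceeds about x / (2J).\<close>

lemma jump_mass:
  assumes J: "J \<ge> 1"
  obtains C where "C > 0" "\<And>x. x \<ge> 2 * J \<Longrightarrow> (\<Sum>w<x - x div (2 * J). p (x - w)) \<le> C / A (real x)"
proof -
  obtain c0 C0 where c0: "c0 > 0" "\<And>k. c0 / A (real k) \<le> tail k" "\<And>k. tail k \<le> C0 / A (real k)"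
    using tail_bounds by blast
  have C0: "C0 > 0"
  proof -
    have "c0 / A 0 \<le> C0 / A 0" using c0(2)[of 0] c0(3)[of 0] by simp
    then show ?thesis using c0(1) by (simp add: divide_le_cancel)
  qed
  have d: "0 < 1 / (4 * real J)" "1 / (4 * real J) \<le> 1" using J by auto
  obtain D where D: "D \<ge> 1" "\<And>x w. w \<ge> 1 \<Longrightarrow> 1 / (4 * real J) * x \<le> w \<Longrightarrow> w \<le> x \<Longrightarrow> A x \<le> D * A w"
    using A_comparable[OF d] by blast
  have "(\<Sum>w<x - x div (2 * J). p (x - w)) \<le> C0 * D / A (real x)" if x: "x \<ge> 2 * J" for x
  proof -
    define Y where "Y = x div (2 * J)"
    have Y: "Y \<ge> 1" using x J by (simp add: Y_def Suc_le_eq div_greater_zero_iff)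
    have "2 * J * Y + x mod (2 * J) = x" unfolding Y_def by (rule mult_div_mod_eq)
    moreover have "x mod (2 * J) < 2 * J" using J by simp
    ultimately have Yx: "2 * (J * Y) \<le> x" "x < 2 * (J * Y) + 2 * J" by (simp_all add: mult.assoc)
    have JY: "J \<le> J * Y" "Y \<le> J * Y" using Y J by simp_all
    have xY: "x \<le> 4 * (J * Y)" and Yle: "Y \<le> x" using Yx JY Y by linarith+
    have "real x \<le> real (4 * (J * Y))" using xY by (simp only: of_nat_le_iff)
    then have "1 / (4 * real J) * real x \<le> real Y" using J by (simp add: divide_le_eq mult_ac)
    then have AY: "A x \<le> D * A Y" using D(2)[of "real Y" "real x"] Y Yle by simp
    have "(\<Sum>w<x - Y. p (x - w)) = (\<Sum>i\<in>{Y<..x}. p i)"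
      using Yle by (intro sum.reindex_bij_witness[of _ "\<lambda>w. x - w" "\<lambda>i. x - i"]) auto
    also have "\<dots> \<le> tail Y" using tail_diff[OF Yle] tail_nonneg[of x] by simp
    also have "\<dots> \<le> C0 / A Y" by (rule c0)
    also have "\<dots> \<le> C0 * D / A x"
      using mult_left_mono[OF AY, of C0] C0 by (simp add: field_simps)
    finally show ?thesis by (simp add: Y_def)
  qed
  then show ?thesis using that[of "C0 * D"] C0 D by simp
qed

lemma big_jump_bound:
  assumes J: "J \<ge> 1"
  obtains C c where "C > 0" "c > 0"
    "\<And>x n. x \<ge> 2 * J \<Longrightarrow> n \<ge> 1 \<Longrightarrow> real n \<le> c * A (real x) \<Longrightarrow>
       P n x \<le> C / a n * (real n / A (real x)) ^ J + real n * (\<Sum>w<x - x div (2 * J). p (x - w) * P (n - 1) w)"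
proof -
  obtain C c where C: "C > 0" and c: "c > 0"
    and bd: "\<And>x n. x \<ge> 2 * J \<Longrightarrow> n \<ge> 1 \<Longrightarrow> real n \<le> c * A (real x) \<Longrightarrow>
       conv_pow (truncate_at (x div (2 * J)) p) n x \<le> C / a n * (real n / A (real x)) ^ J"
    using truncated_local_bound[OF J] by blast
  show ?thesis
  proof (rule that[OF C c])
    fix x n :: nat assume *: "x \<ge> 2 * J" "n \<ge> 1" "real n \<le> c * A (real x)"
    have "P n x \<le> conv_pow (truncate_at (x div (2 * J)) p) n x
        + real n * (\<Sum>w<x - x div (2 * J). p (x - w) * P (n - 1) w)"
      by (intro conv_pow_big_jump_upper p_nonneg) simp
    with bd[OF *] show "P n x \<le> C / a n * (real n / A (real x)) ^ J + real n * (\<Sum>w<x - x div (2 * J). p (x - w) * P (n - 1) w)"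
      by linarith
  qed
qed

text \<open>The uniform bound for the other n - 1 steps gives P(S_n = x) at most of order n / (a_n
  A(x)). The sum of n^(K+1) b(n) / a_n over early times is then small under the condition on
  \<open>K\<close>, which for K = 0 reads \<alpha>(2 + \<beta>) > 1.\<close>

lemma small_times_negligible_base:
  assumes K: "real K + 2 > 1 / \<alpha> - \<beta>"
  shows "small_times_negligible K"
proof -
  obtain r where r: "r > 1 / \<alpha> - \<beta>" "real K + 2 - r > 0" using dense[OF K] by auto
  have r': "real (K + 1) + 1 - r > 0" using r by simp
  obtain Cs where Cs: "Cs > 0" "\<And>x \<epsilon>. x \<ge> 1 \<Longrightarrow> 0 < \<epsilon> \<Longrightarrow> \<epsilon> \<le> 1 \<Longrightarrow>
    (\<Sum>n\<in>{1..nat \<lfloor>\<epsilon> * A x\<rfloor>}. real n ^ (K + 1) * (b (real n) / a n)) \<le> Cs * \<epsilon> powr (real (K + 1) + 1 - r) * A x ^ (K + 1 + 1) * (B x / x)"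
    using sum_b_over_a[OF r(1) r'] by blast
  define e where "e = real (K + 1) + 1 - r"
  have e: "e > 0" using r' by (simp add: e_def)
  \<comment> \<open>J = 1 suffices: the part without a large jump is then already of order n / (a_n
    A(x)).\<close>
  have one: "(1::nat) \<le> 1" by simp
  obtain C0 c0 where C0: "C0 > 0" "c0 > 0"
    "\<And>x n. x \<ge> 2 * 1 \<Longrightarrow> n \<ge> 1 \<Longrightarrow> real n \<le> c0 * A (real x) \<Longrightarrow>
       P n x \<le> C0 / a n * (real n / A (real x)) ^ 1 + real n * (\<Sum>w<x - x div (2 * 1). p (x - w) * P (n - 1) w)"
    using big_jump_bound[OF one] by blast
  obtain Cj where Cj: "Cj > 0" "\<And>x. x \<ge> 2 * 1 \<Longrightarrow> (\<Sum>w<x - x div (2 * 1). p (x - w)) \<le> Cj / A (real x)"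
    using jump_mass[OF one] by blast
  obtain C1 where C1: "C1 > 0" "\<And>n z. n \<ge> 1 \<Longrightarrow> P n z \<le> C1 / a n" using P_uniform_bound by blast
  obtain C2 where C2: "C2 > 0" "\<And>m n. m \<ge> 1 \<Longrightarrow> n \<le> 3 * m \<Longrightarrow> a n \<le> C2 * a m" using a_doubling by blast
  define D where "D = max (C1 * C2) (a 1)"
  have D: "D > 0" "C1 * C2 \<le> D" "a 1 \<le> D" using C1 C2 by (auto simp: D_def less_max_iff_disj)
  have sup: "P (n - 1) w \<le> D / a n" if n: "n \<ge> 1" for n w
  proof (cases "n = 1")
    case True
    have "1 \<le> D / a n" unfolding True using D by (simp add: le_divide_eq)
    then show ?thesis by (rule order_trans[OF P_le_1])
  next
    case False
    then have "P (n - 1) w \<le> C1 / a (n - 1)" using n by (intro C1) auto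
    also have "\<dots> \<le> C1 * C2 / a n"
      using C2(2)[of "n - 1" n] n False C1 by (simp add: field_simps)
    also have "\<dots> \<le> D / a n" using D by (intro divide_right_mono) auto
    finally show ?thesis .
  qed
  define L where "L = (C0 + D * Cj) * Cs"
  have L: "L > 0" unfolding L_def using C0 D Cj Cs by (intro mult_pos_pos add_pos_pos) auto
  show ?thesis
    unfolding small_times_negligible_def
  proof (intro allI impI)
    fix \<kappa> :: real assume \<kappa>: "\<kappa> > 0"
    define \<epsilon> where "\<epsilon> = min (min 1 c0) ((\<kappa> / L) powr (1 / e))"
    have \<epsilon>: "\<epsilon> > 0" "\<epsilon> \<le> 1" "\<epsilon> \<le> c0" "\<epsilon> \<le> (\<kappa> / L) powr (1 / e)"
      using C0 \<kappa> L by (auto simp: \<epsilon>_def)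
    have "\<epsilon> powr e \<le> ((\<kappa> / L) powr (1 / e)) powr e" using \<epsilon> e by (intro powr_mono2) auto
    also have "\<dots> = \<kappa> / L" using e \<kappa> L by (simp add: powr_powr)
    finally have L\<epsilon>: "L * \<epsilon> powr e \<le> \<kappa>" using L by (simp add: pos_le_divide_eq mult.commute)
    have "partial_green K (nat \<lfloor>\<epsilon> * A (real x)\<rfloor>) x \<le> \<kappa> * scale K x" if x: "x \<ge> 2" for x
    proof -
      have "partial_green K (nat \<lfloor>\<epsilon> * A (real x)\<rfloor>) x
          \<le> (\<Sum>n\<in>{1..nat \<lfloor>\<epsilon> * A (real x)\<rfloor>}. (C0 + D * Cj) / A x * (real n ^ (K + 1) * (b (real n) / a n)))"
        unfolding partial_green_def
      proof (rule sum_mono)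
        fix n assume "n \<in> {1..nat \<lfloor>\<epsilon> * A (real x)\<rfloor>}"
        then have n: "n \<ge> 1" "real n \<le> \<epsilon> * A x" by (simp_all only: nat_floor_ge_iff)
        have "\<epsilon> * A x \<le> c0 * A x" using \<epsilon> by (intro mult_right_mono) auto
        then have nc: "real n \<le> c0 * A x" using n by linarith
        have "(\<Sum>w<x - x div (2 * 1). p (x - w) * P (n - 1) w) \<le> (\<Sum>w<x - x div (2 * 1). p (x - w) * (D / a n))"
          using sup n by (intro sum_mono mult_left_mono p_nonneg) auto
        also have "\<dots> = (\<Sum>w<x - x div (2 * 1). p (x - w)) * (D / a n)" by (rule sum_distrib_right[symmetric])
        also have "\<dots> \<le> (Cj / A x) * (D / a n)" using Cj(2)[of x] x D by (intro mult_right_mono) auto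
        finally have "real n * (\<Sum>w<x - x div (2 * 1). p (x - w) * P (n - 1) w) \<le> real n * ((Cj / A x) * (D / a n))"
          by (rule mult_left_mono) simp
        moreover have "P n x \<le> C0 / a n * (real n / A x) ^ 1 + real n * (\<Sum>w<x - x div (2 * 1). p (x - w) * P (n - 1) w)"
          by (intro C0(3)) (use x n nc in auto)
        ultimately have "P n x \<le> C0 / a n * (real n / A x) ^ 1 + real n * ((Cj / A x) * (D / a n))"
          by linarith
        also have "\<dots> = (C0 + D * Cj) / A x * (real n / a n)" by (simp add: field_simps)
        finally have "real n ^ K * b (real n) * P n x \<le> real n ^ K * b (real n) * ((C0 + D * Cj) / A x * (real n / a n))"
          by (intro mult_left_mono) auto
        then show "real n ^ K * b (real n) * P n x \<le> (C0 + D * Cj) / A x * (real n ^ (K + 1) * (b (real n) / a n))"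
          by (simp add: mult_ac)
      qed
      also have "\<dots> = (C0 + D * Cj) / A x * (\<Sum>n\<in>{1..nat \<lfloor>\<epsilon> * A (real x)\<rfloor>}. real n ^ (K + 1) * (b (real n) / a n))"
        by (rule sum_distrib_left[symmetric])
      also have "\<dots> \<le> (C0 + D * Cj) / A x * (Cs * \<epsilon> powr e * A x ^ (K + 1 + 1) * (B x / x))"
        unfolding e_def using C0 D Cj \<epsilon> x by (intro mult_left_mono Cs) auto
      also have "\<dots> = (L * \<epsilon> powr e) * scale K x" by (simp add: L_def scale_def)
      also have "\<dots> \<le> \<kappa> * scale K x" using L\<epsilon> by (intro mult_right_mono) auto
      finally show ?thesis .
    qed
    then show "\<exists>\<epsilon>>0. \<epsilon> \<le> 1 \<and> (\<exists>x0. \<forall>x\<ge>x0. partial_green K (nat \<lfloor>\<epsilon> * A (real x)\<rfloor>) x \<le> \<kappa> * scale K x)"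
      using \<epsilon>(1,2) by blast
  qed
qed

text \<open>If \<open>S\<^sub>n = x\<close> with \<open>n\<close> small, up to a negligible probability one jump takes the walk from some \<open>w\<close>
  to \<open>x\<close>. Summing over its position multiplies the weight by \<open>n\<close>; for \<open>w \<le> \<delta>x\<close> the weighted Green
  function at \<open>w\<close> is bounded by its expected order and the conditions apply, while for larger \<open>w\<close>
  the time is again small compared with \<open>A(w)\<close>.\<close>

lemma small_times_negligible_step:
  assumes mass: mass_condition and sumc: sum_condition and Suc: "small_times_negligible (Suc k)"
  shows "small_times_negligible k"
proof -
  define r where "r = \<bar>1 / \<alpha> - \<beta>\<bar> + 1"
  \<comment> \<open>With this \<open>J\<close> the exponent J + k + 1 - r is positive, so the part
    without a large jump is negligible without recourse to the two conditions.\<close>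
  define J where "J = nat \<lceil>r\<rceil> + 1"
  have r: "r > 1 / \<alpha> - \<beta>" by (auto simp: r_def)
  have J: "J \<ge> 1" by (simp add: J_def)
  have Jr: "real J \<ge> r + 1" unfolding J_def by linarith
  have e': "real (J + k) + 1 - r > 0" using Jr by simp
  define e where "e = real (J + k) + 1 - r"
  have e: "e > 0" using e' by (simp add: e_def)
  obtain Cs where Cs: "Cs > 0" "\<And>x \<epsilon>. x \<ge> 1 \<Longrightarrow> 0 < \<epsilon> \<Longrightarrow> \<epsilon> \<le> 1 \<Longrightarrow>
    (\<Sum>n\<in>{1..nat \<lfloor>\<epsilon> * A x\<rfloor>}. real n ^ (J + k) * (b (real n) / a n)) \<le> Cs * \<epsilon> powr (real (J + k) + 1 - r) * A x ^ (J + k + 1) * (B x / x)"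
    using sum_b_over_a[OF r e'] by blast
  obtain C0 c0 where C0: "C0 > 0" "c0 > 0"
    "\<And>x n. x \<ge> 2 * J \<Longrightarrow> n \<ge> 1 \<Longrightarrow> real n \<le> c0 * A (real x) \<Longrightarrow>
       P n x \<le> C0 / a n * (real n / A (real x)) ^ J + real n * (\<Sum>w<x - x div (2 * J). p (x - w) * P (n - 1) w)"
    using big_jump_bound[OF J] by blast
  obtain Cj where Cj: "Cj > 0" "\<And>x. x \<ge> 2 * J \<Longrightarrow> (\<Sum>w<x - x div (2 * J). p (x - w)) \<le> Cj / A (real x)"
    using jump_mass[OF J] by blast
  have Sk: "Suc k \<ge> 1" by simp
  obtain Cb where Cb: "Cb \<ge> 1" "\<And>M w. w \<ge> 1 \<Longrightarrow> (\<Sum>n\<in>{1..M}. real n ^ Suc k * b (real n) * P (n - 1) w) \<le> Cb * partial_green (Suc k) M w"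
    using shifted_green_le[OF Sk] by blast
  obtain Cz where Cz: "Cz > 0" "\<And>M. (\<Sum>n\<in>{1..M}. real n ^ Suc k * b (real n) * P (n - 1) 0) \<le> Cz"
    using shifted_green_at_0[of "Suc k"] by blast
  obtain C1 where C1: "C1 > 0" "\<And>x N. x \<ge> 1 \<Longrightarrow> partial_green (Suc k) N x \<le> C1 * scale (Suc k) x"
    using small_times_negligible_imp_bounded[OF Suc] by blast
  show ?thesis
    unfolding small_times_negligible_def
  proof (intro allI impI)
    fix \<kappa> :: real assume \<kappa>: "\<kappa> > 0"
    have "\<kappa> / (4 * Cz) > 0" using \<kappa> Cz by simp
    then obtain x1 where x1: "\<And>x. x \<ge> x1 \<Longrightarrow> p x \<le> \<kappa> / (4 * Cz) * scale 0 x"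
      using mass unfolding mass_condition_def by blast
    have "\<kappa> / (4 * (Cb * C1)) > 0" using \<kappa> Cb C1 by simp
    then obtain \<delta>0 x2 where \<delta>0: "\<delta>0 > 0" and x2: "\<And>x. x \<ge> x2 \<Longrightarrow>
        (\<Sum>w\<in>{1..nat \<lfloor>\<delta>0 * real x\<rfloor>}. p (x - w) * scale 1 w) \<le> \<kappa> / (4 * (Cb * C1)) * scale 0 x"
      using sumc unfolding sum_condition_def by blast
    define \<delta> where "\<delta> = min 1 \<delta>0"
    have \<delta>: "0 < \<delta>" "\<delta> \<le> 1" "\<delta> \<le> \<delta>0" using \<delta>0 by (auto simp: \<delta>_def)
    obtain CB where CB: "CB \<ge> 1" "\<And>x w. w \<ge> 1 \<Longrightarrow> \<delta> * x \<le> w \<Longrightarrow> w \<le> x \<Longrightarrow>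
        B w \<le> CB * B x \<and> B x \<le> CB * B w \<and> A x \<le> CB * A w"
      using B_comparable[OF \<delta>(1,2)] by blast
    \<comment> \<open>Chosen so that the starting points w > \<delta>x, weighted by the jump mass
      bound Cj / A(x), contribute at most \<kappa>/4.\<close>
    define \<kappa>3 where "\<kappa>3 = \<kappa> * \<delta> / (4 * Cb * Cj * CB)"
    have \<kappa>3: "\<kappa>3 > 0" using \<kappa> \<delta> Cb Cj CB by (simp add: \<kappa>3_def)
    then obtain \<epsilon>3 x3 where \<epsilon>3: "\<epsilon>3 > 0" and x3: "\<And>x. x \<ge> x3 \<Longrightarrow>
        partial_green (Suc k) (nat \<lfloor>\<epsilon>3 * A (real x)\<rfloor>) x \<le> \<kappa>3 * scale (Suc k) x"
      using Suc unfolding small_times_negligible_def by blast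
    define \<epsilon>1 where "\<epsilon>1 = (\<kappa> / (4 * (C0 * Cs))) powr (1 / e)"
    \<comment> \<open>The bound \<epsilon>3 / CB turns times n <= \<epsilon> A(x) into n <=
      \<epsilon>3 A(w) for w > \<delta>x; \<epsilon>1 takes care of the part without a large
      jump.\<close>
    define \<epsilon> where "\<epsilon> = min (min 1 c0) (min (\<epsilon>3 / CB) \<epsilon>1)"
    have "\<epsilon>1 > 0" using \<kappa> C0 Cs by (simp add: \<epsilon>1_def)
    then have \<epsilon>: "\<epsilon> > 0" "\<epsilon> \<le> 1" "\<epsilon> \<le> c0" "\<epsilon> \<le> \<epsilon>3 / CB" "\<epsilon> \<le> \<epsilon>1"
      using C0 \<epsilon>3 CB by (auto simp: \<epsilon>_def)
    have "\<epsilon> powr e \<le> \<epsilon>1 powr e" using \<epsilon> e by (intro powr_mono2) auto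
    also have "\<dots> = \<kappa> / (4 * (C0 * Cs))" unfolding \<epsilon>1_def using e \<kappa> C0 Cs by (simp add: powr_powr)
    finally have small1: "C0 * Cs * \<epsilon> powr e \<le> \<kappa> / 4" using C0 Cs by (simp add: field_simps)
    \<comment> \<open>The last entry ensures w >= x3 for every w > \<delta>x.\<close>
    define x0 where "x0 = Max {2 * J, x1, x2, nat \<lceil>real (x3 + 1) / \<delta>\<rceil>}"
    have "partial_green k (nat \<lfloor>\<epsilon> * A (real x)\<rfloor>) x \<le> \<kappa> * scale k x" if "x \<ge> x0" for x
    proof -
      have x: "x \<ge> 2 * J" "x \<ge> x1" "x \<ge> x2" "x \<ge> nat \<lceil>real (x3 + 1) / \<delta>\<rceil>" using that by (auto simp: x0_def)
      have xx: "x \<ge> 1" using x(1) J by linarith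
      have "real (x3 + 1) / \<delta> \<le> real x" using x(4) by linarith
      then have x\<delta>: "real (x3 + 1) \<le> \<delta> * real x" using \<delta> by (simp add: pos_divide_le_eq mult.commute)
      define M where "M = nat \<lfloor>\<epsilon> * A (real x)\<rfloor>"
      define Y where "Y = x div (2 * J)"
      define S where "S = (\<lambda>w. \<Sum>n\<in>{1..M}. real n ^ Suc k * b (real n) * P (n - 1) w)"
      define V where "V = Cb * \<kappa>3 * (CB / \<delta>) * scale (Suc k) x"
      have V: "V \<ge> 0" using Cb \<kappa>3 CB \<delta> by (simp add: V_def)
      have S0: "S 0 \<le> Cz" unfolding S_def by (rule Cz)
      have S1: "S w \<le> Cb * C1 * A x ^ k * scale 1 w" if w: "w \<ge> 1" "w \<le> x" for w
      proof -
        have "S w \<le> Cb * partial_green (Suc k) M w" unfolding S_def by (rule Cb(2)[OF w(1)])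
        also have "\<dots> \<le> Cb * (C1 * (A w ^ k * scale 1 w))"
        proof (rule mult_left_mono)
          show "partial_green (Suc k) M w \<le> C1 * (A w ^ k * scale 1 w)"
            using C1(2)[OF w(1), of M] unfolding scale_1_eq[of k] .
        qed (use Cb in simp)
        also have "\<dots> \<le> Cb * (C1 * (A x ^ k * scale 1 w))"
          using Cb C1 w by (intro mult_left_mono mult_right_mono power_mono A_mono) auto
        finally show ?thesis by (simp only: mult_ac)
      qed
      have S2: "S w \<le> V" if w: "w \<le> x" "real w > \<delta> * real x" for w
      proof -
        have w1: "w \<ge> 1" "w \<ge> x3" using w x\<delta> by linarith+
        have cmp: "B w \<le> CB * B x" "A x \<le> CB * A w" using CB(2)[of "real w" "real x"] w w1 by auto
        have M: "M \<le> nat \<lfloor>\<epsilon>3 * A (real w)\<rfloor>"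
          unfolding M_def
        proof (intro nat_mono floor_mono)
          have "\<epsilon> * A x \<le> (\<epsilon>3 / CB) * (CB * A w)" using \<epsilon> \<epsilon>3 CB cmp by (intro mult_mono) auto
          also have "\<dots> = \<epsilon>3 * A w" using CB by simp
          finally show "\<epsilon> * A x \<le> \<epsilon>3 * A w" .
        qed
        have "S w \<le> Cb * partial_green (Suc k) M w" unfolding S_def by (rule Cb(2)[OF w1(1)])
        also have "\<dots> \<le> Cb * (\<kappa>3 * scale (Suc k) w)"
          using partial_green_mono[OF M, of "Suc k" w] x3[OF w1(2)] Cb by (intro mult_left_mono) auto
        also have "scale (Suc k) w \<le> (CB / \<delta>) * scale (Suc k) x"
        proof -
          have "B w / real w \<le> (CB * B x) / (\<delta> * real x)"
            using cmp w \<delta> xx CB by (intro frac_le) auto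
          then have "scale (Suc k) w \<le> A x ^ (Suc k + 1) * ((CB * B x) / (\<delta> * real x))"
            unfolding scale_def using w by (intro mult_mono power_mono A_mono) auto
          then show ?thesis by (simp add: scale_def mult_ac)
        qed
        finally show ?thesis using Cb \<kappa>3 by (simp add: V_def mult_left_mono)
      qed
      have "partial_green k M x \<le> (\<Sum>n\<in>{1..M}. C0 / A x ^ J * (real n ^ (J + k) * (b (real n) / a n))
           + (\<Sum>w<x - Y. p (x - w) * (real n ^ Suc k * b (real n) * P (n - 1) w)))"
        unfolding partial_green_def
      proof (rule sum_mono)
        fix n assume "n \<in> {1..M}"
        then have n: "n \<ge> 1" "real n \<le> \<epsilon> * A x" unfolding M_def by (simp_all only: nat_floor_ge_iff)
        have "\<epsilon> * A x \<le> c0 * A x" using \<epsilon> by (intro mult_right_mono) auto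
        then have "real n \<le> c0 * A x" using n by linarith
        then have "P n x \<le> C0 / a n * (real n / A x) ^ J + real n * (\<Sum>w<x - Y. p (x - w) * P (n - 1) w)"
          unfolding Y_def by (rule C0(3)[OF x(1) n(1)])
        then have "real n ^ k * b (real n) * P n x \<le> real n ^ k * b (real n) *
            (C0 / a n * (real n / A x) ^ J + real n * (\<Sum>w<x - Y. p (x - w) * P (n - 1) w))"
          by (intro mult_left_mono) auto
        also have "\<dots> = C0 / A x ^ J * (real n ^ (J + k) * (b (real n) / a n))
            + (\<Sum>w<x - Y. p (x - w) * (real n ^ Suc k * b (real n) * P (n - 1) w))"
          by (simp add: distrib_left sum_distrib_left power_divide power_add mult_ac)
        finally show "real n ^ k * b (real n) * P n x \<le> C0 / A x ^ J * (real n ^ (J + k) * (b (real n) / a n))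
            + (\<Sum>w<x - Y. p (x - w) * (real n ^ Suc k * b (real n) * P (n - 1) w))" .
      qed
      also have "\<dots> = C0 / A x ^ J * (\<Sum>n\<in>{1..M}. real n ^ (J + k) * (b (real n) / a n)) + (\<Sum>w<x - Y. p (x - w) * S w)"
        unfolding sum.distrib S_def sum_distrib_left by (subst (2) sum.swap) simp
      also have "\<dots> \<le> \<kappa> / 4 * scale k x + (\<kappa> / 4 * scale k x + \<kappa> / 4 * scale k x + \<kappa> / 4 * scale k x)"
      proof (rule add_mono)
        have "C0 / A x ^ J * (\<Sum>n\<in>{1..M}. real n ^ (J + k) * (b (real n) / a n))
            \<le> C0 / A x ^ J * (Cs * \<epsilon> powr e * A x ^ (J + k + 1) * (B x / x))"
          unfolding M_def e_def using C0 \<epsilon> xx by (intro mult_left_mono Cs) auto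
        also have "\<dots> = (C0 * Cs * \<epsilon> powr e) * scale k x"
          by (simp add: scale_def power_add)
        also have "\<dots> \<le> \<kappa> / 4 * scale k x" using small1 by (intro mult_right_mono) auto
        finally show "C0 / A x ^ J * (\<Sum>n\<in>{1..M}. real n ^ (J + k) * (b (real n) / a n)) \<le> \<kappa> / 4 * scale k x" .
        \<comment> \<open>Three kinds of starting points: w = 0 is handled by the mass condition, 1
          <= w <= \<delta>x by the sum condition, and larger w by negligibility for k + 1.\<close>
        have "(\<Sum>w<x - Y. p (x - w) * S w) \<le> (\<Sum>w<x - Y. (if w = 0 then p x * Cz else 0)
            + (if w \<in> {1..nat \<lfloor>\<delta> * real x\<rfloor>} then (Cb * C1 * A x ^ k) * (p (x - w) * scale 1 w) else 0) + p (x - w) * V)"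
        proof (rule sum_mono)
          fix w assume "w \<in> {..<x - Y}"
          then have w: "w \<le> x" by auto
          consider "w = 0" | "w \<in> {1..nat \<lfloor>\<delta> * real x\<rfloor>}" | "w \<noteq> 0" "w \<notin> {1..nat \<lfloor>\<delta> * real x\<rfloor>}" by blast
          then show "p (x - w) * S w \<le> (if w = 0 then p x * Cz else 0)
            + (if w \<in> {1..nat \<lfloor>\<delta> * real x\<rfloor>} then (Cb * C1 * A x ^ k) * (p (x - w) * scale 1 w) else 0) + p (x - w) * V"
          proof cases
            case 1
            then show ?thesis using mult_left_mono[OF S0 p_nonneg[of x]] mult_nonneg_nonneg[OF p_nonneg[of x] V] by simp
          next
            case 2
            then have "p (x - w) * S w \<le> p (x - w) * (Cb * C1 * A x ^ k * scale 1 w)"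
              using w by (intro mult_left_mono S1 p_nonneg) auto
            then have "p (x - w) * S w \<le> (Cb * C1 * A x ^ k) * (p (x - w) * scale 1 w)" by (simp only: mult_ac)
            then show ?thesis using 2 mult_nonneg_nonneg[OF p_nonneg[of "x - w"] V] by auto
          next
            case 3
            then have "real w > \<delta> * real x" using nat_floor_ge_iff[of w "\<delta> * real x"] by auto
            then have "p (x - w) * S w \<le> p (x - w) * V" using w by (intro mult_left_mono S2 p_nonneg) auto
            then show ?thesis using 3 by auto
          qed
        qed
        also have "\<dots> = (\<Sum>w<x - Y. if w = 0 then p x * Cz else 0)
            + (\<Sum>w<x - Y. if w \<in> {1..nat \<lfloor>\<delta> * real x\<rfloor>} then (Cb * C1 * A x ^ k) * (p (x - w) * scale 1 w) else 0)
            + (\<Sum>w<x - Y. p (x - w) * V)"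
          by (simp only: sum.distrib)
        also have "\<dots> \<le> \<kappa> / 4 * scale k x + \<kappa> / 4 * scale k x + \<kappa> / 4 * scale k x"
        proof (intro add_mono)
          have "(\<Sum>w<x - Y. if w = 0 then p x * Cz else 0) \<le> p x * Cz"
            using p_nonneg[of x] Cz by (simp add: sum.delta)
          also have "\<dots> \<le> (\<kappa> / (4 * Cz) * scale 0 x) * Cz" using x1[OF x(2)] Cz by (intro mult_right_mono) auto
          also have "\<dots> = \<kappa> / 4 * scale 0 x" using Cz by simp
          also have "\<dots> \<le> \<kappa> / 4 * scale k x" using \<kappa> scale_0_le by (intro mult_left_mono) auto
          finally show "(\<Sum>w<x - Y. if w = 0 then p x * Cz else 0) \<le> \<kappa> / 4 * scale k x" .
          have nn: "(Cb * C1 * A x ^ k) * (p (x - w) * scale 1 w) \<ge> 0" for w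
            using Cb C1 p_nonneg by (intro mult_nonneg_nonneg) auto
          have "(\<Sum>w<x - Y. if w \<in> {1..nat \<lfloor>\<delta> * real x\<rfloor>} then (Cb * C1 * A x ^ k) * (p (x - w) * scale 1 w) else 0)
              = (\<Sum>w\<in>{..<x - Y} \<inter> {1..nat \<lfloor>\<delta> * real x\<rfloor>}. (Cb * C1 * A x ^ k) * (p (x - w) * scale 1 w))"
            by (rule sum.inter_restrict[symmetric]) simp
          also have "\<dots> \<le> (\<Sum>w\<in>{1..nat \<lfloor>\<delta>0 * real x\<rfloor>}. (Cb * C1 * A x ^ k) * (p (x - w) * scale 1 w))"
          proof (rule sum_mono2)
            have "nat \<lfloor>\<delta> * real x\<rfloor> \<le> nat \<lfloor>\<delta>0 * real x\<rfloor>"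
              using \<delta> by (intro nat_mono floor_mono mult_right_mono) auto
            then show "{..<x - Y} \<inter> {1..nat \<lfloor>\<delta> * real x\<rfloor>} \<subseteq> {1..nat \<lfloor>\<delta>0 * real x\<rfloor>}" by auto
          qed (use nn in auto)
          also have "\<dots> = (Cb * C1 * A x ^ k) * (\<Sum>w\<in>{1..nat \<lfloor>\<delta>0 * real x\<rfloor>}. p (x - w) * scale 1 w)"
            by (rule sum_distrib_left[symmetric])
          also have "\<dots> \<le> (Cb * C1 * A x ^ k) * (\<kappa> / (4 * (Cb * C1)) * scale 0 x)"
            using Cb C1 by (intro mult_left_mono x2 x(3)) auto
          also have "\<dots> = \<kappa> / 4 * scale k x" using Cb C1 by (simp add: scale_def)
          finally show "(\<Sum>w<x - Y. if w \<in> {1..nat \<lfloor>\<delta> * real x\<rfloor>} then (Cb * C1 * A x ^ k) * (p (x - w) * scale 1 w) else 0) \<le> \<kappa> / 4 * scale k x" .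
          have "(\<Sum>w<x - Y. p (x - w) * V) = (\<Sum>w<x - Y. p (x - w)) * V" by (rule sum_distrib_right[symmetric])
          also have "\<dots> \<le> (Cj / A x) * V" unfolding Y_def using Cj(2)[OF x(1)] V by (intro mult_right_mono) auto
          also have "\<dots> = \<kappa> / 4 * scale k x"
            using Cb Cj CB \<delta> by (simp add: V_def \<kappa>3_def scale_Suc)
          finally show "(\<Sum>w<x - Y. p (x - w) * V) \<le> \<kappa> / 4 * scale k x" .
        qed
        finally show "(\<Sum>w<x - Y. p (x - w) * S w) \<le> \<kappa> / 4 * scale k x + \<kappa> / 4 * scale k x + \<kappa> / 4 * scale k x" .
      qed
      also have "\<dots> = \<kappa> * scale k x" by (simp add: field_simps)
      finally show ?thesis by (simp only: M_def)
    qed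
    then show "\<exists>\<epsilon>>0. \<epsilon> \<le> 1 \<and> (\<exists>x0. \<forall>x\<ge>x0. partial_green k (nat \<lfloor>\<epsilon> * A (real x)\<rfloor>) x \<le> \<kappa> * scale k x)"
      using \<epsilon>(1,2) by blast
  qed
qed

lemma conditions_imp_small_times_negligible:
  assumes mass_condition sum_condition
  shows "small_times_negligible 0"
proof -
  define K where "K = nat \<lceil>\<bar>1 / \<alpha> - \<beta>\<bar>\<rceil>"
  have "real K + 2 > 1 / \<alpha> - \<beta>" unfolding K_def by linarith
  then have "small_times_negligible K" by (rule small_times_negligible_base)
  then have "small_times_negligible (K - j)" if "j \<le> K" for j
    using that
  proof (induction j)
    case (Suc j)
    then have "Suc (K - Suc j) = K - j" by simp
    with Suc show ?case using small_times_negligible_step[OF assms, of "K - Suc j"] by simp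
  qed simp
  from this[of K] show ?thesis by simp
qed

end

section \<open>Riemann sums of decreasing functions\<close>

lemma antimono_Riemann_bounds:
  fixes K :: "real \<Rightarrow> real" and t :: "nat \<Rightarrow> real"
  assumes t: "\<And>i. i < m \<Longrightarrow> t i \<le> t (Suc i)"
    and K: "\<And>u v. t 0 \<le> u \<Longrightarrow> u \<le> v \<Longrightarrow> v \<le> t m \<Longrightarrow> K v \<le> K u" "continuous_on {t 0..t m} K"
  shows "(\<Sum>i<m. (t (Suc i) - t i) * K (t (Suc i))) \<le> integral {t 0..t m} K"
    and "integral {t 0..t m} K \<le> (\<Sum>i<m. (t (Suc i) - t i) * K (t i))"
proof -
  have mono: "t i \<le> t j" if "i \<le> j" "j \<le> m" for i j
    using that by (induction j rule: dec_induct) (auto intro: order_trans[OF _ t])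
  have "(\<Sum>i<k. (t (Suc i) - t i) * K (t (Suc i))) \<le> integral {t 0..t k} K \<and>
      integral {t 0..t k} K \<le> (\<Sum>i<k. (t (Suc i) - t i) * K (t i))" if "k \<le> m" for k
    using that
  proof (induction k)
    case (Suc k)
    have km: "k < m" using Suc by simp
    have tk: "t 0 \<le> t k" "t k \<le> t (Suc k)" "t (Suc k) \<le> t m"
      using mono[of 0 k] mono[of k "Suc k"] mono[of "Suc k" m] Suc.prems by auto
    have int: "K integrable_on {u..v}" if "t 0 \<le> u" "v \<le> t m" for u v
      using that by (intro integrable_continuous_interval continuous_on_subset[OF K(2)]) auto
    have split: "integral {t 0..t (Suc k)} K = integral {t 0..t k} K + integral {t k..t (Suc k)} K"
      using tk by (intro Henstock_Kurzweil_Integration.integral_combine[symmetric] int) auto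
    have "integral {t k..t (Suc k)} (\<lambda>_. K (t (Suc k))) \<le> integral {t k..t (Suc k)} K"
      using tk by (intro integral_le int K(1)) auto
    moreover have "integral {t k..t (Suc k)} K \<le> integral {t k..t (Suc k)} (\<lambda>_. K (t k))"
      using tk by (intro integral_le int K(1)) auto
    ultimately show ?case using Suc tk unfolding split by (simp add: mult.commute)
  qed simp
  then show "(\<Sum>i<m. (t (Suc i) - t i) * K (t (Suc i))) \<le> integral {t 0..t m} K"
    and "integral {t 0..t m} K \<le> (\<Sum>i<m. (t (Suc i) - t i) * K (t i))" by auto
qed

lemma sum_blocks:
  fixes N :: "nat \<Rightarrow> nat" and f :: "nat \<Rightarrow> real"
  assumes "\<And>i. i < m \<Longrightarrow> N i \<le> N (Suc i)"
  shows "(\<Sum>n\<in>{N 0<..N m}. f n) = (\<Sum>i<m. \<Sum>n\<in>{N i<..N (Suc i)}. f n)"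
  using assms
proof (induction m)
  case (Suc m)
  have "N 0 \<le> N j" if "j \<le> m" for j
    using that Suc.prems by (induction j) (auto intro: order_trans)
  then have "{N 0<..N (Suc m)} = {N 0<..N m} \<union> {N m<..N (Suc m)}" using Suc.prems[of m] by force
  moreover have "sum f ({N 0<..N m} \<union> {N m<..N (Suc m)}) = sum f {N 0<..N m} + sum f {N m<..N (Suc m)}"
    by (rule sum.union_disjoint) auto
  ultimately show ?case using Suc by simp
qed simp

text \<open>\<open>N x t\<close> plays the role of \<open>t A(x)\<close> rounded down.\<close>

lemma antimono_Riemann_limit:
  fixes h :: "nat \<Rightarrow> nat \<Rightarrow> real" and K A :: "_ \<Rightarrow> real" and N :: "nat \<Rightarrow> real \<Rightarrow> nat"
  assumes st: "0 < s" "s < s'"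
    and A: "\<And>x. A x > 0"
    and Nmono: "\<And>x u v. u \<le> v \<Longrightarrow> N x u \<le> N x v"
    and Nlim: "\<And>t. t > 0 \<Longrightarrow> (\<lambda>x. real (N x t) / A x) \<longlonglongrightarrow> t"
    and h: "\<And>x m n. m \<le> n \<Longrightarrow> h x n \<le> h x m"
    and lim: "\<And>t. t > 0 \<Longrightarrow> (\<lambda>x. h x (N x t)) \<longlonglongrightarrow> K t"
    and K: "\<And>u v. 0 < u \<Longrightarrow> u \<le> v \<Longrightarrow> K v \<le> K u" "continuous_on {s..s'} K"
  shows "(\<lambda>x. (\<Sum>n\<in>{N x s<..N x s'}. h x n) / A x) \<longlonglongrightarrow> integral {s..s'} K"
proof (rule LIMSEQ_I)
  fix \<epsilon> :: real assume \<epsilon>: "\<epsilon> > 0"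
  \<comment> \<open>Upper and lower sums differ by (s' - s)(K(s) - K(s')) / m, because the
    differences of K telescope.\<close>
  obtain m0 :: nat where m0: "(s' - s) * (K s - K s') < real m0 * (\<epsilon> / 2)"
    using reals_Archimedean3[OF half_gt_zero[OF \<epsilon>]] by blast
  define m where "m = Suc m0"
  have m: "m > 0" "(s' - s) * (K s - K s') < real m * (\<epsilon> / 2)"
    using m0 \<epsilon> by (auto simp: m_def distrib_right)
  define \<Delta> where "\<Delta> = (s' - s) / real m"
  define t where "t = (\<lambda>i. s + real i * \<Delta>)"
  have \<Delta>: "\<Delta> > 0" using st m by (simp add: \<Delta>_def)
  have t: "t 0 = s" "t m = s'" "t (Suc i) - t i = \<Delta>" "t i \<le> t (Suc i)" "t i > 0" for i
  proof -
    have "real m * \<Delta> = s' - s" using m by (simp add: \<Delta>_def)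
    then show "t 0 = s" "t m = s'" "t (Suc i) - t i = \<Delta>" "t i \<le> t (Suc i)" "t i > 0"
      using st \<Delta> by (auto simp: t_def distrib_right add_pos_nonneg)
  qed
  define U where "U = (\<Sum>i<m. \<Delta> * K (t i))"
  define L where "L = (\<Sum>i<m. \<Delta> * K (t (Suc i)))"
  have L: "L \<le> integral {s..s'} K" and U: "integral {s..s'} K \<le> U"
    using antimono_Riemann_bounds[of m t K] t K st by (auto simp: L_def U_def)
  have UL: "U - L < \<epsilon> / 2"
  proof -
    have "U - L = \<Delta> * (\<Sum>i<m. K (t i) - K (t (Suc i)))"
      by (simp add: U_def L_def sum_distrib_left sum_subtractf right_diff_distrib)
    also have "(\<Sum>i<m. K (t i) - K (t (Suc i))) = K (t 0) - K (t m)" by (rule sum_lessThan_telescope')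
    finally have "U - L = ((s' - s) * (K s - K s')) / real m" by (simp only: t \<Delta>_def times_divide_eq_left)
    also have "\<dots> < \<epsilon> / 2" using m by (simp only: pos_divide_less_eq of_nat_0_less_iff mult.commute)
    finally show ?thesis .
  qed
  define c where "c = (\<lambda>x i. (real (N x (t (Suc i))) - real (N x (t i))) / A x)"
  have clim: "(\<lambda>x. c x i) \<longlonglongrightarrow> \<Delta>" for i
    using tendsto_diff[OF Nlim[OF t(5)] Nlim[OF t(5)], of "Suc i" i] t(3) by (simp add: c_def diff_divide_distrib)
  have "(\<lambda>x. \<Sum>i<m. c x i * h x (N x (t i))) \<longlonglongrightarrow> U" unfolding U_def by (intro tendsto_sum tendsto_mult clim lim t(5))
  moreover have "(\<lambda>x. \<Sum>i<m. c x i * h x (N x (t (Suc i)))) \<longlonglongrightarrow> L" unfolding L_def by (intro tendsto_sum tendsto_mult clim lim t(5))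
  ultimately have "eventually (\<lambda>x. (\<Sum>i<m. c x i * h x (N x (t i))) < U + \<epsilon> / 2 \<and> (\<Sum>i<m. c x i * h x (N x (t (Suc i)))) > L - \<epsilon> / 2) sequentially"
    using \<epsilon> by (intro eventually_conj order_tendstoD(1)[where y = L] order_tendstoD(2)[where y = U]) auto
  then obtain x0 where x0: "\<And>x. x \<ge> x0 \<Longrightarrow> (\<Sum>i<m. c x i * h x (N x (t i))) < U + \<epsilon> / 2"
     "\<And>x. x \<ge> x0 \<Longrightarrow> (\<Sum>i<m. c x i * h x (N x (t (Suc i)))) > L - \<epsilon> / 2"
    by (auto simp: eventually_sequentially)
  show "\<exists>no. \<forall>x\<ge>no. norm ((\<Sum>n\<in>{N x s<..N x s'}. h x n) / A x - integral {s..s'} K) < \<epsilon>"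
  proof (intro exI[of _ x0] allI impI)
    fix x assume x: "x \<ge> x0"
    have "(\<Sum>n\<in>{N x (t 0)<..N x (t m)}. h x n) = (\<Sum>i<m. \<Sum>n\<in>{N x (t i)<..N x (t (Suc i))}. h x n)"
      by (intro sum_blocks Nmono t)
    then have eq: "(\<Sum>n\<in>{N x s<..N x s'}. h x n) / A x = (\<Sum>i<m. (\<Sum>n\<in>{N x (t i)<..N x (t (Suc i))}. h x n) / A x)"
      by (simp only: t sum_divide_distrib)
    have card: "real (card {N x (t i)<..N x (t (Suc i))}) = real (N x (t (Suc i))) - real (N x (t i))" for i
      using Nmono[OF t(4)[of i], of x] by (simp add: of_nat_diff)
    have up: "(\<Sum>n\<in>{N x (t i)<..N x (t (Suc i))}. h x n) / A x \<le> c x i * h x (N x (t i))" for i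
    proof -
      have "(\<Sum>n\<in>{N x (t i)<..N x (t (Suc i))}. h x n) \<le> (\<Sum>n\<in>{N x (t i)<..N x (t (Suc i))}. h x (N x (t i)))"
        by (intro sum_mono h) auto
      then show ?thesis using A[of x] unfolding c_def sum_constant card by (simp add: divide_right_mono)
    qed
    have lo: "c x i * h x (N x (t (Suc i))) \<le> (\<Sum>n\<in>{N x (t i)<..N x (t (Suc i))}. h x n) / A x" for i
    proof -
      have "(\<Sum>n\<in>{N x (t i)<..N x (t (Suc i))}. h x (N x (t (Suc i)))) \<le> (\<Sum>n\<in>{N x (t i)<..N x (t (Suc i))}. h x n)"
        by (intro sum_mono h) auto
      then show ?thesis using A[of x] unfolding c_def sum_constant card by (simp add: divide_right_mono)
    qed
    have "(\<Sum>n\<in>{N x s<..N x s'}. h x n) / A x < U + \<epsilon> / 2"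
      unfolding eq using x0(1)[OF x] sum_mono[of "{..<m}", OF up] by (meson le_less_trans)
    moreover have "(\<Sum>n\<in>{N x s<..N x s'}. h x n) / A x > L - \<epsilon> / 2"
      unfolding eq using x0(2)[OF x] sum_mono[of "{..<m}", OF lo] by (meson less_le_trans)
    ultimately show "norm ((\<Sum>n\<in>{N x s<..N x s'}. h x n) / A x - integral {s..s'} K) < \<epsilon>"
      using L U UL by (simp add: abs_less_iff)
  qed
qed

lemma (in real_distribution) ex_continuity_point:
  assumes "u < v"
  obtains y where "u < y" "y < v" "isCont (cdf M) y"
proof -
  have "countable {y. \<not> isCont (cdf M) y}"
    by (rule mono_ctble_discont) (auto intro!: monoI cdf_nondecreasing)
  then have "\<not> {u<..<v} \<subseteq> {y. \<not> isCont (cdf M) y}"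
    using assms uncountable_open_interval countable_subset by blast
  then show ?thesis using that by auto
qed

section \<open>Middle times\<close>

locale attracted_walk = weighted_walk + real_distribution \<mu> for \<mu> +
  assumes \<mu>_pos: "measure \<mu> {0<..} = 1"
    and weak_limit: "\<And>y. y > 0 \<Longrightarrow> isCont (cdf \<mu>) y \<Longrightarrow>
      (\<lambda>n. \<Sum>k\<le>nat \<lfloor>y * a n\<rfloor>. P n k) \<longlonglongrightarrow> cdf \<mu> y"
begin

definition Fd :: "nat \<Rightarrow> real \<Rightarrow> real" where "Fd n z = (\<Sum>k\<le>nat \<lfloor>z\<rfloor>. P n k)"

lemma Fd_mono: "z \<le> z' \<Longrightarrow> Fd n z \<le> Fd n z'"
  unfolding Fd_def by (intro sum_mono2) (auto intro!: nat_mono floor_mono P_nonneg)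

text \<open>S_n does not decrease in n. This monotonicity in time permits Riemann sums with
  pointwise limits only.\<close>

lemma Fd_antimono: "m \<le> n \<Longrightarrow> Fd n z \<le> Fd m z"
proof (induction n rule: dec_induct)
  case (step n)
  let ?K = "nat \<lfloor>z\<rfloor>"
  have "(\<Sum>k\<le>?K. P (Suc n) k) = (\<Sum>k\<le>?K. \<Sum>i\<le>k. p (k - i) * P n i)"
  proof (rule sum.cong)
    fix k
    have "P (Suc n) k = (\<Sum>i\<le>k. p i * P n (k - i))" by (rule conv_pow_Suc)
    also have "\<dots> = (\<Sum>i\<le>k. p (k - i) * P n i)"
      by (rule sum.reindex_bij_witness[of _ "\<lambda>i. k - i" "\<lambda>i. k - i"]) auto
    finally show "P (Suc n) k = (\<Sum>i\<le>k. p (k - i) * P n i)" .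
  qed simp
  also have "\<dots> = (\<Sum>i\<le>?K. \<Sum>k\<in>{i..?K}. p (k - i) * P n i)"
  proof -
    have "(\<Sum>k\<in>{..?K}. \<Sum>i\<in>{i\<in>{..?K}. i \<le> k}. p (k - i) * P n i)
        = (\<Sum>i\<in>{..?K}. \<Sum>k\<in>{k\<in>{..?K}. i \<le> k}. p (k - i) * P n i)"
      by (rule sum.swap_restrict) auto
    moreover have "(\<Sum>k\<in>{..?K}. \<Sum>i\<in>{i\<in>{..?K}. i \<le> k}. p (k - i) * P n i) = (\<Sum>k\<le>?K. \<Sum>i\<le>k. p (k - i) * P n i)"
      by (intro sum.cong) auto
    moreover have "(\<Sum>i\<in>{..?K}. \<Sum>k\<in>{k\<in>{..?K}. i \<le> k}. p (k - i) * P n i) = (\<Sum>i\<le>?K. \<Sum>k\<in>{i..?K}. p (k - i) * P n i)"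
      by (intro sum.cong) auto
    ultimately show ?thesis by (simp only:)
  qed
  also have "\<dots> \<le> (\<Sum>i\<le>?K. P n i)"
  proof (rule sum_mono)
    fix i assume "i \<in> {..?K}"
    have "(\<Sum>k\<in>{i..?K}. p (k - i)) = (\<Sum>j\<le>?K - i. p j)"
      by (rule sum.reindex_bij_witness[of _ "\<lambda>j. j + i" "\<lambda>k. k - i"]) (use \<open>i \<in> {..?K}\<close> in auto)
    also have "\<dots> \<le> 1" by (rule sum_p_le_1) simp
    finally have "(\<Sum>k\<in>{i..?K}. p (k - i)) * P n i \<le> 1 * P n i" by (rule mult_right_mono) (rule P_nonneg)
    then show "(\<Sum>k\<in>{i..?K}. p (k - i) * P n i) \<le> P n i" by (simp add: sum_distrib_right)
  qed
  finally show ?case using step by (simp add: Fd_def)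
qed simp

text \<open>The local bound \<open>P(S\<^sub>n = z) \<le> C / a\<^sub>n\<close> passes to the limit: the law of \<open>Y\<close> has a bounded density.\<close>

lemma cdf_Lipschitz:
  obtains C where "C > 0" "\<And>u v. 0 < u \<Longrightarrow> u \<le> v \<Longrightarrow> cdf \<mu> v - cdf \<mu> u \<le> C * (v - u)"
proof -
  obtain C where C: "C > 0" "\<And>n z. n \<ge> 1 \<Longrightarrow> P n z \<le> C / a n" using P_uniform_bound by blast
  have cont: "cdf \<mu> v - cdf \<mu> u \<le> C * (v - u)"
    if uv: "0 < u" "u \<le> v" "isCont (cdf \<mu>) u" "isCont (cdf \<mu>) v" for u v
  proof (rule LIMSEQ_le)
    show "(\<lambda>n. Fd n (v * a n) - Fd n (u * a n)) \<longlonglongrightarrow> cdf \<mu> v - cdf \<mu> u"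
      unfolding Fd_def using uv by (intro tendsto_diff weak_limit) auto
    have "(\<lambda>n. C * (v - u) + C / a n) \<longlonglongrightarrow> C * (v - u) + 0"
      by (intro tendsto_add tendsto_const tendsto_divide_0[OF tendsto_const] filterlim_at_top_imp_at_infinity a_top)
    then show "(\<lambda>n. C * (v - u) + C / a n) \<longlonglongrightarrow> C * (v - u)" by simp
    have "Fd n (v * a n) - Fd n (u * a n) \<le> C * (v - u) + C / a n" if n: "n \<ge> 1" for n
    proof -
      have le: "nat \<lfloor>u * a n\<rfloor> \<le> nat \<lfloor>v * a n\<rfloor>" using uv by (intro nat_mono floor_mono mult_right_mono) auto
      have "{..nat \<lfloor>v * a n\<rfloor>} = {..nat \<lfloor>u * a n\<rfloor>} \<union> {nat \<lfloor>u * a n\<rfloor><..nat \<lfloor>v * a n\<rfloor>}" using le by auto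
      moreover have "sum (P n) ({..nat \<lfloor>u * a n\<rfloor>} \<union> {nat \<lfloor>u * a n\<rfloor><..nat \<lfloor>v * a n\<rfloor>}) = Fd n (u * a n) + sum (P n) {nat \<lfloor>u * a n\<rfloor><..nat \<lfloor>v * a n\<rfloor>}"
        unfolding Fd_def by (rule sum.union_disjoint) auto
      ultimately have "Fd n (v * a n) - Fd n (u * a n) = sum (P n) {nat \<lfloor>u * a n\<rfloor><..nat \<lfloor>v * a n\<rfloor>}"
        by (simp add: Fd_def)
      also have "\<dots> \<le> (\<Sum>k\<in>{nat \<lfloor>u * a n\<rfloor><..nat \<lfloor>v * a n\<rfloor>}. C / a n)" by (intro sum_mono C n)
      also have "\<dots> = real (nat \<lfloor>v * a n\<rfloor> - nat \<lfloor>u * a n\<rfloor>) * (C / a n)" by simp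
      also have "\<dots> \<le> ((v - u) * a n + 1) * (C / a n)"
      proof (rule mult_right_mono)
        have "u * a n \<ge> 0" "v * a n \<ge> 0" using uv by auto
        then have "real (nat \<lfloor>v * a n\<rfloor>) \<le> v * a n" "real (nat \<lfloor>u * a n\<rfloor>) \<ge> u * a n - 1" by linarith+
        then show "real (nat \<lfloor>v * a n\<rfloor> - nat \<lfloor>u * a n\<rfloor>) \<le> (v - u) * a n + 1"
          using le by (simp add: of_nat_diff left_diff_distrib)
      qed (use C in auto)
      also have "\<dots> = C * (v - u) + C / a n" by (simp add: field_simps)
      finally show ?thesis .
    qed
    then show "\<exists>N. \<forall>n\<ge>N. Fd n (v * a n) - Fd n (u * a n) \<le> C * (v - u) + C / a n" by blast
  qed
  have mono: "cdf \<mu> s \<le> cdf \<mu> t" if "s \<le> t" for s t using cdf_nondecreasing that by auto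
  have "cdf \<mu> v - cdf \<mu> u \<le> C * (v - u)" if uv: "0 < u" "u \<le> v" for u v
  proof (rule field_le_epsilon)
    fix e :: real assume e: "e > 0"
    have "(cdf \<mu> \<longlongrightarrow> cdf \<mu> u) (at_right u)" using cdf_is_right_cont[of u] by (simp add: continuous_within)
    then have "eventually (\<lambda>y. cdf \<mu> y < cdf \<mu> u + e / 2) (at_right u)" by (rule order_tendstoD) (use e in simp)
    then obtain w where w: "w > u" "\<And>y. u < y \<Longrightarrow> y < w \<Longrightarrow> cdf \<mu> y < cdf \<mu> u + e / 2"
      by (auto simp: eventually_at_right_field)
    show "cdf \<mu> v - cdf \<mu> u \<le> C * (v - u) + e"
    proof (cases "u = v")
      case False
      \<comment> \<open>Both ends move to the right, to continuity points: right continuity makes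
        the loss at u small, and at v monotonicity suffices.\<close>
      obtain u' where u': "u < u'" "u' < min w v" "isCont (cdf \<mu>) u'"
        using ex_continuity_point[of u "min w v"] w uv False by auto
      obtain v' where v': "v < v'" "v' < v + e / (2 * C)" "isCont (cdf \<mu>) v'"
        using ex_continuity_point[of v "v + e / (2 * C)"] e C by auto
      have "cdf \<mu> v' - cdf \<mu> u' \<le> C * (v' - u')" using u' v' uv by (intro cont) auto
      also have "\<dots> \<le> C * (v + e / (2 * C) - u)" using u' v' C by (intro mult_left_mono) auto
      also have "\<dots> = C * (v - u) + e / 2" using C by (simp add: field_simps)
      finally have "cdf \<mu> v' - cdf \<mu> u' \<le> C * (v - u) + e / 2" .
      moreover have "cdf \<mu> u' < cdf \<mu> u + e / 2" using w(2) u' by auto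
      moreover have "cdf \<mu> v \<le> cdf \<mu> v'" using v' by (intro mono) auto
      ultimately show ?thesis by linarith
    qed (use e in simp)
  qed
  then show ?thesis using that C(1) by blast
qed

lemma cdf_isCont: "y > 0 \<Longrightarrow> isCont (cdf \<mu>) y"
proof -
  assume y: "y > 0"
  obtain C where C: "C > 0" "\<And>u v. 0 < u \<Longrightarrow> u \<le> v \<Longrightarrow> cdf \<mu> v - cdf \<mu> u \<le> C * (v - u)"
    using cdf_Lipschitz by blast
  have mono: "cdf \<mu> s \<le> cdf \<mu> t" if "s \<le> t" for s t using cdf_nondecreasing that by auto
  have "C-lipschitz_on {0<..} (cdf \<mu>)"
  proof (rule lipschitz_onI)
    show "dist (cdf \<mu> u) (cdf \<mu> v) \<le> C * dist u v" if "u \<in> {0<..}" "v \<in> {0<..}" for u v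
      using C(2)[of u v] C(2)[of v u] mono[of u v] mono[of v u] that
      by (cases "u \<le> v") (auto simp: dist_real_def)
  qed (use C in simp)
  then have "continuous_on {0<..} (cdf \<mu>)" by (rule lipschitz_on_continuous_on)
  then show ?thesis using y by (simp add: continuous_on_eq_continuous_at)
qed

definition N :: "nat \<Rightarrow> real \<Rightarrow> nat" where "N x t = nat \<lfloor>t * A (real x)\<rfloor>"

lemma A_top: "filterlim (\<lambda>x::nat. A (real x)) at_top sequentially"
proof -
  obtain D where D: "D \<ge> 1" "\<And>x y. x \<ge> 1 \<Longrightarrow> y \<ge> x \<Longrightarrow> A x \<le> D * (y / x) powr (- (\<alpha> / 2)) * A y"
    using A_lower_half by blast
  have "filterlim (\<lambda>x::nat. (1 / D) * real x powr (\<alpha> / 2)) at_top sequentially"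
    using D alpha
    by (intro filterlim_tendsto_pos_mult_at_top[OF tendsto_const] filterlim_compose[OF real_powr_at_top filterlim_real_sequentially]) auto
  then show ?thesis
  proof (rule filterlim_at_top_mono)
    show "eventually (\<lambda>x. (1 / D) * real x powr (\<alpha> / 2) \<le> A (real x)) sequentially"
      using eventually_ge_at_top[of 1]
    proof eventually_elim
      case (elim x)
      have "1 \<le> A 1" by (rule A_ge_1)
      also have "\<dots> \<le> D * (real x / 1) powr (- (\<alpha> / 2)) * A x" using elim by (intro D) auto
      finally show ?case using elim D by (simp add: powr_minus field_simps)
    qed
  qed
qed

lemma N_mono: "u \<le> v \<Longrightarrow> N x u \<le> N x v"
  unfolding N_def by (intro nat_mono floor_mono mult_right_mono) auto

lemma N_le: "t \<ge> 0 \<Longrightarrow> real (N x t) \<le> t * A (real x)"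
  and N_ge: "t * A (real x) - 1 \<le> real (N x t)"
  unfolding N_def using mult_nonneg_nonneg[of t "A (real x)"] by (linarith | simp; linarith)+

lemma N_limit:
  assumes t: "t > 0"
  shows "(\<lambda>x. real (N x t) / A (real x)) \<longlonglongrightarrow> t"
proof (rule tendsto_sandwich)
  show "eventually (\<lambda>x. t - 1 / A (real x) \<le> real (N x t) / A (real x)) sequentially"
    using N_ge[of t] by (intro always_eventually allI) (simp add: le_divide_eq left_diff_distrib)
  show "eventually (\<lambda>x. real (N x t) / A (real x) \<le> t) sequentially"
    using N_le[of t] t by (intro always_eventually allI) (simp add: divide_le_eq)
  have "(\<lambda>x. t - 1 / A (real x)) \<longlonglongrightarrow> t - 0"
    by (intro tendsto_diff tendsto_const tendsto_divide_0[OF tendsto_const] filterlim_at_top_imp_at_infinity A_top)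
  then show "(\<lambda>x. t - 1 / A (real x)) \<longlonglongrightarrow> t" by simp
qed simp

lemma N_top:
  assumes t: "t > 0"
  shows "filterlim (\<lambda>x. N x t) at_top sequentially"
proof -
  have "filterlim (\<lambda>x. t * A (real x)) at_top sequentially"
    using t by (intro filterlim_tendsto_pos_mult_at_top[OF tendsto_const] A_top)
  then show ?thesis
    unfolding N_def
    by (intro filterlim_compose[OF filterlim_nat_sequentially] filterlim_compose[OF filterlim_floor_sequentially])
qed

end

section \<open>Limits along times proportional to A(x)\<close>

lemma ex_small_right:
  fixes f :: "real \<Rightarrow> real"
  assumes "eventually Q (at_right (0::real))"
  obtains \<tau> where "\<tau> > 0" "Q \<tau>"
proof -
  have "eventually (\<lambda>\<tau>. \<tau> > (0::real)) (at_right 0)" by (rule eventually_at_right_less)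
  with assms have "eventually (\<lambda>\<tau>. Q \<tau> \<and> \<tau> > 0) (at_right 0)" by (rule eventually_conj)
  then show ?thesis using that eventually_happens'[OF trivial_limit_at_right_real] by blast
qed

text \<open>Potter's inequalities with \<tau> tending to 0; factors below 1 are inverted.\<close>

lemma potter_ratio_limit:
  fixes f :: "real \<Rightarrow> real"
  assumes f: "potter_bounds \<rho> f" and c: "c > 0"
  shows "((\<lambda>x. f (c * x) / f x) \<longlongrightarrow> c powr \<rho>) at_top"
proof -
  have ge1: "((\<lambda>x. f (c * x) / f x) \<longlongrightarrow> c powr \<rho>) at_top" if c: "c \<ge> 1" for c
  proof (rule order_tendstoI)
    fix u assume u: "u < c powr \<rho>"
    have "((\<lambda>\<tau>. 1 / ((1 + \<tau>) * c powr (\<tau> - \<rho>))) \<longlongrightarrow> 1 / ((1 + 0) * c powr (0 - \<rho>))) (at_right (0::real))"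
      using c by (intro tendsto_intros) auto
    also have "1 / ((1 + 0) * c powr (0 - \<rho>)) = c powr \<rho>" using c by (simp add: powr_minus_divide)
    finally have "eventually (\<lambda>\<tau>. 1 / ((1 + \<tau>) * c powr (\<tau> - \<rho>)) > u) (at_right 0)"
      using u by (rule order_tendstoD)
    then obtain \<tau> where \<tau>: "\<tau> > 0" "1 / ((1 + \<tau>) * c powr (\<tau> - \<rho>)) > u" by (rule ex_small_right)
    obtain x0 where x0: "x0 \<ge> 1" "\<forall>x\<ge>x0. f x > 0 \<and> (\<forall>y\<ge>x. f y \<le> (1 + \<tau>) * (y / x) powr (\<rho> + \<tau>) * f x \<and>
        f x \<le> (1 + \<tau>) * (y / x) powr (\<tau> - \<rho>) * f y)"
      using f \<tau> unfolding potter_bounds_def by blast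
    show "eventually (\<lambda>x. u < f (c * x) / f x) at_top"
      using eventually_ge_at_top[of x0]
    proof eventually_elim
      case (elim x)
      have cx: "c * x \<ge> x" using c elim x0 mult_right_mono[of 1 c x] by simp
      have fx: "f x > 0" using x0 elim by blast
      have "f x \<le> (1 + \<tau>) * (c * x / x) powr (\<tau> - \<rho>) * f (c * x)" using x0(2) elim cx by blast
      also have "c * x / x = c" using elim x0 by simp
      finally have le: "f x \<le> (1 + \<tau>) * c powr (\<tau> - \<rho>) * f (c * x)" .
      have Q: "(1 + \<tau>) * c powr (\<tau> - \<rho>) > 0" using \<tau> c by simp
      have "1 / Q \<le> f (c * x) / f x" if "Q > 0" "f x \<le> Q * f (c * x)" for Q
        using that fx by (simp add: field_simps)
      from this[OF Q le] have "1 / ((1 + \<tau>) * c powr (\<tau> - \<rho>)) \<le> f (c * x) / f x" .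
      with \<tau>(2) show ?case by linarith
    qed
  next
    fix u assume u: "c powr \<rho> < u"
    have "((\<lambda>\<tau>. (1 + \<tau>) * c powr (\<rho> + \<tau>)) \<longlongrightarrow> (1 + 0) * c powr (\<rho> + 0)) (at_right (0::real))"
      using c by (intro tendsto_intros) auto
    then have "((\<lambda>\<tau>. (1 + \<tau>) * c powr (\<rho> + \<tau>)) \<longlongrightarrow> c powr \<rho>) (at_right (0::real))" by simp
    then have "eventually (\<lambda>\<tau>. (1 + \<tau>) * c powr (\<rho> + \<tau>) < u) (at_right 0)"
      using u by (rule order_tendstoD)
    then obtain \<tau> where \<tau>: "\<tau> > 0" "(1 + \<tau>) * c powr (\<rho> + \<tau>) < u" by (rule ex_small_right)
    obtain x0 where x0: "x0 \<ge> 1" "\<forall>x\<ge>x0. f x > 0 \<and> (\<forall>y\<ge>x. f y \<le> (1 + \<tau>) * (y / x) powr (\<rho> + \<tau>) * f x \<and>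
        f x \<le> (1 + \<tau>) * (y / x) powr (\<tau> - \<rho>) * f y)"
      using f \<tau> unfolding potter_bounds_def by blast
    show "eventually (\<lambda>x. f (c * x) / f x < u) at_top"
      using eventually_ge_at_top[of x0]
    proof eventually_elim
      case (elim x)
      have cx: "c * x \<ge> x" using c elim x0 mult_right_mono[of 1 c x] by simp
      have fx: "f x > 0" using x0 elim by blast
      have "f (c * x) \<le> (1 + \<tau>) * (c * x / x) powr (\<rho> + \<tau>) * f x" using x0(2) elim cx by blast
      also have "c * x / x = c" using elim x0 by simp
      finally have "f (c * x) / f x \<le> (1 + \<tau>) * c powr (\<rho> + \<tau>)" using fx by (simp add: pos_divide_le_eq)
      with \<tau>(2) show ?case by linarith
    qed
  qed
  show ?thesis
  proof (cases "c \<ge> 1")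
    case False
    have top: "filterlim (\<lambda>x. c * x) at_top at_top"
      using c by (intro filterlim_tendsto_pos_mult_at_top[OF tendsto_const] filterlim_ident) auto
    have "((\<lambda>x. f ((1 / c) * (c * x)) / f (c * x)) \<longlongrightarrow> (1 / c) powr \<rho>) at_top"
      by (rule filterlim_compose[OF ge1 top]) (use c False in simp)
    then have "((\<lambda>x. 1 / (f x / f (c * x))) \<longlongrightarrow> 1 / (1 / c) powr \<rho>) at_top"
      using c by (intro tendsto_intros) auto
    then show ?thesis using c by (simp add: powr_divide)
  qed (rule ge1)
qed

context attracted_walk
begin

text \<open>A(a_N) / A(x) tends to t, and A(x / d) / A(x) tends to d^(-\<alpha>). As
  \<open>A\<close> is monotone, comparing the two limits orders a_N and x / d.\<close>

lemma x_over_a_limit: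
  assumes t: "t > 0"
  shows "(\<lambda>x. real x / a (N x t)) \<longlonglongrightarrow> t powr (- 1 / \<alpha>)"
proof -
  define c where "c = t powr (- 1 / \<alpha>)"
  have c: "c > 0" using t by (simp add: c_def)
  have ct: "c powr - \<alpha> = t" using t alpha by (simp add: c_def powr_powr)
  have Aeq: "eventually (\<lambda>x. A (a (N x t)) = real (N x t)) sequentially"
    by (rule eventually_compose_filterlim[OF A_a N_top[OF t]])
  have ratio: "(\<lambda>x. A ((1 / d) * real x) / A (real x)) \<longlonglongrightarrow> d powr - \<alpha>" if d: "d > 0" for d
  proof -
    have "(\<lambda>x. A ((1 / d) * real x) / A (real x)) \<longlonglongrightarrow> (1 / d) powr \<alpha>"
      by (rule filterlim_compose[OF potter_ratio_limit[OF A_potter] filterlim_real_sequentially]) (use d in simp)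
    then show ?thesis using d by (simp add: powr_divide powr_minus_divide)
  qed
  show ?thesis unfolding c_def[symmetric]
  proof (rule order_tendstoI)
    fix d assume d: "c < d"
    have "d powr - \<alpha> < c powr - \<alpha>" using d c alpha by (intro powr_less_mono2_neg) auto
    then have "d powr - \<alpha> < t" by (simp add: ct)
    then obtain m where m: "d powr - \<alpha> < m" "m < t" using dense by blast
    have "d > 0" using c d by simp
    then have "eventually (\<lambda>x. A ((1 / d) * real x) / A (real x) < m) sequentially"
      using order_tendstoD(2)[OF ratio m(1)] by simp
    moreover have "eventually (\<lambda>x. m < real (N x t) / A (real x)) sequentially"
      by (rule order_tendstoD(1)[OF N_limit[OF t] m(2)])
    ultimately show "eventually (\<lambda>x. real x / a (N x t) < d) sequentially" using Aeq
    proof eventually_elim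
      case (elim x)
      then have "A ((1 / d) * real x) / A (real x) < A (a (N x t)) / A (real x)" by simp
      then have "A ((1 / d) * real x) < A (a (N x t))" by (simp add: divide_less_cancel)
      then have "(1 / d) * real x < a (N x t)" using A_mono by (meson not_le)
      then show ?case using \<open>d > 0\<close> by (simp add: pos_divide_less_eq field_simps)
    qed
  next
    fix d assume d: "d < c"
    show "eventually (\<lambda>x. d < real x / a (N x t)) sequentially"
    proof (cases "d > 0")
      case True
      have "c powr - \<alpha> < d powr - \<alpha>" using d True alpha by (intro powr_less_mono2_neg) auto
      then have "t < d powr - \<alpha>" by (simp add: ct)
      then obtain m where m: "m < d powr - \<alpha>" "t < m" using dense by blast
      have "eventually (\<lambda>x. m < A ((1 / d) * real x) / A (real x)) sequentially"
        using order_tendstoD(1)[OF ratio m(1)] True by simp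
      moreover have "eventually (\<lambda>x. real (N x t) / A (real x) < m) sequentially"
        by (rule order_tendstoD(2)[OF N_limit[OF t] m(2)])
      ultimately show ?thesis using Aeq
      proof eventually_elim
        case (elim x)
        then have "A (a (N x t)) / A (real x) < A ((1 / d) * real x) / A (real x)" by simp
        then have "A (a (N x t)) < A ((1 / d) * real x)" by (simp add: divide_less_cancel)
        then have "a (N x t) < (1 / d) * real x" using A_mono by (meson not_le)
        then show ?case using True by (simp add: pos_less_divide_eq field_simps)
      qed
    next
      case False
      show ?thesis using eventually_gt_at_top[of 0]
      proof eventually_elim
        case (elim x)
        then have "real x / a (N x t) > 0" by simp
        with False show ?case by linarith
      qed
    qed
  qed
qed

lemma cdf_mono: "s \<le> t \<Longrightarrow> cdf \<mu> s \<le> cdf \<mu> t"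
  by (rule cdf_nondecreasing)

text \<open>c x / a_N converges to a positive limit y0, a continuity point. By monotonicity of
  \<open>Fd\<close> the argument c x is enclosed between y a_N for fixed y on either side of
  y0.\<close>

lemma Fd_limit:
  assumes "c > 0" "t > 0"
  shows "(\<lambda>x. Fd (N x t) (c * real x)) \<longlonglongrightarrow> cdf \<mu> (c * t powr (- 1 / \<alpha>))"
proof -
  define y0 where "y0 = c * t powr (- 1 / \<alpha>)"
  have y0: "y0 > 0" using assms by (simp add: y0_def)
  have yl: "(\<lambda>x. c * (real x / a (N x t))) \<longlonglongrightarrow> y0"
    unfolding y0_def by (intro tendsto_mult tendsto_const x_over_a_limit assms)
  have lim: "(\<lambda>x. Fd (N x t) (y * a (N x t))) \<longlonglongrightarrow> cdf \<mu> y" if "y > 0" for y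
    unfolding Fd_def by (rule filterlim_compose[OF weak_limit[OF that cdf_isCont[OF that]] N_top[OF assms(2)]])
  have cont: "(cdf \<mu> \<longlongrightarrow> cdf \<mu> y0) (at y0)" using cdf_isCont[OF y0] by (simp add: isCont_def)
  show ?thesis unfolding y0_def[symmetric]
  proof (rule order_tendstoI)
    fix u assume "u > cdf \<mu> y0"
    then have "eventually (\<lambda>y. cdf \<mu> y < u) (at_right y0)"
      using order_tendstoD(2)[OF cont] by (simp add: eventually_at_split)
    then obtain w where w: "w > y0" "\<And>y. y0 < y \<Longrightarrow> y < w \<Longrightarrow> cdf \<mu> y < u"
      by (auto simp: eventually_at_right_field)
    obtain y where y: "y0 < y" "y < w" using dense[OF w(1)] by blast
    have "eventually (\<lambda>x. Fd (N x t) (y * a (N x t)) < u) sequentially"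
      using w(2)[OF y] y y0 by (intro order_tendstoD(2)[OF lim]) auto
    moreover have "eventually (\<lambda>x. c * (real x / a (N x t)) < y) sequentially"
      by (rule order_tendstoD(2)[OF yl y(1)])
    ultimately show "eventually (\<lambda>x. Fd (N x t) (c * real x) < u) sequentially"
    proof eventually_elim
      case (elim x)
      then have "c * real x \<le> y * a (N x t)" by (simp add: pos_divide_less_eq)
      then show ?case using Fd_mono elim(1) by (meson le_less_trans)
    qed
  next
    fix u assume "u < cdf \<mu> y0"
    then have "eventually (\<lambda>y. u < cdf \<mu> y) (at_left y0)"
      using order_tendstoD(1)[OF cont] by (simp add: eventually_at_split)
    then obtain w where w: "w < y0" "\<And>y. w < y \<Longrightarrow> y < y0 \<Longrightarrow> u < cdf \<mu> y"
      by (auto simp: eventually_at_left_field)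
    have "max w 0 < y0" using w y0 by simp
    then obtain y where y: "max w 0 < y" "y < y0" using dense by blast
    have "eventually (\<lambda>x. u < Fd (N x t) (y * a (N x t))) sequentially"
      using w(2)[of y] y by (intro order_tendstoD(1)[OF lim]) auto
    moreover have "eventually (\<lambda>x. y < c * (real x / a (N x t))) sequentially"
      by (rule order_tendstoD(1)[OF yl y(2)])
    ultimately show "eventually (\<lambda>x. u < Fd (N x t) (c * real x)) sequentially"
    proof eventually_elim
      case (elim x)
      then have "y * a (N x t) \<le> c * real x" by (simp add: pos_less_divide_eq)
      then show ?case using Fd_mono elim(1) by (meson less_le_trans)
    qed
  qed
qed

text \<open>H(t) = P(Y^(-\<alpha>) >= t), the limit of P(S_n <= x) when n is asymptotic to t
  A(x).\<close>

definition H :: "real \<Rightarrow> real" where "H t = cdf \<mu> (t powr (- 1 / \<alpha>))"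

lemma H_antimono: "0 < u \<Longrightarrow> u \<le> v \<Longrightarrow> H v \<le> H u"
  unfolding H_def using alpha by (intro cdf_mono powr_mono2') auto

lemma H_continuous: "S \<subseteq> {0<..} \<Longrightarrow> continuous_on S H"
proof -
  have "isCont H t" if "t > 0" for t
  proof -
    have "isCont (cdf \<mu>) (t powr (- 1 / \<alpha>))" using that by (intro cdf_isCont) simp
    moreover have "isCont (\<lambda>t. t powr (- 1 / \<alpha>)) t" using that by (intro continuous_intros) auto
    ultimately show ?thesis unfolding H_def[abs_def] using isCont_o2 by blast
  qed
  then show "continuous_on S H" if "S \<subseteq> {0<..}"
    using that by (intro continuous_at_imp_continuous_on) auto
qed

lemma H_scale: "c > 0 \<Longrightarrow> t > 0 \<Longrightarrow> cdf \<mu> (c * t powr (- 1 / \<alpha>)) = H (c powr - \<alpha> * t)"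
  unfolding H_def using alpha by (simp add: powr_mult powr_powr)

lemma Riemann_Fd:
  assumes s: "0 < s" "s < s'" and c: "c > 0"
  shows "(\<lambda>x. (\<Sum>n\<in>{N x s<..N x s'}. Fd n (c * real x)) / A (real x)) \<longlonglongrightarrow> integral {s..s'} (\<lambda>t. H (c powr - \<alpha> * t))"
proof (rule antimono_Riemann_limit[OF s])
  show "(\<lambda>x. Fd (N x t) (c * real x)) \<longlonglongrightarrow> H (c powr - \<alpha> * t)" if "t > 0" for t
    using Fd_limit[OF c that] unfolding H_scale[OF c that] .
  show "H (c powr - \<alpha> * v) \<le> H (c powr - \<alpha> * u)" if "0 < u" "u \<le> v" for u v
    using that c by (intro H_antimono mult_left_mono) auto
  show "continuous_on {s..s'} (\<lambda>t. H (c powr - \<alpha> * t))"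
  proof (rule continuous_on_compose2[OF H_continuous[OF order_refl]])
    show "(\<lambda>t. c powr - \<alpha> * t) ` {s..s'} \<subseteq> {0<..}"
      by (rule image_subsetI) (use s c in simp)
  qed (intro continuous_intros)
qed (auto intro: N_mono N_limit Fd_antimono)

text \<open>Divided by 1/q - 1, the difference approximates minus the integral of t dH(t) as q tends
  to 1. Monotonicity of \<open>H\<close> encloses it without a density; the terms H(q s) - H(s) and
  H(q s') - H(s') vanish in the limit.\<close>

lemma integral_H_stretch:
  assumes s: "0 < s" "s < s'" and q: "0 < q" "q < 1"
  shows "integral {s..s'} (\<lambda>t. H (q * t)) - integral {s..s'} H
      \<le> (1 / q - 1) * (s' * (H s - H s') + s * (H (q * s) - H s))"
    and "integral {s..s'} (\<lambda>t. H (q * t)) - integral {s..s'} H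
      \<ge> (1 / q - 1) * (s * (H s - H s') - s' * (H (q * s') - H s'))"
proof -
  have int: "H integrable_on {u..v}" if "u > 0" for u v
    using that by (intro integrable_continuous_interval H_continuous) auto
  have qs: "0 < q * s" "q * s \<le> s" "q * s' \<le> s'" "q * s \<le> q * s'" "0 < q * s'"
    using s q by (auto simp: mult_le_cancel_right1)
  have "((\<lambda>t. H (q * t)) has_integral (1 / \<bar>q\<bar>) *\<^sub>R integral {q * s..q * s'} H) ((\<lambda>t. t / q) ` {q * s..q * s'})"
    using q by (intro has_integral_stretch_real integrable_integral int qs) auto
  moreover have "(\<lambda>t. t / q) ` {q * s..q * s'} = {s..s'}"
  proof -
    have "(\<lambda>t. t / q) ` {q * s..q * s'} = (*) (1 / q) ` {q * s..q * s'}" by (simp add: divide_inverse mult.commute)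
    also have "\<dots> = {s..s'}" using q s by (subst image_mult_atLeastAtMost) auto
    finally show ?thesis .
  qed
  ultimately have e1: "integral {s..s'} (\<lambda>t. H (q * t)) = (1 / q) * integral {q * s..q * s'} H"
    using q by (simp add: integral_unique)
  have "integral {q * s..q * s'} H + integral {q * s'..s'} H = integral {q * s..s'} H"
    using qs by (intro Henstock_Kurzweil_Integration.integral_combine int) auto
  moreover have "integral {q * s..s} H + integral {s..s'} H = integral {q * s..s'} H"
    using qs s by (intro Henstock_Kurzweil_Integration.integral_combine int) auto
  ultimately have e2: "integral {q * s..q * s'} H = integral {q * s..s} H + integral {s..s'} H - integral {q * s'..s'} H"
    by linarith
  have bd: "(v - u) * H v \<le> integral {u..v} H" "integral {u..v} H \<le> (v - u) * H u" if "0 < u" "u \<le> v" for u v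
  proof -
    have "integral {u..v} (\<lambda>_. H v) \<le> integral {u..v} H"
      using that by (intro integral_le int H_antimono) auto
    then show "(v - u) * H v \<le> integral {u..v} H" using that by simp
    have "integral {u..v} H \<le> integral {u..v} (\<lambda>_. H u)"
      using that by (intro integral_le int H_antimono) auto
    then show "integral {u..v} H \<le> (v - u) * H u" using that by simp
  qed
  define r where "r = 1 / q - 1"
  have r: "r > 0" "1 / q = 1 + r" using q by (auto simp: r_def field_simps)
  have rq: "(1 + r) * (1 - q) = r" using q by (simp add: r_def field_simps)
  have eq: "integral {s..s'} (\<lambda>t. H (q * t)) - integral {s..s'} H
      = (1 + r) * (integral {q * s..s} H - integral {q * s'..s'} H) + r * integral {s..s'} H"
    unfolding e1 e2 r(2) by (simp add: algebra_simps)
  have "(1 + r) * (integral {q * s..s} H - integral {q * s'..s'} H) \<le> (1 + r) * ((s - q * s) * H (q * s) - (s' - q * s') * H s')"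
    using bd(2)[OF qs(1,2)] bd(1)[OF qs(5,3)] r by (intro mult_left_mono diff_mono) auto
  also have "\<dots> = ((1 + r) * (1 - q)) * (s * H (q * s) - s' * H s')" by (simp add: algebra_simps)
  also have "\<dots> = r * (s * H (q * s) - s' * H s')" by (simp only: rq)
  finally have "integral {s..s'} (\<lambda>t. H (q * t)) - integral {s..s'} H \<le> r * (s * H (q * s) - s' * H s') + r * ((s' - s) * H s)"
    unfolding eq by (rule add_mono) (intro mult_left_mono bd(2); use s r in simp)
  then show "integral {s..s'} (\<lambda>t. H (q * t)) - integral {s..s'} H
      \<le> (1 / q - 1) * (s' * (H s - H s') + s * (H (q * s) - H s))"
    unfolding r_def[symmetric] by (simp add: algebra_simps)
  have "(1 + r) * ((s - q * s) * H s - (s' - q * s') * H (q * s')) \<le> (1 + r) * (integral {q * s..s} H - integral {q * s'..s'} H)"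
    using bd(1)[OF qs(1,2)] bd(2)[OF qs(5,3)] r by (intro mult_left_mono diff_mono) auto
  also have "(1 + r) * ((s - q * s) * H s - (s' - q * s') * H (q * s')) = ((1 + r) * (1 - q)) * (s * H s - s' * H (q * s'))" by (simp add: algebra_simps)
  also have "\<dots> = r * (s * H s - s' * H (q * s'))" by (simp only: rq)
  finally have "r * (s * H s - s' * H (q * s')) + r * ((s' - s) * H s') \<le> integral {s..s'} (\<lambda>t. H (q * t)) - integral {s..s'} H"
    unfolding eq by (rule add_mono) (intro mult_left_mono bd(1); use s r in simp)
  then show "integral {s..s'} (\<lambda>t. H (q * t)) - integral {s..s'} H
      \<ge> (1 / q - 1) * (s * (H s - H s') - s' * (H (q * s') - H s'))"
    unfolding r_def[symmetric] by (simp add: algebra_simps)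
qed

text \<open>P(S_n = x), summed over the block, is replaced by its average over (x, (1 + \<eta>)x] at
  a cost proportional to \<eta>. The average is a difference of distribution functions and
  converges; \<eta> is taken small last. The factors s and s' instead of an exact limit are enough,
  since blocks are refined later.\<close>

lemma block_limit:
  assumes s: "0 < s" "s < s'" and \<kappa>: "\<kappa> > 0"
  shows "eventually (\<lambda>x. \<alpha> * s * (H s - H s') - \<kappa> \<le> real x / A (real x) * (\<Sum>n\<in>{N x s<..N x s'}. P n x) \<and>
     real x / A (real x) * (\<Sum>n\<in>{N x s<..N x s'}. P n x) \<le> \<alpha> * s' * (H s - H s') + \<kappa>) sequentially"
proof -
  obtain C where C: "C > 0"
    "\<And>N N' x y. N \<ge> 1 \<Longrightarrow> N \<le> N' \<Longrightarrow> \<bar>\<Sum>n\<in>{N..<N'}. P n x - P n y\<bar>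
       \<le> C * (\<bar>real x - real y\<bar> * real (N' - N) / (a N)\<^sup>2 + 1 / a N)"
    using block_equicontinuity by blast
  define c where "c = s powr (- 1 / \<alpha>)"
  \<comment> \<open>E \<eta> is the limit of the averaging error; \<open>c\<close> is the limit of x
    / a_n at the first time of the block.\<close>
  define E where "E = C * c\<^sup>2 * (s' - s)"
  define q where "q = (\<lambda>\<eta>::real. (1 + \<eta>) powr - \<alpha>)"
  \<comment> \<open>A difference quotient of (1 + \<eta>)^\<alpha> at \<eta> = 0; its limit is the
    source of the factor \<alpha>.\<close>
  define r where "r = (\<lambda>\<eta>. (1 / q \<eta> - 1) / \<eta>)"
  define up where "up = (\<lambda>\<eta>. r \<eta> * (s' * (H s - H s') + s * (H (q \<eta> * s) - H s)) + E * \<eta>)"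
  define lo where "lo = (\<lambda>\<eta>. r \<eta> * (s * (H s - H s') - s' * (H (q \<eta> * s') - H s')) - E * \<eta>)"
  have id: "((\<lambda>\<eta>. \<eta>) \<longlongrightarrow> (0::real)) (at_right 0)" by (rule tendsto_ident_at)
  have rlim: "(r \<longlongrightarrow> \<alpha>) (at_right 0)"
  proof -
    have "((\<lambda>y. y powr \<alpha>) has_real_derivative \<alpha> * 1 powr (\<alpha> - 1)) (at 1)"
      by (rule has_real_derivative_powr) simp
    then have "((\<lambda>h. ((1 + h) powr \<alpha> - 1 powr \<alpha>) / h) \<longlongrightarrow> \<alpha>) (at 0)" by (simp add: DERIV_def)
    then have "((\<lambda>h. ((1 + h) powr \<alpha> - 1) / h) \<longlongrightarrow> \<alpha>) (at_right 0)"
      by (simp add: filterlim_at_split)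
    moreover have "eventually (\<lambda>\<eta>. ((1 + \<eta>) powr \<alpha> - 1) / \<eta> = r \<eta>) (at_right 0)"
      using eventually_at_right_less[of 0]
    proof eventually_elim
      case (elim \<eta>)
      then show ?case by (simp add: r_def q_def powr_minus_divide)
    qed
    ultimately show ?thesis by (rule Lim_transform_eventually)
  qed
  have "((\<lambda>\<eta>. (1 + \<eta>) powr - \<alpha>) \<longlongrightarrow> (1 + 0) powr - \<alpha>) (at_right (0::real))"
    by (intro tendsto_intros id) auto
  then have qlim: "(q \<longlongrightarrow> 1) (at_right 0)" by (simp add: q_def)
  have Hq: "((\<lambda>\<eta>. H (q \<eta> * t)) \<longlongrightarrow> H t) (at_right 0)" if t: "t > 0" for t
  proof -
    have "continuous_on {0<..} H" by (rule H_continuous) simp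
    then have "isCont H t" using t by (simp add: continuous_on_eq_continuous_at)
    moreover have "((\<lambda>\<eta>. q \<eta> * t) \<longlongrightarrow> 1 * t) (at_right 0)" by (intro tendsto_mult qlim tendsto_const)
    ultimately show ?thesis using isCont_tendsto_compose[of t H "\<lambda>\<eta>. q \<eta> * t" "at_right 0"] by simp
  qed
  have "(up \<longlongrightarrow> \<alpha> * (s' * (H s - H s') + s * (H s - H s)) + E * 0) (at_right 0)"
    unfolding up_def using s by (intro tendsto_intros rlim Hq id) auto
  then have up: "(up \<longlongrightarrow> \<alpha> * s' * (H s - H s')) (at_right 0)" by (simp add: mult.assoc)
  have "(lo \<longlongrightarrow> \<alpha> * (s * (H s - H s') - s' * (H s' - H s')) - E * 0) (at_right 0)"
    unfolding lo_def using s by (intro tendsto_intros rlim Hq id) auto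
  then have lo: "(lo \<longlongrightarrow> \<alpha> * s * (H s - H s')) (at_right 0)" by (simp add: mult.assoc)
  have "eventually (\<lambda>\<eta>. up \<eta> < \<alpha> * s' * (H s - H s') + \<kappa> \<and> lo \<eta> > \<alpha> * s * (H s - H s') - \<kappa>) (at_right 0)"
    using \<kappa> by (intro eventually_conj order_tendstoD(2)[OF up] order_tendstoD(1)[OF lo]) auto
  then obtain \<eta> where \<eta>: "\<eta> > 0" and "up \<eta> < \<alpha> * s' * (H s - H s') + \<kappa> \<and> lo \<eta> > \<alpha> * s * (H s - H s') - \<kappa>"
    by (rule ex_small_right)
  then have \<eta>up: "up \<eta> < \<alpha> * s' * (H s - H s') + \<kappa>" and \<eta>lo: "lo \<eta> > \<alpha> * s * (H s - H s') - \<kappa>" by auto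
  have q: "0 < q \<eta>" "q \<eta> < 1"
    using \<eta> alpha powr_less_mono[of "- \<alpha>" 0 "1 + \<eta>"] by (auto simp: q_def)
  define I where "I = integral {s..s'} (\<lambda>t. H (q \<eta> * t)) - integral {s..s'} H"
  have Iup: "I / \<eta> + E * \<eta> \<le> up \<eta>"
    using divide_right_mono[OF integral_H_stretch(1)[OF s q], of \<eta>] \<eta> by (simp add: I_def up_def r_def)
  have Ilo: "I / \<eta> - E * \<eta> \<ge> lo \<eta>"
    using divide_right_mono[OF integral_H_stretch(2)[OF s q], of \<eta>] \<eta> by (simp add: I_def lo_def r_def)
  define U where "U = (\<lambda>x z. \<Sum>n\<in>{N x s<..N x s'}. P n z)"
  define L where "L = (\<lambda>x::nat. nat \<lfloor>\<eta> * real x\<rfloor>)"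
  define W where "W = (\<lambda>x. \<Sum>n\<in>{N x s<..N x s'}. Fd n ((1 + \<eta>) * real x) - Fd n (1 * real x))"
  have Wlim: "(\<lambda>x. W x / A (real x)) \<longlonglongrightarrow> I"
  proof -
    have "(\<lambda>x. (\<Sum>n\<in>{N x s<..N x s'}. Fd n ((1 + \<eta>) * real x)) / A (real x) - (\<Sum>n\<in>{N x s<..N x s'}. Fd n (1 * real x)) / A (real x))
       \<longlonglongrightarrow> integral {s..s'} (\<lambda>t. H ((1 + \<eta>) powr - \<alpha> * t)) - integral {s..s'} (\<lambda>t. H (1 powr - \<alpha> * t))"
      using \<eta> by (intro tendsto_diff Riemann_Fd s) auto
    then show ?thesis by (simp add: W_def I_def q_def sum_subtractf diff_divide_distrib)
  qed
  have Llim: "(\<lambda>x. real (L x) / real x) \<longlonglongrightarrow> \<eta>"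
  proof (rule tendsto_sandwich)
    show "eventually (\<lambda>x. \<eta> - 1 / real x \<le> real (L x) / real x) sequentially"
      using eventually_gt_at_top[of 0]
    proof eventually_elim
      case (elim x)
      have "\<eta> * real x - 1 \<le> real (L x)" unfolding L_def by linarith
      then have "(\<eta> * real x - 1) / real x \<le> real (L x) / real x" by (rule divide_right_mono) simp
      then show ?case using elim by (simp add: diff_divide_distrib)
    qed
    show "eventually (\<lambda>x. real (L x) / real x \<le> \<eta>) sequentially"
      using eventually_gt_at_top[of 0]
    proof eventually_elim
      case (elim x)
      have "0 \<le> \<eta> * real x" using \<eta> by simp
      then have "real (L x) \<le> \<eta> * real x" unfolding L_def by linarith
      then show ?case using elim by (simp add: field_simps)
    qed
    have "(\<lambda>x. \<eta> - 1 / real x) \<longlonglongrightarrow> \<eta> - 0" by (intro tendsto_diff tendsto_const lim_1_over_n)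
    then show "(\<lambda>x. \<eta> - 1 / real x) \<longlonglongrightarrow> \<eta>" by simp
  qed simp
  define err where "err = (\<lambda>x. C * ((real (L x) / real x) * (real x / a (N x s))\<^sup>2 * ((real (N x s') - real (N x s)) / A (real x))
      + (real x / a (N x s)) * (1 / A (real x))))"
  have "err \<longlonglongrightarrow> C * (\<eta> * c\<^sup>2 * (s' - s) + c * 0)"
    unfolding err_def c_def diff_divide_distrib
    using s
    by (intro tendsto_mult tendsto_add tendsto_const tendsto_power tendsto_diff Llim x_over_a_limit N_limit
        tendsto_divide_0[OF tendsto_const] filterlim_at_top_imp_at_infinity A_top) auto
  then have errlim: "err \<longlonglongrightarrow> E * \<eta>" by (simp add: E_def mult_ac)
  have main: "eventually (\<lambda>x. \<bar>real x / A (real x) * U x x - (W x / A (real x)) / (real (L x) / real x)\<bar> \<le> err x) sequentially"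
  proof -
    have "eventually (\<lambda>x. real (L x) / real x > 0) sequentially" by (rule order_tendstoD(1)[OF Llim \<eta>])
    then show ?thesis using eventually_gt_at_top[of 0]
    proof eventually_elim
      case (elim x)
      have Lx: "real (L x) > 0" using elim by (simp add: zero_less_divide_iff)
      define M where "M = N x s"
      define M' where "M' = N x s'"
      have MM: "M \<le> M'" using N_mono[of s s' x] s by (simp add: M_def M'_def)
      \<comment> \<open>The block excludes its left end, so the comparison starts at
        \<open>Suc M\<close>; monotonicity of \<open>a\<close> allows \<open>a M\<close> in the
        error term.\<close>
      have blk: "{M<..M'} = {Suc M..<Suc M'}" by auto
      define e0 where "e0 = C * (real (L x) * (real M' - real M) / (a M)\<^sup>2 + 1 / a M)"
      have e0: "\<bar>U x x - U x z\<bar> \<le> e0" if z: "z \<in> {x<..x + L x}" for z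
      proof -
        have "\<bar>U x x - U x z\<bar> = \<bar>\<Sum>n\<in>{Suc M..<Suc M'}. P n x - P n z\<bar>"
          unfolding U_def M_def[symmetric] M'_def[symmetric] blk by (simp add: sum_subtractf)
        also have "\<dots> \<le> C * (\<bar>real x - real z\<bar> * real (Suc M' - Suc M) / (a (Suc M))\<^sup>2 + 1 / a (Suc M))"
          using MM by (intro C(2)) auto
        also have "\<dots> \<le> e0"
          unfolding e0_def
        proof (intro mult_left_mono add_mono frac_le mult_mono)
          show "\<bar>real x - real z\<bar> \<le> real (L x)" using z by auto
          show "real (Suc M' - Suc M) \<le> real M' - real M" using MM by (simp add: of_nat_diff)
          have am: "a M \<le> a (Suc M)" by (rule a_mono) simp
          then show "a M \<le> a (Suc M)" .
          show "(a M)\<^sup>2 \<le> (a (Suc M))\<^sup>2" using am by (intro power_mono) auto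
        qed (use C MM in auto)
        finally show ?thesis .
      qed
      have Weq: "W x = (\<Sum>z\<in>{x<..x + L x}. U x z)"
      proof -
        have fl: "nat \<lfloor>(1 + \<eta>) * real x\<rfloor> = x + L x"
        proof -
          have "\<lfloor>(1 + \<eta>) * real x\<rfloor> = int x + \<lfloor>\<eta> * real x\<rfloor>" by (simp add: distrib_right)
          moreover have "\<lfloor>\<eta> * real x\<rfloor> \<ge> 0" using \<eta> by simp
          ultimately show ?thesis by (simp add: L_def nat_add_distrib)
        qed
        have "Fd n ((1 + \<eta>) * real x) - Fd n (1 * real x) = (\<Sum>z\<in>{x<..x + L x}. P n z)" for n
        proof -
          have "{..x + L x} = {..x} \<union> {x<..x + L x}" by auto
          moreover have "sum (P n) ({..x} \<union> {x<..x + L x}) = sum (P n) {..x} + sum (P n) {x<..x + L x}"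
            by (rule sum.union_disjoint) auto
          ultimately show ?thesis by (simp add: Fd_def fl)
        qed
        then show ?thesis unfolding W_def U_def by (simp only: sum.swap[of _ "{x<..x + L x}"])
      qed
      have "real (L x) * U x x - W x = (\<Sum>z\<in>{x<..x + L x}. U x x - U x z)" by (simp add: Weq sum_subtractf)
      then have "\<bar>real (L x) * U x x - W x\<bar> \<le> (\<Sum>z\<in>{x<..x + L x}. \<bar>U x x - U x z\<bar>)" by simp
      also have "\<dots> \<le> (\<Sum>z\<in>{x<..x + L x}. e0)" by (intro sum_mono e0)
      also have "\<dots> = real (L x) * e0" by simp
      finally have b1: "\<bar>real (L x) * U x x - W x\<bar> \<le> real (L x) * e0" .
      have "\<bar>real x / A (real x) * U x x - (W x / A (real x)) / (real (L x) / real x)\<bar>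
          = \<bar>real x / (A (real x) * real (L x)) * (real (L x) * U x x - W x)\<bar>"
        using Lx elim(2) by (intro arg_cong[where f = abs]) (simp add: field_simps)
      also have "\<dots> = real x / (A (real x) * real (L x)) * \<bar>real (L x) * U x x - W x\<bar>" by (simp add: abs_mult)
      also have "\<dots> \<le> real x / (A (real x) * real (L x)) * (real (L x) * e0)" by (intro mult_left_mono b1) auto
      also have "\<dots> = real x / A (real x) * e0" using Lx by simp
      also have "\<dots> = err x"
        using elim(2) by (simp add: err_def e0_def M_def M'_def power2_eq_square field_simps)
      finally show ?case .
    qed
  qed
  have "(\<lambda>x. (W x / A (real x)) / (real (L x) / real x)) \<longlonglongrightarrow> I / \<eta>"
    using \<eta> by (intro tendsto_divide Wlim Llim) auto
  then have "(\<lambda>x. (W x / A (real x)) / (real (L x) / real x) + err x) \<longlonglongrightarrow> I / \<eta> + E * \<eta>"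
    "(\<lambda>x. (W x / A (real x)) / (real (L x) / real x) - err x) \<longlonglongrightarrow> I / \<eta> - E * \<eta>"
    by (intro tendsto_add tendsto_diff errlim; assumption)+
  then have "eventually (\<lambda>x. (W x / A (real x)) / (real (L x) / real x) + err x < \<alpha> * s' * (H s - H s') + \<kappa>) sequentially"
    "eventually (\<lambda>x. (W x / A (real x)) / (real (L x) / real x) - err x > \<alpha> * s * (H s - H s') - \<kappa>) sequentially"
    using \<eta>up \<eta>lo Iup Ilo by (auto intro: order_tendstoD(2)[where y = "I / \<eta> + E * \<eta>"] order_tendstoD(1)[where y = "I / \<eta> - E * \<eta>"])
  with main show ?thesis unfolding U_def
  proof eventually_elim
    case (elim x)
    then show ?case unfolding abs_le_iff by (intro conjI; linarith)
  qed
qed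

text \<open>The event u <= Y^(-\<alpha>) < v in terms of Y, half-open so that adjacent windows are
  disjoint and fit together.\<close>

definition window :: "real \<Rightarrow> real \<Rightarrow> real set" where
  "window u v = {v powr (- 1 / \<alpha>)<..u powr (- 1 / \<alpha>)}"

definition moment :: "real \<Rightarrow> real \<Rightarrow> real" where
  "moment u v = \<alpha> * (LINT y:window u v|\<mu>. y powr (- \<alpha> * (\<beta> + 1)))"

definition middle :: "real \<Rightarrow> real \<Rightarrow> nat \<Rightarrow> real" where
  "middle u v x = (\<Sum>n\<in>{N x u<..N x v}. b (real n) * P n x) / scale 0 x"

lemma window_mem:
  assumes "0 < u" "u < v" "y \<in> window u v"
  shows "y > 0" "u \<le> y powr - \<alpha>" "y powr - \<alpha> \<le> v"
proof -
  show y: "y > 0" using assms less_trans[of 0 "v powr (- 1 / \<alpha>)" y] by (auto simp: window_def)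
  have "(u powr (- 1 / \<alpha>)) powr - \<alpha> \<le> y powr - \<alpha>"
    using assms y alpha by (intro powr_mono2') (auto simp: window_def)
  then show "u \<le> y powr - \<alpha>" using assms alpha by (simp add: powr_powr)
  have "y powr - \<alpha> \<le> (v powr (- 1 / \<alpha>)) powr - \<alpha>"
    using assms y alpha by (intro powr_mono2') (auto simp: window_def)
  then show "y powr - \<alpha> \<le> v" using assms alpha by (simp add: powr_powr)
qed

lemma window_sets [measurable]: "window u v \<in> sets \<mu>"
  by (simp add: window_def)

lemma measure_window:
  assumes "0 < u" "u < v"
  shows "measure \<mu> (window u v) = H u - H v"
proof -
  have "v powr (- 1 / \<alpha>) < u powr (- 1 / \<alpha>)" using assms alpha by (intro powr_less_mono2_neg) auto
  then show ?thesis using cdf_diff_eq[of "v powr (- 1 / \<alpha>)" "u powr (- 1 / \<alpha>)"] by (simp add: window_def H_def)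
qed

lemma powr_window_bounds:
  fixes e :: real
  assumes u: "0 < u" and \<rho>: "\<rho> > 1" and w: "u \<le> w" "w \<le> \<rho> * u"
  shows "\<rho> powr - \<bar>e\<bar> * u powr e \<le> w powr e" "w powr e \<le> \<rho> powr \<bar>e\<bar> * u powr e"
proof -
  define z where "z = w / u"
  have z: "1 \<le> z" "z \<le> \<rho>" using w u by (auto simp: z_def divide_le_eq)
  have wz: "w powr e = z powr e * u powr e" using u w by (simp add: z_def flip: powr_mult)
  have "z powr e \<le> z powr \<bar>e\<bar>" using z by (intro powr_mono) auto
  also have "\<dots> \<le> \<rho> powr \<bar>e\<bar>" using z by (intro powr_mono2) auto
  finally show "w powr e \<le> \<rho> powr \<bar>e\<bar> * u powr e" unfolding wz by (intro mult_right_mono) auto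
  have "\<rho> powr - \<bar>e\<bar> \<le> z powr - \<bar>e\<bar>" using z by (intro powr_mono2') auto
  also have "\<dots> \<le> z powr e" using z by (intro powr_mono) auto
  finally show "\<rho> powr - \<bar>e\<bar> * u powr e \<le> w powr e" unfolding wz by (intro mult_right_mono) auto
qed

lemma set_integrable_window:
  assumes "0 < u" "u < v"
  shows "set_integrable \<mu> (window u v) (\<lambda>y. y powr e)"
proof -
  define K where "K = max ((v powr (- 1 / \<alpha>)) powr e) ((u powr (- 1 / \<alpha>)) powr e)"
  have "norm (indicator (window u v) y *\<^sub>R y powr e) \<le> K" for y
  proof (cases "y \<in> window u v")
    case True
    have y: "0 < y" "v powr (- 1 / \<alpha>) \<le> y" "y \<le> u powr (- 1 / \<alpha>)"
      using window_mem[OF assms True] True by (auto simp: window_def)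
    have "y powr e \<le> K"
    proof (cases "e \<ge> 0")
      case True
      then have "y powr e \<le> (u powr (- 1 / \<alpha>)) powr e" using y by (intro powr_mono2) auto
      then show ?thesis by (simp add: K_def)
    next
      case False
      then have "y powr e \<le> (v powr (- 1 / \<alpha>)) powr e" using y assms by (intro powr_mono2') auto
      then show ?thesis by (simp add: K_def)
    qed
    then show ?thesis using True by simp
  next
    case False
    have "0 \<le> K" by (simp add: K_def le_max_iff_disj)
    with False show ?thesis by simp
  qed
  then show ?thesis unfolding set_integrable_def by (intro integrable_const_bound[where B = K]) auto
qed

lemma moment_add:
  assumes "0 < u" "u < v" "v < w"
  shows "moment u w = moment u v + moment v w"
proof -
  have "w powr (- 1 / \<alpha>) < v powr (- 1 / \<alpha>)" "v powr (- 1 / \<alpha>) < u powr (- 1 / \<alpha>)"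
    using assms alpha by (auto intro!: powr_less_mono2_neg)
  then have "window u w = window u v \<union> window v w" "window u v \<inter> window v w = {}"
    by (auto simp: window_def)
  then have "(LINT y:window u w|\<mu>. y powr e) = (LINT y:window u v|\<mu>. y powr e) + (LINT y:window v w|\<mu>. y powr e)" for e
    using set_integral_Un[OF _ set_integrable_window[OF assms(1,2)] set_integrable_window[of v w]] assms by simp
  then show ?thesis by (simp only: moment_def distrib_left)
qed

text \<open>The integrand is the power \<beta> + 1 of y^(-\<alpha>), which lies between u and
  \<rho>u on the window, so it is constant up to a power of \<rho>.\<close>

lemma moment_block_bounds:
  assumes u: "0 < u" and \<rho>: "\<rho> > 1"
  defines "Q \<equiv> H u - H (\<rho> * u)"
  shows "\<alpha> * (\<rho> powr - \<bar>\<beta> + 1\<bar> * u powr (\<beta> + 1) * Q) \<le> moment u (\<rho> * u)"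
    and "moment u (\<rho> * u) \<le> \<alpha> * (\<rho> powr \<bar>\<beta> + 1\<bar> * u powr (\<beta> + 1) * Q)"
proof -
  have v: "u < \<rho> * u" using u \<rho> by simp
  have f: "y powr (- \<alpha> * (\<beta> + 1)) = (y powr - \<alpha>) powr (\<beta> + 1)" for y by (simp add: powr_powr)
  have c: "(LINT y:window u (\<rho> * u)|\<mu>. k) = k * Q" for k
    using set_integral_const[of "window u (\<rho> * u)" \<mu> k] measure_window[OF u v] window_sets[of u "\<rho> * u"]
    by (simp add: Q_def mult.commute)
  have ci: "set_integrable \<mu> (window u (\<rho> * u)) (\<lambda>_. k)" for k :: real
    unfolding set_integrable_def by (intro integrable_const_bound[where B = "\<bar>k\<bar>"]) (auto split: split_indicator)
  have "(LINT y:window u (\<rho> * u)|\<mu>. \<rho> powr - \<bar>\<beta> + 1\<bar> * u powr (\<beta> + 1)) \<le> (LINT y:window u (\<rho> * u)|\<mu>. y powr (- \<alpha> * (\<beta> + 1)))"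
    unfolding f by (intro set_integral_mono ci powr_window_bounds u \<rho> set_integrable_window[OF u v, of "- \<alpha> * (\<beta> + 1)", unfolded f])
      (use window_mem[OF u v] in auto)
  then show "\<alpha> * (\<rho> powr - \<bar>\<beta> + 1\<bar> * u powr (\<beta> + 1) * Q) \<le> moment u (\<rho> * u)"
    unfolding moment_def c using alpha by (intro mult_left_mono) auto
  have "(LINT y:window u (\<rho> * u)|\<mu>. y powr (- \<alpha> * (\<beta> + 1))) \<le> (LINT y:window u (\<rho> * u)|\<mu>. \<rho> powr \<bar>\<beta> + 1\<bar> * u powr (\<beta> + 1))"
    unfolding f by (intro set_integral_mono ci powr_window_bounds u \<rho> set_integrable_window[OF u v, of "- \<alpha> * (\<beta> + 1)", unfolded f])
      (use window_mem[OF u v] in auto)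
  then show "moment u (\<rho> * u) \<le> \<alpha> * (\<rho> powr \<bar>\<beta> + 1\<bar> * u powr (\<beta> + 1) * Q)"
    unfolding moment_def c using alpha by (intro mult_left_mono) auto
qed

lemma N_range:
  assumes "0 < u" "0 < v" "n \<in> {N x u<..N x v}"
  shows "u < real n / A (real x)" "real n / A (real x) \<le> v"
proof -
  have "real (N x u) + 1 \<le> real n" using assms by auto
  moreover have "u * A (real x) < real (N x u) + 1" unfolding N_def by linarith
  ultimately show "u < real n / A (real x)" by (simp add: pos_less_divide_eq)
  have "real n \<le> real (N x v)" using assms by auto
  also have "\<dots> \<le> v * A (real x)" using assms by (intro N_le) auto
  finally show "real n / A (real x) \<le> v" by (simp add: pos_divide_le_eq)
qed

text \<open>The uniform convergence theorem for b on compact sets of ratios, in multiplicative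
  form.\<close>

lemma b_uniform:
  assumes uv: "0 < u" "u < v" and \<rho>: "\<rho> > 1"
  shows "eventually (\<lambda>x. \<forall>n\<in>{N x u<..N x v}.
     (1 / \<rho>) * (real n / A (real x)) powr \<beta> \<le> b (real n) / B (real x) \<and>
     b (real n) / B (real x) \<le> \<rho> * (real n / A (real x)) powr \<beta>) sequentially"
proof -
  \<comment> \<open>An upper bound for the ratio n / A(x) and for its inverse, so that the Potter
    errors are at most M^\<tau>.\<close>
  define M where "M = max v (1 / u)"
  have M: "M \<ge> v" "M \<ge> 1 / u" "M > 0" using uv by (auto simp: M_def less_max_iff_disj)
  have "((\<lambda>\<tau>. (1 + \<tau>) * M powr \<tau>) \<longlongrightarrow> (1 + 0) * M powr 0) (at_right (0::real))"
    using M by (intro tendsto_intros tendsto_ident_at) auto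
  then have "((\<lambda>\<tau>. (1 + \<tau>) * M powr \<tau>) \<longlongrightarrow> 1) (at_right 0)" using M by simp
  then have "eventually (\<lambda>\<tau>. (1 + \<tau>) * M powr \<tau> < \<rho>) (at_right 0)" using \<rho> by (rule order_tendstoD)
  then obtain \<tau> where \<tau>: "\<tau> > 0" "(1 + \<tau>) * M powr \<tau> < \<rho>" by (rule ex_small_right)
  obtain x1 where x1: "x1 \<ge> 1" "\<forall>x\<ge>x1. b x > 0 \<and> (\<forall>y\<ge>x. b y \<le> (1 + \<tau>) * (y / x) powr (\<beta> + \<tau>) * b x \<and>
      b x \<le> (1 + \<tau>) * (y / x) powr (\<tau> - \<beta>) * b y)"
    using b_potter \<tau> unfolding potter_bounds_def by blast
  have "eventually (\<lambda>x. A (real x) \<ge> x1 / u) sequentially" "eventually (\<lambda>x. A (real x) \<ge> x1) sequentially"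
    using A_top by (auto simp: filterlim_at_top)
  then show ?thesis
  proof eventually_elim
    case (elim x)
    show ?case
    proof
      fix n assume n: "n \<in> {N x u<..N x v}"
      define w where "w = real n / A (real x)"
      have w: "u < w" "w \<le> v" using N_range[OF _ _ n] uv by (auto simp: w_def)
      have w0: "w > 0" using w uv by simp
      have "x1 \<le> u * A (real x)" using elim(1) uv by (simp add: pos_divide_le_eq mult.commute)
      also have "\<dots> \<le> real n" using w(1) by (simp add: w_def pos_less_divide_eq)
      finally have nx1: "x1 \<le> real n" .
      have bp: "b (real n) > 0" "b (A (real x)) > 0" using x1 nx1 elim(2) by auto
      have up: "b (real n) \<le> (1 + \<tau>) * (M powr \<tau> * w powr \<beta>) * b (A (real x))"
        and lo: "b (A (real x)) \<le> (1 + \<tau>) * (M powr \<tau> * w powr - \<beta>) * b (real n)"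
      proof -
        have pw: "w powr \<tau> \<le> M powr \<tau>" "(1 / w) powr \<tau> \<le> M powr \<tau>"
        proof -
          have "1 / w \<le> 1 / u" using w uv by (intro divide_left_mono) auto
          then show "w powr \<tau> \<le> M powr \<tau>" "(1 / w) powr \<tau> \<le> M powr \<tau>"
            using w w0 M \<tau> by (auto intro!: powr_mono2)
        qed
        have "b (real n) \<le> (1 + \<tau>) * (M powr \<tau> * w powr \<beta>) * b (A (real x)) \<and>
            b (A (real x)) \<le> (1 + \<tau>) * (M powr \<tau> * w powr - \<beta>) * b (real n)"
        proof (cases "A (real x) \<le> real n")
          case True
          then have "b (real n) \<le> (1 + \<tau>) * w powr (\<beta> + \<tau>) * b (A (real x))"
            "b (A (real x)) \<le> (1 + \<tau>) * w powr (\<tau> - \<beta>) * b (real n)"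
            using x1(2) elim(2) by (auto simp: w_def)
          moreover have "w powr (\<beta> + \<tau>) \<le> M powr \<tau> * w powr \<beta>" "w powr (\<tau> - \<beta>) \<le> M powr \<tau> * w powr - \<beta>"
            using pw(1) by (auto simp: powr_add powr_diff powr_minus_divide divide_right_mono mult_right_mono mult.commute[of "w powr \<beta>"])
          ultimately show ?thesis using \<tau> bp
            by (meson mult_left_mono mult_right_mono order_trans less_imp_le add_pos_pos zero_less_one)
        next
          case False
          then have "b (A (real x)) \<le> (1 + \<tau>) * (1 / w) powr (\<beta> + \<tau>) * b (real n)"
            "b (real n) \<le> (1 + \<tau>) * (1 / w) powr (\<tau> - \<beta>) * b (A (real x))"
            using x1(2) nx1 by (auto simp: w_def)
          moreover have "(1 / w) powr (\<beta> + \<tau>) \<le> M powr \<tau> * w powr - \<beta>"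
          proof -
            have "(1 / w) powr (\<beta> + \<tau>) = (1 / w) powr \<tau> * w powr - \<beta>"
              using w0 by (simp add: powr_add powr_divide powr_minus_divide)
            then show ?thesis using pw(2) by (simp add: mult_right_mono)
          qed
          moreover have "(1 / w) powr (\<tau> - \<beta>) \<le> M powr \<tau> * w powr \<beta>"
          proof -
            have "(1 / w) powr (\<tau> - \<beta>) = (1 / w) powr \<tau> * w powr \<beta>"
              using w0 by (simp add: powr_diff powr_divide)
            then show ?thesis using pw(2) by (simp add: mult_right_mono)
          qed
          ultimately show ?thesis using \<tau> bp
            by (meson mult_left_mono mult_right_mono order_trans less_imp_le add_pos_pos zero_less_one)
        qed
        then show "b (real n) \<le> (1 + \<tau>) * (M powr \<tau> * w powr \<beta>) * b (A (real x))"
          "b (A (real x)) \<le> (1 + \<tau>) * (M powr \<tau> * w powr - \<beta>) * b (real n)" by auto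
      qed
      have "b (real n) / B (real x) \<le> (1 + \<tau>) * M powr \<tau> * w powr \<beta>"
        using up bp by (simp add: B_def pos_divide_le_eq mult.assoc)
      also have "\<dots> \<le> \<rho> * w powr \<beta>" using \<tau>(2) by (intro mult_right_mono) auto
      finally have 1: "b (real n) / B (real x) \<le> \<rho> * w powr \<beta>" .
      have "B (real x) \<le> ((1 + \<tau>) * M powr \<tau>) * (w powr - \<beta> * b (real n))" using lo by (simp add: B_def mult.assoc)
      also have "\<dots> \<le> \<rho> * (w powr - \<beta> * b (real n))" using \<tau>(2) bp by (intro mult_right_mono) auto
      finally have "B (real x) * w powr \<beta> \<le> \<rho> * b (real n)"
        using w0 by (simp add: powr_minus_divide field_simps)
      then have 2: "(1 / \<rho>) * w powr \<beta> \<le> b (real n) / B (real x)"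
        using \<rho> by (simp add: field_simps)
      show "(1 / \<rho>) * (real n / A (real x)) powr \<beta> \<le> b (real n) / B (real x) \<and>
         b (real n) / B (real x) \<le> \<rho> * (real n / A (real x)) powr \<beta>"
        using 1 2 by (simp add: w_def)
    qed
  qed
qed

text \<open>The total exponent of \<rho> lost on one geometric block: 1 from the enclosure of the
  block sum, 1 + |\<beta>| from the weights and |\<beta> + 1| from the integrand.\<close>

definition slack :: real where "slack = 2 + \<bar>\<beta>\<bar> + \<bar>\<beta> + 1\<bar>"

lemma middle_block:
  assumes u: "0 < u" and \<rho>: "\<rho> > 1" and \<kappa>: "\<kappa> > 0"
  shows "eventually (\<lambda>x. \<rho> powr - slack * moment u (\<rho> * u) - \<kappa> \<le> middle u (\<rho> * u) x \<and>
     middle u (\<rho> * u) x \<le> \<rho> powr slack * moment u (\<rho> * u) + \<kappa>) sequentially"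
proof -
  have v: "u < \<rho> * u" using u \<rho> by simp
  define Q where "Q = H u - H (\<rho> * u)"
  have Q: "Q \<ge> 0" unfolding Q_def using H_antimono[OF u less_imp_le[OF v]] by simp
  define g where "g = \<rho> powr (1 + \<bar>\<beta>\<bar>)"
  have g: "g \<ge> 1" using \<rho> by (simp add: g_def ge_one_powr_ge_zero)
  define \<kappa>' where "\<kappa>' = \<kappa> / (g * u powr \<beta>)"
  have \<kappa>': "\<kappa>' > 0" using \<kappa> g u by (simp add: \<kappa>'_def)
  have \<kappa>g: "g * u powr \<beta> * \<kappa>' = \<kappa>" using g u by (simp add: \<kappa>'_def)
  have "eventually (\<lambda>x::nat. x > 0) sequentially" by (rule eventually_gt_at_top)
  with block_limit[OF u v \<kappa>'] b_uniform[OF u v \<rho>] show ?thesis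
  proof eventually_elim
    case (elim x)
    let ?S = "{N x u<..N x (\<rho> * u)}"
    define \<Lambda> where "\<Lambda> = real x / A (real x) * (\<Sum>n\<in>?S. P n x)"
    have \<Lambda>0: "\<Lambda> \<ge> 0" unfolding \<Lambda>_def by (intro mult_nonneg_nonneg sum_nonneg P_nonneg) auto
    have mid: "middle u (\<rho> * u) x = real x / A (real x) * (\<Sum>n\<in>?S. b (real n) / B (real x) * P n x)"
      using elim(3) by (simp add: middle_def scale_def sum_divide_distrib sum_distrib_left field_simps)
    have bb: "b (real n) / B (real x) \<le> g * u powr \<beta>" "(1 / g) * u powr \<beta> \<le> b (real n) / B (real x)" if n: "n \<in> ?S" for n
    proof -
      define w where "w = real n / A (real x)"
      have w: "u \<le> w" "w \<le> \<rho> * u" using N_range[OF _ _ n] u v by (auto simp: w_def)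
      have "b (real n) / B (real x) \<le> \<rho> * w powr \<beta>" using elim(2) n by (auto simp: w_def)
      also have "\<dots> \<le> \<rho> * (\<rho> powr \<bar>\<beta>\<bar> * u powr \<beta>)" using \<rho> by (intro mult_left_mono powr_window_bounds u w) auto
      also have "\<dots> = g * u powr \<beta>" using \<rho> by (simp add: g_def powr_add)
      finally show "b (real n) / B (real x) \<le> g * u powr \<beta>" .
      have "(1 / g) * u powr \<beta> = (1 / \<rho>) * (\<rho> powr - \<bar>\<beta>\<bar> * u powr \<beta>)" using \<rho> by (simp add: g_def powr_add powr_minus_divide)
      also have "\<dots> \<le> (1 / \<rho>) * w powr \<beta>" using \<rho> by (intro mult_left_mono powr_window_bounds u w) auto
      also have "\<dots> \<le> b (real n) / B (real x)" using elim(2) n by (auto simp: w_def)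
      finally show "(1 / g) * u powr \<beta> \<le> b (real n) / B (real x)" .
    qed
    have up: "middle u (\<rho> * u) x \<le> g * u powr \<beta> * \<Lambda>"
    proof -
      have "(\<Sum>n\<in>?S. b (real n) / B (real x) * P n x) \<le> (\<Sum>n\<in>?S. (g * u powr \<beta>) * P n x)"
        using bb by (intro sum_mono mult_right_mono P_nonneg) auto
      then have "middle u (\<rho> * u) x \<le> real x / A (real x) * (\<Sum>n\<in>?S. (g * u powr \<beta>) * P n x)"
        unfolding mid by (rule mult_left_mono) simp
      also have "\<dots> = g * u powr \<beta> * \<Lambda>" by (simp add: \<Lambda>_def sum_distrib_left mult_ac)
      finally show ?thesis .
    qed
    have lo: "(1 / g) * u powr \<beta> * \<Lambda> \<le> middle u (\<rho> * u) x"
    proof -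
      have "(\<Sum>n\<in>?S. ((1 / g) * u powr \<beta>) * P n x) \<le> (\<Sum>n\<in>?S. b (real n) / B (real x) * P n x)"
        using bb by (intro sum_mono mult_right_mono P_nonneg) auto
      then have "real x / A (real x) * (\<Sum>n\<in>?S. ((1 / g) * u powr \<beta>) * P n x) \<le> middle u (\<rho> * u) x"
        unfolding mid by (rule mult_left_mono) simp
      moreover have "real x / A (real x) * (\<Sum>n\<in>?S. ((1 / g) * u powr \<beta>) * P n x) = (1 / g) * u powr \<beta> * \<Lambda>"
        by (simp add: \<Lambda>_def sum_distrib_left mult_ac)
      ultimately show ?thesis by simp
    qed
    have \<Lambda>: "\<alpha> * u * Q - \<kappa>' \<le> \<Lambda>" "\<Lambda> \<le> \<alpha> * (\<rho> * u) * Q + \<kappa>'"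
      using elim(1) by (simp_all add: \<Lambda>_def Q_def)
    have "middle u (\<rho> * u) x \<le> g * u powr \<beta> * (\<alpha> * (\<rho> * u) * Q + \<kappa>')"
      using up \<Lambda>(2) g by (meson mult_left_mono order_trans mult_nonneg_nonneg powr_ge_zero zero_le_one)
    also have "\<dots> = (\<rho> powr slack) * (\<alpha> * (\<rho> powr - \<bar>\<beta> + 1\<bar> * u powr (\<beta> + 1) * Q)) + \<kappa>"
    proof -
      have "\<rho> powr slack * \<rho> powr - \<bar>\<beta> + 1\<bar> = g * \<rho>"
        using \<rho> by (simp add: slack_def g_def power2_eq_square powr_add powr_minus_divide mult_ac)
      moreover have "u powr (\<beta> + 1) = u powr \<beta> * u" using u by (simp add: powr_add)
      ultimately have "(\<rho> powr slack) * (\<alpha> * (\<rho> powr - \<bar>\<beta> + 1\<bar> * u powr (\<beta> + 1) * Q)) = g * u powr \<beta> * (\<alpha> * (\<rho> * u) * Q)"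
        by (metis (no_types, lifting) mult.assoc mult.commute mult.left_commute)
      then show ?thesis by (simp only: distrib_left \<kappa>g)
    qed
    also have "\<dots> \<le> \<rho> powr slack * moment u (\<rho> * u) + \<kappa>"
      using moment_block_bounds(1)[OF u \<rho>] by (intro add_right_mono mult_left_mono) (auto simp: Q_def)
    finally have U: "middle u (\<rho> * u) x \<le> \<rho> powr slack * moment u (\<rho> * u) + \<kappa>" .
    have "\<rho> powr - slack * moment u (\<rho> * u) \<le> \<rho> powr - slack * (\<alpha> * (\<rho> powr \<bar>\<beta> + 1\<bar> * u powr (\<beta> + 1) * Q))"
      using moment_block_bounds(2)[OF u \<rho>] by (intro mult_left_mono) (auto simp: Q_def)
    also have "\<dots> = (\<rho> powr - slack * \<rho> powr \<bar>\<beta> + 1\<bar>) * (\<alpha> * (u powr (\<beta> + 1) * Q))" by simp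
    also have "\<rho> powr - slack * \<rho> powr \<bar>\<beta> + 1\<bar> \<le> 1 / g"
    proof -
      have "\<rho> powr - slack * \<rho> powr \<bar>\<beta> + 1\<bar> = \<rho> powr (- 2 - \<bar>\<beta>\<bar>)" by (simp add: slack_def flip: powr_add)
      also have "\<dots> \<le> \<rho> powr - (1 + \<bar>\<beta>\<bar>)" using \<rho> by (intro powr_mono) auto
      also have "\<rho> powr - (1 + \<bar>\<beta>\<bar>) = 1 / g" unfolding g_def by (rule powr_minus_divide)
      finally show ?thesis .
    qed
    then have "(\<rho> powr - slack * \<rho> powr \<bar>\<beta> + 1\<bar>) * (\<alpha> * (u powr (\<beta> + 1) * Q)) \<le> (1 / g) * (\<alpha> * (u powr (\<beta> + 1) * Q))"
      using alpha Q by (intro mult_right_mono) auto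
    also have "\<dots> = (1 / g) * u powr \<beta> * (\<alpha> * u * Q)" using u by (simp add: powr_add)
    also have "\<dots> \<le> (1 / g) * u powr \<beta> * (\<Lambda> + \<kappa>')" using \<Lambda>(1) g by (intro mult_left_mono) auto
    also have "\<dots> \<le> middle u (\<rho> * u) x + \<kappa>"
    proof -
      have "(1 / g) * (u powr \<beta> * \<kappa>') \<le> g * (u powr \<beta> * \<kappa>')"
        using g \<kappa>' by (intro mult_right_mono) (auto intro: order_trans[of _ 1])
      then show ?thesis using lo \<kappa>g by (simp add: distrib_left mult.assoc)
    qed
    finally have "\<rho> powr - slack * moment u (\<rho> * u) \<le> middle u (\<rho> * u) x + \<kappa>" .
    with U show ?case by linarith
  qed
qed

lemma middle_add:
  assumes "u \<le> v" "v \<le> w"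
  shows "middle u w x = middle u v x + middle v w x"
proof -
  have "{N x u<..N x w} = {N x u<..N x v} \<union> {N x v<..N x w}" using N_mono[OF assms(1), of x] N_mono[OF assms(2), of x] by auto
  moreover have "sum f ({N x u<..N x v} \<union> {N x v<..N x w}) = sum f {N x u<..N x v} + sum f {N x v<..N x w}" for f :: "nat \<Rightarrow> real"
    by (rule sum.union_disjoint) auto
  ultimately show ?thesis by (simp add: middle_def add_divide_distrib)
qed

text \<open>Every block carries the same factor, so the multiplicative error does not accumulate
  under addition; only the additive error is shared among the blocks.\<close>

lemma middle_geometric:
  assumes u: "0 < u" and \<rho>: "\<rho> > 1" and \<kappa>: "\<kappa> > 0"
  shows "eventually (\<lambda>x. \<rho> powr - slack * moment u (\<rho> ^ Suc K * u) - \<kappa> \<le> middle u (\<rho> ^ Suc K * u) x \<and>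
     middle u (\<rho> ^ Suc K * u) x \<le> \<rho> powr slack * moment u (\<rho> ^ Suc K * u) + \<kappa>) sequentially"
  using \<kappa>
proof (induction K arbitrary: \<kappa>)
  case 0
  then show ?case using middle_block[OF u \<rho>] by simp
next
  case (Suc K)
  define v where "v = \<rho> ^ Suc K * u"
  have "\<rho> ^ Suc K > 1" using \<rho> by (intro one_less_power) auto
  then have v: "0 < v" "u < v" "v < \<rho> * v" "\<rho> ^ Suc (Suc K) * u = \<rho> * v" using u \<rho> by (auto simp: v_def)
  have k2: "\<kappa> / 2 > 0" using Suc.prems by simp
  have m: "moment u (\<rho> * v) = moment u v + moment v (\<rho> * v)" by (intro moment_add u v)
  have mid: "middle u (\<rho> * v) x = middle u v x + middle v (\<rho> * v) x" for x
    using v by (intro middle_add) auto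
  from Suc.IH[OF k2, folded v_def] middle_block[OF v(1) \<rho> k2] show ?case
    unfolding v(4)
  proof eventually_elim
    case (elim x)
    then show ?case unfolding m mid distrib_left by linarith
  qed
qed

text \<open>Cut [u, v] into K + 1 geometric blocks: their common ratio tends to 1 as K grows, and
  the multiplicative error with it.\<close>

lemma middle_limit:
  assumes uv: "0 < u" "u < v"
  shows "middle u v \<longlonglongrightarrow> moment u v"
proof (rule LIMSEQ_I)
  fix \<kappa> :: real assume \<kappa>: "\<kappa> > 0"
  define q where "q = v / u"
  have q: "q > 1" using uv by (simp add: q_def)
  have z: "(\<lambda>K::nat. e / real (Suc K)) \<longlonglongrightarrow> 0" for e :: real
    using LIMSEQ_Suc[OF lim_const_over_n[of e]] by simp
  have "(\<lambda>K. q powr (e / real (Suc K)) * moment u v) \<longlonglongrightarrow> q powr 0 * moment u v" for e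
    using q by (intro tendsto_intros z) auto
  then have lim: "(\<lambda>K. q powr (e / real (Suc K)) * moment u v) \<longlonglongrightarrow> moment u v" for e using q by simp
  have "eventually (\<lambda>K. q powr (slack / real (Suc K)) * moment u v < moment u v + \<kappa> / 2 \<and>
      q powr (- slack / real (Suc K)) * moment u v > moment u v - \<kappa> / 2) sequentially"
    using \<kappa> by (intro eventually_conj order_tendstoD(2)[OF lim] order_tendstoD(1)[OF lim]) auto
  then obtain K where K: "q powr (slack / real (Suc K)) * moment u v < moment u v + \<kappa> / 2"
      "q powr (- slack / real (Suc K)) * moment u v > moment u v - \<kappa> / 2"
    unfolding eventually_sequentially by blast
  define \<rho> where "\<rho> = q powr (1 / real (Suc K))"
  have \<rho>: "\<rho> > 1" unfolding \<rho>_def using q by simp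
  have \<rho>K: "\<rho> ^ Suc K * u = v"
  proof -
    have "\<rho> ^ Suc K = \<rho> powr real (Suc K)" using \<rho> by (subst powr_realpow) auto
    also have "\<dots> = q" unfolding \<rho>_def powr_powr using q by simp
    finally show ?thesis using uv by (simp add: q_def)
  qed
  have \<rho>e: "\<rho> powr e = q powr (e / real (Suc K))" for e unfolding \<rho>_def powr_powr by simp
  have "\<kappa> / 2 > 0" using \<kappa> by simp
  from middle_geometric[OF uv(1) \<rho> this, of K] obtain x0 where x0: "\<And>x. x \<ge> x0 \<Longrightarrow>
      \<rho> powr - slack * moment u v - \<kappa> / 2 \<le> middle u v x \<and> middle u v x \<le> \<rho> powr slack * moment u v + \<kappa> / 2"
    unfolding \<rho>K eventually_sequentially by blast
  have "norm (middle u v x - moment u v) < \<kappa>" if "x \<ge> x0" for x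
    using x0[OF that] K unfolding \<rho>e by (simp add: abs_less_iff)
  then show "\<exists>no. \<forall>x\<ge>no. norm (middle u v x - moment u v) < \<kappa>" by blast
qed

end

context weighted_walk
begin

lemma scale_comparable:
  obtains C where "C \<ge> 1"
    "\<And>x y. 1 \<le> y \<Longrightarrow> y \<le> x \<Longrightarrow> x \<le> 2 * y \<Longrightarrow> scale 0 x \<le> C * scale 0 y \<and> scale 0 y \<le> C * scale 0 x"
proof -
  obtain C where C: "C \<ge> 1" "\<And>x w. w \<ge> 1 \<Longrightarrow> 1/2 * x \<le> w \<Longrightarrow> w \<le> x \<Longrightarrow>
    B w \<le> C * B x \<and> B x \<le> C * B w \<and> A x \<le> C * A w"
    by (rule B_comparable[of "1/2"]) auto
  have "scale 0 x \<le> (2 * C * C) * scale 0 y \<and> scale 0 y \<le> (2 * C * C) * scale 0 x"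
    if xy: "1 \<le> y" "y \<le> x" "x \<le> 2 * y" for x y
  proof -
    have BA: "B (real y) \<le> C * B (real x)" "B (real x) \<le> C * B (real y)" "A (real x) \<le> C * A (real y)"
      using C(2)[of "real y" "real x"] xy by auto
    have Am: "A (real y) \<le> C * A (real x)"
    proof -
      have "A (real y) \<le> A (real x)" using xy by (intro A_mono) simp
      also have "\<dots> \<le> C * A (real x)" using C(1) mult_right_mono[of 1 C "A (real x)"] by simp
      finally show ?thesis .
    qed
    have y: "real y > 0" "real x > 0" "real y \<le> real x" "real x \<le> 2 * real y" using xy by auto
    have "A (real x) * B (real x) / real x \<le> (C * A (real y)) * (C * B (real y)) / real y"
      using BA y C(1) by (intro frac_le mult_mono) auto
    also have "\<dots> = (C * C) * scale 0 y" by (simp add: scale_def)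
    also have "\<dots> \<le> (2 * C * C) * scale 0 y" using C(1) by (intro mult_right_mono) auto
    finally have 1: "scale 0 x \<le> (2 * C * C) * scale 0 y" by (simp add: scale_def)
    have "A (real y) * B (real y) / real y \<le> (C * A (real x)) * (C * B (real x)) / (real x / 2)"
      using BA Am y C(1) by (intro frac_le mult_mono) auto
    also have "\<dots> = (2 * C * C) * scale 0 x" by (simp add: scale_def)
    finally have "scale 0 y \<le> (2 * C * C) * scale 0 x" by (simp add: scale_def)
    with 1 show ?thesis by simp
  qed
  moreover have "2 * C * C \<ge> 1" using C(1) mult_mono[of 1 C 1 C] by auto
  ultimately show thesis by (rule that[rotated])
qed

section \<open>The limit of the Green function\<close>

text \<open>General weights \<open>c\<close>, because the given weight function may differ from its
  frozen version at finitely many integers.\<close>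

definition green_ratio :: "(nat \<Rightarrow> real) \<Rightarrow> nat \<Rightarrow> real" where
  "green_ratio c x = (\<Sum>n. c n * P n x) / scale 0 x"

lemma P_0 [simp]: "x \<ge> 1 \<Longrightarrow> P 0 x = 0"
  by (simp add: conv_pow_0)

lemma sum_lessThan_partial_green:
  assumes "x \<ge> 1"
  shows "(\<Sum>n<Suc K. b (real n) * P n x) = partial_green 0 K x"
proof -
  have "{..<Suc K} = insert 0 {1..K}" by auto
  then show ?thesis using assms by (simp add: partial_green_def)
qed

lemma green_summable:
  assumes x: "x \<ge> 1"
  shows "summable (\<lambda>n. b (real n) * P n x)"
proof -
  obtain C R where CR: "C > 0" "\<And>x \<Lambda> N. x \<ge> 1 \<Longrightarrow> \<Lambda> > 0 \<Longrightarrow>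
      (\<Sum>n\<in>{n\<in>{1..N}. real n > \<Lambda> * A (real x)}. real n ^ 0 * b (real n) * P n x) \<le> C * scale 0 x / \<Lambda> ^ (R - 1)"
    by (rule partial_green_tail[of 0]) blast
  \<comment> \<open>All times n >= 1 exceed \<Lambda> A(x) = 1/2, so the tail bound covers every
    partial sum.\<close>
  define \<Lambda> where "\<Lambda> = 1 / (2 * A (real x))"
  have \<Lambda>: "\<Lambda> > 0" "\<Lambda> * A (real x) = 1/2" by (auto simp: \<Lambda>_def)
  show ?thesis
  proof (rule summableI_nonneg_bounded)
    fix K
    have "(\<Sum>n<K. b (real n) * P n x) \<le> (\<Sum>n<Suc K. b (real n) * P n x)" by (simp add: P_nonneg)
    also have "\<dots> = (\<Sum>n\<in>{n\<in>{1..K}. real n > \<Lambda> * A (real x)}. real n ^ 0 * b (real n) * P n x)"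
      unfolding sum_lessThan_partial_green[OF x] partial_green_def \<Lambda> by (intro sum.cong) auto
    also have "\<dots> \<le> C * scale 0 x / \<Lambda> ^ (R - 1)" by (intro CR x \<Lambda>)
    finally show "(\<Sum>n<K. b (real n) * P n x) \<le> C * scale 0 x / \<Lambda> ^ (R - 1)" .
  qed (simp add: P_nonneg)
qed

lemma partial_green_le_green: "x \<ge> 1 \<Longrightarrow> partial_green 0 K x \<le> (\<Sum>n. b (real n) * P n x)"
  unfolding sum_lessThan_partial_green[symmetric] by (intro sum_le_suminf green_summable) (auto simp: P_nonneg)

lemma green_le_partial_green:
  obtains C where "C > 0" "\<And>x \<Lambda>. x \<ge> 1 \<Longrightarrow> \<Lambda> \<ge> 1 \<Longrightarrow>
    (\<Sum>n. b (real n) * P n x) \<le> partial_green 0 (nat \<lfloor>\<Lambda> * A (real x)\<rfloor>) x + C / \<Lambda> * scale 0 x"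
proof -
  obtain C R where CR: "C > 0" "R \<ge> 2" "\<And>x \<Lambda> N. x \<ge> 1 \<Longrightarrow> \<Lambda> > 0 \<Longrightarrow>
      (\<Sum>n\<in>{n\<in>{1..N}. real n > \<Lambda> * A (real x)}. real n ^ 0 * b (real n) * P n x) \<le> C * scale 0 x / \<Lambda> ^ (R - 1)"
    by (rule partial_green_tail[of 0]) blast
  have "(\<Sum>n. b (real n) * P n x) \<le> partial_green 0 (nat \<lfloor>\<Lambda> * A (real x)\<rfloor>) x + C / \<Lambda> * scale 0 x"
    if x: "x \<ge> 1" and \<Lambda>: "\<Lambda> \<ge> 1" for x \<Lambda>
  proof (rule suminf_le_const[OF green_summable[OF x]])
    fix K
    have "(\<Sum>n<K. b (real n) * P n x) \<le> (\<Sum>n<Suc K. b (real n) * P n x)" by (simp add: P_nonneg)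
    also have "\<dots> = partial_green 0 K x" by (rule sum_lessThan_partial_green[OF x])
    also have "\<dots> \<le> partial_green 0 (nat \<lfloor>\<Lambda> * A (real x)\<rfloor>) x + C * scale 0 x / \<Lambda> ^ (R - 1)"
      using partial_green_split[of 0 K x \<Lambda>] CR(3)[OF x, of \<Lambda> K] \<Lambda> by linarith
    also have "C * scale 0 x / \<Lambda> ^ (R - 1) \<le> C * scale 0 x / \<Lambda>"
    proof (rule divide_left_mono)
      show "\<Lambda> \<le> \<Lambda> ^ (R - 1)" using \<Lambda> CR(2) power_increasing[of 1 "R - 1" \<Lambda>] by simp
    qed (use CR \<Lambda> in \<open>auto intro!: mult_pos_pos mult_nonneg_nonneg\<close>)
    finally show "(\<Sum>n<K. b (real n) * P n x) \<le> partial_green 0 (nat \<lfloor>\<Lambda> * A (real x)\<rfloor>) x + C / \<Lambda> * scale 0 x"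
      by simp
  qed
  with CR(1) show thesis by (rule that)
qed

text \<open>Changing finitely many weights alters the ratio by a fixed linear combination of terms
  P(S_j = x) / \<open>scale 0 x\<close>.\<close>

lemma green_ratio_transfer:
  assumes neg: "\<And>j. (\<lambda>x. P j x / scale 0 x) \<longlonglongrightarrow> 0"
    and c: "eventually (\<lambda>n. c n = b (real n)) sequentially"
  shows "green_ratio c \<longlonglongrightarrow> l \<longleftrightarrow> green_ratio (\<lambda>n. b (real n)) \<longlonglongrightarrow> l"
proof -
  obtain n0 where n0: "\<And>n. n \<ge> n0 \<Longrightarrow> c n = b (real n)" using c unfolding eventually_sequentially by blast
  have "(\<lambda>x. \<Sum>n<n0. (c n - b (real n)) * (P n x / scale 0 x)) \<longlonglongrightarrow> (\<Sum>n<n0. (c n - b (real n)) * 0)"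
    by (intro tendsto_sum tendsto_mult tendsto_const neg)
  then have lim: "(\<lambda>x. \<Sum>n<n0. (c n - b (real n)) * (P n x / scale 0 x)) \<longlonglongrightarrow> 0" by simp
  have "eventually (\<lambda>x. (\<Sum>n<n0. (c n - b (real n)) * (P n x / scale 0 x))
      = green_ratio c x - green_ratio (\<lambda>n. b (real n)) x) sequentially"
    using eventually_ge_at_top[of 1]
  proof eventually_elim
    case (elim x)
    have ev: "eventually (\<lambda>n. c n * P n x = b (real n) * P n x) sequentially"
      using c by eventually_elim simp
    have sc: "summable (\<lambda>n. c n * P n x)" using green_summable[OF elim] summable_cong[OF ev] by simp
    have "(\<Sum>n. c n * P n x) - (\<Sum>n. b (real n) * P n x) = (\<Sum>n. c n * P n x - b (real n) * P n x)"
      by (rule suminf_diff[OF sc green_summable[OF elim]])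
    also have "\<dots> = (\<Sum>n<n0. c n * P n x - b (real n) * P n x)"
      by (rule suminf_finite) (use n0 in \<open>auto simp: not_less\<close>)
    finally have d: "(\<Sum>n. c n * P n x) - (\<Sum>n. b (real n) * P n x) = (\<Sum>n<n0. c n * P n x - b (real n) * P n x)" .
    show ?case unfolding green_ratio_def diff_divide_distrib[symmetric] d
      by (simp add: left_diff_distrib sum_divide_distrib)
  qed
  with lim have diff: "(\<lambda>x. green_ratio c x - green_ratio (\<lambda>n. b (real n)) x) \<longlonglongrightarrow> 0"
    by (rule Lim_transform_eventually)
  show ?thesis
  proof
    assume "green_ratio c \<longlonglongrightarrow> l"
    from tendsto_diff[OF this diff] show "green_ratio (\<lambda>n. b (real n)) \<longlonglongrightarrow> l" by simp
  next
    assume "green_ratio (\<lambda>n. b (real n)) \<longlonglongrightarrow> l"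
    from tendsto_add[OF this diff] show "green_ratio c \<longlonglongrightarrow> l" by simp
  qed
qed

end

context attracted_walk
begin

lemma N_ge_nat: "t > 0 \<Longrightarrow> eventually (\<lambda>x. n \<le> N x t) sequentially"
  using N_top[of t] by (simp add: filterlim_at_top)

lemma partial_green_middle:
  assumes "u \<le> v" "x \<ge> 1"
  shows "partial_green 0 (N x v) x = partial_green 0 (N x u) x + scale 0 x * middle u v x"
proof -
  have "{1..N x v} = {1..N x u} \<union> {N x u<..N x v}" using N_mono[OF assms(1), of x] by auto
  moreover have "sum f ({1..N x u} \<union> {N x u<..N x v}) = sum f {1..N x u} + sum f {N x u<..N x v}" for f :: "nat \<Rightarrow> real"
    by (rule sum.union_disjoint) auto
  moreover have "scale 0 x \<noteq> 0" using scale_pos[OF assms(2), of 0] by linarith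
  ultimately show ?thesis by (simp add: partial_green_def middle_def)
qed

text \<open>The fixed time \<open>n\<close> precedes the block, so its term comes in addition; n >=
  n0 makes its weight the positive number b(n).\<close>

lemma middle_le_green_ratio:
  assumes c: "\<And>n. c n \<ge> 0" "\<And>n. n \<ge> n0 \<Longrightarrow> c n = b (real n)"
    and x: "x \<ge> 1" and n: "n0 \<le> n" "n \<le> N x u"
  shows "b (real n) * (P n x / scale 0 x) + middle u v x \<le> green_ratio c x"
proof -
  have ev: "eventually (\<lambda>n. c n * P n x = b (real n) * P n x) sequentially"
    using c(2) by (auto simp: eventually_sequentially)
  have sc: "summable (\<lambda>n. c n * P n x)" using green_summable[OF x] summable_cong[OF ev] by simp
  have "b (real n) * P n x + (\<Sum>m\<in>{N x u<..N x v}. b (real m) * P m x) = (\<Sum>m\<in>insert n {N x u<..N x v}. c m * P m x)"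
    using n c(2) by (subst sum.insert) (auto intro!: arg_cong2[where f = "(+)"] sum.cong)
  also have "\<dots> \<le> (\<Sum>m. c m * P m x)" by (rule sum_le_suminf[OF sc]) (auto simp: c P_nonneg)
  finally show ?thesis unfolding green_ratio_def middle_def times_divide_eq_right
    by (simp only: flip: add_divide_distrib) (auto intro!: divide_right_mono)
qed

text \<open>A non-integrable integrand would give the default value 0, so both directions of the
  criterion first prove integrability.\<close>

definition limit_moment :: real where
  "limit_moment = \<alpha> * (\<integral>y. y powr (- \<alpha> * (\<beta> + 1)) \<partial>\<mu>)"

text \<open>Windows increasing to the positive half-line; the offset 2 keeps the lower end below the
  upper one already for k = 0.\<close>

definition exhaust :: "nat \<Rightarrow> real set" where
  "exhaust k = window (1 / (real k + 2)) (real k + 2)"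

lemma AE_pos: "AE y in \<mu>. y > 0"
  using AE_prob_1[OF \<mu>_pos] by simp

lemma exhaust_eventually:
  assumes y: "y > 0"
  shows "eventually (\<lambda>k. y \<in> exhaust k) sequentially"
proof -
  have top: "filterlim (\<lambda>k::nat. real k + 2) at_top sequentially"
    by (rule filterlim_at_top_mono[OF filterlim_real_sequentially]) auto
  have "(\<lambda>k. (real k + 2) powr (- 1 / \<alpha>)) \<longlonglongrightarrow> 0"
    using alpha by (intro tendsto_neg_powr top) auto
  then have 1: "eventually (\<lambda>k. (real k + 2) powr (- 1 / \<alpha>) < y) sequentially" using y by (rule order_tendstoD)
  have "eventually (\<lambda>k. y powr \<alpha> \<le> real k + 2) sequentially" using top by (auto simp: filterlim_at_top)
  then have "eventually (\<lambda>k. y \<le> (real k + 2) powr (1 / \<alpha>)) sequentially"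
  proof eventually_elim
    case (elim k)
    have "(y powr \<alpha>) powr (1 / \<alpha>) \<le> (real k + 2) powr (1 / \<alpha>)" using elim alpha by (intro powr_mono2) auto
    then show ?case using y alpha by (simp add: powr_powr)
  qed
  with 1 show ?thesis
  proof eventually_elim
    case (elim k)
    have "(1 / (real k + 2)) powr (- 1 / \<alpha>) = (real k + 2) powr (1 / \<alpha>)"
      by (simp add: powr_divide powr_minus_divide)
    then show ?case using elim by (simp add: exhaust_def window_def)
  qed
qed

lemma exhaust_mono: "i \<le> k \<Longrightarrow> exhaust i \<subseteq> exhaust k"
proof -
  assume ik: "i \<le> k"
  have "(real k + 2) powr (- 1 / \<alpha>) \<le> (real i + 2) powr (- 1 / \<alpha>)" using ik alpha by (intro powr_mono2') auto
  moreover have "(1 / (real i + 2)) powr (- 1 / \<alpha>) \<le> (1 / (real k + 2)) powr (- 1 / \<alpha>)"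
    using ik alpha by (intro powr_mono2') (auto intro!: divide_left_mono)
  ultimately show ?thesis by (auto simp: exhaust_def window_def)
qed

lemma index_bounds: "0 < 1 / (real k + 2)" "1 / (real k + 2) < real k + 2"
proof -
  show "0 < 1 / (real k + 2)" by simp
  have "1 / (real k + 2) \<le> 1" by simp
  then show "1 / (real k + 2) < real k + 2" by linarith
qed

lemma moment_exhaust:
  "moment (1 / (real k + 2)) (real k + 2) = \<alpha> * (\<integral>y. indicator (exhaust k) y * y powr (- \<alpha> * (\<beta> + 1)) \<partial>\<mu>)"
  by (simp add: moment_def exhaust_def set_lebesgue_integral_def)

lemma integrable_exhaust: "integrable \<mu> (\<lambda>y. indicator (exhaust k) y * y powr (- \<alpha> * (\<beta> + 1)))"
  using set_integrable_window[OF index_bounds, of k "- \<alpha> * (\<beta> + 1)"] by (simp add: set_integrable_def exhaust_def)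

lemma exhaust_limit: "AE y in \<mu>. (\<lambda>k. indicator (exhaust k) y * y powr e) \<longlonglongrightarrow> y powr e"
  using AE_pos
proof eventually_elim
  case (elim y)
  have "eventually (\<lambda>k. indicator (exhaust k) y * y powr e = y powr e) sequentially"
    using exhaust_eventually[OF elim] by eventually_elim simp
  then show ?case by (rule tendsto_eventually)
qed

text \<open>Monotone convergence along the windows \<open>exhaust k\<close>.\<close>

lemma bounded_moments_imp_integrable:
  assumes bd: "\<And>k. moment (1 / (real k + 2)) (real k + 2) \<le> K"
  shows "integrable \<mu> (\<lambda>y. y powr (- \<alpha> * (\<beta> + 1)))"
proof -
  define m where "m = (\<lambda>k. \<integral>y. indicator (exhaust k) y * y powr (- \<alpha> * (\<beta> + 1)) \<partial>\<mu>)"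
  have inc: "incseq (\<lambda>k. indicator (exhaust k) y * y powr e)" for y e :: real
    by (intro monoI mult_right_mono indicator_leI) (use exhaust_mono in blast, simp)
  have "incseq m" unfolding m_def
    by (intro monoI integral_mono integrable_exhaust) (rule monoD[OF inc])
  moreover have "\<bar>m k\<bar> \<le> K / \<alpha>" for k
  proof -
    have "m k \<ge> 0" unfolding m_def by (intro Bochner_Integration.integral_nonneg) auto
    moreover have "m k \<le> K / \<alpha>" using bd[of k] alpha by (simp add: m_def moment_exhaust pos_le_divide_eq mult.commute)
    ultimately show ?thesis by simp
  qed
  ultimately have "incseq m" "\<forall>k. m k \<le> K / \<alpha>" by (auto dest: abs_le_D1)
  then obtain l where l: "m \<longlonglongrightarrow> l" by (rule incseq_convergent)
  show ?thesis
  proof (rule integrable_monotone_convergence)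
    show "AE y in \<mu>. mono (\<lambda>k. indicator (exhaust k) y * y powr (- \<alpha> * (\<beta> + 1)))" using inc by simp
    show "(\<lambda>k. \<integral>y. indicator (exhaust k) y * y powr (- \<alpha> * (\<beta> + 1)) \<partial>\<mu>) \<longlonglongrightarrow> l" using l by (simp add: m_def)
  qed (use integrable_exhaust exhaust_limit in auto)
qed

lemma moment_limit:
  assumes int: "integrable \<mu> (\<lambda>y. y powr (- \<alpha> * (\<beta> + 1)))"
  shows "(\<lambda>k. moment (1 / (real k + 2)) (real k + 2)) \<longlonglongrightarrow> limit_moment"
  unfolding moment_exhaust limit_moment_def
proof (intro tendsto_mult tendsto_const integral_dominated_convergence[where w = "\<lambda>y. y powr (- \<alpha> * (\<beta> + 1))"])
  show "AE y in \<mu>. norm (indicator (exhaust k) y * y powr (- \<alpha> * (\<beta> + 1))) \<le> y powr (- \<alpha> * (\<beta> + 1))" for k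
    by (intro AE_I2) (auto simp: indicator_def)
qed (use int exhaust_limit integrable_exhaust in \<open>auto simp: borel_measurable_integrable\<close>)

lemma small_times_negligible_iff:
  "small_times_negligible 0 \<longleftrightarrow> (\<forall>\<kappa>>0. \<exists>\<epsilon>>0. \<epsilon> \<le> 1 \<and> (\<exists>x0. \<forall>x\<ge>x0. partial_green 0 (N x \<epsilon>) x \<le> \<kappa> * scale 0 x))"
  by (simp add: small_times_negligible_def N_def)

text \<open>Every fixed time j >= 1 is among the early times once x is large.\<close>

lemma small_times_negligible_imp_mass_negligible:
  assumes "small_times_negligible 0"
  shows "(\<lambda>x. P j x / scale 0 x) \<longlonglongrightarrow> 0"
proof (cases "j = 0")
  case True
  have "eventually (\<lambda>x. P j x / scale 0 x = 0) sequentially"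
    using eventually_ge_at_top[of 1] by eventually_elim (simp add: True)
  then show ?thesis by (rule tendsto_eventually)
next
  case False
  show ?thesis
  proof (rule LIMSEQ_I)
    fix r :: real assume r: "r > 0"
    have "r * b (real j) / 2 > 0" using r by simp
    then obtain \<epsilon> x0 where \<epsilon>: "\<epsilon> > 0" "\<And>x. x \<ge> x0 \<Longrightarrow> partial_green 0 (N x \<epsilon>) x \<le> r * b (real j) / 2 * scale 0 x"
      using assms unfolding small_times_negligible_iff by blast
    obtain x1 where x1: "\<And>x. x \<ge> x1 \<Longrightarrow> j \<le> N x \<epsilon>"
      using N_ge_nat[OF \<epsilon>(1), of j] unfolding eventually_sequentially by blast
    have "norm (P j x / scale 0 x - 0) < r" if x: "x \<ge> max (max x0 x1) 1" for x
    proof -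
      have "b (real j) * P j x \<le> partial_green 0 (N x \<epsilon>) x"
        unfolding partial_green_def using False x1[of x] x member_le_sum[of j "{1..N x \<epsilon>}" "\<lambda>n. real n ^ 0 * b (real n) * P n x"]
        by (simp add: P_nonneg)
      also have "\<dots> \<le> b (real j) * (r / 2 * scale 0 x)" using \<epsilon>(2)[of x] x by (simp add: mult_ac)
      finally have "P j x \<le> r / 2 * scale 0 x" by simp
      moreover have "scale 0 x > 0" using scale_pos[of x 0] x by simp
      ultimately have "P j x / scale 0 x \<le> r / 2" by (simp add: pos_divide_le_eq)
      moreover have "P j x / scale 0 x \<ge> 0" by (simp add: P_nonneg)
      ultimately show ?thesis using r by (simp only: diff_0_right real_norm_def abs_of_nonneg)
    qed
    then show "\<exists>no. \<forall>x\<ge>no. norm (P j x / scale 0 x - 0) < r" by blast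
  qed
qed

text \<open>Early and late times contribute at most \<kappa> each, and the middle times converge.
  Integrability comes first: the bound on all partial sums passes to the truncated moments.\<close>

lemma small_times_negligible_imp_green_limit:
  assumes neg: "small_times_negligible 0"
  shows "green_ratio (\<lambda>n. b (real n)) \<longlonglongrightarrow> limit_moment"
proof -
  obtain K where K: "K > 0" "\<And>x M. x \<ge> 1 \<Longrightarrow> partial_green 0 M x \<le> K * scale 0 x"
    by (rule small_times_negligible_imp_bounded[OF neg]) blast
  have midK: "middle u v x \<le> K" if "u \<le> v" "x \<ge> 1" for u v x
  proof -
    have "scale 0 x * middle u v x \<le> scale 0 x * K"
      using partial_green_middle[OF that] partial_green_nonneg[of 0 "N x u" x] K(2)[OF that(2), of "N x v"] by (simp add: mult.commute)
    then show ?thesis using scale_pos[OF that(2), of 0] by simp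
  qed
  have "moment (1 / (real k + 2)) (real k + 2) \<le> K" for k
    using middle_limit[OF index_bounds[of k]]
    by (rule LIMSEQ_le_const2) (use midK[OF less_imp_le[OF index_bounds(2)[of k]]] in \<open>auto intro!: exI[of _ 1]\<close>)
  then have int: "integrable \<mu> (\<lambda>y. y powr (- \<alpha> * (\<beta> + 1)))" by (rule bounded_moments_imp_integrable)
  obtain C where C: "C > 0" "\<And>x \<Lambda>. x \<ge> 1 \<Longrightarrow> \<Lambda> \<ge> 1 \<Longrightarrow>
    (\<Sum>n. b (real n) * P n x) \<le> partial_green 0 (nat \<lfloor>\<Lambda> * A (real x)\<rfloor>) x + C / \<Lambda> * scale 0 x"
    by (rule green_le_partial_green) blast
  show ?thesis
  proof (rule LIMSEQ_I)
    fix r :: real assume r: "r > 0"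
    define \<kappa> where "\<kappa> = r / 5"
    have \<kappa>: "\<kappa> > 0" "r = 5 * \<kappa>" using r by (auto simp: \<kappa>_def)
    obtain \<epsilon> x0 where \<epsilon>: "\<epsilon> > 0" "\<And>x. x \<ge> x0 \<Longrightarrow> partial_green 0 (N x \<epsilon>) x \<le> \<kappa> * scale 0 x"
      using neg \<kappa>(1) unfolding small_times_negligible_iff by blast
    have top: "filterlim (\<lambda>k::nat. real k + 2) at_top sequentially"
      by (rule filterlim_at_top_mono[OF filterlim_real_sequentially]) auto
    have "eventually (\<lambda>k. \<bar>moment (1 / (real k + 2)) (real k + 2) - limit_moment\<bar> < \<kappa> \<and> real k + 2 \<ge> 1 / \<epsilon> \<and> real k + 2 \<ge> C / \<kappa>) sequentially"
      using tendstoD[OF moment_limit[OF int] \<kappa>(1)] top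
      by (intro eventually_conj) (auto simp: dist_real_def filterlim_at_top)
    then obtain k where k: "\<bar>moment (1 / (real k + 2)) (real k + 2) - limit_moment\<bar> < \<kappa>" "real k + 2 \<ge> 1 / \<epsilon>" "real k + 2 \<ge> C / \<kappa>"
      unfolding eventually_sequentially by blast
    define v where "v = real k + 2"
    define u where "u = 1 / v"
    have v: "v \<ge> 2" "u > 0" "u < v" using index_bounds[of k] by (auto simp: v_def u_def)
    have u\<epsilon>: "u \<le> \<epsilon>" using k(2) \<epsilon>(1) v(1) by (simp add: u_def v_def[symmetric] field_simps)
    have Cv: "C / v \<le> \<kappa>" using k(3) \<kappa>(1) v(1) by (simp add: v_def[symmetric] field_simps)
    have "eventually (\<lambda>x. \<bar>middle u v x - moment u v\<bar> < \<kappa>) sequentially"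
      using tendstoD[OF middle_limit[OF v(2,3)] \<kappa>(1)] by (simp add: dist_real_def)
    then obtain x1 where x1: "\<And>x. x \<ge> x1 \<Longrightarrow> \<bar>middle u v x - moment u v\<bar> < \<kappa>"
      unfolding eventually_sequentially by blast
    have "norm (green_ratio (\<lambda>n. b (real n)) x - limit_moment) < r" if x: "x \<ge> max (max x0 x1) 1" for x
    proof -
      have x': "x \<ge> 1" "x \<ge> x0" "x \<ge> x1" using x by auto
      have s: "scale 0 x > 0" by (rule scale_pos[OF x'(1)])
      have m: "partial_green 0 (N x v) x = partial_green 0 (N x u) x + scale 0 x * middle u v x"
        using v x' by (intro partial_green_middle) auto
      have pu: "partial_green 0 (N x u) x \<le> \<kappa> * scale 0 x"
        using partial_green_mono[OF N_mono[OF u\<epsilon>]] \<epsilon>(2)[OF x'(2)] by (rule order_trans)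
      have "scale 0 x * middle u v x \<le> (\<Sum>n. b (real n) * P n x)"
        using partial_green_le_green[OF x'(1), of "N x v"] partial_green_nonneg[of 0 "N x u" x] m by linarith
      then have lo: "middle u v x \<le> green_ratio (\<lambda>n. b (real n)) x"
        using s by (simp add: green_ratio_def pos_le_divide_eq mult.commute)
      have "C / v * scale 0 x \<le> \<kappa> * scale 0 x" using Cv s by (intro mult_right_mono) auto
      moreover have "(\<Sum>n. b (real n) * P n x) \<le> partial_green 0 (N x v) x + C / v * scale 0 x"
        using C(2)[OF x'(1), of v] v(1) by (simp add: N_def)
      ultimately have "(\<Sum>n. b (real n) * P n x) \<le> (middle u v x + 2 * \<kappa>) * scale 0 x"
        using m pu by (simp add: algebra_simps)
      then have "green_ratio (\<lambda>n. b (real n)) x \<le> middle u v x + 2 * \<kappa>"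
        using s by (simp add: green_ratio_def pos_divide_le_eq)
      then show ?thesis using lo x1[OF x'(3)] k(1) \<kappa> by (simp add: v_def[symmetric] u_def[symmetric] abs_less_iff)
    qed
    then show "\<exists>no. \<forall>x\<ge>no. norm (green_ratio (\<lambda>n. b (real n)) x - limit_moment) < r" by blast
  qed
qed

text \<open>From \<open>S\<^sub>j = x\<close> the walk reaches some fixed \<open>x + y\<close> at time \<open>n\<close> with positive probability.\<close>

lemma mass_negligible_shift:
  assumes neg: "(\<lambda>x. P n x / scale 0 x) \<longlonglongrightarrow> 0" and j: "j \<le> n"
  shows "(\<lambda>x. P j x / scale 0 x) \<longlonglongrightarrow> 0"
proof -
  obtain y where y: "P (n - j) y > 0"
  proof -
    have "\<exists>y. P (n - j) y \<noteq> 0"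
    proof (rule ccontr)
      assume "\<not> (\<exists>y. P (n - j) y \<noteq> 0)"
      then have "P (n - j) = (\<lambda>_. 0)" by auto
      then have "(\<lambda>_. 0 :: real) sums 1" using P_sums[of "n - j"] by simp
      from sums_unique2[OF this sums_zero] show False by simp
    qed
    then obtain y where "P (n - j) y \<noteq> 0" by blast
    then have "P (n - j) y > 0" using P_nonneg[of "n - j" y] by simp
    then show thesis by (rule that)
  qed
  obtain C where C: "C \<ge> 1"
    "\<And>x y. 1 \<le> y \<Longrightarrow> y \<le> x \<Longrightarrow> x \<le> 2 * y \<Longrightarrow> scale 0 x \<le> C * scale 0 y \<and> scale 0 y \<le> C * scale 0 x"
    by (rule scale_comparable) blast
  define D where "D = C / P (n - j) y"
  have "(\<lambda>x. D * (P n (x + y) / scale 0 (x + y))) \<longlonglongrightarrow> D * 0"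
    by (intro tendsto_mult tendsto_const LIMSEQ_ignore_initial_segment neg)
  then have lim: "(\<lambda>x. D * (P n (x + y) / scale 0 (x + y))) \<longlonglongrightarrow> 0" by simp
  show ?thesis
  proof (rule tendsto_sandwich[OF _ _ tendsto_const lim])
    show "eventually (\<lambda>x. 0 \<le> P j x / scale 0 x) sequentially" by (simp add: P_nonneg)
    show "eventually (\<lambda>x. P j x / scale 0 x \<le> D * (P n (x + y) / scale 0 (x + y))) sequentially"
      using eventually_ge_at_top[of "max 1 y"]
    proof eventually_elim
      case (elim x)
      have s: "scale 0 x > 0" "scale 0 (x + y) > 0" using elim by (auto intro!: scale_pos)
      have "P j x * P (n - j) y \<le> (\<Sum>i\<le>x + y. P j i * P (n - j) (x + y - i))"
        using member_le_sum[of x "{..x + y}" "\<lambda>i. P j i * P (n - j) (x + y - i)"] by (simp add: P_nonneg)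
      also have "\<dots> = P n (x + y)" using conv_pow_add[of p j "n - j" "x + y"] j by simp
      finally have "P j x \<le> P n (x + y) / P (n - j) y" using y by (simp add: pos_le_divide_eq)
      then have "P j x / scale 0 x \<le> (P n (x + y) / P (n - j) y) / scale 0 x" using s by (intro divide_right_mono) auto
      also have "\<dots> \<le> (P n (x + y) / P (n - j) y) / (scale 0 (x + y) / C)"
        using s C(1) C(2)[of x "x + y"] elim y
        by (intro divide_left_mono divide_pos_pos mult_pos_pos divide_nonneg_pos) (auto simp: P_nonneg pos_divide_le_eq mult.commute)
      also have "\<dots> = D * (P n (x + y) / scale 0 (x + y))" by (simp add: D_def)
      finally show ?case .
    qed
  qed
qed

text \<open>The middle times alone exhaust the limit, so nothing is left for any fixed time.\<close>

lemma green_limit_imp_mass_negligible: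
  assumes c: "\<And>n. c n \<ge> 0" "\<And>n. n \<ge> n0 \<Longrightarrow> c n = b (real n)"
    and lim: "green_ratio c \<longlonglongrightarrow> limit_moment"
  shows "integrable \<mu> (\<lambda>y. y powr (- \<alpha> * (\<beta> + 1)))"
    and "(\<lambda>x. P j x / scale 0 x) \<longlonglongrightarrow> 0"
proof -
  \<comment> \<open>At a time n >= n0 the weight is b(n) > 0; negligibility at \<open>n\<close> is
    passed down to \<open>j\<close> at the end.\<close>
  define n where "n = max j n0"
  let ?u = "\<lambda>k::nat. 1 / (real k + 2)"
  have ev: "eventually (\<lambda>x. b (real n) * (P n x / scale 0 x) + middle (?u k) (real k + 2) x \<le> green_ratio c x) sequentially" for k
    using eventually_ge_at_top[of 1] N_ge_nat[OF index_bounds(1)[of k], of n]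
  proof eventually_elim
    case (elim x)
    then show ?case by (intro middle_le_green_ratio[OF c]) (auto simp: n_def)
  qed
  \<comment> \<open>The assumed limit bounds all truncated moments. Even if
    \<open>limit_moment\<close> were the default value 0, this bound would force
    integrability.\<close>
  have "moment (?u k) (real k + 2) \<le> limit_moment" for k
  proof (rule tendsto_le[OF _ lim middle_limit[OF index_bounds[of k]]])
    show "eventually (\<lambda>x. middle (?u k) (real k + 2) x \<le> green_ratio c x) sequentially"
      using ev[of k]
    proof eventually_elim
      case (elim x)
      have "0 \<le> b (real n) * (P n x / scale 0 x)" by (simp add: P_nonneg)
      then show ?case using elim by linarith
    qed
  qed simp
  then show int: "integrable \<mu> (\<lambda>y. y powr (- \<alpha> * (\<beta> + 1)))" by (rule bounded_moments_imp_integrable)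
  have "(\<lambda>x. b (real n) * (P n x / scale 0 x)) \<longlonglongrightarrow> 0"
  proof (rule LIMSEQ_I)
    fix r :: real assume r: "r > 0"
    then have "eventually (\<lambda>k. \<bar>moment (?u k) (real k + 2) - limit_moment\<bar> < r / 3) sequentially"
      using tendstoD[OF moment_limit[OF int], of "r / 3"] by (simp add: dist_real_def)
    then obtain k where k: "\<bar>moment (?u k) (real k + 2) - limit_moment\<bar> < r / 3"
      unfolding eventually_sequentially by blast
    have "eventually (\<lambda>x. \<bar>middle (?u k) (real k + 2) x - moment (?u k) (real k + 2)\<bar> < r / 3) sequentially"
      "eventually (\<lambda>x. \<bar>green_ratio c x - limit_moment\<bar> < r / 3) sequentially"
      using r tendstoD[OF middle_limit[OF index_bounds[of k]], of "r / 3"] tendstoD[OF lim, of "r / 3"] by (simp_all add: dist_real_def)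
    with ev[of k] have "eventually (\<lambda>x. norm (b (real n) * (P n x / scale 0 x) - 0) < r) sequentially"
    proof eventually_elim
      case (elim x)
      have "0 \<le> b (real n) * (P n x / scale 0 x)" by (simp add: P_nonneg)
      then have "norm (b (real n) * (P n x / scale 0 x) - 0) = b (real n) * (P n x / scale 0 x)" by (simp only: diff_0_right real_norm_def abs_of_nonneg)
      then show ?case using elim k unfolding abs_less_iff by linarith
    qed
    then show "\<exists>no. \<forall>x\<ge>no. norm (b (real n) * (P n x / scale 0 x) - 0) < r" unfolding eventually_sequentially .
  qed
  from tendsto_mult[OF tendsto_const[of "inverse (b (real n))"] this] b_of_nat_pos(1)[of n]
  have "(\<lambda>x. P n x / scale 0 x) \<longlonglongrightarrow> 0"
    by (simp add: mult.assoc[symmetric] left_inverse less_imp_neq[symmetric] del: b_of_nat_pos)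
  then show "(\<lambda>x. P j x / scale 0 x) \<longlonglongrightarrow> 0" by (rule mass_negligible_shift) (simp add: n_def)
qed

text \<open>For the converse, fixed times must be shown negligible before \<open>c\<close> can be
  replaced by b. The early part is then what the middle times leave of the limit.\<close>

theorem green_limit_iff:
  assumes c: "\<And>n. c n \<ge> 0" "eventually (\<lambda>n. c n = b (real n)) sequentially"
  shows "green_ratio c \<longlonglongrightarrow> limit_moment \<longleftrightarrow> small_times_negligible 0"
proof
  assume neg: "small_times_negligible 0"
  show "green_ratio c \<longlonglongrightarrow> limit_moment"
    unfolding green_ratio_transfer[OF small_times_negligible_imp_mass_negligible[OF neg] c(2)]
    by (rule small_times_negligible_imp_green_limit[OF neg])
next
  assume lim: "green_ratio c \<longlonglongrightarrow> limit_moment"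
  obtain n0 where n0: "\<And>n. n \<ge> n0 \<Longrightarrow> c n = b (real n)" using c(2) unfolding eventually_sequentially by blast
  have int: "integrable \<mu> (\<lambda>y. y powr (- \<alpha> * (\<beta> + 1)))"
    by (rule green_limit_imp_mass_negligible(1)[OF c(1) n0 lim])
  have limb: "green_ratio (\<lambda>n. b (real n)) \<longlonglongrightarrow> limit_moment"
    using lim green_ratio_transfer[OF green_limit_imp_mass_negligible(2)[OF c(1) n0 lim] c(2)] by simp
  show "small_times_negligible 0"
    unfolding small_times_negligible_iff
  proof (intro allI impI)
    fix \<kappa> :: real assume \<kappa>: "\<kappa> > 0"
    let ?u = "\<lambda>k::nat. 1 / (real k + 2)"
    have "eventually (\<lambda>k. \<bar>moment (?u k) (real k + 2) - limit_moment\<bar> < \<kappa> / 3) sequentially"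
      using \<kappa> tendstoD[OF moment_limit[OF int], of "\<kappa> / 3"] by (simp add: dist_real_def)
    then obtain k where k: "\<bar>moment (?u k) (real k + 2) - limit_moment\<bar> < \<kappa> / 3"
      unfolding eventually_sequentially by blast
    have "eventually (\<lambda>x. \<bar>middle (?u k) (real k + 2) x - moment (?u k) (real k + 2)\<bar> < \<kappa> / 3) sequentially"
      "eventually (\<lambda>x. \<bar>green_ratio (\<lambda>n. b (real n)) x - limit_moment\<bar> < \<kappa> / 3) sequentially"
      using \<kappa> tendstoD[OF middle_limit[OF index_bounds[of k]], of "\<kappa> / 3"] tendstoD[OF limb, of "\<kappa> / 3"] by (simp_all add: dist_real_def)
    then have "eventually (\<lambda>x. partial_green 0 (N x (?u k)) x \<le> \<kappa> * scale 0 x) sequentially"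
      using eventually_ge_at_top[of 1]
    proof eventually_elim
      case (elim x)
      have s: "scale 0 x > 0" using scale_pos[OF elim(3)] .
      have "partial_green 0 (N x (?u k)) x + scale 0 x * middle (?u k) (real k + 2) x \<le> (\<Sum>n. b (real n) * P n x)"
        using partial_green_le_green[OF elim(3), of "N x (real k + 2)"] partial_green_middle[OF less_imp_le[OF index_bounds(2)[of k]] elim(3)]
        by linarith
      also have "\<dots> = scale 0 x * green_ratio (\<lambda>n. b (real n)) x" using s by (simp add: green_ratio_def)
      finally have "partial_green 0 (N x (?u k)) x \<le> scale 0 x * (green_ratio (\<lambda>n. b (real n)) x - middle (?u k) (real k + 2) x)"
        by (simp add: algebra_simps)
      also have "\<dots> \<le> scale 0 x * \<kappa>"
      proof (intro mult_left_mono)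
        show "green_ratio (\<lambda>n. b (real n)) x - middle (?u k) (real k + 2) x \<le> \<kappa>" using elim(1,2) k unfolding abs_less_iff by linarith
      qed (use s in auto)
      finally show ?case by (simp add: mult.commute)
    qed
    then show "\<exists>\<epsilon>>0. \<epsilon> \<le> 1 \<and> (\<exists>x0. \<forall>x\<ge>x0. partial_green 0 (N x \<epsilon>) x \<le> \<kappa> * scale 0 x)"
      unfolding eventually_sequentially by (intro exI[of _ "?u k"]) auto
  qed
qed

section \<open>Necessity of the two conditions\<close>

lemma H_drop:
  obtains s s' where "0 < s" "s < s'" "H s' < H s"
proof -
  have "eventually (\<lambda>y. cdf \<mu> y > 2/3) at_top"
    using cdf_lim_at_top_prob by (rule order_tendstoD) simp
  then obtain y1 where y1: "\<And>y. y \<ge> y1 \<Longrightarrow> cdf \<mu> y > 2/3" unfolding eventually_at_top_linorder by blast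
  define y where "y = max y1 1"
  have y: "cdf \<mu> y > 2/3" "y > 0" using y1[of y] by (auto simp: y_def)
  have "cdf \<mu> 0 = 0"
  proof -
    have "UNIV - {0<..} = {..0::real}" by auto
    then show ?thesis using prob_compl[of "{0<..}"] \<mu>_pos by (simp add: cdf_def)
  qed
  then have "(cdf \<mu> \<longlongrightarrow> 0) (at_right 0)" using cdf_is_right_cont[of 0] by (simp add: continuous_within)
  then have "eventually (\<lambda>z. cdf \<mu> z < 1/3) (at_right 0)" by (rule order_tendstoD) simp
  then obtain z where z: "z > 0" "cdf \<mu> z < 1/3" by (rule ex_small_right)
  have zy: "z < y"
  proof (rule ccontr)
    assume "\<not> z < y"
    then have "cdf \<mu> y \<le> cdf \<mu> z" by (intro cdf_mono) simp
    then show False using y z by linarith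
  qed
  have inv: "H (t powr - \<alpha>) = cdf \<mu> t" if "t > 0" for t
    using that alpha by (simp add: H_def powr_powr)
  show thesis
  proof (rule that)
    show "0 < y powr - \<alpha>" using y by simp
    show "y powr - \<alpha> < z powr - \<alpha>" using zy z alpha by (intro powr_less_mono2_neg) auto
    show "H (z powr - \<alpha>) < H (y powr - \<alpha>)" using y z by (simp add: inv)
  qed
qed

text \<open>A block of times of order A(w) across which \<open>H\<close> strictly decreases already
  carries the full order of the Green sum with weights n b(n).\<close>

lemma block_weight_lower:
  obtains c s w0 where "c > 0" "s > 0"
    "\<And>w. w \<ge> w0 \<Longrightarrow> c * scale 1 w \<le> (\<Sum>n\<in>{1..N w s}. real n * b (real n) * P (n - 1) w)"
proof -
  obtain s s' where s: "0 < s" "s < s'" "H s' < H s" by (rule H_drop)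
  define d where "d = \<alpha> * s * (H s - H s') / 2"
  have d: "d > 0" unfolding d_def using s alpha by simp
  have dd: "\<alpha> * s * (H s - H s') - d = d" by (simp add: d_def)
  \<comment> \<open>Half the minimum of t^\<beta> for t between s and 2 s'; the factor 1/2 is the
    loss in \<open>b_uniform\<close> with \<rho> = 2.\<close>
  define q where "q = min (s powr \<beta>) ((2 * s') powr \<beta>) / 2"
  have q: "q > 0" using s by (simp add: q_def)
  have powr_q: "2 * q \<le> t powr \<beta>" if "s < t" "t \<le> 2 * s'" for t
  proof (cases "\<beta> \<ge> 0")
    case True
    have "2 * q \<le> s powr \<beta>" by (simp add: q_def)
    also have "\<dots> \<le> t powr \<beta>" using that s True by (intro powr_mono2) auto
    finally show ?thesis .
  next
    case False
    have "2 * q \<le> (2 * s') powr \<beta>" by (simp add: q_def)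
    also have "\<dots> \<le> t powr \<beta>" using that s False by (intro powr_mono2') auto
    finally show ?thesis .
  qed
  have s2: "s < 2 * s'" using s by simp
  have "eventually (\<lambda>w. A (real w) \<ge> 2 / s') sequentially" using A_top by (auto simp: filterlim_at_top)
  then have "eventually (\<lambda>w. (s * q * d) * scale 1 w \<le> (\<Sum>n\<in>{1..N w (2 * s')}. real n * b (real n) * P (n - 1) w)) sequentially"
    using block_limit[OF s(1,2) d] b_uniform[OF s(1) s2, of 2, simplified] eventually_gt_at_top[of 0]
  proof eventually_elim
    case (elim w)
    have blk: "d * (A (real w) / real w) \<le> (\<Sum>n\<in>{N w s<..N w s'}. P n w)"
    proof -
      have "d \<le> real w / A (real w) * (\<Sum>n\<in>{N w s<..N w s'}. P n w)" using elim(2) unfolding dd by simp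
      then show ?thesis using elim(4) by (simp add: field_simps)
    qed
    \<comment> \<open>The shift from n to n + 1 may leave the block, so its upper end is doubled;
      A(w) >= 2 / s' leaves enough room.\<close>
    have up: "real (N w s') + 2 \<le> real (N w (2 * s')) + 1"
    proof -
      have "real (N w s') \<le> s' * A (real w)" using s by (intro N_le) simp
      moreover have "2 * s' * A (real w) - 1 \<le> real (N w (2 * s'))" by (rule N_ge)
      moreover have "2 \<le> s' * A (real w)" using elim(1) s by (simp add: pos_divide_le_eq mult.commute)
      ultimately show ?thesis by linarith
    qed
    have wt: "s * q * (A (real w) * B (real w)) \<le> real (Suc n) * b (real (Suc n))" if n: "n \<in> {N w s<..N w s'}" for n
    proof -
      have m: "Suc n \<in> {N w s<..N w (2 * s')}" using n up by auto
      define t where "t = real (Suc n) / A (real w)"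
      have t: "s < t" "t \<le> 2 * s'" using N_range[OF _ _ m] s by (auto simp: t_def)
      have "t powr \<beta> / 2 \<le> b (real (Suc n)) / B (real w)" using bspec[OF elim(3) m] unfolding t_def by simp
      then have "q \<le> b (real (Suc n)) / B (real w)" using powr_q[OF t] by linarith
      then have 1: "q * B (real w) \<le> b (real (Suc n))" by (simp add: pos_le_divide_eq)
      have 2: "s * A (real w) \<le> real (Suc n)" using t(1) unfolding t_def by (simp add: pos_less_divide_eq)
      have "(s * A (real w)) * (q * B (real w)) \<le> real (Suc n) * b (real (Suc n))"
        using 1 2 s q by (intro mult_mono) auto
      then show ?thesis by (simp add: mult_ac)
    qed
    have "(s * q * d) * scale 1 w = s * q * (A (real w) * B (real w)) * (d * (A (real w) / real w))"
      by (simp add: scale_def power2_eq_square)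
    also have "\<dots> \<le> s * q * (A (real w) * B (real w)) * (\<Sum>n\<in>{N w s<..N w s'}. P n w)"
      using blk s q by (intro mult_left_mono) auto
    also have "\<dots> \<le> (\<Sum>n\<in>{N w s<..N w s'}. real (Suc n) * b (real (Suc n)) * P (Suc n - 1) w)"
      unfolding sum_distrib_left using wt by (intro sum_mono) (auto intro!: mult_right_mono simp: P_nonneg)
    also have "\<dots> = (\<Sum>n\<in>Suc ` {N w s<..N w s'}. real n * b (real n) * P (n - 1) w)"
      by (subst sum.reindex) auto
    also have "\<dots> \<le> (\<Sum>n\<in>{1..N w (2 * s')}. real n * b (real n) * P (n - 1) w)"
      using up by (intro sum_mono2) (auto simp: P_nonneg)
    finally show ?case .
  qed
  then obtain w0 where "\<And>w. w \<ge> w0 \<Longrightarrow> (s * q * d) * scale 1 w \<le> (\<Sum>n\<in>{1..N w (2 * s')}. real n * b (real n) * P (n - 1) w)"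
    unfolding eventually_sequentially by blast
  moreover have "s * q * d > 0" "2 * s' > 0" using s q d by auto
  ultimately show thesis by (rule that[rotated 2])
qed

lemma small_times_negligible_imp_mass_condition:
  assumes "small_times_negligible 0"
  shows mass_condition
  unfolding mass_condition_def
proof (intro allI impI)
  fix \<kappa> :: real assume \<kappa>: "\<kappa> > 0"
  have "eventually (\<lambda>x. P 1 x / scale 0 x < \<kappa>) sequentially"
    using small_times_negligible_imp_mass_negligible[OF assms, of 1] \<kappa> by (rule order_tendstoD)
  then have "eventually (\<lambda>x. p x \<le> \<kappa> * scale 0 x) sequentially"
    using eventually_ge_at_top[of 1]
  proof eventually_elim
    case (elim x)
    then show ?case using scale_pos[OF elim(2), of 0] by (simp add: pos_divide_less_eq)
  qed
  then show "\<exists>x0. \<forall>x\<ge>x0. p x \<le> \<kappa> * scale 0 x" unfolding eventually_sequentially .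
qed

text \<open>For finitely many w the scales at x - w and x are comparable, so the mass condition
  covers all of them. This disposes of the small w to which asymptotic bounds in w do not
  apply.\<close>

lemma mass_condition_shift:
  assumes mass_condition "\<kappa> > 0"
  shows "eventually (\<lambda>x. (\<Sum>w\<in>{1..<w0}. p (x - w) * scale 1 w) \<le> \<kappa> * scale 0 x) sequentially"
proof -
  obtain C where C: "C \<ge> 1"
    "\<And>x y. 1 \<le> y \<Longrightarrow> y \<le> x \<Longrightarrow> x \<le> 2 * y \<Longrightarrow> scale 0 x \<le> C * scale 0 y \<and> scale 0 y \<le> C * scale 0 x"
    by (rule scale_comparable) blast
  define S where "S = (\<Sum>w\<in>{1..<w0}. scale 1 w) + 1"
  have S: "S > 0" unfolding S_def by (intro add_nonneg_pos sum_nonneg) auto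
  have "\<kappa> / (C * S) > 0" using assms(2) C(1) S by simp
  then obtain x0 where x0: "\<And>x. x \<ge> x0 \<Longrightarrow> p x \<le> \<kappa> / (C * S) * scale 0 x"
    using assms(1) unfolding mass_condition_def by blast
  show ?thesis
    using eventually_ge_at_top[of "x0 + 2 * w0 + 1"]
  proof eventually_elim
    case (elim x)
    have "(\<Sum>w\<in>{1..<w0}. p (x - w) * scale 1 w) \<le> (\<Sum>w\<in>{1..<w0}. (\<kappa> / S * scale 0 x) * scale 1 w)"
    proof (intro sum_mono mult_right_mono)
      fix w assume w: "w \<in> {1..<w0}"
      have "p (x - w) \<le> \<kappa> / (C * S) * scale 0 (x - w)" using w elim by (intro x0) auto
      also have "\<dots> \<le> \<kappa> / (C * S) * (C * scale 0 x)"
        using C w elim assms(2) S by (intro mult_left_mono) auto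
      finally show "p (x - w) \<le> \<kappa> / S * scale 0 x" using C(1) by simp
    qed simp
    also have "\<dots> = \<kappa> / S * scale 0 x * (S - 1)" by (simp add: S_def sum_distrib_left)
    also have "\<dots> \<le> \<kappa> / S * scale 0 x * S" using assms(2) S by (intro mult_left_mono) auto
    finally show ?case using S by simp
  qed
qed

text \<open>A jump from w <= \<delta>x to x exceeds x/2, while w itself is reached by smaller steps,
  so the lower big jump bound applies. The times up to s A(w), which carry the Green sum at w, are
  early for x when \<delta> is small.\<close>

lemma small_times_negligible_imp_sum_condition:
  assumes neg: "small_times_negligible 0"
  shows sum_condition
  unfolding sum_condition_def
proof (intro allI impI)
  fix \<kappa> :: real assume \<kappa>: "\<kappa> > 0"
  obtain c s w0 where c: "c > 0" "s > 0"
    "\<And>w. w \<ge> w0 \<Longrightarrow> c * scale 1 w \<le> (\<Sum>n\<in>{1..N w s}. real n * b (real n) * P (n - 1) w)"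
    by (rule block_weight_lower) blast
  have "c * \<kappa> / 2 > 0" using c \<kappa> by simp
  then obtain \<epsilon> x0 where \<epsilon>: "\<epsilon> > 0" "\<And>x. x \<ge> x0 \<Longrightarrow> partial_green 0 (N x \<epsilon>) x \<le> c * \<kappa> / 2 * scale 0 x"
    using neg unfolding small_times_negligible_iff by blast
  obtain C where C: "C \<ge> 1" "\<And>x y. x \<ge> 1 \<Longrightarrow> y \<ge> x \<Longrightarrow> A x \<le> C * (y / x) powr (- (\<alpha> / 2)) * A y"
    by (rule A_lower_half) blast
  \<comment> \<open>For w <= \<delta>x, A(w) <= C \<delta>^(\<alpha>/2) A(x); \<delta> is taken so
    small that s A(w) <= \<epsilon> A(x).\<close>
  have "((\<lambda>\<delta>. s * C * \<delta> powr (\<alpha> / 2)) \<longlongrightarrow> s * C * 0 powr (\<alpha> / 2)) (at_right 0)"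
    using alpha by (intro tendsto_mult tendsto_const tendsto_powr2 tendsto_ident_at) (auto simp: eventually_at_right_less less_imp_le eventually_at_filter)
  then have "((\<lambda>\<delta>. s * C * \<delta> powr (\<alpha> / 2)) \<longlongrightarrow> 0) (at_right 0)" by simp
  then have "eventually (\<lambda>\<delta>. s * C * \<delta> powr (\<alpha> / 2) < \<epsilon>) (at_right 0)" using \<epsilon>(1) by (rule order_tendstoD)
  moreover have "eventually (\<lambda>\<delta>::real. \<delta> < 1/4) (at_right 0)" by (rule order_tendstoD(2)[OF tendsto_ident_at]) simp
  ultimately have "eventually (\<lambda>\<delta>. s * C * \<delta> powr (\<alpha> / 2) < \<epsilon> \<and> \<delta> < 1/4) (at_right 0)" by (rule eventually_conj)
  then obtain \<delta> where \<delta>: "\<delta> > 0" "s * C * \<delta> powr (\<alpha> / 2) < \<epsilon> \<and> \<delta> < 1/4" by (rule ex_small_right)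
  have Nle: "N w s \<le> N x \<epsilon>" if w: "w \<ge> 1" "real w \<le> \<delta> * real x" for w x
  proof -
    have wx: "real w \<le> real x" using w \<delta> mult_right_mono[of \<delta> 1 "real x"] by linarith
    have "A (real w) \<le> C * (real x / real w) powr (- (\<alpha> / 2)) * A (real x)" using w wx by (intro C(2)) auto
    also have "(real x / real w) powr (- (\<alpha> / 2)) = (real w / real x) powr (\<alpha> / 2)"
      by (simp add: powr_minus_divide powr_divide)
    also have "\<dots> \<le> \<delta> powr (\<alpha> / 2)"
      using w wx alpha by (intro powr_mono2) (auto simp: pos_divide_le_eq)
    finally have "A (real w) \<le> C * \<delta> powr (\<alpha> / 2) * A (real x)"
      using C(1) by (simp add: mult_left_mono mult_right_mono)
    then have "s * A (real w) \<le> s * (C * \<delta> powr (\<alpha> / 2) * A (real x))" using c(2) by (intro mult_left_mono) auto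
    also have "\<dots> = (s * C * \<delta> powr (\<alpha> / 2)) * A (real x)" by simp
    also have "\<dots> \<le> \<epsilon> * A (real x)" using \<delta> by (intro mult_right_mono) auto
    finally show ?thesis unfolding N_def by (intro nat_mono floor_mono)
  qed
  have \<kappa>2: "\<kappa> / 2 > 0" using \<kappa> by simp
  have "eventually (\<lambda>x. (\<Sum>w\<in>{1..nat \<lfloor>\<delta> * real x\<rfloor>}. p (x - w) * scale 1 w) \<le> \<kappa> * scale 0 x) sequentially"
    using mass_condition_shift[OF small_times_negligible_imp_mass_condition[OF neg] \<kappa>2, of w0]
      eventually_ge_at_top[of "max x0 4"]
  proof eventually_elim
    case (elim x)
    have x: "x \<ge> x0" "x \<ge> 4" using elim(2) by auto
    \<comment> \<open>As w <= Y, truncation at \<open>Y\<close> does not change the probability of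
      being at w.\<close>
    define Y where "Y = x div 2"
    define W where "W = {w. 1 \<le> w \<and> w0 \<le> w \<and> real w \<le> \<delta> * real x}"
    have Wf: "W \<subseteq> {1..nat \<lfloor>\<delta> * real x\<rfloor>}"
      unfolding subset_iff nat_floor_ge_iff by (simp add: W_def)
    then have fin: "finite W" by (rule finite_subset) simp
    have WY: "w \<le> Y" "w < x - Y" "N w s \<le> N x \<epsilon>" "w0 \<le> w" if "w \<in> W" for w
    proof -
      have "real w \<le> \<delta> * real x" "w \<ge> 1" using that by (auto simp: W_def)
      moreover have "\<delta> * real x \<le> real x / 4" using \<delta> mult_right_mono[of \<delta> "1/4" "real x"] by simp
      ultimately have "4 * w \<le> x" by linarith
      then show "w \<le> Y" "w < x - Y" using \<open>w \<ge> 1\<close> x by (auto simp: Y_def)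
      show "N w s \<le> N x \<epsilon>" "w0 \<le> w" using that by (auto intro!: Nle simp: W_def)
    qed
    have jump: "real n * (\<Sum>w\<in>W. p (x - w) * P (n - 1) w) \<le> P n x" for n
    proof -
      have "(\<Sum>w\<in>W. p (x - w) * P (n - 1) w) = (\<Sum>w\<in>W. p (x - w) * conv_pow (truncate_at Y p) (n - 1) w)"
        using WY by (intro sum.cong) (auto simp: conv_pow_truncate_eq)
      also have "\<dots> \<le> (\<Sum>w<x - Y. p (x - w) * conv_pow (truncate_at Y p) (n - 1) w)"
        using WY p_nonneg by (intro sum_mono2) (auto intro!: mult_nonneg_nonneg conv_pow_nonneg simp: truncate_at_def)
      finally have "real n * (\<Sum>w\<in>W. p (x - w) * P (n - 1) w)
          \<le> real n * (\<Sum>w<x - Y. p (x - w) * conv_pow (truncate_at Y p) (n - 1) w)" by (intro mult_left_mono) auto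
      also have "\<dots> \<le> P n x" by (rule conv_pow_big_jump_lower) (auto simp: p_nonneg Y_def)
      finally show ?thesis .
    qed
    have "c * (\<Sum>w\<in>W. p (x - w) * scale 1 w) = (\<Sum>w\<in>W. p (x - w) * (c * scale 1 w))"
      by (simp add: sum_distrib_left mult_ac)
    also have "\<dots> \<le> (\<Sum>w\<in>W. p (x - w) * (\<Sum>n\<in>{1..N x \<epsilon>}. real n * b (real n) * P (n - 1) w))"
    proof (intro sum_mono mult_left_mono p_nonneg)
      fix w assume w: "w \<in> W"
      have "c * scale 1 w \<le> (\<Sum>n\<in>{1..N w s}. real n * b (real n) * P (n - 1) w)" using WY[OF w] by (intro c(3))
      also have "\<dots> \<le> (\<Sum>n\<in>{1..N x \<epsilon>}. real n * b (real n) * P (n - 1) w)"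
        using WY[OF w] by (intro sum_mono2) (auto simp: P_nonneg)
      finally show "c * scale 1 w \<le> (\<Sum>n\<in>{1..N x \<epsilon>}. real n * b (real n) * P (n - 1) w)" .
    qed
    also have "\<dots> = (\<Sum>n\<in>{1..N x \<epsilon>}. b (real n) * (real n * (\<Sum>w\<in>W. p (x - w) * P (n - 1) w)))"
      unfolding sum_distrib_left by (subst sum.swap) (simp add: mult_ac)
    also have "\<dots> \<le> (\<Sum>n\<in>{1..N x \<epsilon>}. b (real n) * P n x)"
      by (intro sum_mono mult_left_mono jump) auto
    also have "\<dots> = partial_green 0 (N x \<epsilon>) x" by (simp add: partial_green_def)
    also have "\<dots> \<le> c * (\<kappa> / 2 * scale 0 x)" using \<epsilon>(2)[OF x(1)] by simp
    finally have big: "(\<Sum>w\<in>W. p (x - w) * scale 1 w) \<le> \<kappa> / 2 * scale 0 x" using c(1) by simp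
    have "{1..nat \<lfloor>\<delta> * real x\<rfloor>} \<subseteq> {1..<w0} \<union> W"
      unfolding subset_iff nat_floor_ge_iff by (auto simp: W_def)
    then have "(\<Sum>w\<in>{1..nat \<lfloor>\<delta> * real x\<rfloor>}. p (x - w) * scale 1 w) \<le> (\<Sum>w\<in>{1..<w0} \<union> W. p (x - w) * scale 1 w)"
      using fin p_nonneg by (intro sum_mono2) (auto intro!: mult_nonneg_nonneg)
    also have "\<dots> = (\<Sum>w\<in>{1..<w0}. p (x - w) * scale 1 w) + (\<Sum>w\<in>W. p (x - w) * scale 1 w)"
      using fin by (intro sum.union_disjoint) (auto simp: W_def)
    also have "\<dots> \<le> \<kappa> * scale 0 x" using big elim(1) by linarith
    finally show ?case .
  qed
  then show "\<exists>\<delta>>0. \<exists>x0. \<forall>x\<ge>x0. (\<Sum>w\<in>{1..nat \<lfloor>\<delta> * real x\<rfloor>}. p (x - w) * scale 1 w) \<le> \<kappa> * scale 0 x"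
    unfolding eventually_sequentially using \<delta>(1) by blast
qed

theorem green_limit_criterion:
  assumes c: "\<And>n. c n \<ge> 0" "eventually (\<lambda>n. c n = b (real n)) sequentially"
  shows "\<alpha> * (2 + \<beta>) > 1 \<Longrightarrow> green_ratio c \<longlonglongrightarrow> limit_moment"
    and "green_ratio c \<longlonglongrightarrow> limit_moment \<longleftrightarrow> mass_condition \<and> sum_condition"
proof -
  show "green_ratio c \<longlonglongrightarrow> limit_moment" if "\<alpha> * (2 + \<beta>) > 1"
  proof -
    have "1 < (2 + \<beta>) * \<alpha>" using that by (simp add: mult.commute)
    then have "1 / \<alpha> < 2 + \<beta>" using alpha by (simp add: pos_divide_less_eq)
    then have "small_times_negligible 0" by (intro small_times_negligible_base) simp
    then show ?thesis using green_limit_iff[OF c] by simp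
  qed
  show "green_ratio c \<longlonglongrightarrow> limit_moment \<longleftrightarrow> mass_condition \<and> sum_condition"
    unfolding green_limit_iff[OF c]
    using small_times_negligible_imp_mass_condition small_times_negligible_imp_sum_condition
      conditions_imp_small_times_negligible by blast
qed

end

section \<open>The two conditions as limits\<close>

lemma tendsto_times_ratio_iff:
  fixes f r :: "'a \<Rightarrow> real"
  assumes r: "(r \<longlongrightarrow> 1) F"
  shows "((\<lambda>x. r x * f x) \<longlongrightarrow> l) F \<longleftrightarrow> (f \<longlongrightarrow> l) F"
proof
  assume "(f \<longlongrightarrow> l) F"
  from tendsto_mult[OF r this] show "((\<lambda>x. r x * f x) \<longlongrightarrow> l) F" by simp
next
  assume "((\<lambda>x. r x * f x) \<longlongrightarrow> l) F"
  from tendsto_divide[OF this r] have "((\<lambda>x. r x * f x / r x) \<longlongrightarrow> l) F" by simp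
  moreover have "eventually (\<lambda>x. r x * f x / r x = f x) F"
    using order_tendstoD(1)[OF r, of 0] by (auto elim: eventually_mono)
  ultimately show "(f \<longlongrightarrow> l) F" by (rule Lim_transform_eventually)
qed

context attracted_walk
begin

lemma mass_condition_iff: "mass_condition \<longleftrightarrow> (\<lambda>x. p x / scale 0 x) \<longlonglongrightarrow> 0"
proof
  assume mass: mass_condition
  show "(\<lambda>x. p x / scale 0 x) \<longlonglongrightarrow> 0"
  proof (rule LIMSEQ_I)
    fix r :: real assume r: "r > 0"
    then obtain x0 where x0: "\<And>x. x \<ge> x0 \<Longrightarrow> p x \<le> r / 2 * scale 0 x"
      using mass unfolding mass_condition_def by (meson half_gt_zero)
    have "norm (p x / scale 0 x - 0) < r" if "x \<ge> max x0 1" for x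
    proof -
      have "p x / scale 0 x \<le> r / 2" using x0[of x] that scale_pos[of x 0] by (simp add: pos_divide_le_eq)
      moreover have "p x / scale 0 x \<ge> 0" using p_nonneg by simp
      ultimately show ?thesis using r by (simp only: diff_0_right real_norm_def abs_of_nonneg)
    qed
    then show "\<exists>no. \<forall>x\<ge>no. norm (p x / scale 0 x - 0) < r" by blast
  qed
next
  assume lim: "(\<lambda>x. p x / scale 0 x) \<longlonglongrightarrow> 0"
  show mass_condition
    unfolding mass_condition_def
  proof (intro allI impI)
    fix \<kappa> :: real assume "\<kappa> > 0"
    with lim have "eventually (\<lambda>x. p x / scale 0 x < \<kappa>) sequentially" by (rule order_tendstoD)
    then have "eventually (\<lambda>x. p x \<le> \<kappa> * scale 0 x) sequentially"
      using eventually_ge_at_top[of 1]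
    proof eventually_elim
      case (elim x)
      then show ?case using scale_pos[OF elim(2), of 0] by (simp add: pos_divide_less_eq)
    qed
    then show "\<exists>x0. \<forall>x\<ge>x0. p x \<le> \<kappa> * scale 0 x" unfolding eventually_sequentially .
  qed
qed

text \<open>D(w) stands for B(w) / (w Fbar(w)^2) and T(x) for x Fbar(x) / B(x). A lower bound for
  \<open>D\<close> by \<open>scale 1\<close> is available only for w >= w0; the finitely many
  smaller w are covered by the mass condition.\<close>

lemma sum_condition_iff:
  fixes D T :: "nat \<Rightarrow> real"
  assumes mass: mass_condition
    and D: "\<And>w. w \<ge> 1 \<Longrightarrow> D w \<ge> 0" "(\<lambda>w. D w / scale 1 w) \<longlonglongrightarrow> 1"
    and T: "(\<lambda>x. T x * scale 0 x) \<longlonglongrightarrow> 1"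
  shows "sum_condition \<longleftrightarrow>
    ((\<lambda>\<delta>. Limsup sequentially (\<lambda>x. ereal (T x * (\<Sum>w\<in>{1..nat \<lfloor>\<delta> * real x\<rfloor>}. p (x - w) * D w)))) \<longlongrightarrow> 0) (at_right 0)"
    (is "_ \<longleftrightarrow> (?L \<longlongrightarrow> 0) _")
proof -
  have Tb: "eventually (\<lambda>x. 1/2 < T x * scale 0 x \<and> T x * scale 0 x < 2 \<and> scale 0 x > 0) sequentially"
  proof -
    have "eventually (\<lambda>x. 1/2 < T x * scale 0 x) sequentially" "eventually (\<lambda>x. T x * scale 0 x < 2) sequentially"
      by (rule order_tendstoD[OF T]; simp)+
    then show ?thesis using eventually_ge_at_top[of 1] by eventually_elim (simp add: scale_pos)
  qed
  have Tpos: "eventually (\<lambda>x. T x > 0) sequentially"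
    using Tb
  proof eventually_elim
    case (elim x)
    then have "0 < T x * scale 0 x" by linarith
    then show ?case using elim zero_less_mult_pos2 by blast
  qed
  have "eventually (\<lambda>w. 1/2 < D w / scale 1 w \<and> D w / scale 1 w < 2) sequentially"
    using order_tendstoD(1)[OF D(2), of "1/2"] order_tendstoD(2)[OF D(2), of 2] by (simp add: eventually_conj)
  then obtain w0 where w0: "\<And>w. w \<ge> w0 \<Longrightarrow> 1/2 < D w / scale 1 w \<and> D w / scale 1 w < 2"
    unfolding eventually_sequentially by blast
  have Dlow: "scale 1 w \<le> 2 * D w" if "w \<ge> w0" "w \<ge> 1" for w
    using w0[OF that(1)] scale_pos[OF that(2), of 1] by (simp add: pos_less_divide_eq)
  obtain K where K: "K > 0" "\<And>w. w \<ge> 1 \<Longrightarrow> D w \<le> K * scale 1 w"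
  proof -
    define K where "K = 2 + (\<Sum>w<w0. \<bar>D w / scale 1 w\<bar>)"
    have s0: "(\<Sum>w<w0. \<bar>D w / scale 1 w\<bar>) \<ge> 0" by (intro sum_nonneg) simp
    have "D w \<le> K * scale 1 w" if "w \<ge> 1" for w
    proof -
      have "D w / scale 1 w \<le> K"
      proof (cases "w < w0")
        case True
        have "D w / scale 1 w \<le> \<bar>D w / scale 1 w\<bar>" by (rule abs_ge_self)
        also have "\<dots> \<le> (\<Sum>w<w0. \<bar>D w / scale 1 w\<bar>)"
          using True by (intro member_le_sum) auto
        finally show ?thesis by (simp add: K_def)
      next
        case False
        then have "D w / scale 1 w < 2" using w0[of w] by simp
        then show ?thesis using s0 unfolding K_def by linarith
      qed
      then show ?thesis using scale_pos[OF that, of 1] by (simp add: pos_divide_le_eq)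
    qed
    moreover have "K > 0" using s0 by (simp add: K_def)
    ultimately show thesis using that by blast
  qed
  define S where "S \<delta> x = (\<Sum>w\<in>{1..nat \<lfloor>\<delta> * real x\<rfloor>}. p (x - w) * D w)" for \<delta> x
  have S_nonneg: "S \<delta> x \<ge> 0" for \<delta> x unfolding S_def using D(1) p_nonneg by (intro sum_nonneg mult_nonneg_nonneg) auto
  have L_nonneg: "?L \<delta> \<ge> 0" for \<delta>
  proof (rule le_Limsup)
    show "eventually (\<lambda>x. 0 \<le> ereal (T x * (\<Sum>w\<in>{1..nat \<lfloor>\<delta> * real x\<rfloor>}. p (x - w) * D w))) sequentially"
      unfolding S_def[symmetric] using Tpos by eventually_elim (simp add: S_nonneg)
  qed simp
  show ?thesis
  proof
    assume sumc: sum_condition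
    show "(?L \<longlongrightarrow> 0) (at_right 0)"
    proof (rule order_tendstoI)
      fix e :: ereal assume "e < 0"
      then show "eventually (\<lambda>\<delta>. e < ?L \<delta>) (at_right 0)" using L_nonneg by (intro always_eventually allI) (rule less_le_trans)
    next
      fix e :: ereal assume "0 < e"
      then obtain r :: real where r: "r > 0" "ereal r < e" by (metis ereal_dense2 ereal_less(2))
      have "r / (2 * K) > 0" using r K by simp
      then obtain \<delta>0 x0 where \<delta>0: "\<delta>0 > 0" "\<And>x. x \<ge> x0 \<Longrightarrow>
          (\<Sum>w\<in>{1..nat \<lfloor>\<delta>0 * real x\<rfloor>}. p (x - w) * scale 1 w) \<le> r / (2 * K) * scale 0 x"
        using sumc unfolding sum_condition_def by blast
      have "?L \<delta> < e" if \<delta>: "\<delta> < \<delta>0" for \<delta>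
      proof -
        have "eventually (\<lambda>x. ereal (T x * (\<Sum>w\<in>{1..nat \<lfloor>\<delta> * real x\<rfloor>}. p (x - w) * D w)) \<le> ereal r) sequentially"
          using Tb Tpos eventually_ge_at_top[of x0]
        proof eventually_elim
          case (elim x)
          have "S \<delta> x \<le> (\<Sum>w\<in>{1..nat \<lfloor>\<delta> * real x\<rfloor>}. p (x - w) * (K * scale 1 w))"
            unfolding S_def using K p_nonneg by (intro sum_mono mult_left_mono) auto
          also have "\<dots> = K * (\<Sum>w\<in>{1..nat \<lfloor>\<delta> * real x\<rfloor>}. p (x - w) * scale 1 w)"
            by (simp add: sum_distrib_left mult_ac)
          also have "\<dots> \<le> K * (\<Sum>w\<in>{1..nat \<lfloor>\<delta>0 * real x\<rfloor>}. p (x - w) * scale 1 w)"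
          proof (intro mult_left_mono sum_mono2)
            have "nat \<lfloor>\<delta> * real x\<rfloor> \<le> nat \<lfloor>\<delta>0 * real x\<rfloor>"
              using \<delta> by (intro nat_mono floor_mono mult_right_mono) auto
            then show "{1..nat \<lfloor>\<delta> * real x\<rfloor>} \<subseteq> {1..nat \<lfloor>\<delta>0 * real x\<rfloor>}" by auto
          qed (use K p_nonneg in auto)
          also have "\<dots> \<le> K * (r / (2 * K) * scale 0 x)" using K \<delta>0(2)[OF elim(3)] by (intro mult_left_mono) auto
          also have "\<dots> = r / 2 * scale 0 x" using K by simp
          finally have "T x * S \<delta> x \<le> T x * (r / 2 * scale 0 x)" using elim(2) by (intro mult_left_mono) auto
          also have "\<dots> = (T x * scale 0 x) * (r / 2)" by simp
          also have "\<dots> \<le> 2 * (r / 2)" using elim(1) r by (intro mult_right_mono) auto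
          finally show ?case by (simp add: S_def)
        qed
        then have "?L \<delta> \<le> ereal r" by (rule Limsup_bounded)
        then show ?thesis using r(2) by (rule le_less_trans)
      qed
      moreover have "eventually (\<lambda>\<delta>. \<delta> < \<delta>0) (at_right 0)" using \<delta>0(1) by (intro order_tendstoD(2)[OF tendsto_ident_at])
      ultimately show "eventually (\<lambda>\<delta>. ?L \<delta> < e) (at_right 0)" by (auto elim: eventually_mono)
    qed
  next
    assume lim: "(?L \<longlongrightarrow> 0) (at_right 0)"
    show sum_condition
      unfolding sum_condition_def
    proof (intro allI impI)
      fix \<kappa> :: real assume \<kappa>: "\<kappa> > 0"
      \<comment> \<open>The 8 pays for a factor 2 from \<open>T\<close>, a factor 2 from
        \<open>D\<close>, and half of \<kappa> reserved for w < w0.\<close>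
      have "eventually (\<lambda>\<delta>. ?L \<delta> < ereal (\<kappa> / 8)) (at_right 0)" using lim \<kappa> by (intro order_tendstoD) auto
      then obtain \<delta> where \<delta>: "\<delta> > 0" "?L \<delta> < ereal (\<kappa> / 8)" by (rule ex_small_right)
      have \<kappa>2: "\<kappa> / 2 > 0" using \<kappa> by simp
      have "eventually (\<lambda>x. (\<Sum>w\<in>{1..nat \<lfloor>\<delta> * real x\<rfloor>}. p (x - w) * scale 1 w) \<le> \<kappa> * scale 0 x) sequentially"
        using Limsup_lessD[OF \<delta>(2)] Tb Tpos mass_condition_shift[OF mass \<kappa>2, of w0]
      proof eventually_elim
        case (elim x)
        let ?I = "{1..nat \<lfloor>\<delta> * real x\<rfloor>}"
        have TS: "T x * S \<delta> x < \<kappa> / 8" using elim(1) by (simp add: S_def)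
        have "1/2 * S \<delta> x \<le> (T x * scale 0 x) * S \<delta> x" using elim(2) S_nonneg by (intro mult_right_mono) auto
        also have "\<dots> = (T x * S \<delta> x) * scale 0 x" by simp
        also have "\<dots> \<le> \<kappa> / 8 * scale 0 x" using TS elim(2) by (intro mult_right_mono) auto
        finally have S: "2 * S \<delta> x \<le> \<kappa> / 2 * scale 0 x" by simp
        have "(\<Sum>w\<in>?I. p (x - w) * scale 1 w) \<le> (\<Sum>w\<in>{1..<w0} \<union> {w\<in>?I. w0 \<le> w}. p (x - w) * scale 1 w)"
          using p_nonneg by (intro sum_mono2) (auto intro!: mult_nonneg_nonneg)
        also have "\<dots> = (\<Sum>w\<in>{1..<w0}. p (x - w) * scale 1 w) + (\<Sum>w\<in>{w\<in>?I. w0 \<le> w}. p (x - w) * scale 1 w)"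
          by (intro sum.union_disjoint) auto
        also have "(\<Sum>w\<in>{w\<in>?I. w0 \<le> w}. p (x - w) * scale 1 w) \<le> (\<Sum>w\<in>{w\<in>?I. w0 \<le> w}. p (x - w) * (2 * D w))"
          using Dlow p_nonneg by (intro sum_mono mult_left_mono) auto
        also have "\<dots> \<le> (\<Sum>w\<in>?I. p (x - w) * (2 * D w))"
          using D(1) p_nonneg by (intro sum_mono2) (auto intro!: mult_nonneg_nonneg)
        also have "\<dots> = 2 * S \<delta> x" by (simp add: S_def sum_distrib_left mult_ac)
        finally show ?case using S elim(4) by linarith
      qed
      then show "\<exists>\<delta>>0. \<exists>x0. \<forall>x\<ge>x0. (\<Sum>w\<in>{1..nat \<lfloor>\<delta> * real x\<rfloor>}. p (x - w) * scale 1 w) \<le> \<kappa> * scale 0 x"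
        unfolding eventually_sequentially using \<delta>(1) by blast
    qed
  qed
qed

end

section \<open>Limits over the integers and the group generated by the support\<close>

lemma at_top_int_eq: "(at_top :: int filter) = filtermap int sequentially"
proof (rule filter_eqI)
  fix Q :: "int \<Rightarrow> bool"
  show "eventually Q at_top \<longleftrightarrow> eventually Q (filtermap int sequentially)"
    unfolding eventually_filtermap eventually_sequentially eventually_at_top_linorder
  proof
    assume "\<exists>N. \<forall>n\<ge>N. Q n"
    then obtain N where "\<And>n. n \<ge> N \<Longrightarrow> Q n" by blast
    then show "\<exists>N. \<forall>n\<ge>N. Q (int n)" by (intro exI[of _ "nat N"]) auto
  next
    assume "\<exists>N. \<forall>n\<ge>N. Q (int n)"
    then obtain N where N: "\<And>n. n \<ge> N \<Longrightarrow> Q (int n)" by blast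
    have "Q z" if "z \<ge> int N" for z using N[of "nat z"] that by simp
    then show "\<exists>N. \<forall>n\<ge>N. Q n" by blast
  qed
qed

lemma tendsto_at_top_int_iff: "((f :: int \<Rightarrow> 'a :: topological_space) \<longlongrightarrow> l) at_top \<longleftrightarrow> (\<lambda>n. f (int n)) \<longlonglongrightarrow> l"
  unfolding at_top_int_eq filterlim_filtermap ..

lemma Limsup_at_top_int: "Limsup at_top (f :: int \<Rightarrow> ereal) = Limsup sequentially (\<lambda>n. f (int n))"
  unfolding at_top_int_eq by (rule Limsup_filtermap_eq) (rule inj_of_nat)

text \<open>The integers z with cos(z\<theta>) = 1 form a subgroup.\<close>

lemma group_closure_cos:
  fixes S :: "int set"
  assumes "group_closure S = UNIV" and S: "\<And>z. z \<in> S \<Longrightarrow> cos (of_int z * \<theta>) = (1::real)"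
  shows "cos \<theta> = 1"
proof -
  have "cos (of_int z * \<theta>) = 1" if "z \<in> group_closure S" for z
    using that
  proof induction
    case (base z)
    then show ?case using S by auto
  next
    case (diff z z')
    then obtain m m' :: int where "of_int z * \<theta> = of_int m * 2 * pi" "of_int z' * \<theta> = of_int m' * 2 * pi"
      unfolding cos_one_2pi_int by blast
    then have "of_int (z - z') * \<theta> = of_int (m - m') * 2 * pi" by (simp add: algebra_simps)
    then show ?case unfolding cos_one_2pi_int by blast
  qed
  from this[of 1] show ?thesis using assms(1) by simp
qed

section \<open>Random walks with non-negative steps\<close>

locale nonneg_steps =
  fixes M :: "'a measure" and X :: "nat \<Rightarrow> 'a \<Rightarrow> int"
  assumes iid: "iid_steps M X" and nonneg: "measure M {\<omega> \<in> space M. X 1 \<omega> \<ge> 0} = 1"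
begin

sublocale prob_space M
  using iid by (simp add: iid_steps_def)

definition mass :: "nat \<Rightarrow> real" where "mass k = step_mass M X (int k)"

lemma indep: "indep_vars (\<lambda>_. count_space UNIV) X {1..}"
  and same_law: "r \<ge> 1 \<Longrightarrow> distr M (count_space UNIV) (X r) = distr M (count_space UNIV) (X 1)"
  using iid unfolding iid_steps_def by blast+

lemma X_measurable [measurable]: "r \<ge> 1 \<Longrightarrow> X r \<in> measurable M (count_space UNIV)"
  using indep by (auto simp: indep_vars_def)

lemma walk_measurable [measurable]: "walk X n \<in> measurable M (count_space UNIV)"
proof (induction n)
  case 0
  then show ?case by (simp add: walk_def)
next
  case (Suc n)
  have "walk X (Suc n) = (\<lambda>\<omega>. walk X n \<omega> + X (Suc n) \<omega>)" by (auto simp: walk_def)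
  moreover have "(\<lambda>\<omega>. walk X n \<omega> + X (Suc n) \<omega>) \<in> measurable M (count_space UNIV)"
    using Suc X_measurable[of "Suc n"] by simp
  ultimately show ?case by simp
qed

lemma same_prob:
  assumes "r \<ge> 1"
  shows "prob {\<omega> \<in> space M. X r \<omega> \<in> S} = prob {\<omega> \<in> space M. X 1 \<omega> \<in> S}"
proof -
  have "measure (distr M (count_space UNIV) (X r)) S = measure (distr M (count_space UNIV) (X 1)) S"
    using same_law[OF assms] by simp
  then show ?thesis using assms by (simp add: measure_distr vimage_def Int_def conj_commute)
qed

lemma AE_X_nonneg: "r \<ge> 1 \<Longrightarrow> AE \<omega> in M. X r \<omega> \<ge> 0"
proof -
  assume r: "r \<ge> 1"
  have "prob {\<omega> \<in> space M. X r \<omega> \<ge> 0} = 1" using same_prob[OF r, of "{0..}"] nonneg by simp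
  then show ?thesis by (subst (asm) prob_Collect_eq_1) (use r in auto)
qed

lemma AE_walk_nonneg: "AE \<omega> in M. walk X n \<omega> \<ge> 0"
proof -
  have "AE \<omega> in M. \<forall>r\<in>{1..n}. X r \<omega> \<ge> 0" by (intro AE_finite_allI AE_X_nonneg) auto
  then show ?thesis by eventually_elim (auto simp: walk_def intro: sum_nonneg)
qed

lemma walk_joint:
  "prob {\<omega> \<in> space M. X (Suc n) \<omega> = i \<and> walk X n \<omega> = j}
     = step_mass M X i * prob {\<omega> \<in> space M. walk X n \<omega> = j}"
proof -
  have "indep_vars (\<lambda>_. borel) (\<lambda>r \<omega>. real_of_int (X r \<omega>)) {1..}"
    by (rule indep_vars_compose2[OF indep]) simp
  then have "indep_vars (\<lambda>_. borel) (\<lambda>r \<omega>. real_of_int (X r \<omega>)) (insert (Suc n) {1..n})"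
    by (rule indep_vars_subset) auto
  then have iv: "indep_var borel (\<lambda>\<omega>. real_of_int (X (Suc n) \<omega>)) borel (\<lambda>\<omega>. \<Sum>r\<in>{1..n}. real_of_int (X r \<omega>))"
    by (intro indep_vars_sum) auto
  have "prob {\<omega> \<in> space M. X (Suc n) \<omega> = i \<and> walk X n \<omega> = j} = prob {\<omega> \<in> space M. X (Suc n) \<omega> = i} * prob {\<omega> \<in> space M. walk X n \<omega> = j}"
    using indep_varD[OF iv, of "{of_int i}" "{of_int j}"]
    by (simp add: vimage_def Int_def conj_commute walk_def flip: of_int_sum)
  then show ?thesis using same_prob[of "Suc n" "{i}"] by (simp add: step_mass_def)
qed

text \<open>Almost surely both S_n and the next step are non-negative, so only splittings of k into
  two natural numbers occur.\<close>

lemma prob_walk: "prob {\<omega> \<in> space M. walk X n \<omega> = int k} = conv_pow mass n k"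
proof (induction n arbitrary: k)
  case 0
  then show ?case by (auto simp: walk_def conv_pow_0 prob_space)
next
  case (Suc n)
  let ?E = "\<lambda>i. {\<omega> \<in> space M. X (Suc n) \<omega> = int i \<and> walk X n \<omega> = int (k - i)}"
  have sets: "?E i \<in> sets M" for i
    using X_measurable[of "Suc n"] by measurable
  have "prob {\<omega> \<in> space M. walk X (Suc n) \<omega> = int k} = prob (\<Union>i\<in>{..k}. ?E i)"
  proof (rule measure_eq_AE)
    show "AE \<omega> in M. (\<omega> \<in> {\<omega> \<in> space M. walk X (Suc n) \<omega> = int k}) = (\<omega> \<in> (\<Union>i\<in>{..k}. ?E i))"
      using AE_X_nonneg[of "Suc n", simplified] AE_walk_nonneg[of n]
    proof eventually_elim
      case (elim \<omega>)
      have eq: "walk X (Suc n) \<omega> = walk X n \<omega> + X (Suc n) \<omega>" by (simp add: walk_def)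
      show ?case
      proof
        assume "\<omega> \<in> {\<omega> \<in> space M. walk X (Suc n) \<omega> = int k}"
        then have "\<omega> \<in> ?E (nat (X (Suc n) \<omega>))" "nat (X (Suc n) \<omega>) \<le> k" using eq elim by auto
        then show "\<omega> \<in> (\<Union>i\<in>{..k}. ?E i)" by blast
      qed (use eq in auto)
    qed
    show "{\<omega> \<in> space M. walk X (Suc n) \<omega> = int k} \<in> sets M" by measurable
    show "(\<Union>i\<in>{..k}. ?E i) \<in> sets M" using sets by blast
  qed
  also have "\<dots> = (\<Sum>i\<le>k. prob (?E i))"
    by (rule finite_measure_finite_Union) (use sets in \<open>auto simp: disjoint_family_on_def\<close>)
  also have "\<dots> = conv_pow mass (Suc n) k"
    unfolding conv_pow_Suc by (intro sum.cong refl) (simp only: walk_joint Suc.IH flip: mass_def)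
  finally show ?case .
qed

lemma prob_walk_le:
  assumes "z \<ge> 0"
  shows "prob {\<omega> \<in> space M. real_of_int (walk X n \<omega>) \<le> z} = (\<Sum>k\<le>nat \<lfloor>z\<rfloor>. conv_pow mass n k)"
proof -
  let ?E = "\<lambda>k. {\<omega> \<in> space M. walk X n \<omega> = int k}"
  have "prob {\<omega> \<in> space M. real_of_int (walk X n \<omega>) \<le> z} = prob (\<Union>k\<in>{..nat \<lfloor>z\<rfloor>}. ?E k)"
  proof (rule measure_eq_AE)
    show "AE \<omega> in M. (\<omega> \<in> {\<omega> \<in> space M. real_of_int (walk X n \<omega>) \<le> z}) = (\<omega> \<in> (\<Union>k\<in>{..nat \<lfloor>z\<rfloor>}. ?E k))"
      using AE_walk_nonneg[of n]
    proof eventually_elim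
      case (elim \<omega>)
      show ?case
      proof
        assume "\<omega> \<in> {\<omega> \<in> space M. real_of_int (walk X n \<omega>) \<le> z}"
        then have "\<omega> \<in> ?E (nat (walk X n \<omega>))" "nat (walk X n \<omega>) \<le> nat \<lfloor>z\<rfloor>" using elim by (auto simp: le_floor_iff intro!: nat_mono)
        then show "\<omega> \<in> (\<Union>k\<in>{..nat \<lfloor>z\<rfloor>}. ?E k)" by blast
      next
        assume "\<omega> \<in> (\<Union>k\<in>{..nat \<lfloor>z\<rfloor>}. ?E k)"
        then obtain k where "k \<le> nat \<lfloor>z\<rfloor>" "\<omega> \<in> ?E k" by blast
        then show "\<omega> \<in> {\<omega> \<in> space M. real_of_int (walk X n \<omega>) \<le> z}" using assms by (auto simp: le_nat_floor le_nat_iff le_floor_iff)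
      qed
    qed
    show "{\<omega> \<in> space M. real_of_int (walk X n \<omega>) \<le> z} \<in> sets M" by measurable
    show "(\<Union>k\<in>{..nat \<lfloor>z\<rfloor>}. ?E k) \<in> sets M" by measurable
  qed
  also have "\<dots> = (\<Sum>k\<le>nat \<lfloor>z\<rfloor>. prob (?E k))"
    by (rule finite_measure_finite_Union) (auto simp: disjoint_family_on_def)
  finally show ?thesis by (simp add: prob_walk)
qed

lemma walk_1: "walk X (Suc 0) = X (Suc 0)"
  by (auto simp: walk_def)

lemma mass_nonneg: "mass k \<ge> 0"
  by (simp add: mass_def step_mass_def)

lemma step_mass_neg: "z < 0 \<Longrightarrow> step_mass M X z = 0"
proof -
  assume "z < 0"
  have "prob {\<omega> \<in> space M. X 1 \<omega> = z} = prob {}"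
    by (rule measure_eq_AE) (use AE_X_nonneg[of 1] X_measurable[of 1] \<open>z < 0\<close> in \<open>auto elim: eventually_mono\<close>)
  then show ?thesis by (simp add: step_mass_def)
qed

lemma step_tail_eq:
  assumes "z \<ge> 0"
  shows "step_tail M X z = 1 - (\<Sum>k\<le>nat \<lfloor>z\<rfloor>. mass k)"
proof -
  have "prob {\<omega> \<in> space M. real_of_int (X 1 \<omega>) \<le> z} = (\<Sum>k\<le>nat \<lfloor>z\<rfloor>. mass k)"
    using prob_walk_le[OF assms, of 1] by (simp add: walk_1)
  moreover have "{\<omega> \<in> space M. real_of_int (X 1 \<omega>) \<le> z} \<in> sets M" using X_measurable[of 1] by measurable
  moreover have "space M - {\<omega> \<in> space M. real_of_int (X 1 \<omega>) \<le> z} = {\<omega> \<in> space M. real_of_int (X 1 \<omega>) > z}" by auto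
  ultimately show ?thesis using prob_compl[of "{\<omega> \<in> space M. real_of_int (X 1 \<omega>) \<le> z}"] by (simp add: step_tail_def)
qed

lemma cdf_walk:
  assumes "c > 0" "y \<ge> 0"
  shows "cdf (distr M borel (\<lambda>\<omega>. real_of_int (walk X n \<omega>) / c)) y = (\<Sum>k\<le>nat \<lfloor>y * c\<rfloor>. conv_pow mass n k)"
proof -
  have "cdf (distr M borel (\<lambda>\<omega>. real_of_int (walk X n \<omega>) / c)) y = prob {\<omega> \<in> space M. real_of_int (walk X n \<omega>) \<le> y * c}"
    using assms by (simp add: cdf_def measure_distr vimage_def Int_def conj_commute pos_divide_le_eq)
  then show ?thesis using assms by (simp add: prob_walk_le)
qed

lemma mass_sums: "mass sums 1"
proof -
  have "real_distribution (distr M borel (\<lambda>\<omega>. real_of_int (X 1 \<omega>)))"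
    using X_measurable[of 1] by (intro real_distribution_distr) simp
  then have "(cdf (distr M borel (\<lambda>\<omega>. real_of_int (X 1 \<omega>))) \<longlongrightarrow> 1) at_top"
    by (rule real_distribution.cdf_lim_at_top_prob)
  then have "(\<lambda>n. cdf (distr M borel (\<lambda>\<omega>. real_of_int (X 1 \<omega>))) (real n)) \<longlonglongrightarrow> 1"
    by (rule filterlim_compose[OF _ filterlim_real_sequentially])
  then have "(\<lambda>n. \<Sum>k\<le>n. mass k) \<longlonglongrightarrow> 1" using cdf_walk[of 1 _ 1] by (simp add: walk_1)
  then show ?thesis by (simp add: sums_def_le)
qed

lemma mass_aperiodic:
  assumes "aperiodic_step M X" and \<theta>: "\<And>k. mass k > 0 \<Longrightarrow> cos (real k * \<theta>) = 1"
  shows "cos \<theta> = 1"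
proof (rule group_closure_cos)
  show "group_closure {z. step_mass M X z > 0} = UNIV" using assms(1) by (simp add: aperiodic_step_def)
  fix z assume "z \<in> {z. step_mass M X z > 0}"
  then have z: "step_mass M X z > 0" by simp
  then have "z \<ge> 0" using step_mass_neg[of z] by (cases "z < 0") auto
  then show "cos (of_int z * \<theta>) = 1" using \<theta>[of "nat z"] z by (simp add: mass_def)
qed

end

section \<open>Regularisation and transfer to the given functions\<close>

locale attracted_steps = nonneg_steps M X for M :: "'a measure" and X :: "nat \<Rightarrow> 'a \<Rightarrow> int" +
  fixes \<alpha> \<beta> :: real and a :: "nat \<Rightarrow> real" and \<mu> :: "real measure" and A L0 b :: "real \<Rightarrow> real"
  assumes aperiodic: "aperiodic_step M X"
    and alpha: "0 < \<alpha>" "\<alpha> < 1"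
    and attraction: "domain_of_attraction M X \<alpha> 1 a \<mu>"
    and b_nonneg: "\<And>x. x \<ge> 0 \<Longrightarrow> b x \<ge> 0"
    and b_rv: "regularly_varying \<beta> b"
    and L0: "normalised_slowly_varying L0"
    and A_form: "\<And>x. x > 0 \<Longrightarrow> A x = x powr \<alpha> * L0 x"
    and A_tail: "A \<sim>[at_top] (\<lambda>x. 1 / step_tail M X x)"
    and A_norming: "\<And>n. n \<ge> 1 \<Longrightarrow> A (a n) = real n"
begin

abbreviation Fbar :: "real \<Rightarrow> real" where "Fbar \<equiv> step_tail M X"

lemma A_pos: "x > 0 \<Longrightarrow> A x > 0"
  using A_form L0 by (simp add: normalised_slowly_varying_def)

lemma A_Fbar_limit: "((\<lambda>x. A x * Fbar x) \<longlongrightarrow> 1) at_top"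
proof -
  have "eventually (\<lambda>x. A x \<noteq> 0 \<or> 1 / Fbar x \<noteq> 0) at_top"
    using eventually_gt_at_top[of 0] by eventually_elim (use A_pos in force)
  from asymp_equivD_strong[OF A_tail this] show ?thesis by simp
qed

text \<open>A Fbar tends to 1, so Fbar is positive arbitrarily far out, and it is
  decreasing.\<close>

lemma Fbar_pos: "Fbar x > 0"
proof -
  have "eventually (\<lambda>x. A x * Fbar x > 0) at_top" by (rule order_tendstoD(1)[OF A_Fbar_limit]) simp
  then have "eventually (\<lambda>y. A y * Fbar y > 0 \<and> y > max x 0) at_top" using eventually_gt_at_top by (rule eventually_conj)
  then obtain y where y: "A y * Fbar y > 0" "y > x" "y > 0" unfolding eventually_at_top_linorder by (metis max_less_iff_conj order_refl)
  have "Fbar y > 0" using zero_less_mult_pos[OF y(1) A_pos[OF y(3)]] .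
  also have "Fbar y \<le> Fbar x" unfolding step_tail_def using y(2) X_measurable[of 1] by (intro finite_measure_mono) auto
  finally show ?thesis .
qed

lemma a_pos: "n \<ge> 1 \<Longrightarrow> a n > 0"
  and mu_positive: "measure \<mu> {0<..} = 1"
  and mu_distribution: "real_distribution \<mu>"
  and weak: "isCont (cdf \<mu>) y \<Longrightarrow> (\<lambda>n. cdf (distr M borel (\<lambda>\<omega>. real_of_int (walk X n \<omega>) / a n)) y) \<longlonglongrightarrow> cdf \<mu> y"
  using attraction unfolding domain_of_attraction_def stable_law_def weak_conv_m_def weak_conv_def by blast+

text \<open>A(a_n) = n does not suffice, since \<open>A\<close> is not controlled on bounded sets.
  If a_n < R, then P(S_n <= y a_n) is at most q^n, where q < 1 is the probability that a step is at
  most y R; but these probabilities have a limit above 1/2.\<close>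

lemma a_top: "filterlim a at_top sequentially"
  unfolding filterlim_at_top
proof
  fix Z :: real
  define R where "R = max Z 1"
  interpret mu: real_distribution \<mu> by (rule mu_distribution)
  have "eventually (\<lambda>y. cdf \<mu> y > 1/2) at_top"
    by (rule order_tendstoD(1)[OF mu.cdf_lim_at_top_prob]) simp
  then obtain y1 where y1: "\<And>y. y \<ge> y1 \<Longrightarrow> cdf \<mu> y > 1/2" unfolding eventually_at_top_linorder by blast
  obtain y where y: "max y1 0 < y" "isCont (cdf \<mu>) y" using mu.ex_continuity_point[of "max y1 0" "max y1 0 + 1"] by auto
  have y0: "y > 0" "cdf \<mu> y > 1/2" using y(1) y1[of y] by auto
  have ev: "eventually (\<lambda>n. cdf (distr M borel (\<lambda>\<omega>. real_of_int (walk X n \<omega>) / a n)) y > 1/2) sequentially"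
    by (rule order_tendstoD(1)[OF weak[OF y(2)] y0(2)])
  define q where "q = (\<Sum>k\<le>nat \<lfloor>y * R\<rfloor>. mass k)"
  have yR: "y * R \<ge> 0" using y0 by (simp add: R_def)
  have q: "0 \<le> q" "q < 1" using Fbar_pos[of "y * R"] step_tail_eq[OF yR] mass_nonneg by (auto simp: q_def intro: sum_nonneg)
  have "(\<lambda>n. q ^ n) \<longlonglongrightarrow> 0" using q by (intro LIMSEQ_power_zero) simp
  then have "eventually (\<lambda>n. q ^ n < 1/2) sequentially" by (rule order_tendstoD) simp
  with ev show "eventually (\<lambda>n. Z \<le> a n) sequentially"
    using eventually_ge_at_top[of 1]
  proof eventually_elim
    case (elim n)
    have "R \<le> a n"
    proof (rule ccontr)
      assume "\<not> R \<le> a n"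
      then have "y * a n \<le> y * R" using y0 by simp
      then have "nat \<lfloor>y * a n\<rfloor> \<le> nat \<lfloor>y * R\<rfloor>" by (intro nat_mono floor_mono)
      then have "(\<Sum>k\<le>nat \<lfloor>y * a n\<rfloor>. conv_pow mass n k) \<le> (\<Sum>k\<le>nat \<lfloor>y * R\<rfloor>. conv_pow mass n k)"
        by (intro sum_mono2) (auto intro!: conv_pow_nonneg mass_nonneg)
      also have "\<dots> \<le> q ^ n" unfolding q_def by (rule sum_conv_pow_le) (rule mass_nonneg)
      finally show False using elim cdf_walk[OF a_pos[OF elim(3)], of y n] y0 by simp
    qed
    then show ?case by (simp add: R_def)
  qed
qed

text \<open>The hypotheses constrain \<open>A\<close>, \<open>b\<close> and \<open>a\<close> only near infinity. Freezing these functions below a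
  threshold makes the bounds global without affecting any of the limits.\<close>

lemma regularise:
  obtains x1 t0 n0 where "x1 \<ge> 1" "t0 \<ge> 1"
    "attracted_walk mass (\<lambda>x. A (max x x1)) (\<lambda>n. a (max n n0)) \<alpha> (\<lambda>t. b (max t t0)) \<beta> \<mu>"
proof -
  have "\<alpha> / 2 > 0" using alpha by simp
  from normalised_regular_ratio[OF L0 this A_form] obtain x0 where x0: "x0 \<ge> 1"
    "\<And>x y. x \<ge> x0 \<Longrightarrow> y \<ge> x \<Longrightarrow> A x \<le> (y / x) powr (\<alpha> / 2 - \<alpha>) * A y" by metis
  \<comment> \<open>The bound with constant 1 and exponent -\<alpha>/2 gives strict growth, from
    which monotonicity of \<open>a\<close> is recovered through A(a_n) = n.\<close>
  have strict: "A x < A y" if "x0 \<le> x" "x < y" for x y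
  proof -
    have x: "x > 0" "y > 0" using that x0(1) by auto
    have "A x \<le> (y / x) powr (\<alpha> / 2 - \<alpha>) * A y" using that by (intro x0) auto
    also have "(y / x) powr (\<alpha> / 2 - \<alpha>) < (y / x) powr 0" using that x alpha by (intro powr_less_mono) auto
    then have "(y / x) powr (\<alpha> / 2 - \<alpha>) * A y < 1 * A y" using A_pos[OF x(2)] x that by (intro mult_strict_right_mono) auto
    finally show ?thesis by simp
  qed
  then have mono: "A x \<le> A y" if "x0 \<le> x" "x \<le> y" for x y
    using that by (cases "x = y") (auto simp: less_le)
  obtain y where y: "y \<ge> x0" "A y \<ge> 1"
  proof -
    have "eventually (\<lambda>n. a n \<ge> x0) sequentially" using a_top by (simp add: filterlim_at_top)
    then obtain m where "\<And>n. n \<ge> m \<Longrightarrow> a n \<ge> x0" unfolding eventually_sequentially by blast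
    then have "a (max m 1) \<ge> x0" "A (a (max m 1)) \<ge> 1" using A_norming[of "max m 1"] by auto
    then show thesis by (rule that)
  qed
  obtain t1 where t1: "\<And>t0. t0 \<ge> t1 \<Longrightarrow> potter_bounds \<alpha> (\<lambda>x. A (max x t0)) \<and> locally_bounded_pos (\<lambda>x. A (max x t0))"
    using potter_bounds_max[OF normalised_potter[OF L0 A_form]] by metis
  obtain t0 where t0: "t0 \<ge> 1" "\<And>t. t \<ge> t0 \<Longrightarrow> potter_bounds \<beta> (\<lambda>x. b (max x t)) \<and> locally_bounded_pos (\<lambda>x. b (max x t))"
    using potter_bounds_max[OF regularly_varying_potter[OF b_rv]] by metis
  define x1 where "x1 = max y (max t1 x0)"
  have x1: "x1 \<ge> 1" "x1 \<ge> x0" "x1 \<ge> t1" "A x1 \<ge> 1" using x0(1) y mono[OF y(1), of x1] by (auto simp: x1_def)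
  have "eventually (\<lambda>n. a n \<ge> x1 \<and> n \<ge> 1) sequentially" using a_top eventually_ge_at_top by (auto simp: filterlim_at_top intro: eventually_conj)
  then obtain n0 where n0: "\<And>n. n \<ge> n0 \<Longrightarrow> a n \<ge> x1 \<and> n \<ge> 1" unfolding eventually_sequentially by blast
  have a1_eq: "eventually (\<lambda>n. a (max n n0) = a n) sequentially" using eventually_ge_at_top[of n0] by eventually_elim (simp add: max_def)
  interpret mu: real_distribution \<mu> by (rule mu_distribution)
  have "attracted_walk mass (\<lambda>x. A (max x x1)) (\<lambda>n. a (max n n0)) \<alpha> (\<lambda>t. b (max t t0)) \<beta> \<mu>"
  proof unfold_locales
    show "(\<lambda>k. (1 - (\<Sum>j\<le>k. mass j)) * A (max (real k) x1)) \<longlonglongrightarrow> 1"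
    proof (rule Lim_transform_eventually)
      show "(\<lambda>k. A (real k) * Fbar (real k)) \<longlonglongrightarrow> 1"
        by (rule filterlim_compose[OF A_Fbar_limit filterlim_real_sequentially])
      have "eventually (\<lambda>k. real k \<ge> x1) sequentially" using filterlim_real_sequentially by (simp add: filterlim_at_top)
      then show "eventually (\<lambda>k. A (real k) * Fbar (real k) = (1 - (\<Sum>j\<le>k. mass j)) * A (max (real k) x1)) sequentially"
        by eventually_elim (simp add: step_tail_eq max_def)
    qed
    show "potter_bounds \<alpha> (\<lambda>x. A (max x x1))" using t1 x1 by blast
    show "A (max u x1) \<le> A (max v x1)" if "u \<le> v" for u v using that x1 by (intro mono) auto
    show "1 \<le> A (max u x1)" for u using mono[of x1 "max u x1"] x1 by simp
    show "a (max m n0) \<le> a (max n n0)" if mn: "m \<le> n" for m n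
    proof (rule ccontr)
      assume c: "\<not> a (max m n0) \<le> a (max n n0)"
      have "A (a (max n n0)) < A (a (max m n0))"
        using c n0[of "max n n0"] x1(2) by (intro strict) auto
      moreover have "A (a (max n n0)) = real (max n n0)" "A (a (max m n0)) = real (max m n0)"
        using n0[of "max n n0"] n0[of "max m n0"] by (auto intro!: A_norming)
      ultimately show False using mn by auto
    qed
    show "1 \<le> a (max n n0)" for n using n0[of "max n n0"] x1(1) by auto
    show "filterlim (\<lambda>n. a (max n n0)) at_top sequentially"
      using a_top by (rule filterlim_cong[THEN iffD1, rotated -1]) (use a1_eq in \<open>auto elim: eventually_mono\<close>)
    show "eventually (\<lambda>n. A (max (a (max n n0)) x1) = real n) sequentially"
      using eventually_ge_at_top[of n0]
    proof eventually_elim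
      case (elim n)
      then show ?case using n0[of n] A_norming[of n] by (simp add: max.absorb1)
    qed
    show "locally_bounded_pos (\<lambda>t. b (max t t0))" "potter_bounds \<beta> (\<lambda>t. b (max t t0))" using t0 by auto
    show "(\<lambda>n. \<Sum>k\<le>nat \<lfloor>y * a (max n n0)\<rfloor>. conv_pow mass n k) \<longlonglongrightarrow> cdf \<mu> y"
      if y: "0 < y" "isCont (cdf \<mu>) y" for y
    proof (rule Lim_transform_eventually[OF weak[OF y(2)]])
      show "eventually (\<lambda>n. cdf (distr M borel (\<lambda>\<omega>. real_of_int (walk X n \<omega>) / a n)) y
          = (\<Sum>k\<le>nat \<lfloor>y * a (max n n0)\<rfloor>. conv_pow mass n k)) sequentially"
        using a1_eq eventually_ge_at_top[of 1] by eventually_elim (use cdf_walk a_pos y in simp)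
    qed
  qed (use mass_nonneg mass_sums alpha mass_aperiodic[OF aperiodic] mu_positive in auto)
  with x1(1) t0(1) show thesis by (rule that)
qed

lemma green_dichotomy:
  defines "star \<equiv> ((\<lambda>x::int. of_int x * Fbar (of_int x) * green M X b x / b (A (of_int x)))
         \<longlongrightarrow> \<alpha> * (\<integral>y. y powr (- \<alpha> * (\<beta> + 1)) \<partial>\<mu>)) at_top"
  shows "\<alpha> * (2 + \<beta>) > 1 \<Longrightarrow> star"
    and "star \<longleftrightarrow>
       ((\<lambda>x::int. of_int x * Fbar (of_int x) * step_mass M X x / b (A (of_int x))) \<longlongrightarrow> 0) at_top \<and>
       ((\<lambda>\<delta>::real. Limsup at_top (\<lambda>x::int. ereal (of_int x * Fbar (of_int x) / b (A (of_int x)) *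
           (\<Sum>w\<in>{w::int. 1 \<le> w \<and> of_int w \<le> \<delta> * of_int x}.
              step_mass M X (x - w) * b (A (of_int w)) / (of_int w * (Fbar (of_int w))\<^sup>2))))) \<longlongrightarrow> 0) (at_right 0)"
proof -
  obtain x1 t0 n0 where x1: "x1 \<ge> 1" and t0: "t0 \<ge> 1" and
    W: "attracted_walk mass (\<lambda>x. A (max x x1)) (\<lambda>n. a (max n n0)) \<alpha> (\<lambda>t. b (max t t0)) \<beta> \<mu>"
    by (rule regularise)
  interpret W: attracted_walk mass "\<lambda>x. A (max x x1)" "\<lambda>n. a (max n n0)" \<alpha> "\<lambda>t. b (max t t0)" \<beta> \<mu>
    by (rule W)
  define T where "T x = real x * Fbar (real x) / b (A (real x))" for x :: nat
  define D where "D w = b (A (real w)) / (real w * (Fbar (real w))\<^sup>2)" for w :: nat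
  define c where "c n = b (real n)" for n :: nat
  have AF: "(\<lambda>x. A (real x) * Fbar (real x)) \<longlonglongrightarrow> 1"
    by (rule filterlim_compose[OF A_Fbar_limit filterlim_real_sequentially])
  have large: "eventually (\<lambda>x. A (max (real x) x1) = A (real x) \<and> W.B (real x) = b (A (real x)) \<and> x \<ge> 1) sequentially"
  proof -
    have "eventually (\<lambda>x. real x \<ge> x1) sequentially" using filterlim_real_sequentially by (simp add: filterlim_at_top)
    moreover have "eventually (\<lambda>x::nat. A (max (real x) x1) \<ge> t0) sequentially" using W.A_top by (simp add: filterlim_at_top)
    ultimately show ?thesis
    proof eventually_elim
      case (elim x)
      then have "max (real x) x1 = real x" "x \<ge> 1" using x1 by auto
      then show ?case using elim(2) by (simp add: W.B_def max.absorb1)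
    qed
  qed
  have T: "(\<lambda>x. T x * W.scale 0 x) \<longlonglongrightarrow> 1"
  proof (rule Lim_transform_eventually[OF AF])
    show "eventually (\<lambda>x. A (real x) * Fbar (real x) = T x * W.scale 0 x) sequentially"
      using large
    proof eventually_elim
      case (elim x)
      then have "b (A (real x)) \<noteq> 0" using W.B_pos(3)[of "real x"] by simp
      then show ?case using elim by (simp add: T_def W.scale_def)
    qed
  qed
  have D: "(\<lambda>w. D w / W.scale 1 w) \<longlonglongrightarrow> 1"
  proof (rule Lim_transform_eventually)
    show "(\<lambda>w. 1 / (A (real w) * Fbar (real w))\<^sup>2) \<longlonglongrightarrow> 1"
      using tendsto_divide[OF tendsto_const tendsto_power[OF AF, of 2], of 1] by simp
    show "eventually (\<lambda>w. 1 / (A (real w) * Fbar (real w))\<^sup>2 = D w / W.scale 1 w) sequentially"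
      using large
    proof eventually_elim
      case (elim w)
      then have "b (A (real w)) \<noteq> 0" using W.B_pos(3)[of "real w"] by simp
      then show ?case using elim by (simp add: D_def W.scale_def power_mult_distrib power2_eq_square)
    qed
  qed
  have D0: "D w \<ge> 0" if "w \<ge> 1" for w
    unfolding D_def using b_nonneg[of "A (real w)"] A_pos[of "real w"] that by (intro divide_nonneg_nonneg) auto
  have c: "c n \<ge> 0" "eventually (\<lambda>n. c n = b (max (real n) t0)) sequentially" for n
  proof -
    show "c n \<ge> 0" unfolding c_def by (rule b_nonneg) simp
    have "eventually (\<lambda>n. real n \<ge> t0) sequentially" using filterlim_real_sequentially by (simp add: filterlim_at_top)
    then show "eventually (\<lambda>n. c n = b (max (real n) t0)) sequentially" by eventually_elim (simp add: c_def max_def)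
  qed
  have transfer: "(\<lambda>x. T x * f x) \<longlonglongrightarrow> l \<longleftrightarrow> (\<lambda>x. f x / W.scale 0 x) \<longlonglongrightarrow> l" for f l
  proof -
    have "eventually (\<lambda>x. T x * f x = (T x * W.scale 0 x) * (f x / W.scale 0 x)) sequentially"
      using eventually_ge_at_top[of 1]
    proof eventually_elim
      case (elim x)
      then show ?case using W.scale_pos[OF elim, of 0] by simp
    qed
    then have "(\<lambda>x. T x * f x) \<longlonglongrightarrow> l \<longleftrightarrow> (\<lambda>x. (T x * W.scale 0 x) * (f x / W.scale 0 x)) \<longlonglongrightarrow> l"
      by (rule tendsto_cong)
    also have "\<dots> \<longleftrightarrow> (\<lambda>x. f x / W.scale 0 x) \<longlonglongrightarrow> l" by (rule tendsto_times_ratio_iff[OF T])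
    finally show ?thesis .
  qed
  have star: "star \<longleftrightarrow> W.green_ratio c \<longlonglongrightarrow> W.limit_moment"
  proof -
    have "star \<longleftrightarrow> (\<lambda>x. T x * (\<Sum>n. c n * conv_pow mass n x)) \<longlonglongrightarrow> W.limit_moment"
      unfolding star_def tendsto_at_top_int_iff by (simp add: T_def c_def green_def prob_walk W.limit_moment_def)
    then show ?thesis unfolding transfer W.green_ratio_def[abs_def] .
  qed
  have mass_iff: "((\<lambda>x::int. of_int x * Fbar (of_int x) * step_mass M X x / b (A (of_int x))) \<longlongrightarrow> 0) at_top \<longleftrightarrow> W.mass_condition"
  proof -
    have "((\<lambda>x::int. of_int x * Fbar (of_int x) * step_mass M X x / b (A (of_int x))) \<longlongrightarrow> 0) at_top
        \<longleftrightarrow> (\<lambda>x. T x * mass x) \<longlonglongrightarrow> 0"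
      unfolding tendsto_at_top_int_iff by (simp add: T_def mass_def)
    then show ?thesis unfolding transfer W.mass_condition_iff .
  qed
  \<comment> \<open>For \<delta> < 1 all w are at most x, so subtraction of natural numbers agrees
    with that of integers; the limit at 0 sees only such \<delta>.\<close>
  have sums: "(\<Sum>w\<in>{w::int. 1 \<le> w \<and> of_int w \<le> \<delta> * of_int (int x)}.
      step_mass M X (int x - w) * b (A (of_int w)) / (of_int w * (Fbar (of_int w))\<^sup>2))
      = (\<Sum>w\<in>{1..nat \<lfloor>\<delta> * real x\<rfloor>}. mass (x - w) * D w)" if \<delta>: "0 < \<delta>" "\<delta> < 1" for \<delta> x
  proof (rule sum.reindex_bij_witness[where i = int and j = nat])
    fix w assume w: "w \<in> {w::int. 1 \<le> w \<and> of_int w \<le> \<delta> * of_int (int x)}"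
    then show "int (nat w) = w" by auto
    show "nat w \<in> {1..nat \<lfloor>\<delta> * real x\<rfloor>}" unfolding nat_floor_ge_iff using w by auto
    have "real_of_int w \<le> real x" using w \<delta> mult_right_mono[of \<delta> 1 "real x"] by auto
    then have "w \<le> int x" by linarith
    then have "int (x - nat w) = int x - w" using w by auto
    then show "mass (x - nat w) * D (nat w) = step_mass M X (int x - w) * b (A (of_int w)) / (of_int w * (Fbar (of_int w))\<^sup>2)"
      using w by (simp add: mass_def D_def)
  next
    fix w assume w: "w \<in> {1..nat \<lfloor>\<delta> * real x\<rfloor>}"
    then show "int w \<in> {w::int. 1 \<le> w \<and> of_int w \<le> \<delta> * of_int (int x)}" unfolding nat_floor_ge_iff by auto
  qed simp
  \<comment> \<open>An equivalence under the first condition is enough, because the two conditions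
    occur in a conjunction.\<close>
  have sum_iff: "((\<lambda>\<delta>::real. Limsup at_top (\<lambda>x::int. ereal (of_int x * Fbar (of_int x) / b (A (of_int x)) *
           (\<Sum>w\<in>{w::int. 1 \<le> w \<and> of_int w \<le> \<delta> * of_int x}.
              step_mass M X (x - w) * b (A (of_int w)) / (of_int w * (Fbar (of_int w))\<^sup>2))))) \<longlongrightarrow> 0) (at_right 0)
      \<longleftrightarrow> W.sum_condition" if mass: W.mass_condition
  proof (rule trans[OF tendsto_cong W.sum_condition_iff[OF mass D0 D T, symmetric]])
    have "eventually (\<lambda>\<delta>::real. 0 < \<delta> \<and> \<delta> < 1) (at_right 0)"
      by (intro eventually_conj eventually_at_right_less order_tendstoD(2)[OF tendsto_ident_at]) simp
    then show "eventually (\<lambda>\<delta>. Limsup at_top (\<lambda>x::int. ereal (of_int x * Fbar (of_int x) / b (A (of_int x)) *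
           (\<Sum>w\<in>{w::int. 1 \<le> w \<and> of_int w \<le> \<delta> * of_int x}.
              step_mass M X (x - w) * b (A (of_int w)) / (of_int w * (Fbar (of_int w))\<^sup>2))))
        = Limsup sequentially (\<lambda>x. ereal (T x * (\<Sum>w\<in>{1..nat \<lfloor>\<delta> * real x\<rfloor>}. mass (x - w) * D w)))) (at_right 0)"
    proof eventually_elim
      case (elim \<delta>)
      then have "0 < \<delta>" "\<delta> < 1" by auto
      from sums[OF this] show ?case unfolding Limsup_at_top_int T_def by (simp only: of_int_of_nat_eq)
    qed
  qed
  show "star" if "\<alpha> * (2 + \<beta>) > 1" unfolding star by (rule W.green_limit_criterion(1)[OF c that])
  show "star \<longleftrightarrow>
       ((\<lambda>x::int. of_int x * Fbar (of_int x) * step_mass M X x / b (A (of_int x))) \<longlongrightarrow> 0) at_top \<and>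
       ((\<lambda>\<delta>::real. Limsup at_top (\<lambda>x::int. ereal (of_int x * Fbar (of_int x) / b (A (of_int x)) *
           (\<Sum>w\<in>{w::int. 1 \<le> w \<and> of_int w \<le> \<delta> * of_int x}.
              step_mass M X (x - w) * b (A (of_int w)) / (of_int w * (Fbar (of_int w))\<^sup>2))))) \<longlongrightarrow> 0) (at_right 0)"
    unfolding star mass_iff W.green_limit_criterion(2)[OF c] using sum_iff by blast
qed

end

theorem theorem9:
  fixes M :: "'a measure" and X :: "nat \<Rightarrow> 'a \<Rightarrow> int"
    and \<alpha> \<beta> :: real and a :: "nat \<Rightarrow> real" and \<mu> :: "real measure"
    and A L0 b B Fbar :: "real \<Rightarrow> real" and p g :: "int \<Rightarrow> real"
  assumes iid: "iid_steps M X"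
    and aperiodic: "aperiodic_step M X"
    and nonneg: "measure M {\<omega> \<in> space M. X 1 \<omega> \<ge> 0} = 1"
    and alpha: "0 < \<alpha>" "\<alpha> < 1"
    and attraction: "domain_of_attraction M X \<alpha> 1 a \<mu>"
    and beta: "\<beta> > -2"
    and b_nonneg: "\<And>x. x \<ge> 0 \<Longrightarrow> b x \<ge> 0"
    and b_rv: "regularly_varying \<beta> b"
    and p_def: "p = step_mass M X"
    and Fbar_def: "Fbar = step_tail M X"
    and g_def: "g = green M X b"
    and L0: "normalised_slowly_varying L0"
    and A_form: "\<And>x. x > 0 \<Longrightarrow> A x = x powr \<alpha> * L0 x"
    and A_tail: "A \<sim>[at_top] (\<lambda>x. 1 / Fbar x)"
    and A_norming: "\<And>n. n \<ge> 1 \<Longrightarrow> A (a n) = real n"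
    and B_def: "\<And>x. B x = b (A x)"
  defines "star \<equiv>
      ((\<lambda>x::int. of_int x * Fbar (of_int x) * g x / B (of_int x))
         \<longlongrightarrow> \<alpha> * (\<integral>y. y powr (- \<alpha> * (\<beta> + 1)) \<partial>\<mu>)) at_top"
  shows "(\<alpha> * (2 + \<beta>) > 1 \<longrightarrow> star) \<and>
         (\<alpha> * (2 + \<beta>) \<le> 1 \<longrightarrow>
           (star \<longleftrightarrow>
             ((\<lambda>x::int. of_int x * Fbar (of_int x) * p x / B (of_int x)) \<longlongrightarrow> 0) at_top \<and>
             ((\<lambda>\<delta>::real. Limsup at_top (\<lambda>x::int. ereal
                 (of_int x * Fbar (of_int x) / B (of_int x) *
                   (\<Sum>w\<in>{w::int. 1 \<le> w \<and> of_int w \<le> \<delta> * of_int x}.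
                      p (x - w) * B (of_int w) / (of_int w * (Fbar (of_int w))\<^sup>2)))))
               \<longlongrightarrow> 0) (at_right 0)))"
proof -
  interpret attracted_steps M X \<alpha> \<beta> a \<mu> A L0 b
    using assms(1-4,5-6,8-9,13-16) unfolding Fbar_def by unfold_locales
  show ?thesis
    unfolding star_def B_def p_def Fbar_def g_def using green_dichotomy by blast
qed

end
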